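(* Let $k$ be a field of characteristic zero, let $A$ be a torsion-free abelian group of finite rank acted upon by a group $\Gamma$, and let $P$ be a faithful prime ideal of $kA$. If $S_\Gamma(P)=\Gamma$, then $P$ is controlled by $\Delta_\Gamma(A)$, i.e. $P=(P\cap k\Delta_\Gamma(A))kA$.
   Context: $\Gamma$ acts on $A$ by automorphisms, extended to $kA$; $I^\gamma$ is the image of an ideal $I$ under $\gamma$. An ideal $I$ of $kA$ is faithful if $A\cap(1+I)=\{1\}$. $\Delta_\Gamma(A)$ is the subgroup of elements of $A$ having finite orbits under $\Gamma$. A subgroup $B\le A$ is dense if $A/B$ is torsion. The standardiser $S_\Gamma(I)$ is the set of $\gamma\in\Gamma$ such that $I\cap kB=I^\gamma\cap kB$ for some finitely generated dense subgroup $B$ of $A$. *)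

theory Defs
  imports Main "HOL-Library.Poly_Mapping"
begin

(* The abelian group A is the whole type 'a (written additively);
   the group algebra kA is the type ('a \<Rightarrow>\<^sub>0 'k) of finitely supported
   functions with convolution product; the group element a \<in> A is
   the basis element  Poly_Mapping.single a 1. *)

definition nsmul :: "nat \<Rightarrow> 'a::ab_group_add \<Rightarrow> 'a" where
  "nsmul n a = (((+) a) ^^ n) 0"

definition torsion_free :: "'a::ab_group_add itself \<Rightarrow> bool" where
  "torsion_free _ \<longleftrightarrow> (\<forall>(a::'a) n. n > 0 \<longrightarrow> nsmul n a = 0 \<longrightarrow> a = 0)"

definition is_subgroup :: "'a::ab_group_add set \<Rightarrow> bool" where
  "is_subgroup B \<longleftrightarrow> 0 \<in> B \<and> (\<forall>x\<in>B. \<forall>y\<in>B. x - y \<in> B)"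

definition gen_subgroup :: "'a::ab_group_add set \<Rightarrow> 'a set" where
  "gen_subgroup X = \<Inter>{B. is_subgroup B \<and> X \<subseteq> B}"

definition fin_gen :: "'a::ab_group_add set \<Rightarrow> bool" where
  "fin_gen B \<longleftrightarrow> (\<exists>X. finite X \<and> B = gen_subgroup X)"

definition dense_subgroup :: "'a::ab_group_add set \<Rightarrow> bool" where
  "dense_subgroup B \<longleftrightarrow> is_subgroup B \<and> (\<forall>a. \<exists>n>0. nsmul n a \<in> B)"

definition finite_rank :: "'a::ab_group_add itself \<Rightarrow> bool" where
  "finite_rank _ \<longleftrightarrow> (\<exists>B::'a set. fin_gen B \<and> dense_subgroup B)"

definition aut_action :: "('g::group_add \<Rightarrow> 'a::ab_group_add \<Rightarrow> 'a) \<Rightarrow> bool" where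
  "aut_action act \<longleftrightarrow> act 0 = id \<and> (\<forall>g h. act (g + h) = act g \<circ> act h)
     \<and> (\<forall>g x y. act g (x + y) = act g x + act g y)"

text \<open>Linear extension of the action to kA: sum c_a a \<mapsto> sum c_a (g a).\<close>
definition act_alg :: "('g::group_add \<Rightarrow> 'a::ab_group_add \<Rightarrow> 'a) \<Rightarrow> 'g \<Rightarrow>
    ('a \<Rightarrow>\<^sub>0 'k::field) \<Rightarrow> ('a \<Rightarrow>\<^sub>0 'k)" where
  "act_alg act g f = Abs_poly_mapping (\<lambda>b. Poly_Mapping.lookup f (act (- g) b))"

definition is_ideal :: "('a::ab_group_add \<Rightarrow>\<^sub>0 'k::field) set \<Rightarrow> bool" where
  "is_ideal I \<longleftrightarrow> 0 \<in> I \<and> (\<forall>x\<in>I. \<forall>y\<in>I. x + y \<in> I) \<and> (\<forall>r. \<forall>x\<in>I. r * x \<in> I)"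

definition is_prime_ideal :: "('a::ab_group_add \<Rightarrow>\<^sub>0 'k::field) set \<Rightarrow> bool" where
  "is_prime_ideal I \<longleftrightarrow> is_ideal I \<and> I \<noteq> UNIV \<and> (\<forall>x y. x * y \<in> I \<longrightarrow> x \<in> I \<or> y \<in> I)"

definition faithful :: "('a::ab_group_add \<Rightarrow>\<^sub>0 'k::field) set \<Rightarrow> bool" where
  "faithful I \<longleftrightarrow> (\<forall>a. Poly_Mapping.single a 1 \<in> (\<lambda>x. 1 + x) ` I \<longrightarrow> a = 0)"

definition grp_alg :: "'a::ab_group_add set \<Rightarrow> ('a \<Rightarrow>\<^sub>0 'k::field) set" where
  "grp_alg B = {f. Poly_Mapping.keys f \<subseteq> B}"

definition ideal_gen :: "('a::ab_group_add \<Rightarrow>\<^sub>0 'k::field) set \<Rightarrow> ('a \<Rightarrow>\<^sub>0 'k) set" where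
  "ideal_gen X = \<Inter>{I. is_ideal I \<and> X \<subseteq> I}"

definition Delta :: "('g::group_add \<Rightarrow> 'a::ab_group_add \<Rightarrow> 'a) \<Rightarrow> 'a set" where
  "Delta act = {a. finite (range (\<lambda>g. act g a))}"

definition standardiser :: "('g::group_add \<Rightarrow> 'a::ab_group_add \<Rightarrow> 'a) \<Rightarrow>
    ('a \<Rightarrow>\<^sub>0 'k::field) set \<Rightarrow> 'g set" where
  "standardiser act I = {g. \<exists>B. fin_gen B \<and> dense_subgroup B \<and>
      I \<inter> grp_alg B = (act_alg act g ` I) \<inter> grp_alg B}"

end

theory Submission
  imports Defs Complex_Main "HOL-Library.FuncSet" "HOL-Algebra.Algebraic_Closure_Type"
begin

text \<open>The domain \<open>kA/P\<close> embeds into an algebraically closed field, which turns \<open>A\<close> into a group of units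
  via an injective character \<open>\<phi>\<close> with \<open>f \<in> P\<close> iff \<open>\<Sum> f\<^sub>a \<phi>(a) = 0\<close>. An element \<open>\<gamma>\<close> of the standardiser
  induces an endomorphism \<open>\<sigma>\<close> of a subfield, fixing \<open>k\<close>, with \<open>\<sigma>(\<phi>(a))\<close> equal to \<open>\<phi>(\<gamma> a)\<close> up to roots of
  unity. Let \<open>F\<^sub>0\<close> be the field of \<open>\<sigma>\<close>-periodic elements and \<open>D\<close> the subgroup of \<open>\<gamma>\<close>-periodic elements. The
  core of the proof is that elements of \<open>A\<close> that are distinct modulo \<open>D\<close> are linearly independent over
  \<open>F\<^sub>0\<close> under \<open>\<phi>\<close>. A relation forces every valuation ring over \<open>F\<^sub>0\<close> to contain the units coming from a
  subgroup that is invariant under a power of \<open>\<gamma>\<close> and larger than \<open>D\<close>; comparing a valuation with its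
  pullbacks along powers of \<open>\<sigma>\<close> then contradicts the absence of periodic elements.

  Hence \<open>P\<close> is controlled by the \<open>\<gamma>\<close>-periodic elements for every \<open>\<gamma>\<close>, and by the intersection \<open>E\<close> of these
  subgroups, because the supports are finite. Every \<open>\<gamma>\<close> has finite order on \<open>E\<close>, and Minkowski's reduction
  modulo primes bounds the orbits of finitely generated groups of such automorphisms in terms of the
  rank alone. So the orbits of \<open>\<Gamma>\<close> on \<open>E\<close> are finite, i.e. \<open>E = \<Delta>\<^sub>\<Gamma>(A)\<close>.\<close>

text \<open>Independence over F0 cannot be had in one stroke: new periodic elements may appear
  modulo D, as for a unipotent \<gamma>. A Fitting decomposition for \<gamma>^M - 1 separates a part
  without such elements, where valuations give the contradiction, from a rest that is climbed by
  passing from W to {x. \<gamma> x - x \<in> W}. Valuations enter because the least value in a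
  vanishing sum is attained twice. So the finitely many differences of exponents of one relation
  meet the kernel of every valuation over F0, and a rank argument extracts a single subgroup fixed
  by a power of \<gamma>. There the conjugates of \<phi> u have finitely many residues, which yields
  a smaller subgroup whose residues are roots of unity; the finer invariant is then the distance of
  \<phi> z from a root of unity. Characteristic zero makes this distance insensitive to replacing z
  by a multiple. For orbits, the primes of Minkowski's reduction depend on the denominators of the
  chosen generators, and the bound depends on the primes. A preliminary pass produces an invariant
  lattice, on which the primes 2 and 3 give a bound fixed in advance.\<close>

no_notation Polynomials.var (\<open>X\<index>\<close>)
hide_const (open) up_ring.monom up_ring.coeff Divisibility.prime

section \<open>Integer multiples, purity and rank\<close>

lemma nsmul_0 [simp]: "nsmul 0 a = 0" by (simp add: nsmul_def)
lemma nsmul_Suc [simp]: "nsmul (Suc n) a = a + nsmul n a" by (simp add: nsmul_def)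

definition zs :: "int \<Rightarrow> 'a::ab_group_add \<Rightarrow> 'a" where
  "zs k a = (if k \<ge> 0 then nsmul (nat k) a else - nsmul (nat (- k)) a)"

lemma zs_of_nat: "zs (int n) a = nsmul n a"
  by (simp add: zs_def)

lemma zs_0 [simp]: "zs 0 a = 0" by (simp add: zs_def)

lemma zs_succ: "zs (k + 1) a = zs k a + a"
proof (cases "k \<ge> 0")
  case True
  then have "nat (k + 1) = Suc (nat k)" by simp
  with True show ?thesis by (simp add: zs_def)
next
  case False
  then have "nat (- k) = Suc (nat (- (k + 1)))" by simp
  with False show ?thesis by (cases "k = -1") (simp_all add: zs_def)
qed

lemma zs_pred: "zs (k - 1) a = zs k a - a"
  using zs_succ[of "k - 1" a] by simp

lemma zs_add_left: "zs (j + k) a = zs j a + zs k a"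
proof (induction k rule: int_induct[where k = 0])
  case (step1 i)
  have "j + (i + 1) = (j + i) + 1" by simp
  then show ?case using zs_succ[of "j + i" a] zs_succ[of i a] step1 by (simp only: add.assoc)
next
  case (step2 i)
  have "j + (i - 1) = (j + i) - 1" by simp
  then show ?case using zs_pred[of "j + i" a] zs_pred[of i a] step2 by (simp only: add_diff_eq)
qed simp

lemma zs_add_right: "zs k (a + b) = zs k a + zs k b"
proof (induction k rule: int_induct[where k = 0])
  case (step1 i)
  then show ?case unfolding zs_succ by (simp add: ac_simps)
next
  case (step2 i)
  then show ?case unfolding zs_pred by (simp add: algebra_simps)
qed simp

lemma zs_zs [simp]: "zs j (zs k a) = zs (j * k) a"
proof (induction j rule: int_induct[where k = 0])
  case (step1 i)
  then show ?case unfolding zs_succ distrib_right zs_add_left by (simp add: zs_def)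
next
  case (step2 i)
  have "i * k = (i - 1) * k + k" by (simp add: algebra_simps)
  then have "zs (i * k) a = zs ((i - 1) * k) a + zs k a"
    using zs_add_left[of "(i - 1) * k" k a] by metis
  with step2 show ?case unfolding zs_pred by simp
qed simp

lemma zs_1 [simp]: "zs 1 a = a"
  using zs_succ[of 0 a] by simp

lemma zs_zero_right [simp]: "zs k 0 = 0"
  using zs_add_right[of k 0 0] by simp
lemma zs_minus_left: "zs (- k) a = - zs k a"
  using zs_add_left[of k "- k" a] by (simp add: eq_neg_iff_add_eq_0 add.commute)
lemma zs_minus_right: "zs k (- a) = - zs k a"
  using zs_add_right[of k a "- a"] by (simp add: eq_neg_iff_add_eq_0 add.commute)
lemma zs_diff_right: "zs k (a - b) = zs k a - zs k b"
  using zs_add_right[of k a "- b"] by (simp add: zs_minus_right)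
lemma zs_diff_left: "zs (j - k) a = zs j a - zs k a"
  using zs_add_left[of j "- k" a] by (simp add: zs_minus_left)
lemma zs_sum_right: "zs k (sum f X) = (\<Sum>x\<in>X. zs k (f x))"
  by (induction X rule: infinite_finite_induct) (simp_all add: zs_add_right)
lemma zs_sum_left: "zs (sum c X) a = (\<Sum>x\<in>X. zs (c x) a)"
  by (induction X rule: infinite_finite_induct) (simp_all add: zs_add_left)
lemma additive_zs: "additive f \<Longrightarrow> f (zs k a) = zs k (f a)"
proof (induction k rule: int_induct[where k = 0])
  case base
  then show ?case by (simp add: additive.zero)
next
  case (step1 i)
  then show ?case by (simp add: zs_succ additive.add)
next
  case (step2 i)
  then show ?case by (simp add: zs_pred additive.diff)
qed

lemma additive_funpow: "additive f \<Longrightarrow> additive (f ^^ n)" for f :: "'a::ab_group_add \<Rightarrow> 'a"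
  by (induction n) (auto simp: additive_def)

lemma subgroup_0: "is_subgroup H \<Longrightarrow> 0 \<in> H" by (simp add: is_subgroup_def)
lemma subgroup_diff: "is_subgroup H \<Longrightarrow> x \<in> H \<Longrightarrow> y \<in> H \<Longrightarrow> x - y \<in> H" by (simp add: is_subgroup_def)
lemma subgroup_uminus: "is_subgroup H \<Longrightarrow> x \<in> H \<Longrightarrow> - x \<in> H"
  using subgroup_diff[of H 0 x] subgroup_0[of H] by simp
lemma subgroup_add: "is_subgroup H \<Longrightarrow> x \<in> H \<Longrightarrow> y \<in> H \<Longrightarrow> x + y \<in> H"
  using subgroup_diff[of H x "- y"] subgroup_uminus[of H y] by simp
lemma subgroup_zs: "is_subgroup H \<Longrightarrow> x \<in> H \<Longrightarrow> zs k x \<in> H"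
  by (induction k rule: int_induct[where k = 0])
    (auto simp: zs_succ zs_pred subgroup_0 subgroup_add subgroup_diff)
lemma subgroup_sum: "is_subgroup H \<Longrightarrow> (\<And>x. x \<in> X \<Longrightarrow> f x \<in> H) \<Longrightarrow> sum f X \<in> H"
  by (induction X rule: infinite_finite_induct) (auto simp: subgroup_0 subgroup_add)

lemma subgroup_image: assumes "additive f" "is_subgroup H" shows "is_subgroup (f ` H)"
  unfolding is_subgroup_def
proof (intro conjI ballI)
  show "0 \<in> f ` H" using additive.zero[OF assms(1)] subgroup_0[OF assms(2)] by force
  fix x y assume "x \<in> f ` H" "y \<in> f ` H"
  then obtain u v where "x = f u" "y = f v" "u \<in> H" "v \<in> H" by blast
  then have "x - y = f (u - v)" "u - v \<in> H"
    using additive.diff[OF assms(1)] subgroup_diff[OF assms(2)] by auto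
  then show "x - y \<in> f ` H" by blast
qed

definition set_plus :: "'a::ab_group_add set \<Rightarrow> 'a set \<Rightarrow> 'a set" where
  "set_plus H K = {h + k |h k. h \<in> H \<and> k \<in> K}"

lemma subgroup_set_plus: 
  assumes "is_subgroup H" "is_subgroup K" shows "is_subgroup (set_plus H K)"
  unfolding is_subgroup_def
proof (intro conjI ballI)
  show "0 \<in> set_plus H K" using assms subgroup_0 unfolding set_plus_def by force
  fix x y assume "x \<in> set_plus H K" "y \<in> set_plus H K"
  then obtain h k h' k' where "x = h + k" "y = h' + k'" "h \<in> H" "h' \<in> H" "k \<in> K" "k' \<in> K"
    unfolding set_plus_def by blast
  moreover from this have "x - y = (h - h') + (k - k')" by simp
  ultimately show "x - y \<in> set_plus H K"
    unfolding set_plus_def using assms subgroup_diff by blast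
qed

lemma set_plus_left: "is_subgroup K \<Longrightarrow> H \<subseteq> set_plus H K"
  unfolding set_plus_def using subgroup_0 by force
lemma set_plus_right: "is_subgroup H \<Longrightarrow> K \<subseteq> set_plus H K"
  unfolding set_plus_def using subgroup_0 by force
lemma set_plus_least: "is_subgroup L \<Longrightarrow> H \<subseteq> L \<Longrightarrow> K \<subseteq> L \<Longrightarrow> set_plus H K \<subseteq> L"
  unfolding set_plus_def using subgroup_add by blast

lemma image_set_plus: assumes "additive f" shows "f ` set_plus H K = set_plus (f ` H) (f ` K)"
proof (intro Set.set_eqI iffI)
  fix x assume "x \<in> f ` set_plus H K"
  then obtain h k where "h \<in> H" "k \<in> K" "x = f (h + k)" unfolding set_plus_def by blast
  then have "x = f h + f k" "f h \<in> f ` H" "f k \<in> f ` K" using additive.add[OF assms] by simp_all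
  then show "x \<in> set_plus (f ` H) (f ` K)" unfolding set_plus_def by blast
next
  fix x assume "x \<in> set_plus (f ` H) (f ` K)"
  then obtain h k where "h \<in> H" "k \<in> K" "x = f h + f k" unfolding set_plus_def by blast
  then have "x = f (h + k)" "h + k \<in> set_plus H K" using additive.add[OF assms]
    unfolding set_plus_def by auto
  then show "x \<in> f ` set_plus H K" by blast
qed

lemma subgroup_range_zs: "is_subgroup (range (\<lambda>k. zs k a))"
  unfolding is_subgroup_def
proof (intro conjI ballI)
  show "0 \<in> range (\<lambda>k. zs k a)" by (metis rangeI zs_0)
  fix x y assume "x \<in> range (\<lambda>k. zs k a)" "y \<in> range (\<lambda>k. zs k a)"
  then show "x - y \<in> range (\<lambda>k. zs k a)" by (auto simp flip: zs_diff_left)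
qed

lemma in_range_zs: "a \<in> range (\<lambda>k. zs k a)"
  by (metis rangeI zs_1)

section \<open>Pure subgroups and pure closures\<close>

definition pure :: "'a::ab_group_add set \<Rightarrow> bool" where
  "pure H \<longleftrightarrow> is_subgroup H \<and> (\<forall>k x. k \<noteq> 0 \<longrightarrow> zs k x \<in> H \<longrightarrow> x \<in> H)"

text \<open>For torsion-free A this is the trace on A of the rational span of \<open>H\<close>;
  working with it replaces tensoring with the rationals.\<close>

definition pcl :: "'a::ab_group_add set \<Rightarrow> 'a set" where
  "pcl H = {x. \<exists>k. k \<noteq> 0 \<and> zs k x \<in> H}"

lemma pureD: "pure H \<Longrightarrow> zs k x \<in> H \<Longrightarrow> k \<noteq> 0 \<Longrightarrow> x \<in> H" by (auto simp: pure_def)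
lemma pure_subgroup: "pure H \<Longrightarrow> is_subgroup H" by (auto simp: pure_def)

lemma subset_pcl: "H \<subseteq> pcl H"
  unfolding pcl_def by (metis (mono_tags, lifting) mem_Collect_eq subsetI zero_neq_one zs_1)

lemma pcl_mono: "H \<subseteq> K \<Longrightarrow> pcl H \<subseteq> pcl K"
  unfolding pcl_def by auto

lemma pure_pcl: assumes "is_subgroup H" shows "pure (pcl H)"
  unfolding pure_def is_subgroup_def
proof (intro conjI ballI allI impI)
  show "0 \<in> pcl H" using assms subset_pcl subgroup_0 by blast
  fix x y assume "x \<in> pcl H" "y \<in> pcl H"
  then obtain j k where jk: "j \<noteq> 0" "zs j x \<in> H" "k \<noteq> 0" "zs k y \<in> H" by (auto simp: pcl_def)
  have "zs (j * k) (x - y) = zs k (zs j x) - zs j (zs k y)"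
    by (simp add: zs_diff_right zs_zs mult.commute)
  also have "\<dots> \<in> H" using jk(2,4) assms by (metis subgroup_diff subgroup_zs)
  finally show "x - y \<in> pcl H" unfolding pcl_def using jk by (metis (mono_tags, lifting) mem_Collect_eq mult_eq_0_iff)
next
  fix k :: int and x assume "k \<noteq> 0" "zs k x \<in> pcl H"
  then show "x \<in> pcl H" unfolding pcl_def by auto (metis mult_eq_0_iff)
qed

lemma pcl_least: "pure K \<Longrightarrow> H \<subseteq> K \<Longrightarrow> pcl H \<subseteq> K"
  unfolding pcl_def by (auto dest: pureD)

lemma pure_Int: "pure H \<Longrightarrow> pure K \<Longrightarrow> pure (H \<inter> K)"
  unfolding pure_def is_subgroup_def by blast

lemma bij_image_pcl:
  assumes "additive f" "bij f" shows "f ` pcl H = pcl (f ` H)"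
proof (rule Set.set_eqI, rule iffI)
  fix x assume "x \<in> f ` pcl H"
  then obtain y k where "x = f y" "k \<noteq> 0" "zs k y \<in> H" by (auto simp: pcl_def)
  then have "zs k x \<in> f ` H" by (simp flip: additive_zs[OF assms(1)])
  then show "x \<in> pcl (f ` H)" unfolding pcl_def using \<open>k \<noteq> 0\<close> by blast
next
  fix x assume "x \<in> pcl (f ` H)"
  then obtain k h where k: "k \<noteq> 0" "zs k x = f h" "h \<in> H" by (auto simp: pcl_def)
  obtain y where y: "x = f y" using assms(2) by (meson bij_pointE)
  have "f (zs k y) = f h" using additive_zs[OF assms(1)] k y by simp
  then have "zs k y = h" using assms(2) by (meson bij_is_inj injD)
  then show "x \<in> f ` pcl H" unfolding pcl_def using y k by auto
qed

lemma bij_image_pure: 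
  assumes "additive f" "bij f" "pure H" shows "pure (f ` H)"
proof -
  have "pcl H = H" using assms(3) subset_pcl pcl_least by blast
  then have "f ` H = pcl (f ` H)" using bij_image_pcl[OF assms(1,2), of H] by simp
  then show ?thesis using pure_pcl[OF subgroup_image[OF assms(1) pure_subgroup[OF assms(3)]]] by simp
qed

section \<open>Integral independence and rank\<close>

definition zind :: "'a::ab_group_add set \<Rightarrow> bool" where
  "zind X \<longleftrightarrow> finite X \<and> (\<forall>c. (\<Sum>x\<in>X. zs (c x) x) = 0 \<longrightarrow> (\<forall>x\<in>X. c x = 0))"

lemma zindD: "zind X \<Longrightarrow> (\<Sum>x\<in>X. zs (c x) x) = 0 \<Longrightarrow> x \<in> X \<Longrightarrow> c x = 0"
  by (simp add: zind_def)

text \<open>In a relation involving \<open>y\<close> a nonzero multiple of \<open>y\<close> would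
  lie in \<open>H\<close>, and purity would put \<open>y\<close> itself there.\<close>

lemma zind_insert:
  assumes "zind X" "y \<notin> X" and H: "pure H" "X \<subseteq> H" "y \<notin> H"
  shows "zind (insert y X)"
  unfolding zind_def
proof (intro conjI allI impI)
  show "finite (insert y X)" using assms by (simp add: zind_def)
  fix c assume 0: "(\<Sum>x\<in>insert y X. zs (c x) x) = 0"
  have e: "zs (c y) y = - (\<Sum>x\<in>X. zs (c x) x)"
    using 0 assms(1,2) by (simp add: zind_def eq_neg_iff_add_eq_0)
  have "(\<Sum>x\<in>X. zs (c x) x) \<in> H" using H by (auto intro!: subgroup_sum subgroup_zs pure_subgroup)
  then have "zs (c y) y \<in> H" unfolding e using H by (simp add: subgroup_uminus pure_subgroup)
  then have "c y = 0" using H pureD by blast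
  then show "\<forall>x\<in>insert y X. c x = 0" using e assms(1) by (auto simp: zind_def)
qed

lemma zind_image:
  assumes "additive f" "inj f" "zind X" shows "zind (f ` X)"
  unfolding zind_def
proof (intro conjI allI impI)
  show "finite (f ` X)" using assms by (simp add: zind_def)
  fix c assume 0: "(\<Sum>x\<in>f ` X. zs (c x) x) = 0"
  have "f (\<Sum>x\<in>X. zs (c (f x)) x) = (\<Sum>x\<in>X. zs (c (f x)) (f x))"
    by (simp add: additive.sum[OF assms(1)] additive_zs[OF assms(1)])
  also have "\<dots> = 0" using 0 assms(2) by (subst (asm) sum.reindex) (auto simp: inj_on_def inj_def)
  finally have "(\<Sum>x\<in>X. zs (c (f x)) x) = 0"
    using assms(1,2) by (metis additive.zero injD)
  then show "\<forall>x\<in>f ` X. c x = 0" using zindD[OF assms(3), of "\<lambda>x. c (f x)"] by blast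
qed

text \<open>Gaussian elimination without division: one equation is removed at a time by
  cross-multiplying with a nonzero pivot, so that everything stays integral.\<close>

lemma homogeneous_int_solution:
  fixes c :: "'x \<Rightarrow> 'j \<Rightarrow> int"
  assumes "finite J" "finite X" "card X > card J"
  shows "\<exists>d. (\<exists>x\<in>X. d x \<noteq> 0) \<and> (\<forall>j\<in>J. (\<Sum>x\<in>X. d x * c x j) = 0)"
  using assms
proof (induction J arbitrary: X c rule: finite_induct)
  case empty
  then obtain x where "x \<in> X" by fastforce
  then show ?case by (intro exI[of _ "\<lambda>_. 1"]) auto
next
  case (insert j J)
  show ?case
  proof (cases "\<forall>x\<in>X. c x j = 0")
    case True
    obtain d where "\<exists>x\<in>X. d x \<noteq> 0" "\<forall>j\<in>J. (\<Sum>x\<in>X. d x * c x j) = 0"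
      using insert.IH[of X c] insert.prems insert.hyps by auto
    with True show ?thesis by (intro exI[of _ d]) auto
  next
    case False
    then obtain y where y: "y \<in> X" "c y j \<noteq> 0" by blast
    \<comment> \<open>Cross-multiplication with the pivot \<open>c y j\<close> kills equation
      \<open>j\<close> in every remaining unknown. The solution of the reduced system is then scaled
      by the pivot, which leaves an integral value for \<open>y\<close>.\<close>
    define c' where "c' x i = c y j * c x i - c x j * c y i" for x i
    have "card (X - {y}) > card J" using insert y by simp
    then obtain d where d: "\<exists>x\<in>X - {y}. d x \<noteq> 0" "\<forall>i\<in>J. (\<Sum>x\<in>X - {y}. d x * c' x i) = 0"
      using insert.IH[of "X - {y}" c'] insert.prems by auto
    define e where "e x = (if x = y then - (\<Sum>x\<in>X - {y}. d x * c x j) else c y j * d x)" for x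
    have s: "(\<Sum>x\<in>X. e x * c x i) = (\<Sum>x\<in>X - {y}. d x * c' x i)" for i
    proof -
      have "(\<Sum>x\<in>X. e x * c x i) = e y * c y i + (\<Sum>x\<in>X - {y}. e x * c x i)"
        using insert.prems y by (simp add: sum.remove)
      also have "(\<Sum>x\<in>X - {y}. e x * c x i) = (\<Sum>x\<in>X - {y}. c y j * d x * c x i)"
        by (rule sum.cong) (auto simp: e_def)
      also have "e y * c y i = - (\<Sum>x\<in>X - {y}. d x * c x j * c y i)"
        by (simp add: e_def sum_distrib_right)
      finally show ?thesis unfolding c'_def
        by (simp add: right_diff_distrib sum_subtractf algebra_simps)
    qed
    have "(\<Sum>x\<in>X - {y}. d x * c' x j) = 0" by (rule sum.neutral) (simp add: c'_def)
    then have "\<forall>i\<in>insert j J. (\<Sum>x\<in>X. e x * c x i) = 0" using d(2) s by auto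
    moreover have "\<exists>x\<in>X. e x \<noteq> 0" using d(1) y by (auto simp: e_def)
    ultimately show ?thesis by blast
  qed
qed

definition zspan :: "'a::ab_group_add set \<Rightarrow> 'a set" where
  "zspan X = {y. \<exists>c. y = (\<Sum>x\<in>X. zs (c x) x)}"

lemma subgroup_zspan: "is_subgroup (zspan X)"
  unfolding is_subgroup_def
proof (intro conjI ballI)
  show "0 \<in> zspan X" unfolding zspan_def by (auto intro: exI[of _ "\<lambda>_. 0"])
  fix x y assume "x \<in> zspan X" "y \<in> zspan X"
  then obtain c d where "x = (\<Sum>x\<in>X. zs (c x) x)" "y = (\<Sum>x\<in>X. zs (d x) x)"
    unfolding zspan_def by auto
  then have "x - y = (\<Sum>x\<in>X. zs (c x - d x) x)" by (simp add: zs_diff_left sum_subtractf)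
  then show "x - y \<in> zspan X" unfolding zspan_def mem_Collect_eq
    by (intro exI[of _ "\<lambda>x. c x - d x"])
qed

lemma zspan_base: assumes "finite X" "x \<in> X" shows "x \<in> zspan X"
proof -
  have "(\<Sum>y\<in>X. zs (if y = x then 1 else 0) y) = (\<Sum>y\<in>{x}. zs (if y = x then 1 else 0) y)"
    using assms by (intro sum.mono_neutral_right) auto
  then have "x = (\<Sum>y\<in>X. zs (if y = x then 1 else 0) y)" by simp
  then show ?thesis unfolding zspan_def mem_Collect_eq
    by (intro exI[of _ "\<lambda>y. if y = x then 1 else 0"])
qed

lemma zspan_least: "is_subgroup H \<Longrightarrow> X \<subseteq> H \<Longrightarrow> zspan X \<subseteq> H"
  unfolding zspan_def by (auto intro!: subgroup_sum subgroup_zs)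

lemma gen_subgroup_eq_zspan: "finite X \<Longrightarrow> gen_subgroup X = zspan X"
  unfolding gen_subgroup_def using subgroup_zspan[of X] zspan_base[of X] zspan_least[of _ X]
  by (auto 4 4)

text \<open>Suitable multiples of the elements of \<open>X\<close> have integer coordinates over
  \<open>Y\<close>; more vectors than coordinates give an integral relation.\<close>

lemma zind_bounded:
  fixes X Y :: "'a::ab_group_add set"
  assumes "finite Y" and dense: "\<And>a. \<exists>k. k \<noteq> 0 \<and> zs k a \<in> zspan Y" and "zind X"
  shows "card X \<le> card Y"
proof (rule ccontr)
  assume "\<not> card X \<le> card Y"
  obtain n where n: "\<And>a. n a \<noteq> 0" "\<And>a::'a. zs (n a) a \<in> zspan Y"
    using dense by metis
  then obtain c where c: "\<And>a. zs (n a) a = (\<Sum>y\<in>Y. zs (c a y) y)" unfolding zspan_def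
    by (simp, metis)
  have "finite X" using assms(3) by (simp add: zind_def)
  obtain d where d: "\<exists>x\<in>X. d x \<noteq> 0" "\<forall>y\<in>Y. (\<Sum>x\<in>X. d x * c x y) = 0"
    using homogeneous_int_solution[OF \<open>finite Y\<close> \<open>finite X\<close>] \<open>\<not> card X \<le> card Y\<close> by (metis not_le)
  have "(\<Sum>x\<in>X. zs (d x * n x) x) = (\<Sum>x\<in>X. zs (d x) (zs (n x) x))"
    by simp
  also have "\<dots> = (\<Sum>x\<in>X. \<Sum>y\<in>Y. zs (d x * c x y) y)" by (simp add: c zs_sum_right)
  also have "\<dots> = (\<Sum>y\<in>Y. zs (\<Sum>x\<in>X. d x * c x y) y)"
    by (subst sum.swap) (simp add: zs_sum_left)
  also have "\<dots> = 0" using d(2) by (intro sum.neutral) auto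
  finally have "\<forall>x\<in>X. d x * n x = 0" using zindD[OF assms(3), of "\<lambda>x. d x * n x"] by blast
  then show False using d(1) n(1) by auto
qed

text \<open>Finite rank enters as a bound \<open>N\<close> on independent sets. The same
  \<open>N\<close> later bounds the order of \<Lambda>/p\<Lambda> by p^N, so it is kept as an
  explicit parameter.\<close>

locale frg =
  fixes T :: "'a::ab_group_add itself" and N :: nat
  assumes tf: "zs k (a::'a) = 0 \<Longrightarrow> k \<noteq> 0 \<Longrightarrow> a = 0"
    and bd: "zind (X::'a set) \<Longrightarrow> card X \<le> N"
begin

definition rank :: "'a set \<Rightarrow> nat" where
  "rank H = Max {card X |X. X \<subseteq> H \<and> zind X}"

lemma rank_fin: "finite {card X |X. X \<subseteq> H \<and> zind X}" for H :: "'a set"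
  by (rule finite_subset[of _ "{..N}"]) (auto dest: bd)

lemma rank_ge: "X \<subseteq> H \<Longrightarrow> zind X \<Longrightarrow> card X \<le> rank H"
  unfolding rank_def using rank_fin[of H] by (auto intro!: Max_ge)

lemma rank_ex: "\<exists>X. X \<subseteq> H \<and> zind X \<and> card X = rank H"
proof -
  have "zind {}" by (simp add: zind_def)
  then have "{card X |X. X \<subseteq> H \<and> zind X} \<noteq> {}" by blast
  from Max_in[OF rank_fin this] show ?thesis unfolding rank_def by auto
qed

lemma rank_le_N: "rank H \<le> N"
proof -
  obtain X where "X \<subseteq> H" "zind X" "card X = rank H" using rank_ex[of H] by blast
  then show ?thesis using bd[of X] by simp
qed

lemma rank_mono: "H \<subseteq> K \<Longrightarrow> rank H \<le> rank K"
proof -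
  assume HK: "H \<subseteq> K"
  obtain X where "X \<subseteq> H" "zind X" "card X = rank H" using rank_ex by blast
  then show ?thesis using rank_ge[of X K] HK by simp
qed

text \<open>Purity of the smaller group is what makes rank detect a proper inclusion; 2Z inside Z
  shows that rank alone does not. The extremal arguments below therefore work with pure
  subgroups.\<close>

lemma rank_strict: assumes "pure H" "H \<subset> K" shows "rank H < rank K"
proof -
  obtain X where X: "X \<subseteq> H" "zind X" "card X = rank H" using rank_ex by blast
  obtain y where y: "y \<in> K" "y \<notin> H" using assms by blast
  have "zind (insert y X)" using zind_insert[OF X(2) _ assms(1) X(1) y(2)] X y by blast
  then have "card (insert y X) \<le> rank K" using rank_ge[of "insert y X" K] X y assms by auto
  moreover have "finite X" "y \<notin> X" using X y by (auto simp: zind_def)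
  ultimately show ?thesis using X by simp
qed

lemma rank_eqI: "pure H \<Longrightarrow> H \<subseteq> K \<Longrightarrow> rank K \<le> rank H \<Longrightarrow> H = K"
  using rank_strict[of H K] by fastforce

lemma rank_image: assumes "additive f" "inj (f :: 'a \<Rightarrow> 'a)" shows "rank (f ` H) = rank H"
proof (rule antisym)
  obtain X where X: "X \<subseteq> H" "zind X" "card X = rank H" using rank_ex by blast
  have "zind (f ` X)" using zind_image assms X by blast
  then have "card (f ` X) \<le> rank (f ` H)" using rank_ge[of "f ` X" "f ` H"] X by auto
  then show "rank H \<le> rank (f ` H)" using X assms by (metis card_image inj_on_subset subset_UNIV)
next
  obtain Y where Y: "Y \<subseteq> f ` H" "zind Y" "card Y = rank (f ` H)" using rank_ex by blast
  obtain X where X: "X \<subseteq> H" "inj_on f X" "Y = f ` X" using Y(1) by (meson subset_image_inj)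
  have fin: "finite X" using X Y by (metis finite_imageD zind_def)
  have "zind X" unfolding zind_def
  proof (intro conjI fin allI impI)
    fix c assume "(\<Sum>x\<in>X. zs (c x) x) = 0"
    then have "f (\<Sum>x\<in>X. zs (c x) x) = 0" using assms(1) by (simp add: additive.zero)
    then have "(\<Sum>x\<in>X. zs (c x) (f x)) = 0"
      by (simp add: additive.sum[OF assms(1)] additive_zs[OF assms(1)])
    then have "(\<Sum>y\<in>Y. zs (c (inv_into X f y)) y) = 0"
      using X(2) unfolding X(3) by (subst sum.reindex) auto
    then have "\<forall>y\<in>Y. c (inv_into X f y) = 0"
      using zindD[OF Y(2), of "\<lambda>y. c (inv_into X f y)"] by blast
    then show "\<forall>x\<in>X. c x = 0" using X by auto
  qed
  then show "rank (f ` H) \<le> rank H" using rank_ge[OF X(1)] X Y by (metis card_image)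
qed

text \<open>Lift an independent set of the image and add the kernel element \<open>h\<close>:
  applying \<open>f\<close> to a relation first kills the lifted coefficients, and torsion-freeness
  then kills that of \<open>h\<close>.\<close>

lemma rank_image_kernel:
  assumes f: "additive (f :: 'a \<Rightarrow> 'a)" and h: "h \<in> H" "h \<noteq> 0" "f h = 0"
  shows "rank (f ` H) < rank H"
proof -
  obtain Y where Y: "Y \<subseteq> f ` H" "zind Y" "card Y = rank (f ` H)" using rank_ex by blast
  obtain X where X: "X \<subseteq> H" "inj_on f X" "Y = f ` X" using Y(1) by (meson subset_image_inj)
  have fin: "finite X" using X Y by (metis finite_imageD zind_def)
  have key: "\<forall>x\<in>X. c x = 0" if "zs k h + (\<Sum>x\<in>X. zs (c x) x) = 0" for c k
  proof -
    have "f (zs k h + (\<Sum>x\<in>X. zs (c x) x)) = 0" using that f by (simp add: additive.zero)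
    then have "(\<Sum>x\<in>X. zs (c x) (f x)) = 0"
      by (simp add: additive.add[OF f] additive.sum[OF f] additive_zs[OF f] h)
    then have "(\<Sum>y\<in>Y. zs (c (inv_into X f y)) y) = 0"
      using X(2) unfolding X(3) by (subst sum.reindex) auto
    then have "\<forall>y\<in>Y. c (inv_into X f y) = 0"
      using zindD[OF Y(2), of "\<lambda>y. c (inv_into X f y)"] by blast
    then show "\<forall>x\<in>X. c x = 0" using X by auto
  qed
  have hX: "h \<notin> X"
  proof
    assume "h \<in> X"
    then have "(\<Sum>x\<in>X. zs (if x = h then 1 else 0) x) = (\<Sum>x\<in>{h}. zs (if x = h then 1 else 0) x)"
      using fin by (intro sum.mono_neutral_right) auto
    then have "zs (-1) h + (\<Sum>x\<in>X. zs (if x = h then 1 else 0) x) = 0" by (simp add: zs_minus_left)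
    from key[OF this] \<open>h \<in> X\<close> show False by auto
  qed
  have "zind (insert h X)" unfolding zind_def
  proof (intro conjI allI impI)
    show "finite (insert h X)" using fin by simp
    fix c assume 0: "(\<Sum>x\<in>insert h X. zs (c x) x) = 0"
    then have 1: "zs (c h) h + (\<Sum>x\<in>X. zs (c x) x) = 0" using fin hX by simp
    then have "\<forall>x\<in>X. c x = 0" by (rule key)
    moreover from this 1 have "zs (c h) h = 0" by simp
    ultimately show "\<forall>x\<in>insert h X. c x = 0" using tf h by auto
  qed
  then have "card (insert h X) \<le> rank H" using rank_ge[of "insert h X" H] X h by auto
  then show ?thesis using fin hX X Y by (simp add: card_image)
qed

text \<open>A rational basis inside \<open>H\<close>: an element outside the pure closure of the
  span could be added to \<open>X\<close>.\<close>

lemma max_ind: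
  fixes H :: "'a set"
  obtains X where "X \<subseteq> H" "zind X" "\<And>h. is_subgroup H \<Longrightarrow> h \<in> H \<Longrightarrow> \<exists>k. k \<noteq> 0 \<and> zs k h \<in> zspan X"
proof -
  obtain X where X: "X \<subseteq> H" "zind X" "card X = rank H" using rank_ex by blast
  have fin: "finite X" using X by (simp add: zind_def)
  have "\<exists>k. k \<noteq> 0 \<and> zs k h \<in> zspan X" if "is_subgroup H" "h \<in> H" for h
  proof (rule ccontr)
    assume "\<not> ?thesis"
    then have n: "h \<notin> pcl (zspan X)" by (auto simp: pcl_def)
    have s: "X \<subseteq> pcl (zspan X)" using zspan_base fin subset_pcl by blast
    have "zind (insert h X)" using zind_insert[OF X(2) _ pure_pcl[OF subgroup_zspan] s n] n s by blast
    then have "card (insert h X) \<le> rank H" using rank_ge[of "insert h X" H] X that by auto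
    moreover have "h \<notin> X" using n s by blast
    ultimately show False using X fin by simp
  qed
  with X that show ?thesis by blast
qed

end

lemma frg_exists:
  assumes "torsion_free TYPE('a::ab_group_add)" "finite_rank TYPE('a)"
  shows "\<exists>N. frg TYPE('a) N"
proof -
  obtain Y :: "'a set" where Y: "finite Y" "dense_subgroup (gen_subgroup Y)"
    using assms(2) unfolding finite_rank_def fin_gen_def by blast
  have "frg TYPE('a) (card Y)"
  proof
    fix k :: int and a :: 'a assume z: "zs k a = 0" "k \<noteq> 0"
    have "nsmul (nat \<bar>k\<bar>) a = 0" using z by (auto simp: zs_def split: if_splits)
    then show "a = 0" using assms(1) z(2) unfolding torsion_free_def by (metis zero_less_abs_iff zero_less_nat_eq)
  next
    fix X :: "'a set" assume "zind X"
    moreover have "\<exists>k. k \<noteq> 0 \<and> zs k a \<in> zspan Y" for a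
    proof -
      obtain n where "n > 0" "nsmul n a \<in> gen_subgroup Y" using Y(2) unfolding dense_subgroup_def by blast
      then show ?thesis using gen_subgroup_eq_zspan[OF Y(1)] zs_of_nat[of n a]
        by (intro exI[of _ "int n"]) auto
    qed
    ultimately show "card X \<le> card Y" using zind_bounded Y(1) by blast
  qed
  then show ?thesis by blast
qed

lemma nat_pigeonhole:
  assumes "finite S" "\<And>i::nat. f i \<in> S"
  obtains i j where "i < j" "f i = f j"
proof -
  have "\<not> inj f"
    using assms by (metis finite_imageD finite_subset image_subsetI infinite_UNIV_nat)
  then obtain i j where "i \<noteq> j" "f i = f j" unfolding inj_def by blast
  then show ?thesis using that[of i j] that[of j i] by (cases "i < j") auto
qed

lemma image_funpow: "((`) g ^^ i) U = (g ^^ i) ` U" for g :: "'a \<Rightarrow> 'a"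
  by (induction i) (auto simp: image_comp)

lemma bij_funpow: "bij f \<Longrightarrow> bij (f ^^ n)" for f :: "'a \<Rightarrow> 'a"
  by (induction n) (auto intro: bij_comp simp: bij_id[unfolded id_def])

section \<open>Extracting an invariant subgroup from a family of subgroups\<close>

context frg
begin

text \<open>In the application \<open>\<K>\<close> consists of kernels of valuations, closed under
  pulling back along \<open>g\<close> but not fixed by it. Consider finite families of pure
  subgroups such that each member of \<open>\<K>\<close> contains one of them; an extremal family is
  permuted by \<open>g\<close> in its lowest rank, so some member is fixed by a power.\<close>

lemma invariant_core:
  fixes g :: "'a \<Rightarrow> 'a" and D :: "'a set"
  assumes g: "additive g" "bij g"
    and K: "\<And>K. K \<in> \<K> \<Longrightarrow> pure K" "\<And>K. K \<in> \<K> \<Longrightarrow> D \<subseteq> K"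
      "\<And>K. K \<in> \<K> \<Longrightarrow> {a. g a \<in> K} \<in> \<K>" "\<K> \<noteq> {}"
    and E: "finite E" "E \<inter> D = {}" "\<And>K. K \<in> \<K> \<Longrightarrow> E \<inter> K \<noteq> {}"
    and D: "is_subgroup D"
  obtains U i K where "pure U" "D \<subset> U" "i > 0" "(g ^^ i) ` U = U" "K \<in> \<K>" "U \<subseteq> K"
proof -
  \<comment> \<open>\<open>r\<close> is only a lower bound for the ranks, so that enlarging members
    never leaves the notion. It is maximised first; the number of members of rank exactly
    \<open>r\<close> is minimised next.\<close>
  define cov where "cov r \<U> \<longleftrightarrow> finite \<U> \<and> (\<forall>U\<in>\<U>. pure U \<and> D \<subset> U \<and> r \<le> rank U)
    \<and> (\<forall>K\<in>\<K>. \<exists>U\<in>\<U>. U \<subseteq> K)" for r \<U>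
  define R where "R r \<U> = {U\<in>\<U>. rank U = r}" for r \<U>
  define \<U>0 where "\<U>0 = (\<lambda>e. pcl (set_plus D (range (\<lambda>k. zs k e)))) ` E"
  have c0: "cov 0 \<U>0" unfolding cov_def
  proof (intro conjI ballI)
    show "finite \<U>0" using E by (simp add: \<U>0_def)
    fix U assume "U \<in> \<U>0"
    then obtain e where e: "e \<in> E" "U = pcl (set_plus D (range (\<lambda>k. zs k e)))"
      by (auto simp: \<U>0_def)
    show "pure U" unfolding e by (intro pure_pcl subgroup_set_plus D subgroup_range_zs)
    have "D \<subseteq> U" unfolding e using set_plus_left[OF subgroup_range_zs] subset_pcl by blast
    moreover have "e \<in> U" unfolding e
      using set_plus_right[OF D] subset_pcl in_range_zs by blast
    ultimately show "D \<subset> U" using E e by blast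
    show "0 \<le> rank U" by simp
  next
    fix K assume K': "K \<in> \<K>"
    then obtain e where e: "e \<in> E" "e \<in> K" using E by blast
    have "pcl (set_plus D (range (\<lambda>k. zs k e))) \<subseteq> K"
      by (intro pcl_least K set_plus_least pure_subgroup K') (use e K(1)[OF K'] K(2)[OF K'] in \<open>auto intro: subgroup_zs pure_subgroup\<close>)
    then show "\<exists>U\<in>\<U>0. U \<subseteq> K" using e by (auto simp: \<U>0_def)
  qed
  have fin: "finite {r. \<exists>\<U>. cov r \<U>}"
  proof (rule finite_subset[of _ "{..N}"])
    show "{r. \<exists>\<U>. cov r \<U>} \<subseteq> {..N}"
    proof
      fix r assume "r \<in> {r. \<exists>\<U>. cov r \<U>}"
      then obtain \<U> where "cov r \<U>" by blast
      then obtain U where "r \<le> rank U" using K(4) unfolding cov_def by blast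
      then show "r \<in> {..N}" using rank_le_N[of U] by simp
    qed
  qed simp
  define r where "r = Max {r. \<exists>\<U>. cov r \<U>}"
  have "r \<in> {r. \<exists>\<U>. cov r \<U>}" unfolding r_def using c0 fin by (intro Max_in) auto
  then obtain \<U>1 where "cov r \<U>1" by blast
  then obtain \<U> where U: "cov r \<U>" and min: "\<And>\<V>. cov r \<V> \<Longrightarrow> card (R r \<U>) \<le> card (R r \<V>)"
    using ex_has_least_nat[of "cov r" \<U>1 "\<lambda>\<U>. card (R r \<U>)"] by blast
  have notS: "\<not> cov (Suc r) \<V>" for \<V>
  proof
    assume "cov (Suc r) \<V>"
    then have "Suc r \<in> {r. \<exists>\<U>. cov r \<U>}" by blast
    from Max_ge[OF fin this] show False unfolding r_def[symmetric] by simp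
  qed
  have finR: "finite (R r \<U>)" using U by (auto simp: cov_def R_def)
  \<comment> \<open>A member of rank \<open>r\<close> contained in no K could be dropped, against
    minimality.\<close>
  have used: "\<exists>K\<in>\<K>. W \<subseteq> K" if W: "W \<in> R r \<U>" for W
  proof (rule ccontr)
    assume n: "\<not> ?thesis"
    have "\<exists>V\<in>\<U> - {W}. V \<subseteq> K" if "K \<in> \<K>" for K
    proof -
      obtain V where "V \<in> \<U>" "V \<subseteq> K" using U \<open>K \<in> \<K>\<close> by (auto simp: cov_def)
      then show ?thesis using n \<open>K \<in> \<K>\<close> by (cases "V = W") auto
    qed
    then have "cov r (\<U> - {W})" using U by (simp add: cov_def)
    from min[OF this] have "card (R r \<U>) \<le> card (R r (\<U> - {W}))" .
    also have "R r (\<U> - {W}) = R r \<U> - {W}" by (auto simp: R_def)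
    finally show False using W finR by (metis card_Diff1_less not_le)
  qed
  have Rne: "R r \<U> \<noteq> {}"
  proof
    assume "R r \<U> = {}"
    then have "cov (Suc r) \<U>" using U unfolding cov_def R_def by (fastforce simp: Suc_le_eq)
    then show False using notS by blast
  qed
  \<comment> \<open>Each K contains some U, and its preimage under \<open>g\<close> contains some
    U', so K contains the join of U and g U'. The joins therefore form another cover.\<close>
  define J where "J U U' = pcl (set_plus U (g ` U'))" for U U'
  define \<V> where "\<V> = case_prod J ` (\<U> \<times> \<U>)"
  have pureg: "pure (g ` W)" if "pure W" for W using bij_image_pure g that by blast
  have J: "pure (J U1 U2)" "U1 \<subseteq> J U1 U2" "g ` U2 \<subseteq> J U1 U2" if "pure U1" "pure U2" for U1 U2
  proof -
    show "pure (J U1 U2)" unfolding J_def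
      using that pureg by (intro pure_pcl subgroup_set_plus pure_subgroup)
    show "U1 \<subseteq> J U1 U2" unfolding J_def
      using set_plus_left[OF pure_subgroup[OF pureg[OF that(2)]]] subset_pcl by blast
    show "g ` U2 \<subseteq> J U1 U2" unfolding J_def
      using set_plus_right[OF pure_subgroup[OF that(1)]] subset_pcl by blast
  qed
  have rk: "rank (g ` W) = rank W" for W using rank_image g bij_is_inj by blast
  have Up: "pure W" "D \<subset> W" "r \<le> rank W" if "W \<in> \<U>" for W using U that by (auto simp: cov_def)
  have "cov r \<V>" unfolding cov_def
  proof (intro conjI ballI)
    show "finite \<V>" using U by (auto simp: \<V>_def cov_def)
    fix W assume "W \<in> \<V>"
    then obtain U1 U2 where W: "W = J U1 U2" "U1 \<in> \<U>" "U2 \<in> \<U>" by (auto simp: \<V>_def)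
    show "pure W" "D \<subset> W" using J[of U1 U2] Up W by blast+
    show "r \<le> rank W" using rank_mono[OF J(2)[of U1 U2]] Up[of U1] Up[of U2] W by simp
  next
    fix K assume K': "K \<in> \<K>"
    obtain U1 where U1: "U1 \<in> \<U>" "U1 \<subseteq> K" using U K' by (auto simp: cov_def)
    obtain U2 where U2: "U2 \<in> \<U>" "U2 \<subseteq> {a. g a \<in> K}" using U K(3)[OF K'] unfolding cov_def by blast
    have "J U1 U2 \<subseteq> K" unfolding J_def
      by (intro pcl_least set_plus_least pure_subgroup K K') (use U1 U2 in auto)
    then show "\<exists>W\<in>\<V>. W \<subseteq> K" using U1 U2 by (auto simp: \<V>_def)
  qed
  then have le: "card (R r \<U>) \<le> card (R r \<V>)" by (rule min)
  \<comment> \<open>A join of rank \<open>r\<close> equals both of its constituents by purity. So a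
    lowest member of the new cover is a lowest member of the old one and also the image of one;
    minimality makes all of them arise in this way.\<close>
  have sub: "R r \<V> \<subseteq> R r \<U> \<inter> (`) g ` R r \<U>"
  proof
    fix W assume "W \<in> R r \<V>"
    then obtain U1 U2 where W: "W = J U1 U2" "U1 \<in> \<U>" "U2 \<in> \<U>" "rank W = r"
      by (auto simp: \<V>_def R_def)
    have "U1 = W" using rank_eqI[of U1 W] J[of U1 U2] Up W by auto
    moreover have "g ` U2 = W" using rank_eqI[of "g ` U2" W] J[of U1 U2] Up W pureg rk by auto
    ultimately show "W \<in> R r \<U> \<inter> (`) g ` R r \<U>" using W rk[of U2] by (auto simp: R_def)
  qed
  have "R r \<V> = R r \<U>"
    using sub le finR by (intro card_seteq) auto
  then have "R r \<U> \<subseteq> (`) g ` R r \<U>" using sub by blast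
  then have perm: "(`) g ` R r \<U> = R r \<U>"
    using finR by (metis card_image_le card_seteq finite_imageI)
  obtain W where W: "W \<in> R r \<U>" using Rne by blast
  have orb: "((`) g ^^ i) W \<in> R r \<U>" for i
    by (induction i) (use W perm in auto)
  obtain i j where ij: "i < j" "((`) g ^^ i) W = ((`) g ^^ j) W"
    by (rule nat_pigeonhole[OF finR, of "\<lambda>i. ((`) g ^^ i) W"]) (use orb in auto)
  have "(g ^^ i) ` ((g ^^ (j - i)) ` W) = (g ^^ i) ` W"
  proof -
    have "g ^^ j = (g ^^ i) \<circ> (g ^^ (j - i))" using ij(1) by (simp flip: funpow_add)
    then show ?thesis using ij(2) unfolding image_funpow by (simp add: image_comp)
  qed
  then have "(g ^^ (j - i)) ` W = W"
    using bij_funpow[OF g(2), of i] by (metis bij_is_inj inj_image_eq_iff)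
  then show ?thesis using that[of W "j - i"] used[OF W] W Up[of W] ij by (auto simp: R_def)
qed

end

section \<open>Homomorphisms into algebraically closed fields\<close>

text \<open>The last clause does double duty: with 0 in \<open>P\<close> it makes the relation
  single-valued, and it makes the induced map modulo \<open>P\<close> injective. No quotient ring
  has to be formed.\<close>

definition phom :: "'r::comm_ring_1 set \<Rightarrow> ('r \<times> 'l::field) set \<Rightarrow> bool" where
  "phom P \<Gamma> \<longleftrightarrow> (1, 1) \<in> \<Gamma>
     \<and> (\<forall>x a y b. (x, a) \<in> \<Gamma> \<longrightarrow> (y, b) \<in> \<Gamma> \<longrightarrow> (x - y, a - b) \<in> \<Gamma> \<and> (x * y, a * b) \<in> \<Gamma>)
     \<and> (\<forall>x a. (x, a) \<in> \<Gamma> \<longrightarrow> (x \<in> P \<longleftrightarrow> a = 0))"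

definition prime_set :: "'r::comm_ring_1 set \<Rightarrow> bool" where
  "prime_set P \<longleftrightarrow> 0 \<in> P \<and> 1 \<notin> P \<and> (\<forall>x\<in>P. \<forall>y\<in>P. x + y \<in> P) \<and> (\<forall>r. \<forall>x\<in>P. r * x \<in> P)
     \<and> (\<forall>x y. x * y \<in> P \<longrightarrow> x \<in> P \<or> y \<in> P)"

definition ppair :: "('r::comm_ring_1 \<times> 'l::field) set \<Rightarrow> 'r poly \<Rightarrow> 'l poly \<Rightarrow> bool" where
  "ppair \<Gamma> f g \<longleftrightarrow> (\<forall>i. (coeff f i, coeff g i) \<in> \<Gamma>)"

locale part_hom =
  fixes P :: "'r::comm_ring_1 set" and \<Gamma> :: "('r \<times> 'l::field) set"
  assumes P: "prime_set P" and ph: "phom P \<Gamma>"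
begin

lemma g1: "(1, 1) \<in> \<Gamma>" using ph by (simp add: phom_def)
lemma gdiff: "(x, a) \<in> \<Gamma> \<Longrightarrow> (y, b) \<in> \<Gamma> \<Longrightarrow> (x - y, a - b) \<in> \<Gamma>" using ph by (simp add: phom_def)
lemma gmult: "(x, a) \<in> \<Gamma> \<Longrightarrow> (y, b) \<in> \<Gamma> \<Longrightarrow> (x * y, a * b) \<in> \<Gamma>" using ph by (simp add: phom_def)
lemma gker: "(x, a) \<in> \<Gamma> \<Longrightarrow> x \<in> P \<longleftrightarrow> a = 0" using ph by (simp add: phom_def)
lemma g0: "(0, 0) \<in> \<Gamma>" using gdiff[OF g1 g1] by simp
lemma gminus: "(x, a) \<in> \<Gamma> \<Longrightarrow> (- x, - a) \<in> \<Gamma>" using gdiff[OF g0] by force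
lemma gadd: "(x, a) \<in> \<Gamma> \<Longrightarrow> (y, b) \<in> \<Gamma> \<Longrightarrow> (x + y, a + b) \<in> \<Gamma>"
  using gdiff[of x a "- y" "- b"] gminus[of y b] by simp
lemma gsum: "(\<And>i. i \<in> I \<Longrightarrow> (s i, t i) \<in> \<Gamma>) \<Longrightarrow> (sum s I, sum t I) \<in> \<Gamma>"
  by (induction I rule: infinite_finite_induct) (auto simp: g0 intro: gadd)
lemma gpow: "(x, a) \<in> \<Gamma> \<Longrightarrow> (x ^ n, a ^ n) \<in> \<Gamma>"
  by (induction n) (auto simp: g1 intro: gmult)
lemma gfun: "(x, a) \<in> \<Gamma> \<Longrightarrow> (x, b) \<in> \<Gamma> \<Longrightarrow> a = b"
  using gker[of 0 "a - b"] gdiff[of x a x b] P by (simp add: prime_set_def)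

lemma P_add: "x \<in> P \<Longrightarrow> y \<in> P \<Longrightarrow> x + y \<in> P" using P by (simp add: prime_set_def)
lemma P_mult: "x \<in> P \<Longrightarrow> r * x \<in> P" using P by (simp add: prime_set_def)
lemma P_mult2: "x \<in> P \<Longrightarrow> x * r \<in> P" using P_mult[of x r] by (simp add: mult.commute)
lemma P_prime: "x * y \<in> P \<Longrightarrow> x \<in> P \<or> y \<in> P" using P by (simp add: prime_set_def)
lemma P_0: "0 \<in> P" using P by (simp add: prime_set_def)
lemma P_diff: "x \<in> P \<Longrightarrow> y \<in> P \<Longrightarrow> x - y \<in> P" using P_add[of x "- y"] P_mult[of y "-1"] by simp
lemma P_sum: "(\<And>i. i \<in> I \<Longrightarrow> s i \<in> P) \<Longrightarrow> sum s I \<in> P"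
  by (induction I rule: infinite_finite_induct) (auto simp: P_0 intro: P_add)
lemma P_poly: assumes "\<And>i. coeff f i \<in> P" shows "poly f y \<in> P"
  unfolding poly_altdef using assms by (intro P_sum P_mult2)

lemma pp0: "ppair \<Gamma> 0 0" by (simp add: ppair_def g0)
lemma pp_diff: "ppair \<Gamma> f g \<Longrightarrow> ppair \<Gamma> f' g' \<Longrightarrow> ppair \<Gamma> (f - f') (g - g')"
  by (simp add: ppair_def gdiff)
lemma pp_add: "ppair \<Gamma> f g \<Longrightarrow> ppair \<Gamma> f' g' \<Longrightarrow> ppair \<Gamma> (f + f') (g + g')"
  by (simp add: ppair_def gadd)
lemma pp_mult: "ppair \<Gamma> f g \<Longrightarrow> ppair \<Gamma> f' g' \<Longrightarrow> ppair \<Gamma> (f * f') (g * g')"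
  unfolding ppair_def coeff_mult by (auto intro!: gsum gmult)
lemma pp_smult: "(x, a) \<in> \<Gamma> \<Longrightarrow> ppair \<Gamma> f g \<Longrightarrow> ppair \<Gamma> (smult x f) (smult a g)"
  by (simp add: ppair_def gmult)
lemma pp_monom: "(x, a) \<in> \<Gamma> \<Longrightarrow> ppair \<Gamma> (monom x k) (monom a k)"
  by (auto simp: ppair_def coeff_monom g0)
lemma pp_ker: "ppair \<Gamma> f 0 \<Longrightarrow> poly f y \<in> P"
  unfolding ppair_def by (rule P_poly) (use gker in auto)

text \<open>Pseudo-division on both sides at once. The domain side has no inverses, so the dividend
  is multiplied by some \<open>x\<close> whose image \<open>c\<close> is nonzero. The induction runs
  over the degree of the image, since \<open>f\<close> may have further terms with coefficients in
  \<open>P\<close>.\<close>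

lemma pp_division:
  assumes "ppair \<Gamma> f g" "ppair \<Gamma> f1 g1" "g1 \<noteq> 0"
  shows "\<exists>x c hf hg rf rg. (x, c) \<in> \<Gamma> \<and> c \<noteq> 0 \<and> ppair \<Gamma> hf hg \<and> ppair \<Gamma> rf rg
     \<and> smult x f = f1 * hf + rf \<and> smult c g = g1 * hg + rg \<and> (rg = 0 \<or> degree rg < degree g1)"
  using assms(1)
proof (induction "degree g" arbitrary: f g rule: less_induct)
  case less
  show ?case
  proof (cases "g = 0 \<or> degree g < degree g1")
    case True
    then show ?thesis using g1 pp0 less.prems
      by (intro exI[of _ 1] exI[of _ 0] exI[of _ f] exI[of _ g]) auto
  next
    case False
    define n m where "n = degree g" and "m = degree g1"
    have nm: "m \<le> n" and "g \<noteq> 0" using False by (auto simp: n_def m_def)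
    define x1 c1 x2 c2 where "x1 = coeff f1 m" and "c1 = coeff g1 m" and "x2 = coeff f n" and "c2 = coeff g n"
    have c: "(x1, c1) \<in> \<Gamma>" "(x2, c2) \<in> \<Gamma>" "c1 \<noteq> 0" "c2 \<noteq> 0"
      using less.prems assms(2,3) \<open>g \<noteq> 0\<close> by (auto simp: x1_def c1_def x2_def c2_def ppair_def m_def n_def)
    define f' g' where "f' = smult x1 f - monom x2 (n - m) * f1" and "g' = smult c1 g - monom c2 (n - m) * g1"
    have pp': "ppair \<Gamma> f' g'" unfolding f'_def g'_def
      using c less.prems assms(2) by (intro pp_diff pp_smult pp_mult pp_monom)
    have deg': "degree g' \<le> n" unfolding g'_def
      by (intro degree_diff_le order.trans[OF degree_smult_le] order.trans[OF degree_mult_le])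
         (use nm in \<open>auto simp: n_def[symmetric] m_def[symmetric] degree_monom_eq c\<close>)
    have "coeff g' n = c1 * c2 - c2 * c1"
      unfolding g'_def using nm by (simp add: coeff_monom_mult c2_def[symmetric] c1_def)
    then have c0: "coeff g' n = 0" by simp
    show ?thesis
    proof (cases "g' = 0")
      case True
      have "smult x1 f = f1 * monom x2 (n - m) + f'" "smult c1 g = g1 * monom c2 (n - m) + g'"
        by (simp_all add: f'_def g'_def mult.commute)
      then show ?thesis using True c pp' pp_monom by blast
    next
      case False
      then have "degree g' < n" using deg' c0 by (metis leading_coeff_0_iff le_less)
      from less.hyps[OF this[unfolded n_def] pp'] obtain x d hf hg rf rg where
        *: "(x, d) \<in> \<Gamma>" "d \<noteq> 0" "ppair \<Gamma> hf hg" "ppair \<Gamma> rf rg"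
        "smult x f' = f1 * hf + rf" "smult d g' = g1 * hg + rg" "rg = 0 \<or> degree rg < degree g1" by blast
      have "smult (x * x1) f = f1 * (hf + smult x (monom x2 (n - m))) + rf"
        using *(5) unfolding f'_def by (simp add: smult_diff_right algebra_simps)
      moreover have "smult (d * c1) g = g1 * (hg + smult d (monom c2 (n - m))) + rg"
        using *(6) unfolding g'_def by (simp add: smult_diff_right algebra_simps)
      moreover have "(x * x1, d * c1) \<in> \<Gamma>" "d * c1 \<noteq> 0" using * c gmult by auto
      moreover have "ppair \<Gamma> (hf + smult x (monom x2 (n - m))) (hg + smult d (monom c2 (n - m)))"
        using * c by (intro pp_add pp_smult pp_monom)
      ultimately show ?thesis using * by blast
    qed
  qed
qed

definition adjoin :: "'r \<Rightarrow> 'l \<Rightarrow> ('r \<times> 'l) set" where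
  "adjoin y \<alpha> = {(poly f y, poly g \<alpha>) |f g. ppair \<Gamma> f g}"

lemma subset_adjoin: "\<Gamma> \<subseteq> adjoin y \<alpha>"
proof safe
  fix x a assume "(x, a) \<in> \<Gamma>"
  then have "ppair \<Gamma> [:x:] [:a:]" by (auto simp: ppair_def g0 coeff_pCons split: nat.split)
  then show "(x, a) \<in> adjoin y \<alpha>" unfolding adjoin_def by force
qed

lemma in_adjoin: "(y, \<alpha>) \<in> adjoin y \<alpha>"
proof -
  have "ppair \<Gamma> [:0, 1:] [:0, 1:]" by (auto simp: ppair_def g0 g1 coeff_pCons split: nat.split)
  then show ?thesis unfolding adjoin_def by force
qed

text \<open>The image of \<open>y\<close> is a root of a relation of least degree; least degrees on both sides agree by primality.\<close>
lemma extend_algebraic: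
  assumes alg: "ppair \<Gamma> f g" "g \<noteq> 0" "poly f y \<in> P"
    and root: "\<And>p :: 'l poly. degree p > 0 \<Longrightarrow> \<exists>x. poly p x = 0"
  shows "\<exists>\<alpha>. phom P (adjoin y \<alpha>)"
proof -
  define Q where "Q p \<longleftrightarrow> ppair \<Gamma> (fst p) (snd p) \<and> snd p \<noteq> 0 \<and> poly (fst p) y \<in> P" for p
  have "Q (f, g)" using alg by (simp add: Q_def)
  then obtain p where "Q p" and pmin: "\<And>q. Q q \<Longrightarrow> degree (snd p) \<le> degree (snd q)"
    using ex_has_least_nat[of Q _ "\<lambda>p. degree (snd p)"] by blast
  define f0 g0 where "f0 = fst p" and "g0 = snd p"
  have p0: "ppair \<Gamma> f0 g0" "g0 \<noteq> 0" "poly f0 y \<in> P" using \<open>Q p\<close> by (auto simp: Q_def f0_def g0_def)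
  have min0: "g' = 0" if "ppair \<Gamma> f' g'" "poly f' y \<in> P" "degree g' < degree g0" for f' g'
    using pmin[of "(f', g')"] that by (auto simp: Q_def g0_def)
  \<comment> \<open>A constant \<open>g0\<close> would force the constant coefficient of
    \<open>f0\<close> into \<open>P\<close>, since all other coefficients are there, whereas its
    image is nonzero.\<close>
  have "degree g0 \<noteq> 0"
  proof
    assume d0: "degree g0 = 0"
    have c0: "(coeff f0 0, coeff g0 0) \<in> \<Gamma>" "coeff g0 0 \<noteq> 0"
      using p0 d0 by (auto simp: ppair_def) (metis leading_coeff_neq_0)
    have "coeff f0 i \<in> P" if "i > 0" for i
    proof -
      have "(coeff f0 i, coeff g0 i) \<in> \<Gamma>" using p0 by (simp add: ppair_def)
      moreover have "coeff g0 i = 0" using d0 that by (intro coeff_eq_0) simp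
      ultimately show ?thesis using gker by auto
    qed
    then have "poly (f0 - [:coeff f0 0:]) y \<in> P"
      by (intro P_poly) (auto simp: coeff_pCons P_0 split: nat.split)
    then have "coeff f0 0 \<in> P" using P_diff[OF p0(3)] by fastforce
    then show False using c0 gker by blast
  qed
  then obtain \<alpha> where \<alpha>: "poly g0 \<alpha> = 0" using root by blast
  have dir1: "poly g' \<alpha> = 0" if a: "ppair \<Gamma> f' g'" "poly f' y \<in> P" for f' g'
  proof -
    obtain x c hf hg rf rg where *: "(x, c) \<in> \<Gamma>" "c \<noteq> 0" "ppair \<Gamma> hf hg" "ppair \<Gamma> rf rg"
      "smult x f' = f0 * hf + rf" "smult c g' = g0 * hg + rg" "rg = 0 \<or> degree rg < degree g0"
      using pp_division[OF a(1) p0(1,2)] by blast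
    have "rf = smult x f' - f0 * hf" using *(5) by simp
    then have "poly rf y \<in> P" using a(2) p0(3) by (simp add: P_diff P_mult P_mult2)
    then have "rg = 0" using min0 * by blast
    then have "c * poly g' \<alpha> = poly g0 \<alpha> * poly hg \<alpha>" using *(6) by (metis add.right_neutral poly_mult poly_smult)
    then show ?thesis using \<alpha> *(2) by simp
  qed
  \<comment> \<open>The converse direction needs a relation of least degree for \<alpha>; its
    counterpart \<open>f1\<close> must then be shown to vanish at \<open>y\<close> modulo
    \<open>P\<close>.\<close>
  define Q1 where "Q1 p \<longleftrightarrow> ppair \<Gamma> (fst p) (snd p) \<and> snd p \<noteq> 0 \<and> poly (snd p) \<alpha> = 0" for p
  have "Q1 p" using p0 \<alpha> by (simp add: Q1_def f0_def g0_def)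
  then obtain p' where "Q1 p'" and pmin1: "\<And>q. Q1 q \<Longrightarrow> degree (snd p') \<le> degree (snd q)"
    using ex_has_least_nat[of Q1 _ "\<lambda>p. degree (snd p)"] by blast
  define f1 g1 where "f1 = fst p'" and "g1 = snd p'"
  have p1: "ppair \<Gamma> f1 g1" "g1 \<noteq> 0" "poly g1 \<alpha> = 0" using \<open>Q1 p'\<close> by (auto simp: Q1_def f1_def g1_def)
  have min1: "g' = 0" if "ppair \<Gamma> f' g'" "poly g' \<alpha> = 0" "degree g' < degree g1" for f' g'
    using pmin1[of "(f', g')"] that by (auto simp: Q1_def g1_def)
  have "degree g1 \<noteq> 0"
  proof
    assume "degree g1 = 0"
    then obtain c where "g1 = [:c:]" by (meson degree_eq_zeroE)
    then show False using p1 by simp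
  qed
  have f1P: "poly f1 y \<in> P"
  proof -
    obtain x c hf hg rf rg where *: "(x, c) \<in> \<Gamma>" "c \<noteq> 0" "ppair \<Gamma> hf hg" "ppair \<Gamma> rf rg"
      "smult x f0 = f1 * hf + rf" "smult c g0 = g1 * hg + rg" "rg = 0 \<or> degree rg < degree g1"
      using pp_division[OF p0(1) p1(1,2)] by blast
    have "poly rg \<alpha> = c * poly g0 \<alpha> - poly g1 \<alpha> * poly hg \<alpha>"
      using arg_cong[OF *(6), of "\<lambda>q. poly q \<alpha>"] by simp
    then have "rg = 0" using min1 * p1 \<alpha> by auto
    then have "poly rf y \<in> P" using pp_ker *(4) by blast
    moreover have "poly f1 y * poly hf y = x * poly f0 y - poly rf y"
      using arg_cong[OF *(5), of "\<lambda>q. poly q y"] by simp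
    ultimately have "poly f1 y * poly hf y \<in> P" using p0(3) by (simp add: P_diff P_mult)
    \<comment> \<open>Otherwise \<open>hf\<close> would be a relation for \<open>y\<close> whose
      image has smaller degree than \<open>g0\<close>, as \<open>g1\<close> is not constant.\<close>
    moreover have "poly hf y \<notin> P"
    proof
      assume h: "poly hf y \<in> P"
      have e: "smult c g0 = g1 * hg" using *(6) \<open>rg = 0\<close> by simp
      then have "hg \<noteq> 0" using *(2) p0(2) by auto
      then have "degree g0 = degree g1 + degree hg"
        using arg_cong[OF e, of degree] p1(2) *(2) by (simp add: degree_mult_eq)
      then show False using min0[OF *(3) h] \<open>hg \<noteq> 0\<close> \<open>degree g1 \<noteq> 0\<close> by simp
    qed
    ultimately show ?thesis using P_prime by blast
  qed
  have dir2: "poly f' y \<in> P" if a: "ppair \<Gamma> f' g'" "poly g' \<alpha> = 0" for f' g'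
  proof -
    obtain x c hf hg rf rg where *: "(x, c) \<in> \<Gamma>" "c \<noteq> 0" "ppair \<Gamma> hf hg" "ppair \<Gamma> rf rg"
      "smult x f' = f1 * hf + rf" "smult c g' = g1 * hg + rg" "rg = 0 \<or> degree rg < degree g1"
      using pp_division[OF a(1) p1(1,2)] by blast
    have "poly rg \<alpha> = c * poly g' \<alpha> - poly g1 \<alpha> * poly hg \<alpha>"
      using arg_cong[OF *(6), of "\<lambda>q. poly q \<alpha>"] by simp
    then have "rg = 0" using min1 * p1 a by auto
    then have "poly rf y \<in> P" using pp_ker *(4) by blast
    moreover have "x * poly f' y = poly f1 y * poly hf y + poly rf y"
      using arg_cong[OF *(5), of "\<lambda>q. poly q y"] by simp
    ultimately have "x * poly f' y \<in> P" using f1P by (simp add: P_add P_mult2)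
    then show ?thesis using P_prime gker *(1,2) by blast
  qed
  have "phom P (adjoin y \<alpha>)" unfolding phom_def
  proof (intro conjI allI impI)
    show "(1, 1) \<in> adjoin y \<alpha>" using subset_adjoin part_hom.g1[OF part_hom_axioms] by blast
  next
    fix u a v b assume "(u, a) \<in> adjoin y \<alpha>" "(v, b) \<in> adjoin y \<alpha>"
    then obtain f g f' g' where *: "u = poly f y" "a = poly g \<alpha>" "ppair \<Gamma> f g" "v = poly f' y" "b = poly g' \<alpha>" "ppair \<Gamma> f' g'"
      unfolding adjoin_def by blast
    have "(u - v, a - b) = (poly (f - f') y, poly (g - g') \<alpha>)" using * by simp
    then show "(u - v, a - b) \<in> adjoin y \<alpha>" unfolding adjoin_def using pp_diff[OF *(3,6)] by blast
    have "(u * v, a * b) = (poly (f * f') y, poly (g * g') \<alpha>)" using * by simp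
    then show "(u * v, a * b) \<in> adjoin y \<alpha>" unfolding adjoin_def using pp_mult[OF *(3,6)] by blast
  next
    fix u a assume "(u, a) \<in> adjoin y \<alpha>"
    then obtain f g where "u = poly f y" "a = poly g \<alpha>" "ppair \<Gamma> f g"
      unfolding adjoin_def by blast
    then show "u \<in> P \<longleftrightarrow> a = 0" using dir1 dir2 by metis
  qed
  then show ?thesis by blast
qed

end

lemma phom_chain:
  assumes "subset.chain {\<Gamma>. phom P \<Gamma> \<and> \<Gamma>0 \<subseteq> \<Gamma>} \<C>" "\<C> \<noteq> {}"
  shows "phom P (\<Union>\<C>)"
proof -
  have c: "\<And>\<Gamma>. \<Gamma> \<in> \<C> \<Longrightarrow> phom P \<Gamma>" "\<And>\<Gamma> \<Gamma>'. \<Gamma> \<in> \<C> \<Longrightarrow> \<Gamma>' \<in> \<C> \<Longrightarrow> \<Gamma> \<subseteq> \<Gamma>' \<or> \<Gamma>' \<subseteq> \<Gamma>"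
    using assms(1) by (auto simp: subset_chain_def)
  have "\<exists>\<Gamma>\<in>\<C>. p \<in> \<Gamma> \<and> q \<in> \<Gamma>" if "p \<in> \<Union>\<C>" "q \<in> \<Union>\<C>" for p q
    using that c(2) by blast
  note common = this
  show ?thesis unfolding phom_def
  proof (intro conjI allI impI)
    show "(1, 1) \<in> \<Union>\<C>" using assms(2) c(1) unfolding phom_def by blast
  next
    fix x a y b assume "(x, a) \<in> \<Union>\<C>" "(y, b) \<in> \<Union>\<C>"
    then obtain \<Gamma> where G: "\<Gamma> \<in> \<C>" "(x, a) \<in> \<Gamma>" "(y, b) \<in> \<Gamma>" using common by blast
    then have "(x - y, a - b) \<in> \<Gamma>" "(x * y, a * b) \<in> \<Gamma>" using c(1)[OF G(1)] by (simp_all add: phom_def)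
    then show "(x - y, a - b) \<in> \<Union>\<C>" "(x * y, a * b) \<in> \<Union>\<C>" using G by blast+
  next
    fix x a assume "(x, a) \<in> \<Union>\<C>"
    then obtain \<Gamma> where "\<Gamma> \<in> \<C>" "(x, a) \<in> \<Gamma>" by blast
    then show "x \<in> P \<longleftrightarrow> a = 0" using c(1)[of \<Gamma>] by (simp add: phom_def)
  qed
qed

text \<open>Extension of homomorphisms with kernel \<open>P\<close> into an algebraically closed field: a partial
  homomorphism is encoded by its graph, a subring of the product.\<close>
lemma maximal_phom:
  fixes \<Gamma>0 :: "('r::comm_ring_1 \<times> 'l::alg_closed_field) set"
  assumes "prime_set P" "phom P \<Gamma>0"
  obtains \<Gamma> where "phom P \<Gamma>" "\<Gamma>0 \<subseteq> \<Gamma>"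
    "\<And>y f g. ppair \<Gamma> f g \<Longrightarrow> g \<noteq> 0 \<Longrightarrow> poly f y \<in> P \<Longrightarrow> \<exists>\<alpha>. (y, \<alpha>) \<in> \<Gamma>"
proof -
  have "\<exists>U\<in>{\<Gamma>. phom P \<Gamma> \<and> \<Gamma>0 \<subseteq> \<Gamma>}. \<forall>X\<in>\<C>. X \<subseteq> U" if ch: "subset.chain {\<Gamma>. phom P \<Gamma> \<and> \<Gamma>0 \<subseteq> \<Gamma>} \<C>" for \<C>
  proof (cases "\<C> = {}")
    case True
    then show ?thesis using assms by blast
  next
    case False
    then obtain X where "X \<in> \<C>" by blast
    then have "\<Gamma>0 \<subseteq> \<Union>\<C>" using ch unfolding subset_chain_def by blast
    then show ?thesis using phom_chain[OF ch False] by blast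
  qed
  then have "\<exists>M\<in>{\<Gamma>. phom P \<Gamma> \<and> \<Gamma>0 \<subseteq> \<Gamma>}. \<forall>X\<in>{\<Gamma>. phom P \<Gamma> \<and> \<Gamma>0 \<subseteq> \<Gamma>}. M \<subseteq> X \<longrightarrow> X = M"
    by (rule subset_Zorn)
  then obtain \<Gamma> where \<Gamma>: "phom P \<Gamma>" "\<Gamma>0 \<subseteq> \<Gamma>" and mx: "\<And>X. phom P X \<Longrightarrow> \<Gamma>0 \<subseteq> X \<Longrightarrow> \<Gamma> \<subseteq> X \<Longrightarrow> X = \<Gamma>"
    by auto
  interpret part_hom P \<Gamma> using assms(1) \<Gamma> by unfold_locales
  show ?thesis
  proof (rule that[OF \<Gamma>])
    fix y f g assume "ppair \<Gamma> f g" "g \<noteq> 0" "poly f y \<in> P"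
    then obtain \<alpha> where "phom P (adjoin y \<alpha>)"
      using extend_algebraic alg_closed_imp_poly_has_root by blast
    then have "adjoin y \<alpha> = \<Gamma>" using mx[OF _ _ subset_adjoin] \<Gamma> subset_adjoin by blast
    then show "\<exists>\<alpha>. (y, \<alpha>) \<in> \<Gamma>" using in_adjoin by blast
  qed
qed

section \<open>Valuation rings\<close>

definition subr :: "'l::field set \<Rightarrow> bool" where
  "subr R \<longleftrightarrow> 1 \<in> R \<and> (\<forall>x\<in>R. \<forall>y\<in>R. x - y \<in> R \<and> x * y \<in> R)"

lemma subr_1: "subr R \<Longrightarrow> 1 \<in> R" by (simp add: subr_def)
lemma subr_diff: "subr R \<Longrightarrow> x \<in> R \<Longrightarrow> y \<in> R \<Longrightarrow> x - y \<in> R" by (simp add: subr_def)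
lemma subr_mult: "subr R \<Longrightarrow> x \<in> R \<Longrightarrow> y \<in> R \<Longrightarrow> x * y \<in> R" by (simp add: subr_def)
lemma subr_0: "subr R \<Longrightarrow> 0 \<in> R" using subr_diff[of R 1 1] subr_1[of R] by simp
lemma subr_minus: "subr R \<Longrightarrow> x \<in> R \<Longrightarrow> - x \<in> R" using subr_diff[of R 0 x] subr_0[of R] by simp
lemma subr_add: "subr R \<Longrightarrow> x \<in> R \<Longrightarrow> y \<in> R \<Longrightarrow> x + y \<in> R"
  using subr_diff[of R x "- y"] subr_minus[of R y] by simp
lemma subr_sum: "subr R \<Longrightarrow> (\<And>i. i \<in> I \<Longrightarrow> f i \<in> R) \<Longrightarrow> sum f I \<in> R"
  by (induction I rule: infinite_finite_induct) (auto simp: subr_0 subr_add)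
lemma subr_prod: "subr R \<Longrightarrow> (\<And>i. i \<in> I \<Longrightarrow> f i \<in> R) \<Longrightarrow> prod f I \<in> R"
  by (induction I rule: infinite_finite_induct) (auto simp: subr_1 subr_mult)
lemma subr_power: "subr R \<Longrightarrow> x \<in> R \<Longrightarrow> x ^ n \<in> R"
  by (induction n) (auto simp: subr_1 subr_mult)
lemma subr_of_nat: "subr R \<Longrightarrow> of_nat n \<in> R"
  by (induction n) (auto simp: subr_0 subr_1 subr_add)
lemma subr_poly: "subr R \<Longrightarrow> (\<And>i. coeff p i \<in> R) \<Longrightarrow> x \<in> R \<Longrightarrow> poly p x \<in> R"
  unfolding poly_altdef by (intro subr_sum subr_mult subr_power)

section \<open>Chevalley's extension theorem\<close>

inductive_set idl :: "'l::field set \<Rightarrow> 'l set \<Rightarrow> 'l set" for I R where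
  zero: "0 \<in> idl I R"
| step: "i \<in> I \<Longrightarrow> r \<in> R \<Longrightarrow> x \<in> idl I R \<Longrightarrow> i * r + x \<in> idl I R"

lemma idl_base: "i \<in> I \<Longrightarrow> r \<in> R \<Longrightarrow> i * r \<in> idl I R"
  using idl.step[OF _ _ idl.zero] by force

lemma idl_mono: assumes "x \<in> idl I R" "R \<subseteq> R'" shows "x \<in> idl I R'"
  using assms(1) by induction (use assms(2) in \<open>auto intro: idl.intros\<close>)

lemma idl_add: assumes "x \<in> idl I R" "y \<in> idl I R" shows "x + y \<in> idl I R"
  using assms(1) by induction (use assms(2) in \<open>auto simp: add.assoc intro: idl.intros\<close>)

lemma idl_mult: assumes "x \<in> idl I R" "subr R" "r \<in> R" shows "r * x \<in> idl I R"
  using assms(1)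
proof induction
  case (step i s x)
  have "r * (i * s + x) = i * (r * s) + r * x" by (simp add: algebra_simps)
  then show ?case using step assms by (simp add: idl.step subr_mult)
qed (simp add: idl.zero)

lemma idl_subset: assumes "x \<in> idl I R" "subr R" "I \<subseteq> R" shows "x \<in> R"
  using assms(1) by induction (use assms(2,3) in \<open>auto simp: subr_0 intro: subr_add subr_mult\<close>)

lemma idl_sum: "(\<And>k. k \<in> K \<Longrightarrow> f k \<in> idl I R) \<Longrightarrow> sum f K \<in> idl I R"
  by (induction K rule: infinite_finite_induct) (auto simp: idl.zero idl_add)

definition radj :: "'l::field set \<Rightarrow> 'l \<Rightarrow> 'l set" where
  "radj R x = {poly p x |p. \<forall>i. coeff p i \<in> R}"

lemma subr_radj: assumes "subr R" shows "subr (radj R x)"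
  unfolding subr_def
proof (intro conjI ballI)
  have "1 = poly [:1:] x" "\<forall>i. coeff [:1:] i \<in> R"
    using assms by (auto simp: coeff_pCons subr_0 subr_1 split: nat.split)
  then show "1 \<in> radj R x" unfolding radj_def by blast
  fix u v assume "u \<in> radj R x" "v \<in> radj R x"
  then obtain p q where *: "u = poly p x" "v = poly q x" "\<forall>i. coeff p i \<in> R" "\<forall>i. coeff q i \<in> R"
    unfolding radj_def by blast
  then have "u - v = poly (p - q) x" "\<forall>i. coeff (p - q) i \<in> R" using assms by (simp_all add: subr_diff)
  then show "u - v \<in> radj R x" unfolding radj_def by blast
  have "u * v = poly (p * q) x" "\<forall>i. coeff (p * q) i \<in> R"
    using * assms by (auto simp: coeff_mult intro!: subr_sum subr_mult)
  then show "u * v \<in> radj R x" unfolding radj_def by blast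
qed

lemma radj_base: assumes "subr R" shows "R \<subseteq> radj R x" "x \<in> radj R x"
proof
  fix r assume "r \<in> R"
  then have "r = poly [:r:] x" "\<forall>i. coeff [:r:] i \<in> R"
    using assms by (auto simp: coeff_pCons subr_0 split: nat.split)
  then show "r \<in> radj R x" unfolding radj_def by blast
next
  have "x = poly [:0, 1:] x" "\<forall>i. coeff [:0, 1:] i \<in> R"
    using assms by (auto simp: coeff_pCons subr_0 subr_1 split: nat.split)
  then show "x \<in> radj R x" unfolding radj_def by blast
qed

lemma idl_radj: 
  assumes "z \<in> idl I (radj R x)" "subr R"
  shows "\<exists>p. (\<forall>k. coeff p k \<in> idl I R) \<and> poly p x = z"
  using assms(1)
proof induction
  case zero
  show ?case by (intro exI[of _ 0]) (simp add: idl.zero)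
next
  case (step i r z)
  then obtain p q where "\<forall>k. coeff p k \<in> idl I R" "poly p x = z" "r = poly q x" "\<forall>k. coeff q k \<in> R"
    unfolding radj_def by blast
  then show ?case using step(1) by (intro exI[of _ "smult i q + p"]) (auto intro: idl_add idl_base)
qed

text \<open>The equation for \<open>inverse x\<close> expresses x^n (1 - b0) through lower powers of
  \<open>x\<close>, so the top term of \<open>p\<close> can be replaced. Applied to a pair of least
  degrees, in whichever order fits, this is the contradiction in Chevalley's theorem.\<close>

lemma chevalley_step:
  assumes R: "subr R" "I \<subseteq> R" "1 \<notin> idl I R" and "x \<noteq> 0"
    and p: "\<forall>k. coeff p k \<in> idl I R" "poly p x = 1"
    and q: "\<forall>k. coeff q k \<in> idl I R" "poly q (inverse x) = 1"
    and deg: "degree q \<le> degree p"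
  shows "\<exists>p'. (\<forall>k. coeff p' k \<in> idl I R) \<and> poly p' x = 1 \<and> degree p' < degree p"
proof -
  define n m a b where "n = degree p" and "m = degree q" and "a = coeff p n" and "b = coeff q"
  have J: "u \<in> R" if "u \<in> idl I R" for u using idl_subset that R by blast
  have "n \<noteq> 0"
  proof
    assume "n = 0"
    then obtain c where "p = [:c:]" unfolding n_def by (meson degree_eq_zeroE)
    then show False using p R(3) by (metis coeff_pCons_0 mult_zero_right poly_0 poly_pCons add.right_neutral)
  qed
  define r where "r = (\<Sum>k=1..m. monom (b k) (n - k))"
  \<comment> \<open>The equation p(x) = 1 is multiplied by 1 - b0, its top term is exchanged for a
    r, and b0 is added to restore the value 1.\<close>
  define p' where "p' = [:b 0:] + smult (1 - b 0) (p - monom a n) + smult a r"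
  have ainJ: "a \<in> idl I R" "b k \<in> idl I R" for k using p q by (auto simp: a_def b_def)
  have "coeff (p - monom a n) k \<in> idl I R" for k
    using p by (auto simp: coeff_monom a_def idl.zero)
  moreover have "1 - b 0 \<in> R" using J ainJ R subr_1 subr_diff by blast
  moreover have "coeff r k \<in> idl I R" for k
    unfolding r_def coeff_sum using ainJ by (intro idl_sum) (auto simp: coeff_monom idl.zero)
  moreover have "coeff [:b 0:] k \<in> idl I R" for k
    using ainJ by (cases k) (auto simp: idl.zero)
  ultimately have c1: "\<forall>k. coeff p' k \<in> idl I R"
    unfolding p'_def coeff_add coeff_smult using R(1) J[OF ainJ(1)]
    by (intro allI idl_add idl_mult)
  have "1 = b 0 + (\<Sum>k=1..m. b k * inverse x ^ k)"
  proof -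
    have "1 = (\<Sum>k\<le>m. b k * inverse x ^ k)" using q(2) by (simp add: poly_altdef m_def b_def)
    also have "{..m} = insert 0 {1..m}" by auto
    finally show ?thesis by simp
  qed
  then have "1 - b 0 = (\<Sum>k=1..m. b k * inverse x ^ k)" by (metis add_diff_cancel_left')
  then have "x ^ n * (1 - b 0) = (\<Sum>k=1..m. x ^ n * (b k * inverse x ^ k))"
    by (simp add: sum_distrib_left)
  also have "\<dots> = (\<Sum>k=1..m. b k * x ^ (n - k))"
  proof (rule sum.cong)
    fix k assume "k \<in> {1..m}"
    then have "k \<le> n" using deg by (simp add: n_def m_def)
    then have "x ^ n * inverse x ^ k = x ^ (n - k)"
      using \<open>x \<noteq> 0\<close> by (simp add: power_diff power_inverse divide_inverse)
    then show "x ^ n * (b k * inverse x ^ k) = b k * x ^ (n - k)" by (simp add: algebra_simps)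
  qed simp
  also have "\<dots> = poly r x" by (simp add: r_def poly_sum poly_monom)
  finally have r: "poly r x = x ^ n * (1 - b 0)" by simp
  have "poly p' x = b 0 + (1 - b 0) * (1 - a * x ^ n) + a * (x ^ n * (1 - b 0))"
    unfolding p'_def by (simp add: p r poly_monom)
  also have "\<dots> = 1" by (simp add: algebra_simps)
  finally have c2: "poly p' x = 1" .
  have "coeff p' k = 0" if "k \<ge> n" for k
  proof -
    have "coeff (p - monom a n) k = 0"
      using that by (cases "k = n") (auto simp: a_def n_def coeff_eq_0 coeff_monom)
    moreover have "coeff r k = 0" unfolding r_def coeff_sum
      using that \<open>n \<noteq> 0\<close> by (intro sum.neutral) (auto simp: coeff_monom)
    moreover have "coeff [:b 0:] k = 0" using that \<open>n \<noteq> 0\<close> by (cases k) auto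
    ultimately show ?thesis by (simp add: p'_def)
  qed
  then have "degree p' < n" using \<open>n \<noteq> 0\<close> by (intro degree_lessI) auto
  then show ?thesis using c1 c2 n_def by blast
qed

text \<open>A subring maximal among those in which \<open>I\<close> still generates a proper ideal
  is a valuation ring. Properness passes to unions of chains because an expression of 1 uses
  finitely many ring elements. The last conclusion says that \<open>I\<close> lands among the
  nonunits.\<close>

lemma chevalley:
  assumes R0: "subr R0" "I \<subseteq> R0" "1 \<notin> idl I R0"
  obtains R where "subr R" "R0 \<subseteq> R" "\<And>x. x \<in> R \<or> inverse x \<in> R"
    "\<And>i. i \<in> I \<Longrightarrow> i \<noteq> 0 \<Longrightarrow> inverse i \<notin> R"
proof -
  define \<A> where "\<A> = {R. subr R \<and> R0 \<subseteq> R \<and> 1 \<notin> idl I R}"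
  have "\<exists>U\<in>\<A>. \<forall>X\<in>\<C>. X \<subseteq> U" if ch: "subset.chain \<A> \<C>" for \<C>
  proof (cases "\<C> = {}")
    case True
    then show ?thesis using R0 by (auto simp: \<A>_def)
  next
    case False
    have c: "\<And>X. X \<in> \<C> \<Longrightarrow> subr X \<and> R0 \<subseteq> X \<and> 1 \<notin> idl I X" "\<And>X Y. X \<in> \<C> \<Longrightarrow> Y \<in> \<C> \<Longrightarrow> X \<subseteq> Y \<or> Y \<subseteq> X"
      using ch by (auto simp: subset_chain_def \<A>_def)
    have common: "\<exists>X\<in>\<C>. u \<in> X \<and> v \<in> X" if "u \<in> \<Union>\<C>" "v \<in> \<Union>\<C>" for u v
      using that c(2) by blast
    have s: "subr (\<Union>\<C>)" unfolding subr_def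
    proof (intro conjI ballI)
      obtain X where X: "X \<in> \<C>" using False by blast
      then have "1 \<in> X" using c(1)[OF X] subr_1 by blast
      then show "1 \<in> \<Union>\<C>" using X by blast
      fix u v assume "u \<in> \<Union>\<C>" "v \<in> \<Union>\<C>"
      then obtain X where X: "X \<in> \<C>" "u \<in> X" "v \<in> X" using common by blast
      then have "u - v \<in> X" "u * v \<in> X" using c(1)[OF X(1)] by (auto intro: subr_diff subr_mult)
      then show "u - v \<in> \<Union>\<C>" "u * v \<in> \<Union>\<C>" using X(1) by blast+
    qed
    have f: "\<exists>X\<in>\<C>. z \<in> idl I X" if "z \<in> idl I (\<Union>\<C>)" for z
      using that
    proof induction
      case zero
      obtain X where "X \<in> \<C>" using False by blast
      then show ?case using idl.zero[of I X] by blast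
    next
      case (step i r x)
      then obtain X Y where X: "X \<in> \<C>" "x \<in> idl I X" "Y \<in> \<C>" "r \<in> Y" by blast
      obtain Z where Z: "Z \<in> \<C>" "X \<subseteq> Z" "Y \<subseteq> Z"
        using c(2)[OF X(1,3)] X(1,3) by (elim disjE) auto
      then have "i * r + x \<in> idl I Z" using X idl_mono[OF X(2) Z(2)] step(1) by (auto intro: idl.step)
      then show ?case using Z by blast
    qed
    obtain X where "X \<in> \<C>" using False by blast
    then have "R0 \<subseteq> \<Union>\<C>" using c(1)[of X] by blast
    moreover have "1 \<notin> idl I (\<Union>\<C>)" using f[of 1] c(1) by blast
    ultimately have "\<Union>\<C> \<in> \<A>" using s unfolding \<A>_def by blast
    then show ?thesis by blast
  qed
  then have "\<exists>M\<in>\<A>. \<forall>X\<in>\<A>. M \<subseteq> X \<longrightarrow> X = M" by (rule subset_Zorn)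
  then obtain R where R: "R \<in> \<A>" and mx: "\<And>X. X \<in> \<A> \<Longrightarrow> R \<subseteq> X \<Longrightarrow> X = R" by blast
  have R': "subr R" "R0 \<subseteq> R" "1 \<notin> idl I R" "I \<subseteq> R" using R R0 by (auto simp: \<A>_def)
  have ex: "\<exists>p. (\<forall>k. coeff p k \<in> idl I R) \<and> poly p x = 1" if "x \<notin> R" for x
  proof -
    have "radj R x \<notin> \<A>" using mx radj_base[OF R'(1), of x] that by blast
    then have "1 \<in> idl I (radj R x)"
      using subr_radj[OF R'(1), of x] radj_base[OF R'(1), of x] R'(2) unfolding \<A>_def by blast
    then show ?thesis using idl_radj R'(1) by blast
  qed
  have val: "x \<in> R \<or> inverse x \<in> R" for x
  proof (rule ccontr)
    assume n: "\<not> ?thesis"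
    then have "x \<noteq> 0" using subr_0[OF R'(1)] by auto
    define Q where "Q y p \<longleftrightarrow> (\<forall>k. coeff p k \<in> idl I R) \<and> poly p y = 1" for y p
    have "\<exists>p. Q x p" "\<exists>p. Q (inverse x) p" using ex n unfolding Q_def by auto
    then obtain p0 q0 where "Q x p0" "Q (inverse x) q0" by blast
    obtain p where p: "Q x p" "\<And>p'. Q x p' \<Longrightarrow> degree p \<le> degree p'"
      using ex_has_least_nat[of "Q x" p0 degree] \<open>Q x p0\<close> by blast
    obtain q where q: "Q (inverse x) q" "\<And>q'. Q (inverse x) q' \<Longrightarrow> degree q \<le> degree q'"
      using ex_has_least_nat[of "Q (inverse x)" q0 degree] \<open>Q (inverse x) q0\<close> by blast
    show False
    proof (cases "degree q \<le> degree p")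
      case True
      then show False using chevalley_step[of R I x p q] R' p q \<open>x \<noteq> 0\<close>
        by (auto simp: Q_def) (meson not_le)
    next
      case False
      then show False using chevalley_step[of R I "inverse x" q p] R' p q \<open>x \<noteq> 0\<close>
        by (auto simp: Q_def) (meson not_le)
    qed
  qed
  have "inverse i \<notin> R" if "i \<in> I" "i \<noteq> 0" for i
  proof
    assume "inverse i \<in> R"
    then have "i * inverse i \<in> idl I R" using idl_base that by blast
    then show False using that R'(3) by simp
  qed
  then show ?thesis using that R' val by blast
qed

section \<open>Valuation rings of a subfield\<close>

definition subf :: "'l::field set \<Rightarrow> bool" where
  "subf L \<longleftrightarrow> subr L \<and> (\<forall>x\<in>L. inverse x \<in> L)"

text \<open>The maximal ideal of a valuation ring, described as its set of nonunits. Zero is listed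
  separately because \<open>inverse 0 = 0\<close> would make it look like a unit.\<close>

definition mxi :: "'l::field set \<Rightarrow> 'l set" where
  "mxi R = {x \<in> R. x = 0 \<or> inverse x \<notin> R}"

definition valr :: "'l::field set \<Rightarrow> 'l set \<Rightarrow> bool" where
  "valr L R \<longleftrightarrow> subr R \<and> R \<subseteq> L \<and> (\<forall>x\<in>L. x \<in> R \<or> inverse x \<in> R)"

lemma mxi_iff_inverse: 
  assumes "valr L R" "x \<in> L" shows "x \<notin> R \<longleftrightarrow> inverse x \<in> mxi R \<and> x \<noteq> 0"
  using assms subr_0[of R] by (auto simp: valr_def mxi_def)

lemma mxi_mult:
  assumes "valr L R" "r \<in> R" "x \<in> mxi R" shows "r * x \<in> mxi R"
proof -
  have s: "subr R" using assms by (simp add: valr_def)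
  have "inverse x \<in> R" if "r * x \<noteq> 0" "inverse (r * x) \<in> R"
  proof -
    have "r * inverse (r * x) \<in> R" using s assms that subr_mult by blast
    moreover have "r * inverse (r * x) = inverse x" using that(1) by (simp add: nonzero_inverse_mult_distrib)
    ultimately show ?thesis by metis
  qed
  then show ?thesis using s assms by (auto simp: mxi_def subr_mult)
qed

lemma subf_divide: "subf L \<Longrightarrow> x \<in> L \<Longrightarrow> y \<in> L \<Longrightarrow> x / y \<in> L"
  unfolding divide_inverse subf_def by (auto intro: subr_mult)

lemma subf_subr: "subf L \<Longrightarrow> subr L" by (simp add: subf_def)
lemma subf_inverse: "subf L \<Longrightarrow> x \<in> L \<Longrightarrow> inverse x \<in> L" by (simp add: subf_def)

locale vring =
  fixes L R :: "'l::field set"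
  assumes L: "subf L" and v: "valr L R"
begin

lemma s: "subr R" using v by (simp add: valr_def)
lemma RL: "x \<in> R \<Longrightarrow> x \<in> L" using v by (auto simp: valr_def)
lemma total: "x \<in> L \<Longrightarrow> x \<notin> R \<Longrightarrow> inverse x \<in> R" using v by (auto simp: valr_def)
lemma mR: "x \<in> mxi R \<Longrightarrow> x \<in> R" by (simp add: mxi_def)
lemma m0: "0 \<in> mxi R" using s by (simp add: mxi_def subr_0)
lemma m1: "1 \<notin> mxi R" using s by (simp add: mxi_def subr_1)
lemma m_unit: "x \<in> R \<Longrightarrow> x \<notin> mxi R \<Longrightarrow> x \<noteq> 0 \<and> inverse x \<in> R" by (simp add: mxi_def)
lemma m_out: "x \<in> L \<Longrightarrow> x \<notin> R \<Longrightarrow> inverse x \<in> mxi R" using mxi_iff_inverse[OF v] by blast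

lemma m_mult: "r \<in> R \<Longrightarrow> x \<in> mxi R \<Longrightarrow> r * x \<in> mxi R" using mxi_mult[OF v] .
lemma m_mult2: "x \<in> mxi R \<Longrightarrow> r \<in> R \<Longrightarrow> x * r \<in> mxi R" using m_mult[of r x] by (simp add: mult.commute)

lemma m_add: assumes "x \<in> mxi R" "y \<in> mxi R" shows "x + y \<in> mxi R"
proof -
  have gen: "x + y \<in> mxi R" if "x \<in> mxi R" "y / x \<in> R" "x \<noteq> 0" for x y
  proof -
    have "(1 + y / x) * x \<in> mxi R" using that s by (intro m_mult subr_add subr_1)
    moreover have "(1 + y / x) * x = x + y" using that by (simp add: distrib_right)
    ultimately show ?thesis by simp
  qed
  show ?thesis
  proof (cases "x = 0 \<or> y = 0")
    case True
    then show ?thesis using assms by auto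
  next
    case False
    have "y / x \<in> L" using assms L by (intro subf_divide RL mR) auto
    then have "y / x \<in> R \<or> x / y \<in> R" using total[of "y / x"] by (auto simp: inverse_divide)
    then show ?thesis using gen[of x y] gen[of y x] assms False by (auto simp: add.commute)
  qed
qed

lemma m_minus: "x \<in> mxi R \<Longrightarrow> - x \<in> mxi R"
  using m_mult[of "-1" x] subr_minus[OF s subr_1[OF s]] by simp
lemma m_diff: "x \<in> mxi R \<Longrightarrow> y \<in> mxi R \<Longrightarrow> x - y \<in> mxi R"
  using m_add[of x "- y"] m_minus[of y] by simp
lemma m_sum: "(\<And>i. i \<in> I \<Longrightarrow> f i \<in> mxi R) \<Longrightarrow> sum f I \<in> mxi R"
  by (induction I rule: infinite_finite_induct) (auto simp: m0 m_add)
lemma m_prime: assumes "x * y \<in> mxi R" "x \<in> R" "y \<in> R" shows "x \<in> mxi R \<or> y \<in> mxi R"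
proof (rule ccontr)
  assume n: "\<not> ?thesis"
  then have "inverse x \<in> R" "inverse y \<in> R" using assms m_unit by blast+
  then have "inverse x * inverse y * (x * y) \<in> mxi R"
    by (intro m_mult[OF subr_mult[OF s] assms(1)])
  moreover have "x \<noteq> 0" "y \<noteq> 0" using n m0 by auto
  ultimately show False using m1 by (simp add: field_simps)
qed
lemma m_pow: "x \<in> mxi R \<Longrightarrow> n > 0 \<Longrightarrow> x ^ n \<in> mxi R"
  by (cases n) (simp_all add: m_mult2 subr_power[OF s] mR)
lemma unit_plus_m: assumes "x \<in> R" "x \<notin> mxi R" "y \<in> mxi R" shows "x + y \<in> R \<and> x + y \<notin> mxi R"
  using m_diff[of "x + y" y] assms s mR subr_add by auto

text \<open>The instance of integral closedness that makes value groups torsion-free; the purity of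
  \<open>kerv\<close> rests on it.\<close>

lemma root_closed: assumes "x \<in> L" "n > 0" "x ^ n \<in> R" shows "x \<in> R"
proof (rule ccontr)
  assume n: "x \<notin> R"
  then have "inverse x \<in> mxi R" using assms m_out by blast
  then have "inverse x ^ n \<in> mxi R" using \<open>n > 0\<close> m_pow by blast
  then have "x ^ n * inverse x ^ n \<in> mxi R" using m_mult assms by blast
  moreover have "x \<noteq> 0" using n s subr_0 by auto
  ultimately show False using m1 by (simp add: power_inverse)
qed

text \<open>Stands in for a term of least value: divisibility in \<open>R\<close> is a total
  preorder on the nonzero elements, so no value group has to be constructed.\<close>

lemma min_term:
  assumes "finite S" "S \<noteq> {}" "\<And>a. a \<in> S \<Longrightarrow> t a \<in> L" "\<And>a. a \<in> S \<Longrightarrow> t a \<noteq> 0"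
  shows "\<exists>b\<in>S. \<forall>a\<in>S. t a / t b \<in> R"
  using assms
proof (induction S rule: finite_ne_induct)
  case (singleton a)
  then show ?case using subr_1[OF s] by auto
next
  case (insert a S)
  then obtain b where b: "b \<in> S" "\<forall>a\<in>S. t a / t b \<in> R" by auto
  have nz: "t a \<noteq> 0" "t b \<noteq> 0" and "t a / t b \<in> L" using insert.prems b L by (auto intro: subf_divide)
  then consider "t a / t b \<in> R" | "t b / t a \<in> R" using total[of "t a / t b"] by (auto simp: inverse_divide)
  then show ?case
  proof cases
    case 1
    then show ?thesis using b by auto
  next
    case 2
    have "t c / t a \<in> R" if "c \<in> S" for c
    proof -
      have "t c / t b * (t b / t a) \<in> R" using b 2 that s subr_mult by blast
      then show ?thesis using nz by simp
    qed
    then show ?thesis using nz subr_1[OF s] by auto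
  qed
qed

end

lemma chevalley_valr:
  assumes "subf L" "subr R0" "R0 \<subseteq> L" "I \<subseteq> R0" "1 \<notin> idl I R0"
  obtains R where "valr L R" "R0 \<subseteq> R" "I \<subseteq> mxi R"
proof -
  obtain R where R: "subr R" "R0 \<subseteq> R" "\<And>x. x \<in> R \<or> inverse x \<in> R"
    "\<And>i. i \<in> I \<Longrightarrow> i \<noteq> 0 \<Longrightarrow> inverse i \<notin> R" using chevalley[OF assms(2,4,5)] by blast
  have "valr L (R \<inter> L)" unfolding valr_def subr_def
    using R(1,3) subf_subr[OF assms(1)] subf_inverse[OF assms(1)] 
    by (auto simp: subr_1 subr_diff subr_mult)
  moreover have "I \<subseteq> mxi (R \<inter> L)" using R assms by (auto simp: mxi_def)
  ultimately show ?thesis using that[of "R \<inter> L"] R assms by auto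
qed

section \<open>Linear independence modulo periodic elements\<close>

text \<open>\<open>Q\<close> is the preimage of the nonnegative cone of a total order on the
  torsion-free group W/D; it supplies the exponents of nonnegative value in
  \<open>Val_exists\<close>. A maximal cone is total, because adjoining \<open>x\<close> can fail
  only if a positive multiple of - x is already present, and this cannot happen for both signs by
  purity of \<open>D\<close>.\<close>

lemma pos_cone:
  fixes W D :: "'a::ab_group_add set"
  assumes W: "is_subgroup W" and D: "pure D" "D \<subseteq> W"
  shows "\<exists>Q. Q \<subseteq> W \<and> D \<subseteq> Q \<and> (\<forall>x\<in>Q. \<forall>y\<in>Q. x + y \<in> Q)
    \<and> (\<forall>x\<in>W. x \<in> Q \<or> - x \<in> Q) \<and> (\<forall>x\<in>Q. - x \<in> Q \<longrightarrow> x \<in> D)"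
proof -
  define \<A> where "\<A> = {Q. Q \<subseteq> W \<and> D \<subseteq> Q \<and> (\<forall>x\<in>Q. \<forall>y\<in>Q. x + y \<in> Q) \<and> (\<forall>x\<in>Q. - x \<in> Q \<longrightarrow> x \<in> D)}"
  have D': "is_subgroup D" using D pure_subgroup by blast
  have DA: "D \<in> \<A>" using D D' by (auto simp: \<A>_def subgroup_add)
  have "\<exists>U\<in>\<A>. \<forall>X\<in>\<C>. X \<subseteq> U" if ch: "subset.chain \<A> \<C>" for \<C>
  proof (cases "\<C> = {}")
    case True
    then show ?thesis using DA by blast
  next
    case False
    have c: "\<And>X. X \<in> \<C> \<Longrightarrow> X \<in> \<A>" "\<And>X Y. X \<in> \<C> \<Longrightarrow> Y \<in> \<C> \<Longrightarrow> X \<subseteq> Y \<or> Y \<subseteq> X"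
      using ch by (auto simp: subset_chain_def)
    have common: "\<exists>X\<in>\<C>. u \<in> X \<and> v \<in> X" if "u \<in> \<Union>\<C>" "v \<in> \<Union>\<C>" for u v
      using that c(2) by blast
    have "\<Union>\<C> \<in> \<A>" unfolding \<A>_def mem_Collect_eq
    proof (intro conjI ballI impI)
      show "\<Union>\<C> \<subseteq> W" using c(1) unfolding \<A>_def by blast
      show "D \<subseteq> \<Union>\<C>" using c(1) False unfolding \<A>_def by blast
      fix x y assume "x \<in> \<Union>\<C>" "y \<in> \<Union>\<C>"
      then obtain X where X: "X \<in> \<C>" "x \<in> X" "y \<in> X" using common by blast
      then have "x + y \<in> X" using c(1)[OF X(1)] by (simp add: \<A>_def)
      then show "x + y \<in> \<Union>\<C>" using X by blast
    next
      fix x assume "x \<in> \<Union>\<C>" "- x \<in> \<Union>\<C>"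
      then obtain X where X: "X \<in> \<C>" "x \<in> X" "- x \<in> X" using common by blast
      then show "x \<in> D" using c(1)[OF X(1)] by (simp add: \<A>_def)
    qed
    then show ?thesis by blast
  qed
  then have "\<exists>M\<in>\<A>. \<forall>X\<in>\<A>. M \<subseteq> X \<longrightarrow> X = M" by (rule subset_Zorn)
  then obtain Q where QA: "Q \<in> \<A>" and mx: "\<And>X. X \<in> \<A> \<Longrightarrow> Q \<subseteq> X \<Longrightarrow> X = Q" by blast
  have Q: "Q \<subseteq> W" "D \<subseteq> Q" "\<And>x y. x \<in> Q \<Longrightarrow> y \<in> Q \<Longrightarrow> x + y \<in> Q" "\<And>x. x \<in> Q \<Longrightarrow> - x \<in> Q \<Longrightarrow> x \<in> D"
    using QA by (auto simp: \<A>_def)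
  have Q0: "0 \<in> Q" using Q D' subgroup_0 by blast
  have Qn: "zs (int n) x \<in> Q" if "x \<in> Q" for n x
    by (induction n) (use that Q0 Q(3) in \<open>auto simp: zs_add_left\<close>)
  have step: "\<exists>n>0. zs (int n) (- x) \<in> Q" if x: "x \<in> W" "x \<notin> Q" for x
  proof -
    \<comment> \<open>The cone generated by \<open>Q\<close> and \<open>x\<close> is properly
      larger, so it must violate the condition on pairs u, - u; adding the two expressions isolates
      a multiple of - x.\<close>
    define X where "X = {q + zs (int n) x |q n. q \<in> Q}"
    have "q \<in> X" if "q \<in> Q" for q unfolding X_def using that by (force intro: exI[of _ q] exI[of _ "0::nat"])
    then have sub: "Q \<subseteq> X" by blast
    have "0 + zs (int 1) x \<in> X" unfolding X_def using Q0 by blast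
    then have "X \<noteq> Q" using x by auto
    then have "X \<notin> \<A>" using mx sub by blast
    moreover have "X \<subseteq> W" unfolding X_def using Q(1) x W by (auto intro!: subgroup_add subgroup_zs)
    moreover have "u + v \<in> X" if "u \<in> X" "v \<in> X" for u v
    proof -
      obtain q n q' n' where "u = q + zs (int n) x" "v = q' + zs (int n') x" "q \<in> Q" "q' \<in> Q"
        using \<open>u \<in> X\<close> \<open>v \<in> X\<close> unfolding X_def by blast
      moreover from this have "u + v = (q + q') + zs (int (n + n')) x" by (simp add: zs_add_left)
      ultimately show ?thesis unfolding X_def using Q(3) by blast
    qed
    ultimately obtain u where u: "u \<in> X" "- u \<in> X" "u \<notin> D" using sub Q(2) unfolding \<A>_def by blast
    then obtain q n q' n' where e: "u = q + zs (int n) x" "- u = q' + zs (int n') x" and qq: "q \<in> Q" "q' \<in> Q"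
      unfolding X_def by blast
    have "zs (int (n + n')) (- x) = - (zs (int n) x + zs (int n') x)"
      by (simp add: zs_add_left zs_minus_right)
    also have "\<dots> = q + q'" using e by (simp add: algebra_simps eq_neg_iff_add_eq_0)
        (metis add.assoc add.commute add_diff_cancel_left' diff_add_cancel eq_neg_iff_add_eq_0)
    finally have "zs (int (n + n')) (- x) \<in> Q" using qq Q(3) by simp
    moreover have "n + n' > 0"
    proof (rule ccontr)
      assume "\<not> n + n' > 0"
      then have "u = q" "- u = q'" using e by auto
      then show False using Q(4)[of u] u qq by simp
    qed
    ultimately show ?thesis by blast
  qed
  have "x \<in> Q \<or> - x \<in> Q" if x: "x \<in> W" for x
  proof (rule ccontr)
    assume n: "\<not> ?thesis"
    obtain n where n1: "n > 0" "zs (int n) (- x) \<in> Q" using step[OF x] n by blast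
    obtain m where m1: "m > 0" "zs (int m) x \<in> Q" using step[of "- x"] subgroup_uminus[OF W x] n by auto
    have "zs (int n) (zs (int m) x) \<in> Q" using Qn m1 by blast
    moreover have "zs (int m) (zs (int n) (- x)) \<in> Q" using Qn n1 by blast
    ultimately have "zs (int n * int m) x \<in> D" using Q(4)[of "zs (int n * int m) x"]
      by (simp add: zs_minus_right mult.commute)
    then have "x \<in> D" using pureD[OF D(1), of "int n * int m" x] n1 m1 by simp
    then show False using n Q(2) by blast
  qed
  then show ?thesis using Q by (intro exI[of _ Q]) simp
qed

text \<open>\<open>\<sigma>\<close> lifts \<open>\<gamma>\<close> only up to roots of unity: the standardiser prescribes it on a dense
  subgroup, and an element of \<open>A\<close> is merely a root of an element of that subgroup.\<close>
locale dyn = frg T N for T :: "'a::ab_group_add itself" and N +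
  fixes \<gamma> :: "'a \<Rightarrow> 'a" and L0 :: "'l::alg_closed_field set" and \<phi> :: "'a \<Rightarrow> 'l" and \<sigma> :: "'l \<Rightarrow> 'l"
  assumes char0: "n > 0 \<Longrightarrow> of_nat n \<noteq> (0::'l)"
    and \<gamma>_add: "additive \<gamma>" and \<gamma>_bij: "bij \<gamma>"
    and L0: "subf L0"
    and \<phi>_add: "\<phi> (a + b) = \<phi> a * \<phi> b" and \<phi>_L: "\<phi> a \<in> L0" and \<phi>_nz: "\<phi> a \<noteq> 0"
    and \<phi>_inj: "\<phi> a = 1 \<Longrightarrow> a = 0"
    and \<sigma>_L: "x \<in> L0 \<Longrightarrow> \<sigma> x \<in> L0" and \<sigma>_1: "\<sigma> 1 = 1"
    and \<sigma>_diff: "x \<in> L0 \<Longrightarrow> y \<in> L0 \<Longrightarrow> \<sigma> (x - y) = \<sigma> x - \<sigma> y"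
    and \<sigma>_mult: "x \<in> L0 \<Longrightarrow> y \<in> L0 \<Longrightarrow> \<sigma> (x * y) = \<sigma> x * \<sigma> y"
    and \<sigma>_\<phi>: "\<exists>m>0. \<sigma> (\<phi> a) ^ m = \<phi> (\<gamma> a) ^ m"
    and roots: "x ^ m = 1 \<Longrightarrow> m > 0 \<Longrightarrow> x \<in> L0"
begin

lemma Ls: "subr L0" using L0 by (simp add: subf_def)
lemma L_inv: "x \<in> L0 \<Longrightarrow> inverse x \<in> L0" using L0 by (simp add: subf_def)
lemma L_div: "x \<in> L0 \<Longrightarrow> y \<in> L0 \<Longrightarrow> x / y \<in> L0" using L0 by (rule subf_divide)

lemma \<phi>_0: "\<phi> 0 = 1"
  using \<phi>_add[of 0 0] \<phi>_nz[of 0] by simp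
lemma \<phi>_minus: "\<phi> (- a) = inverse (\<phi> a)"
  using \<phi>_add[of a "- a"] \<phi>_0 by (simp add: inverse_unique)
lemma \<phi>_diff: "\<phi> (a - b) = \<phi> a / \<phi> b"
  using \<phi>_add[of a "- b"] by (simp add: \<phi>_minus divide_inverse)
lemma \<phi>_zs: "\<phi> (zs (int n) a) = \<phi> a ^ n"
  by (induction n) (simp_all add: \<phi>_0 \<phi>_add zs_add_left)
lemma \<phi>_eq: "\<phi> a = \<phi> b \<Longrightarrow> a = b"
  using \<phi>_inj[of "a - b"] \<phi>_nz by (simp add: \<phi>_diff)
lemma \<phi>_pow_eq: assumes "\<phi> a ^ m = \<phi> b ^ m" "m > 0" shows "a = b"
proof -
  have "\<phi> (zs (int m) a) = \<phi> (zs (int m) b)" using assms by (simp add: \<phi>_zs)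
  then have "zs (int m) (a - b) = 0" using \<phi>_eq by (simp add: zs_diff_right)
  then show ?thesis using tf[of "int m" "a - b"] assms by simp
qed

lemma \<sigma>_0: "\<sigma> 0 = 0" using \<sigma>_diff[of 0 0] subr_0[OF Ls] by simp
lemma \<sigma>_minus: "x \<in> L0 \<Longrightarrow> \<sigma> (- x) = - \<sigma> x" using \<sigma>_diff[of 0 x] \<sigma>_0 subr_0[OF Ls] by simp
lemma \<sigma>_add: "x \<in> L0 \<Longrightarrow> y \<in> L0 \<Longrightarrow> \<sigma> (x + y) = \<sigma> x + \<sigma> y"
  using \<sigma>_diff[of x "- y"] \<sigma>_minus[of y] subr_minus[OF Ls] by simp
lemma \<sigma>_inverse: assumes "x \<in> L0" shows "\<sigma> (inverse x) = inverse (\<sigma> x)"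
proof (cases "x = 0")
  case False
  then have "\<sigma> x * \<sigma> (inverse x) = 1" using \<sigma>_mult[OF assms L_inv[OF assms]] \<sigma>_1 by simp
  then show ?thesis by (simp add: inverse_unique)
qed (simp add: \<sigma>_0)
lemma \<sigma>_divide: "x \<in> L0 \<Longrightarrow> y \<in> L0 \<Longrightarrow> \<sigma> (x / y) = \<sigma> x / \<sigma> y"
  by (simp add: divide_inverse \<sigma>_mult \<sigma>_inverse L_inv)
lemma \<sigma>_power: "x \<in> L0 \<Longrightarrow> \<sigma> (x ^ n) = \<sigma> x ^ n"
  by (induction n) (simp_all add: \<sigma>_1 \<sigma>_mult subr_power[OF Ls])
lemma \<sigma>_sum: "(\<And>i. i \<in> I \<Longrightarrow> f i \<in> L0) \<Longrightarrow> \<sigma> (sum f I) = (\<Sum>i\<in>I. \<sigma> (f i))"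
  by (induction I rule: infinite_finite_induct) (simp_all add: \<sigma>_0 \<sigma>_add subr_sum[OF Ls])
lemma \<sigma>_eq_0: assumes "x \<in> L0" "\<sigma> x = 0" shows "x = 0"
proof (rule ccontr)
  assume "x \<noteq> 0"
  then have "\<sigma> x * \<sigma> (inverse x) = 1" using \<sigma>_mult[OF assms(1) L_inv[OF assms(1)]] \<sigma>_1 by simp
  then show False using assms by simp
qed
lemma \<sigma>_eq: "x \<in> L0 \<Longrightarrow> y \<in> L0 \<Longrightarrow> \<sigma> x = \<sigma> y \<Longrightarrow> x = y"
  using \<sigma>_eq_0[of "x - y"] by (simp add: \<sigma>_diff subr_diff[OF Ls])

lemma \<sigma>n_L: "x \<in> L0 \<Longrightarrow> (\<sigma> ^^ n) x \<in> L0" by (induction n) (simp_all add: \<sigma>_L)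

text \<open>Periods, invariant subgroups and fixed coefficients are available only for some power of
  \<gamma>; this instance moves the facts of the locale to such a power. The exponents m multiply
  because \<sigma> is applied to an equation between m-th powers.\<close>

lemma dyn_power: "dyn N (\<gamma> ^^ i) L0 \<phi> (\<sigma> ^^ i)"
proof (rule dyn.intro[OF frg_axioms dyn_axioms.intro])
  show "additive (\<gamma> ^^ i)" by (rule additive_funpow[OF \<gamma>_add])
  show "bij (\<gamma> ^^ i)" by (rule bij_funpow[OF \<gamma>_bij])
  show "subf L0" by (rule L0)
  show "(\<sigma> ^^ i) 1 = 1" by (induction i) (simp_all add: \<sigma>_1)
  show "x \<in> L0 \<Longrightarrow> (\<sigma> ^^ i) x \<in> L0" for x by (rule \<sigma>n_L)
  show "x \<in> L0 \<Longrightarrow> y \<in> L0 \<Longrightarrow> (\<sigma> ^^ i) (x - y) = (\<sigma> ^^ i) x - (\<sigma> ^^ i) y" for x y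
    by (induction i) (simp_all add: \<sigma>_diff \<sigma>n_L)
  show mul: "x \<in> L0 \<Longrightarrow> y \<in> L0 \<Longrightarrow> (\<sigma> ^^ i) (x * y) = (\<sigma> ^^ i) x * (\<sigma> ^^ i) y" for x y
    by (induction i) (simp_all add: \<sigma>_mult \<sigma>n_L)
  show "\<exists>m>0. (\<sigma> ^^ i) (\<phi> a) ^ m = \<phi> ((\<gamma> ^^ i) a) ^ m" for a
  proof (induction i)
    case 0
    show ?case by (intro exI[of _ 1]) simp
  next
    case (Suc i)
    then obtain m where m: "m > 0" "(\<sigma> ^^ i) (\<phi> a) ^ m = \<phi> ((\<gamma> ^^ i) a) ^ m" by blast
    obtain m' where m': "m' > 0" "\<sigma> (\<phi> ((\<gamma> ^^ i) a)) ^ m' = \<phi> (\<gamma> ((\<gamma> ^^ i) a)) ^ m'" using \<sigma>_\<phi> by blast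
    have "\<sigma> ((\<sigma> ^^ i) (\<phi> a)) ^ m = \<sigma> (\<phi> ((\<gamma> ^^ i) a)) ^ m"
      using m(2) \<phi>_L \<sigma>n_L by (metis \<sigma>_power)
    then have "\<sigma> ((\<sigma> ^^ i) (\<phi> a)) ^ (m * m') = \<phi> (\<gamma> ((\<gamma> ^^ i) a)) ^ (m' * m)"
      using m'(2) by (metis power_mult mult.commute)
    then show ?case using m(1) m'(1) by (intro exI[of _ "m * m'"]) (simp add: mult.commute)
  qed
qed (auto simp: char0 \<phi>_add \<phi>_L \<phi>_nz roots intro: \<phi>_inj tf bd)

definition F0 :: "'l set" where "F0 = {x \<in> L0. \<exists>i>0. (\<sigma> ^^ i) x = x}"
definition D :: "'a set" where "D = {a. \<exists>i>0. (\<gamma> ^^ i) a = a}"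

lemma fix_mult: "(f ^^ i) x = x \<Longrightarrow> (f ^^ (i * n)) x = x" for f :: "'c \<Rightarrow> 'c"
  by (induction n) (simp_all add: funpow_add)

lemma F0_L: "x \<in> F0 \<Longrightarrow> x \<in> L0" by (simp add: F0_def)

lemma common_period:
  assumes "finite S" "S \<subseteq> F0"
  shows "\<exists>t>0. \<forall>x\<in>S. \<forall>n. (\<sigma> ^^ (t * n)) x = x"
  using assms
proof (induction S rule: finite_induct)
  case (insert x S)
  then obtain t where t: "t > 0" "\<forall>x\<in>S. \<forall>n. (\<sigma> ^^ (t * n)) x = x" by auto
  obtain i where i: "i > 0" "(\<sigma> ^^ i) x = x" using insert.prems by (auto simp: F0_def)
  have "(\<sigma> ^^ ((t * i) * n)) y = y" if "y \<in> insert x S" for y n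
  proof (cases "y = x")
    case True
    then show ?thesis using fix_mult[OF i(2), of "t * n"] by (simp add: mult_ac)
  next
    case False
    then show ?thesis using t(2)[rule_format, of y "i * n"] that by (simp add: mult_ac)
  qed
  then show ?case using t i by (intro exI[of _ "t * i"]) auto
qed (auto intro: exI[of _ 1])

lemma \<sigma>n_eq: "x \<in> L0 \<Longrightarrow> y \<in> L0 \<Longrightarrow> (\<sigma> ^^ n) x = (\<sigma> ^^ n) y \<Longrightarrow> x = y"
  using dyn.\<sigma>_eq[OF dyn_power] by blast

lemma F0_I:
  assumes "x \<in> L0" "(\<sigma> ^^ i) x = (\<sigma> ^^ j) x" "i < j" shows "x \<in> F0"
proof -
  have "(\<sigma> ^^ i) ((\<sigma> ^^ (j - i)) x) = (\<sigma> ^^ i) x"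
    using assms by (simp flip: funpow_add comp_apply[of "\<sigma> ^^ i"])
  then have "(\<sigma> ^^ (j - i)) x = x" using \<sigma>n_eq assms(1) \<sigma>n_L by blast
  moreover have "j - i > 0" using assms by simp
  ultimately show ?thesis unfolding F0_def using assms(1) by blast
qed

lemma F0_subf: "subf F0"
proof -
  have *: "\<exists>t>0. (\<sigma> ^^ t) x = x \<and> (\<sigma> ^^ t) y = y" if "x \<in> F0" "y \<in> F0" for x y
    using common_period[of "{x, y}"] that by (metis empty_iff finite.intros insert_iff mult.right_neutral subsetI)
  have 1: "1 \<in> F0" unfolding F0_def using \<sigma>_1 subr_1[OF Ls] by (auto intro: exI[of _ 1])
  have "x - y \<in> F0 \<and> x * y \<in> F0" if xy: "x \<in> F0" "y \<in> F0" for x y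
  proof -
    obtain t where "t > 0" "(\<sigma> ^^ t) x = x" "(\<sigma> ^^ t) y = y" using *[OF xy] by blast
    then show ?thesis using xy dyn.\<sigma>_diff[OF dyn_power, of x y t] dyn.\<sigma>_mult[OF dyn_power, of x y t]
      by (auto simp: F0_def intro: subr_diff[OF Ls] subr_mult[OF Ls])
  qed
  moreover have "inverse x \<in> F0" if "x \<in> F0" for x
    using that dyn.\<sigma>_inverse[OF dyn_power] by (auto simp: F0_def L_inv)
  ultimately show ?thesis using 1 by (simp add: subf_def subr_def)
qed

lemma Fs: "subr F0" using F0_subf by (simp add: subf_def)
lemma F_inv: "x \<in> F0 \<Longrightarrow> inverse x \<in> F0" using F0_subf by (simp add: subf_def)
lemma F_div: "x \<in> F0 \<Longrightarrow> y \<in> F0 \<Longrightarrow> x / y \<in> F0" using F0_subf by (rule subf_divide)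

lemma \<sigma>n_poly: assumes "\<And>k. coeff p k \<in> L0" "\<And>k. (\<sigma> ^^ n) (coeff p k) = coeff p k" "x \<in> L0"
  shows "(\<sigma> ^^ n) (poly p x) = poly p ((\<sigma> ^^ n) x)"
  using assms unfolding poly_altdef
  by (simp add: dyn.\<sigma>_sum[OF dyn_power] dyn.\<sigma>_mult[OF dyn_power] dyn.\<sigma>_power[OF dyn_power] subr_mult[OF Ls] subr_power[OF Ls])

lemma coeff_period:
  assumes "\<And>k. coeff p k \<in> F0"
  shows "\<exists>t>0. \<forall>k n. (\<sigma> ^^ (t * n)) (coeff p k) = coeff p k"
proof -
  have "range (coeff p) \<subseteq> insert 0 (coeff p ` {..degree p})"
  proof (rule image_subsetI)
    fix k show "coeff p k \<in> insert 0 (coeff p ` {..degree p})"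
      by (cases "k \<le> degree p") (auto simp: coeff_eq_0)
  qed
  then have "finite (range (coeff p))" by (rule finite_subset) simp
  then show ?thesis using common_period[of "range (coeff p)"] assms by auto
qed

text \<open>F0 is algebraically closed in \<open>L0\<close>: a power of \<sigma> fixing the
  coefficients maps roots to roots, of which there are finitely many, so the orbit of a root
  repeats.\<close>

lemma F0_root:
  assumes "x \<in> L0" "p \<noteq> 0" "\<And>k. coeff p k \<in> F0" "poly p x = 0" shows "x \<in> F0"
proof -
  obtain t where t: "t > 0" "\<And>k n. (\<sigma> ^^ (t * n)) (coeff p k) = coeff p k"
    using coeff_period[OF assms(3)] by blast
  have "poly p ((\<sigma> ^^ (t * n)) x) = 0" for n
    using \<sigma>n_poly[of p "t * n" x] t assms F0_L dyn.\<sigma>_0[OF dyn_power] by simp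
  then have "(\<sigma> ^^ (t * n)) x \<in> {y. poly p y = 0}" for n by simp
  then obtain i j where "i < j" "(\<sigma> ^^ (t * i)) x = (\<sigma> ^^ (t * j)) x"
    using nat_pigeonhole[OF poly_roots_finite[OF assms(2)], of "\<lambda>n. (\<sigma> ^^ (t * n)) x"] by blast
  then show ?thesis using F0_I[of x "t * i" "t * j"] assms(1) t(1) by simp
qed

lemma F0_power: assumes "x \<in> L0" "n > 0" "x ^ n \<in> F0" shows "x \<in> F0"
proof (rule F0_root[of x "monom 1 n - [:x ^ n:]"])
  have "coeff (monom 1 n - [:x ^ n:]) n = 1" using assms(2) by (cases n) (auto simp: coeff_monom)
  then show "monom 1 n - [:x ^ n:] \<noteq> 0" by (metis coeff_0 zero_neq_one)
  show "coeff (monom 1 n - [:x ^ n:]) k \<in> F0" for k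
    using assms Fs by (auto simp: coeff_monom coeff_pCons subr_0 subr_1 intro!: subr_minus subr_diff split: nat.split)
qed (use assms in \<open>auto simp: poly_monom\<close>)

text \<open>This absorbs the ambiguity of \<sigma>: the factor between \<sigma> (\<phi> a) and
  \<phi> (\<gamma> a) is a scalar of \<open>F0\<close>.\<close>

lemma F0_root_of_unity: "x ^ m = 1 \<Longrightarrow> m > 0 \<Longrightarrow> x \<in> F0"
  using F0_power[of x m] roots[of x m] subr_1[OF Fs] by simp

text \<open>Periodicity in A and in the field agree although \<sigma> lifts \<gamma> only up to
  roots of unity: one direction uses that \<open>F0\<close> is closed under roots in
  \<open>L0\<close>, the other that a \<mapsto> \<phi> a ^ m is injective on a torsion-free
  group.\<close>

lemma D_iff: "a \<in> D \<longleftrightarrow> \<phi> a \<in> F0"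
proof
  assume "a \<in> D"
  then obtain i where i: "i > 0" "(\<gamma> ^^ i) a = a" by (auto simp: D_def)
  obtain m where m: "m > 0" "(\<sigma> ^^ i) (\<phi> a) ^ m = \<phi> a ^ m"
    using dyn.\<sigma>_\<phi>[OF dyn_power, of i a] i by auto
  then have "(\<sigma> ^^ i) (\<phi> a ^ m) = \<phi> a ^ m" using dyn.\<sigma>_power[OF dyn_power] \<phi>_L by simp
  then have "\<phi> a ^ m \<in> F0" using i by (auto simp: F0_def subr_power[OF Ls] \<phi>_L)
  then show "\<phi> a \<in> F0" using F0_power m \<phi>_L by blast
next
  assume "\<phi> a \<in> F0"
  then obtain i where i: "i > 0" "(\<sigma> ^^ i) (\<phi> a) = \<phi> a" by (auto simp: F0_def)
  obtain m where m: "m > 0" "(\<sigma> ^^ i) (\<phi> a) ^ m = \<phi> ((\<gamma> ^^ i) a) ^ m"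
    using dyn.\<sigma>_\<phi>[OF dyn_power, of i a] by auto
  then have "(\<gamma> ^^ i) a = a" using \<phi>_pow_eq[of a m "(\<gamma> ^^ i) a"] i by simp
  then show "a \<in> D" using i by (auto simp: D_def)
qed

lemma D_pure: "pure D"
  unfolding pure_def is_subgroup_def
proof (intro conjI ballI allI impI)
  show "0 \<in> D" by (simp add: D_iff \<phi>_0 subr_1[OF Fs])
  show "x - y \<in> D" if "x \<in> D" "y \<in> D" for x y using that by (simp add: D_iff \<phi>_diff F_div)
  fix k :: int and x assume k: "k \<noteq> 0" "zs k x \<in> D"
  then have "zs \<bar>k\<bar> x \<in> D" by (cases "k \<ge> 0") (auto simp: zs_minus_left D_iff \<phi>_minus F_inv)
  then have "\<phi> x ^ nat \<bar>k\<bar> \<in> F0" using \<phi>_zs[of "nat \<bar>k\<bar>" x] by (simp add: D_iff)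
  then show "x \<in> D" using F0_power[of "\<phi> x" "nat \<bar>k\<bar>"] \<phi>_L k by (simp add: D_iff)
qed

lemma D_sub: "is_subgroup D" using D_pure pure_subgroup by blast

lemma D_\<gamma>: "\<gamma> ` D = D"
proof
  have "(\<gamma> ^^ i) (\<gamma> a) = \<gamma> a" if "(\<gamma> ^^ i) a = a" for i a
    using that funpow_swap1[of \<gamma> i a] by simp
  then show "\<gamma> ` D \<subseteq> D" unfolding D_def by blast
  show "D \<subseteq> \<gamma> ` D"
  proof
    fix a assume "a \<in> D"
    then obtain i where i: "i > 0" "(\<gamma> ^^ i) a = a" by (auto simp: D_def)
    then have "a = \<gamma> ((\<gamma> ^^ (i - 1)) a)" by (cases i) auto
    moreover have "(\<gamma> ^^ (i - 1)) a \<in> D" unfolding D_def using i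
      by (auto intro!: exI[of _ i]) (metis add.commute comp_apply funpow_add)
    ultimately show "a \<in> \<gamma> ` D" by blast
  qed
qed

lemma period_pow:
  fixes f :: "'c \<Rightarrow> 'c"
  assumes "i > 0"
  shows "(\<exists>j>0. ((f ^^ i) ^^ j) x = x) \<longleftrightarrow> (\<exists>j>0. (f ^^ j) x = x)"
proof
  assume "\<exists>j>0. ((f ^^ i) ^^ j) x = x"
  then obtain j where "j > 0" "(f ^^ (i * j)) x = x" by (auto simp: funpow_mult)
  then show "\<exists>j>0. (f ^^ j) x = x" using assms by (intro exI[of _ "i * j"]) simp
next
  assume "\<exists>j>0. (f ^^ j) x = x"
  then obtain j where "j > 0" "(f ^^ j) x = x" by blast
  then have "((f ^^ i) ^^ j) x = x" using fix_mult[of j f x i] by (simp add: funpow_mult mult.commute)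
  then show "\<exists>j>0. ((f ^^ i) ^^ j) x = x" using \<open>j > 0\<close> by blast
qed

lemma F0_pow: "i > 0 \<Longrightarrow> dyn.F0 L0 (\<sigma> ^^ i) = F0"
  unfolding dyn.F0_def[OF dyn_power] F0_def using period_pow[of i \<sigma>] by simp

lemma D_pow: "i > 0 \<Longrightarrow> dyn.D (\<gamma> ^^ i) = D"
  unfolding dyn.D_def[OF dyn_power] D_def using period_pow[of i \<gamma>] by simp

section \<open>Independence modulo \<open>D\<close>, and spans over \<open>F0\<close>\<close>

definition distD :: "'a set \<Rightarrow> bool" where
  "distD S \<longleftrightarrow> (\<forall>a\<in>S. \<forall>b\<in>S. a - b \<in> D \<longrightarrow> a = b)"

text \<open>Distinctness modulo \<open>D\<close> is the natural demand: \<phi> maps \<open>D\<close>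
  into \<open>F0\<close>, so congruent exponents have proportional values.\<close>

definition Ind :: "'a set \<Rightarrow> bool" where
  "Ind W \<longleftrightarrow> (\<forall>S c. finite S \<longrightarrow> S \<subseteq> W \<longrightarrow> distD S \<longrightarrow> (\<forall>a\<in>S. c a \<in> F0)
     \<longrightarrow> (\<Sum>a\<in>S. c a * \<phi> a) = 0 \<longrightarrow> (\<forall>a\<in>S. c a = 0))"

lemma IndD: "Ind W \<Longrightarrow> finite S \<Longrightarrow> S \<subseteq> W \<Longrightarrow> distD S \<Longrightarrow> (\<And>a. a \<in> S \<Longrightarrow> c a \<in> F0)
   \<Longrightarrow> (\<Sum>a\<in>S. c a * \<phi> a) = 0 \<Longrightarrow> a \<in> S \<Longrightarrow> c a = 0"
  unfolding Ind_def by blast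

inductive_set Fspan :: "'a set \<Rightarrow> 'l set" for X where
  zero: "0 \<in> Fspan X"
| step: "c \<in> F0 \<Longrightarrow> a \<in> X \<Longrightarrow> x \<in> Fspan X \<Longrightarrow> c * \<phi> a + x \<in> Fspan X"

lemma Fspan_base: "c \<in> F0 \<Longrightarrow> a \<in> X \<Longrightarrow> c * \<phi> a \<in> Fspan X"
  using Fspan.step[OF _ _ Fspan.zero] by force

lemma Fspan_add: assumes "x \<in> Fspan X" "y \<in> Fspan X" shows "x + y \<in> Fspan X"
  using assms(1) by induction (use assms(2) in \<open>auto simp: add.assoc intro: Fspan.intros\<close>)

lemma Fspan_sum: "(\<And>k. k \<in> K \<Longrightarrow> f k \<in> Fspan X) \<Longrightarrow> sum f K \<in> Fspan X"
  by (induction K rule: infinite_finite_induct) (auto simp: Fspan.zero Fspan_add)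

lemma Fspan_mult:
  assumes "x \<in> Fspan X" "y \<in> Fspan Y" "\<And>a b. a \<in> X \<Longrightarrow> b \<in> Y \<Longrightarrow> a + b \<in> Z"
  shows "x * y \<in> Fspan Z"
  using assms(1)
proof induction
  case (step c a x)
  have "c * \<phi> a * y \<in> Fspan Z"
    using assms(2)
  proof induction
    case (step d b y)
    have "c * \<phi> a * (d * \<phi> b + y) = (c * d) * \<phi> (a + b) + c * \<phi> a * y"
      by (simp add: \<phi>_add algebra_simps)
    then show ?case using step \<open>c \<in> F0\<close> \<open>a \<in> X\<close> assms(3)
      by (metis Fspan.step Fs subr_mult)
  qed (simp add: Fspan.zero)
  then show ?case using step by (simp add: distrib_right Fspan_add)
qed (simp add: Fspan.zero)

lemma Fspan_uminus: assumes "x \<in> Fspan X" shows "- x \<in> Fspan X"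
  using assms
proof induction
  case (step c a x)
  then have "(- c) * \<phi> a + - x \<in> Fspan X" by (intro Fspan.step subr_minus[OF Fs])
  then show ?case by simp
qed (simp add: Fspan.zero)

lemma Fspan_L: assumes "x \<in> Fspan X" shows "x \<in> L0"
  using assms
proof induction
  case (step c a x)
  then show ?case using subr_add[OF Ls subr_mult[OF Ls F0_L \<phi>_L]] by blast
qed (rule subr_0[OF Ls])

lemma Fspan_subr: assumes "is_subgroup W" shows "subr (Fspan W)"
  unfolding subr_def
proof (intro conjI ballI)
  show "1 \<in> Fspan W" using Fspan_base[of 1 0 W] subgroup_0[OF assms] subr_1[OF Fs] by (simp add: \<phi>_0)
  fix x y assume xy: "x \<in> Fspan W" "y \<in> Fspan W"
  show "x - y \<in> Fspan W" using Fspan_add[OF xy(1) Fspan_uminus[OF xy(2)]] by simp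
  show "x * y \<in> Fspan W" using Fspan_mult[OF xy] subgroup_add[OF assms] by blast
qed

text \<open>Terms with exponents congruent modulo \<open>D\<close> merge; a merged coefficient may
  vanish, and then the exponent is dropped.\<close>

lemma Fspan_normal:
  assumes "x \<in> Fspan X"
  shows "\<exists>S c. finite S \<and> S \<subseteq> X \<and> distD S \<and> (\<forall>a\<in>S. c a \<in> F0 - {0}) \<and> x = (\<Sum>a\<in>S. c a * \<phi> a)"
  using assms
proof induction
  case zero
  show ?case by (intro exI[of _ "{}"]) (simp add: distD_def)
next
  case (step d b x)
  then obtain S c where S: "finite S" "S \<subseteq> X" "distD S" "\<forall>a\<in>S. c a \<in> F0 - {0}" "x = (\<Sum>a\<in>S. c a * \<phi> a)"
    by blast
  show ?case
  proof (cases "d = 0")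
    case True
    then show ?thesis using S by auto
  next
    case d: False
    show ?thesis
    proof (cases "\<exists>s\<in>S. b - s \<in> D")
      case False
      have "distD (insert b S)" unfolding distD_def
      proof (intro ballI impI)
        fix u v assume uv: "u \<in> insert b S" "v \<in> insert b S" "u - v \<in> D"
        have "v - u \<in> D" using subgroup_uminus[OF D_sub uv(3)] by simp
        then show "u = v" using uv False S(3) unfolding distD_def by blast
      qed
      moreover have nb: "b \<notin> S" using False subgroup_0[OF D_sub] by force
      moreover have "d * \<phi> b + x = (\<Sum>a\<in>insert b S. (c(b := d)) a * \<phi> a)"
      proof -
        have "(\<Sum>a\<in>S. (c(b := d)) a * \<phi> a) = (\<Sum>a\<in>S. c a * \<phi> a)"
          using nb by (intro sum.cong) auto
        then show ?thesis using S nb by simp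
      qed
      moreover have "\<forall>a\<in>insert b S. (c(b := d)) a \<in> F0 - {0}" using S(4) d step(1) by auto
      ultimately show ?thesis using S(1,2) step(2)
        by (intro exI[of _ "insert b S"] exI[of _ "c(b := d)"]) auto
    next
      case True
      then obtain s where s: "s \<in> S" "b - s \<in> D" by blast
      define e where "e = c s + d * \<phi> (b - s)"
      have eF: "e \<in> F0" unfolding e_def using s S(4) step(1) D_iff by (intro subr_add[OF Fs] subr_mult[OF Fs]) auto
      have "d * \<phi> b = d * \<phi> (b - s) * \<phi> s" by (simp flip: \<phi>_add)
      moreover have "x = c s * \<phi> s + (\<Sum>a\<in>S - {s}. c a * \<phi> a)" unfolding S(5) using S(1) s(1) by (rule sum.remove)
      ultimately have eq: "d * \<phi> b + x = e * \<phi> s + (\<Sum>a\<in>S - {s}. c a * \<phi> a)"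
        by (simp add: e_def algebra_simps)
      show ?thesis
      proof (cases "e = 0")
        case True
        have "distD (S - {s})" using S(3) unfolding distD_def by blast
        then show ?thesis using S eq True by (intro exI[of _ "S - {s}"] exI[of _ c]) auto
      next
        case False
        have "(\<Sum>a\<in>S. (c(s := e)) a * \<phi> a) = e * \<phi> s + (\<Sum>a\<in>S - {s}. (c(s := e)) a * \<phi> a)"
          using sum.remove[OF S(1) s(1), of "\<lambda>a. (c(s := e)) a * \<phi> a"] by simp
        also have "(\<Sum>a\<in>S - {s}. (c(s := e)) a * \<phi> a) = (\<Sum>a\<in>S - {s}. c a * \<phi> a)"
          by (rule sum.cong) auto
        finally have "d * \<phi> b + x = (\<Sum>a\<in>S. (c(s := e)) a * \<phi> a)" using eq by simp
        then show ?thesis using S eF False by (intro exI[of _ S] exI[of _ "c(s := e)"]) auto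
      qed
    qed
  qed
qed

section \<open>Valuations over \<open>F0\<close> and their pullbacks\<close>

definition Val :: "'l set \<Rightarrow> bool" where "Val R \<longleftrightarrow> valr L0 R \<and> F0 \<subseteq> R"
text \<open>The kernel of the homomorphism from A to the value group of \<open>R\<close> that \<phi>
  induces.\<close>

definition kerv :: "'l set \<Rightarrow> 'a set" where "kerv R = {a. \<phi> a \<in> R \<and> \<phi> (- a) \<in> R}"
definition pull :: "'l set \<Rightarrow> 'l set" where "pull R = {x \<in> L0. \<sigma> x \<in> R}"

lemma Val_vring: "Val R \<Longrightarrow> vring L0 R" by (simp add: Val_def vring_def L0)
lemma Val_F: "Val R \<Longrightarrow> c \<in> F0 \<Longrightarrow> c \<in> R" by (auto simp: Val_def)
text \<open>Reduction modulo the maximal ideal is injective on \<open>F0\<close>, so congruences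
  between elements of \<open>F0\<close> are equalities.\<close>

lemma Val_F_m: "Val R \<Longrightarrow> c \<in> F0 \<Longrightarrow> c \<in> mxi R \<Longrightarrow> c = 0"
  using F_inv[of c] by (auto simp: mxi_def Val_def)
lemma Val_s: "Val R \<Longrightarrow> subr R" using vring.s[OF Val_vring] .

lemma kerv_not_m: "Val R \<Longrightarrow> a \<in> kerv R \<Longrightarrow> \<phi> a \<notin> mxi R"
  by (auto simp: kerv_def mxi_def \<phi>_minus \<phi>_nz)
lemma kervI: "Val R \<Longrightarrow> \<phi> a \<in> R \<Longrightarrow> \<phi> a \<notin> mxi R \<Longrightarrow> a \<in> kerv R"
  by (auto simp: kerv_def mxi_def \<phi>_minus)

lemma kerv_pure: assumes R: "Val R" shows "pure (kerv R)"
  unfolding pure_def is_subgroup_def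
proof (intro conjI ballI allI impI)
  interpret R: vring L0 R using Val_vring[OF R] .
  show "0 \<in> kerv R" using subr_1[OF R.s] by (simp add: kerv_def \<phi>_0)
  show "x - y \<in> kerv R" if "x \<in> kerv R" "y \<in> kerv R" for x y
    using that subr_mult[OF R.s] \<phi>_add[of x "- y"] \<phi>_add[of "- x" y] by (simp add: kerv_def)
  fix k :: int and x assume k: "k \<noteq> 0" "zs k x \<in> kerv R"
  then have "zs (int (nat \<bar>k\<bar>)) x \<in> kerv R" by (cases "k \<ge> 0") (auto simp: zs_minus_left kerv_def)
  then have "\<phi> x ^ nat \<bar>k\<bar> \<in> R" "\<phi> (- x) ^ nat \<bar>k\<bar> \<in> R"
    by (simp_all only: kerv_def mem_Collect_eq \<phi>_zs[symmetric] zs_minus_right)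
  then show "x \<in> kerv R" using R.root_closed[of "\<phi> x" "nat \<bar>k\<bar>"] R.root_closed[of "\<phi> (- x)" "nat \<bar>k\<bar>"] k
    by (simp add: kerv_def \<phi>_L)
qed

lemma D_kerv: "Val R \<Longrightarrow> D \<subseteq> kerv R"
  by (auto simp: kerv_def D_iff \<phi>_minus F_inv Val_F)

lemma \<sigma>_F0: "x \<in> F0 \<Longrightarrow> \<sigma> x \<in> F0"
proof -
  assume "x \<in> F0"
  then obtain i where "i > 0" "(\<sigma> ^^ i) x = x" "x \<in> L0" by (auto simp: F0_def)
  then show ?thesis using \<sigma>_L[of x] funpow_swap1[of \<sigma> i x] unfolding F0_def by auto
qed

lemma pull_Val: assumes R: "Val R" shows "Val (pull R)"
proof -
  interpret R: vring L0 R using Val_vring[OF R] .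
  have "subr (pull R)" unfolding subr_def pull_def
    using R.s by (auto simp: \<sigma>_diff \<sigma>_mult \<sigma>_1 subr_1 subr_diff subr_mult Ls)
  moreover have "x \<in> pull R \<or> inverse x \<in> pull R" if "x \<in> L0" for x
    using R.total[of "\<sigma> x"] that by (auto simp: pull_def \<sigma>_inverse L_inv \<sigma>_L)
  ultimately show ?thesis unfolding Val_def valr_def
    using \<sigma>_F0 F0_L Val_F[OF R] by (auto simp: pull_def)
qed

lemma pull_m: "Val R \<Longrightarrow> mxi (pull R) = {x \<in> L0. \<sigma> x \<in> mxi R}"
  using \<sigma>_eq_0 \<sigma>_0 by (auto simp: mxi_def pull_def \<sigma>_inverse L_inv)

lemma \<sigma>_\<phi>_root: obtains z where "z \<in> F0" "z \<noteq> 0" "\<sigma> (\<phi> a) = z * \<phi> (\<gamma> a)"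
proof -
  obtain m where m: "m > 0" "\<sigma> (\<phi> a) ^ m = \<phi> (\<gamma> a) ^ m" using \<sigma>_\<phi> by blast
  have "(\<sigma> (\<phi> a) / \<phi> (\<gamma> a)) ^ m = 1" using m \<phi>_nz by (simp add: power_divide)
  then have "\<sigma> (\<phi> a) / \<phi> (\<gamma> a) \<in> F0" using F0_root_of_unity m(1) by blast
  moreover have "\<sigma> (\<phi> a) / \<phi> (\<gamma> a) \<noteq> 0" using \<open>(\<sigma> (\<phi> a) / \<phi> (\<gamma> a)) ^ m = 1\<close> m(1) by (cases m) auto
  ultimately show ?thesis using that[of "\<sigma> (\<phi> a) / \<phi> (\<gamma> a)"] \<phi>_nz by simp
qed

lemma Val_F_mult_iff: assumes R: "Val R" and "c \<in> F0" "c \<noteq> 0" shows "c * x \<in> R \<longleftrightarrow> x \<in> R"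
proof
  assume "c * x \<in> R"
  then have "inverse c * (c * x) \<in> R" using assms F_inv Val_F subr_mult[OF Val_s[OF R]] by blast
  moreover have "inverse c * (c * x) = x" using assms(3) by (simp flip: mult.assoc)
  ultimately show "x \<in> R" by metis
qed (use assms Val_F subr_mult[OF Val_s[OF R]] in blast)

text \<open>The root of unity between \<sigma> (\<phi> a) and \<phi> (\<gamma> a) is a unit of every
  valuation ring over \<open>F0\<close>; values see only \<gamma>.\<close>

lemma pull_kerv: assumes R: "Val R" shows "kerv (pull R) = {a. \<gamma> a \<in> kerv R}"
proof -
  have "\<phi> a \<in> pull R \<longleftrightarrow> \<phi> (\<gamma> a) \<in> R" for a
  proof -
    obtain z where "z \<in> F0" "z \<noteq> 0" "\<sigma> (\<phi> a) = z * \<phi> (\<gamma> a)" by (rule \<sigma>_\<phi>_root)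
    then show ?thesis using Val_F_mult_iff[OF R] by (simp add: pull_def \<phi>_L)
  qed
  then show ?thesis using additive.minus[OF \<gamma>_add] by (simp add: kerv_def)
qed

text \<open>Order W/D, and take the span of the nonnegative cone as ring and the span of its
  strictly positive part as ideal. \<open>Ind W\<close> says that 1 is not a combination of positive
  monomials, so the ideal is proper and Chevalley's theorem gives a valuation that is positive on
  the positive elements.\<close>

lemma Val_exists:
  assumes W: "is_subgroup W" "D \<subseteq> W" "Ind W"
  obtains R where "Val R" "kerv R \<inter> W = D"
proof -
  obtain Q where Q': "Q \<subseteq> W \<and> D \<subseteq> Q \<and> (\<forall>x\<in>Q. \<forall>y\<in>Q. x + y \<in> Q)
    \<and> (\<forall>x\<in>W. x \<in> Q \<or> - x \<in> Q) \<and> (\<forall>x\<in>Q. - x \<in> Q \<longrightarrow> x \<in> D)"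
    using pos_cone[OF W(1) D_pure W(2)] by (rule exE)
  then have Q: "Q \<subseteq> W" "D \<subseteq> Q" "\<And>x y. x \<in> Q \<Longrightarrow> y \<in> Q \<Longrightarrow> x + y \<in> Q"
    "\<And>x. x \<in> W \<Longrightarrow> x \<in> Q \<or> - x \<in> Q" "\<And>x. x \<in> Q \<Longrightarrow> - x \<in> Q \<Longrightarrow> x \<in> D"
    by simp_all
  have Q0: "0 \<in> Q" using Q(2) subgroup_0[OF D_sub] by blast
  have QD: "x + y \<in> Q - D" if "x \<in> Q - D" "y \<in> Q" for x y
  proof -
    have "x + y \<notin> D"
    proof
      assume "x + y \<in> D"
      then have "- (x + y) \<in> Q" using Q(2) subgroup_uminus[OF D_sub] by blast
      then have "y + - (x + y) \<in> Q" using Q(3) that by blast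
      then show False using Q(5)[of x] that by simp
    qed
    then show ?thesis using Q(3) that by blast
  qed
  let ?R0 = "Fspan Q" and ?I = "Fspan (Q - D)"
  have s: "subr ?R0" unfolding subr_def
  proof (intro conjI ballI)
    show "1 \<in> Fspan Q" using Fspan_base[of 1 0 Q] Q0 subr_1[OF Fs] by (simp add: \<phi>_0)
    fix x y assume xy: "x \<in> Fspan Q" "y \<in> Fspan Q"
    show "x - y \<in> Fspan Q" using Fspan_add[OF xy(1) Fspan_uminus[OF xy(2)]] by simp
    show "x * y \<in> Fspan Q" using Fspan_mult[OF xy] Q(3) by blast
  qed
  have "x \<in> ?R0" if "x \<in> ?I" for x using that by induction (auto intro: Fspan.intros)
  then have sub: "?I \<subseteq> ?R0" by blast
  have id: "x \<in> ?I" if "x \<in> idl ?I ?R0" for x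
    using that
  proof induction
    case (step i r x)
    have "i * r \<in> ?I" using Fspan_mult[OF step(1,2), of "Q - D"] QD by blast
    then show ?case using step Fspan_add by blast
  qed (simp add: Fspan.zero)
  have n1: "1 \<notin> ?I"
  proof
    assume one: "1 \<in> ?I"
    obtain S c where S: "finite S" "S \<subseteq> Q - D" "distD S" "\<forall>a\<in>S. c a \<in> F0 - {0}" "1 = (\<Sum>a\<in>S. c a * \<phi> a)"
      using Fspan_normal[OF one] by blast
    have z: "0 \<notin> S" using S(2) subgroup_0[OF D_sub] by blast
    have "distD (insert 0 S)" unfolding distD_def
    proof (intro ballI impI)
      fix u v assume uv: "u \<in> insert 0 S" "v \<in> insert 0 S" "u - v \<in> D"
      have "v - u \<in> D" using subgroup_uminus[OF D_sub uv(3)] by simp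
      then show "u = v" using uv S(2,3) unfolding distD_def by auto
    qed
    moreover have "(\<Sum>a\<in>insert 0 S. (c(0 := -1)) a * \<phi> a) = 0"
    proof -
      have "(\<Sum>a\<in>S. (c(0 := -1)) a * \<phi> a) = (\<Sum>a\<in>S. c a * \<phi> a)" using z by (intro sum.cong) auto
      then show ?thesis using S(1,5) z by (simp add: \<phi>_0)
    qed
    moreover have "insert 0 S \<subseteq> W" using S(2) Q(1) Q0 by blast
    moreover have "(c(0 := -1)) a \<in> F0" if "a \<in> insert 0 S" for a
      using that S(4) subr_minus[OF Fs subr_1[OF Fs]] by auto
    ultimately have "(c(0 := -1)) 0 = 0"
      using S(1) by (intro IndD[OF W(3), of "insert 0 S" "c(0 := -1)" 0]) simp_all
    then show False by simp
  qed
  have "?R0 \<subseteq> L0" "1 \<notin> idl ?I ?R0" using Fspan_L id n1 by blast+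
  from chevalley_valr[OF L0 s this(1) sub this(2)]
  obtain R where R: "valr L0 R" "?R0 \<subseteq> R" "?I \<subseteq> mxi R" by blast
  have "c \<in> R" if "c \<in> F0" for c using Fspan_base[OF that Q0] R(2) by (auto simp: \<phi>_0)
  then have V: "Val R" using R(1) by (auto simp: Val_def)
  have "a \<in> D" if a: "a \<in> kerv R" "a \<in> W" for a
  proof (rule ccontr)
    assume n: "a \<notin> D"
    then have n': "- a \<notin> D" using subgroup_uminus[OF D_sub, of "- a"] by auto
    have m: "\<phi> b \<in> mxi R" if "b \<in> Q" "b \<notin> D" for b
      using Fspan_base[of 1 b "Q - D"] that subr_1[OF Fs] R(3) by auto
    have "- a \<in> kerv R" using a(1) subgroup_uminus[OF pure_subgroup[OF kerv_pure[OF V]]] by blast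
    then show False using Q(4)[OF a(2)] m n n' kerv_not_m[OF V] a(1) by blast
  qed
  then show ?thesis using that[OF V] D_kerv[OF V] W(2) by blast
qed

text \<open>With pairwise distinct values the least term would dominate: dividing the vanishing sum
  by it puts its coefficient, a nonzero element of \<open>F0\<close>, into the maximal
  ideal.\<close>

lemma relation_ker:
  assumes R: "Val R" and S: "finite S" "S \<noteq> {}" "\<forall>a\<in>S. c a \<in> F0 - {0}" "(\<Sum>a\<in>S. c a * \<phi> a) = 0"
  shows "\<exists>a\<in>S. \<exists>b\<in>S. a \<noteq> b \<and> a - b \<in> kerv R"
proof -
  interpret R: vring L0 R using Val_vring[OF R] .
  obtain b where b: "b \<in> S" "\<And>a. a \<in> S \<Longrightarrow> \<phi> a / \<phi> b \<in> R"
    using R.min_term[OF S(1,2), of \<phi>] \<phi>_L \<phi>_nz by blast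
  show ?thesis
  proof (rule ccontr)
    assume n: "\<not> ?thesis"
    have "\<phi> a / \<phi> b \<in> mxi R" if "a \<in> S - {b}" for a
      using kervI[OF R, of "a - b"] b that n by (auto simp: \<phi>_diff)
    then have "(\<Sum>a\<in>S - {b}. c a * (\<phi> a / \<phi> b)) \<in> mxi R"
      using S(3) Val_F[OF R] by (intro R.m_sum R.m_mult) auto
    moreover have "(\<Sum>a\<in>S. c a * \<phi> a) / \<phi> b = c b + (\<Sum>a\<in>S - {b}. c a * (\<phi> a / \<phi> b))"
      using sum.remove[OF S(1) b(1), of "\<lambda>a. c a * \<phi> a"] \<phi>_nz[of b]
      by (simp add: add_divide_distrib sum_divide_distrib)
    moreover from calculation have "- c b = (\<Sum>a\<in>S - {b}. c a * (\<phi> a / \<phi> b))"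
      using S(4) by (intro minus_unique) (metis div_0)
    ultimately have "- c b \<in> mxi R" by metis
    then have "c b \<in> mxi R" using R.m_minus by fastforce
    then show False using Val_F_m[OF R] S(3) b(1) by auto
  qed
qed

text \<open>Distinct exponents now have distinct values, as their difference lies in
  \<open>W\<close> but outside the kernel. The unique least term determines the residue.\<close>

lemma leading_term:
  assumes R: "Val R" and S: "finite S" "S \<noteq> {}" "\<forall>a\<in>S. c a \<in> F0 - {0}"
    and W: "S \<subseteq> W" "is_subgroup W" "kerv R \<inter> W = D" "distD S"
  shows "\<exists>b\<in>S. (\<Sum>a\<in>S. c a * \<phi> a) / \<phi> b - c b \<in> mxi R"
proof -
  interpret R: vring L0 R using Val_vring[OF R] .
  obtain b where b: "b \<in> S" "\<And>a. a \<in> S \<Longrightarrow> \<phi> a / \<phi> b \<in> R"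
    using R.min_term[OF S(1,2), of \<phi>] \<phi>_L \<phi>_nz by blast
  have "\<phi> a / \<phi> b \<in> mxi R" if "a \<in> S - {b}" for a
  proof (rule ccontr)
    assume "\<phi> a / \<phi> b \<notin> mxi R"
    then have "a - b \<in> kerv R" using kervI[OF R, of "a - b"] b that by (auto simp: \<phi>_diff)
    then have "a - b \<in> D" using W that b(1) subgroup_diff[OF W(2)] by blast
    then show False using W(4) that b(1) unfolding distD_def by blast
  qed
  then have "(\<Sum>a\<in>S - {b}. c a * (\<phi> a / \<phi> b)) \<in> mxi R"
    using S(3) Val_F[OF R] by (intro R.m_sum R.m_mult) auto
  moreover have "(\<Sum>a\<in>S. c a * \<phi> a) / \<phi> b = c b + (\<Sum>a\<in>S - {b}. c a * (\<phi> a / \<phi> b))"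
    using sum.remove[OF S(1) b(1), of "\<lambda>a. c a * \<phi> a"] \<phi>_nz[of b]
    by (simp add: add_divide_distrib sum_divide_distrib)
  ultimately have "(\<Sum>a\<in>S. c a * \<phi> a) / \<phi> b - c b \<in> mxi R" by (metis add_diff_cancel_left')
  then show ?thesis using b(1) by blast
qed

lemma Val_quotient:
  assumes R: "Val R" and "u - c \<in> mxi R" "v - d \<in> mxi R" "c \<in> F0" "d \<in> F0" "d \<noteq> 0"
  shows "u / v - c / d \<in> mxi R" "v \<noteq> 0"
proof -
  interpret R: vring L0 R using Val_vring[OF R] .
  have dR: "d \<in> R" "inverse d \<in> R" using assms Val_F[OF R] F_inv by auto
  have dm: "d \<notin> mxi R" using Val_F_m[OF R] assms by blast
  have v: "d + (v - d) \<in> R \<and> d + (v - d) \<notin> mxi R" using R.unit_plus_m[OF dR(1) dm assms(3)] .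
  then have vu: "v \<noteq> 0" "inverse v \<in> R" using R.m_unit[of v] by auto
  then show "v \<noteq> 0" by simp
  have "d * (u - c) - c * (v - d) \<in> mxi R"
    by (intro R.m_diff R.m_mult[OF Val_F[OF R]] assms)
  then have "(inverse v * inverse d) * (d * (u - c) - c * (v - d)) \<in> mxi R"
    by (rule R.m_mult[OF subr_mult[OF R.s vu(2) dR(2)]])
  moreover have "(inverse v * inverse d) * (d * (u - c) - c * (v - d)) = u / v - c / d"
    using vu(1) assms(6) by (simp add: field_simps)
  ultimately show "u / v - c / d \<in> mxi R" by simp
qed

lemma pull_funpow: 
  "Val R \<Longrightarrow> Val ((pull ^^ n) R) \<and> (pull ^^ n) R = {x \<in> L0. (\<sigma> ^^ n) x \<in> R}
    \<and> mxi ((pull ^^ n) R) = {x \<in> L0. (\<sigma> ^^ n) x \<in> mxi R} \<and> kerv ((pull ^^ n) R) = {a. (\<gamma> ^^ n) a \<in> kerv R}"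
proof (induction n)
  case 0
  then show ?case using vring.RL[OF Val_vring[of R]] by (auto simp: mxi_def)
next
  case (Suc n)
  let ?R = "(pull ^^ n) R"
  have IH: "Val ?R" "?R = {x \<in> L0. (\<sigma> ^^ n) x \<in> R}" "mxi ?R = {x \<in> L0. (\<sigma> ^^ n) x \<in> mxi R}"
    "kerv ?R = {a. (\<gamma> ^^ n) a \<in> kerv R}" using Suc by auto
  have "pull ?R = {x \<in> L0. (\<sigma> ^^ n) (\<sigma> x) \<in> R}" unfolding pull_def[of ?R] by (subst IH(2)) (auto simp: \<sigma>_L)
  moreover have "mxi (pull ?R) = {x \<in> L0. (\<sigma> ^^ n) (\<sigma> x) \<in> mxi R}"
    unfolding pull_m[OF IH(1)] IH(3) by (auto simp: \<sigma>_L)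
  moreover have "kerv (pull ?R) = {a. (\<gamma> ^^ n) (\<gamma> a) \<in> kerv R}"
    unfolding pull_kerv[OF IH(1)] IH(4) by simp
  ultimately show ?case using pull_Val[OF IH(1)] by (simp add: funpow_swap1)
qed

lemma \<gamma>n_mem: "\<gamma> ` W = W \<Longrightarrow> (\<gamma> ^^ n) a \<in> W \<longleftrightarrow> a \<in> W"
proof (induction n)
  case (Suc n)
  have "\<gamma> b \<in> W \<longleftrightarrow> b \<in> W" for b
    using Suc.prems \<gamma>_bij by (metis bij_is_inj inj_image_mem_iff)
  then show ?case using Suc by simp
qed simp

lemma \<gamma>_diff: "\<gamma> (a - b) = \<gamma> a - \<gamma> b" by (rule additive.diff[OF \<gamma>_add])

lemma \<gamma>n_diff_mem:
  assumes "is_subgroup W" "\<gamma> ` W = W" "\<gamma> a - a \<in> W" shows "(\<gamma> ^^ n) a - a \<in> W"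
proof (induction n)
  case (Suc n)
  have "\<gamma> ((\<gamma> ^^ n) a - a) + (\<gamma> a - a) \<in> W" using Suc assms by (intro subgroup_add) auto
  then show ?case by (simp add: \<gamma>_diff)
qed (simp add: subgroup_0 assms)

text \<open>In each pullback of one valuation the leading terms of \<open>p\<close> and
  \<open>q\<close>, with exponents \<alpha> and \<beta>, give the residue of \<phi> (a - \<alpha> +
  \<beta>). Two pullbacks share \<alpha> and \<beta>, and comparing them through \<sigma>^h shows
  that a - \<alpha> + \<beta> is periodic.\<close>

lemma fraction_in_base:
  assumes W: "is_subgroup W" "\<gamma> ` W = W" "D \<subseteq> W" "Ind W"
    and a: "\<gamma> a - a \<in> W" and pq: "\<phi> a * q = p" "p \<in> Fspan W" "q \<in> Fspan W" "q \<noteq> 0"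
  shows "a \<in> W"
proof -
  obtain S c where S: "finite S" "S \<subseteq> W" "distD S" "\<forall>a\<in>S. c a \<in> F0 - {0}" "p = (\<Sum>a\<in>S. c a * \<phi> a)"
    using Fspan_normal[OF pq(2)] by blast
  obtain S' d where S': "finite S'" "S' \<subseteq> W" "distD S'" "\<forall>a\<in>S'. d a \<in> F0 - {0}" "q = (\<Sum>a\<in>S'. d a * \<phi> a)"
    using Fspan_normal[OF pq(3)] by blast
  have "p \<noteq> 0" using pq(1,4) \<phi>_nz by auto
  then have ne: "S \<noteq> {}" "S' \<noteq> {}" using S(5) S'(5) pq(4) by auto
  \<comment> \<open>Only pullbacks along multiples of a common period of the coefficients are used,
    so that the residues built from \<open>c\<close> and \<open>d\<close> stay fixed.\<close>
  have "finite (c ` S \<union> d ` S')" "c ` S \<union> d ` S' \<subseteq> F0" using S(1,4) S'(1,4) by auto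
  from common_period[OF this] obtain t where t: "t > 0" "\<forall>x\<in>c ` S \<union> d ` S'. \<forall>n. (\<sigma> ^^ (t * n)) x = x"
    by blast
  obtain R where R: "Val R" "kerv R \<inter> W = D" using Val_exists[OF W(1,3,4)] by blast
  define RR where "RR i = (pull ^^ (t * i)) R" for i
  have RR: "Val (RR i)" "kerv (RR i) = {a. (\<gamma> ^^ (t * i)) a \<in> kerv R}" for i
    using pull_funpow[OF R(1)] unfolding RR_def by blast+
  have OW: "kerv (RR i) \<inter> W = D" for i
  proof -
    have "a \<in> kerv (RR i) \<inter> W \<longleftrightarrow> a \<in> D" for a
      unfolding RR(2) using R(2) \<gamma>n_mem[OF W(2), of "t * i" a] \<gamma>n_mem[OF D_\<gamma>, of "t * i" a] by blast
    then show ?thesis by blast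
  qed
  have "\<exists>s. s \<in> S \<times> S' \<and> p / \<phi> (fst s) - c (fst s) \<in> mxi (RR i) \<and> q / \<phi> (snd s) - d (snd s) \<in> mxi (RR i)" for i
    using leading_term[OF RR(1) S(1) ne(1) S(4) S(2) W(1) OW S(3)]
      leading_term[OF RR(1) S'(1) ne(2) S'(4) S'(2) W(1) OW S'(3)] S(5) S'(5) by fastforce
  then obtain s where s: "\<And>i. s i \<in> S \<times> S'" "\<And>i. p / \<phi> (fst (s i)) - c (fst (s i)) \<in> mxi (RR i)"
    "\<And>i. q / \<phi> (snd (s i)) - d (snd (s i)) \<in> mxi (RR i)" by metis
  obtain i j where ij: "i < j" "s i = s j"
    by (rule nat_pigeonhole[of "S \<times> S'" s]) (use S(1) S'(1) s(1) in auto)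
  \<comment> \<open>With the leading exponents removed, \<phi> x has the same residue
    \<open>e\<close> in both rings.\<close>
  define \<alpha> \<beta> x e where "\<alpha> = fst (s i)" and "\<beta> = snd (s i)" and "x = a - \<alpha> + \<beta>" and "e = c \<alpha> / d \<beta>"
  have \<alpha>\<beta>: "\<alpha> \<in> S" "\<beta> \<in> S'" using s(1)[of i] by (auto simp: \<alpha>_def \<beta>_def)
  have cd: "c \<alpha> \<in> F0" "d \<beta> \<in> F0" "c \<alpha> \<noteq> 0" "d \<beta> \<noteq> 0" using \<alpha>\<beta> S(4) S'(4) by auto
  have eF: "e \<in> F0" "e \<noteq> 0" using cd F_div by (auto simp: e_def)
  have \<phi>x: "\<phi> x = (p / \<phi> \<alpha>) / (q / \<phi> \<beta>)"
    using pq(4) \<phi>_nz unfolding x_def pq(1)[symmetric] by (simp add: \<phi>_add \<phi>_diff field_simps)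
  have sm: "p / \<phi> \<alpha> - c \<alpha> \<in> mxi (RR i)" "q / \<phi> \<beta> - d \<beta> \<in> mxi (RR i)"
    "p / \<phi> \<alpha> - c \<alpha> \<in> mxi (RR j)" "q / \<phi> \<beta> - d \<beta> \<in> mxi (RR j)"
    using s(2,3)[of i] s(2,3)[of j] ij(2) by (simp_all add: \<alpha>_def \<beta>_def)
  have xm: "\<phi> x - e \<in> mxi (RR i)" "\<phi> x - e \<in> mxi (RR j)"
    unfolding \<phi>x e_def by (rule Val_quotient(1)[OF RR(1) _ _ cd(1,2,4)]; rule sm)+
  define h where "h = t * (j - i)"
  have OjOi: "RR j = (pull ^^ h) (RR i)"
  proof -
    have "t * j = h + t * i" using ij(1) by (simp add: h_def algebra_simps)
    then show ?thesis by (simp add: RR_def funpow_add)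
  qed
  have "(\<sigma> ^^ h) (\<phi> x - e) \<in> mxi (RR i)"
    using xm(2) pull_funpow[OF RR(1)[of i], of h] unfolding OjOi by blast
  moreover have "(\<sigma> ^^ h) e = e"
    using t(2) \<alpha>\<beta> dyn.\<sigma>_divide[OF dyn_power, of "c \<alpha>" "d \<beta>" h] cd F0_L by (simp add: e_def h_def)
  ultimately have m1: "(\<sigma> ^^ h) (\<phi> x) - e \<in> mxi (RR i)"
    using dyn.\<sigma>_diff[OF dyn_power, of "\<phi> x" e h] \<phi>_L F0_L eF by simp
  obtain z where z: "z \<in> F0" "z \<noteq> 0" "(\<sigma> ^^ h) (\<phi> x) = z * \<phi> ((\<gamma> ^^ h) x)"
  proof -
    have "\<exists>z. z \<in> dyn.F0 L0 (\<sigma> ^^ h) \<and> z \<noteq> 0 \<and> (\<sigma> ^^ h) (\<phi> x) = z * \<phi> ((\<gamma> ^^ h) x)"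
      using dyn.\<sigma>_\<phi>_root[OF dyn_power, of h x] by metis
    moreover have "h > 0" using t(1) ij(1) by (simp add: h_def)
    ultimately show ?thesis using that F0_pow by auto
  qed
  \<comment> \<open>\<phi> x and \<sigma>^h (\<phi> x) = z \<phi> \<eta> \<phi> x have the same
    nonzero residue, so \<phi> \<eta> is a unit. As \<eta> also lies in \<open>W\<close>, it lies in
    \<open>D\<close>; then z \<phi> \<eta> is in \<open>F0\<close> and its congruence to 1 is an
    equality.\<close>
  define \<eta> where "\<eta> = (\<gamma> ^^ h) x - x"
  have "\<gamma> x - x \<in> W"
  proof -
    have "\<gamma> x - x = (\<gamma> a - a) - (\<gamma> \<alpha> - \<alpha>) + (\<gamma> \<beta> - \<beta>)"
      by (simp add: x_def \<gamma>_diff additive.add[OF \<gamma>_add])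
    moreover have "\<gamma> \<alpha> - \<alpha> \<in> W" "\<gamma> \<beta> - \<beta> \<in> W" using \<alpha>\<beta> S(2) S'(2) W(1,2) by (auto intro!: subgroup_diff)
    ultimately show ?thesis using a W(1) by (simp add: subgroup_add subgroup_diff)
  qed
  then have \<eta>W: "\<eta> \<in> W" unfolding \<eta>_def using \<gamma>n_diff_mem W by blast
  interpret R: vring L0 "RR i" using Val_vring[OF RR(1)] .
  have unit: "y \<in> RR i \<and> y \<notin> mxi (RR i)" if "y - e \<in> mxi (RR i)" for y
    using R.unit_plus_m[of e "y - e"] that eF Val_F[OF RR(1)[of i]] Val_F_m[OF RR(1)[of i]] by auto
  have x_eq: "(\<sigma> ^^ h) (\<phi> x) = (z * \<phi> \<eta>) * \<phi> x" unfolding z(3) \<eta>_def by (simp add: \<phi>_diff \<phi>_nz)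
  have "\<eta> \<in> kerv (RR i)"
  proof -
    have u: "(z * \<phi> \<eta>) * \<phi> x \<in> RR i" "(z * \<phi> \<eta>) * \<phi> x \<notin> mxi (RR i)" using unit[OF m1] x_eq by auto
    have xu: "\<phi> x \<in> RR i" "inverse (\<phi> x) \<in> RR i" using unit[OF xm(1)] R.m_unit by auto
    have "z * \<phi> \<eta> = (z * \<phi> \<eta>) * \<phi> x * inverse (\<phi> x)" using \<phi>_nz by simp
    then have "z * \<phi> \<eta> \<in> RR i" using u xu subr_mult[OF R.s] by metis
    then have "\<phi> \<eta> \<in> RR i" using Val_F_mult_iff[OF RR(1)] z by blast
    moreover have "\<phi> \<eta> \<notin> mxi (RR i)"
    proof
      assume "\<phi> \<eta> \<in> mxi (RR i)"
      then have "(z * \<phi> x) * \<phi> \<eta> \<in> mxi (RR i)" using xu z Val_F[OF RR(1)] by (intro R.m_mult subr_mult[OF R.s]) auto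
      then show False using u(2) by (simp add: mult_ac)
    qed
    ultimately show ?thesis using kervI[OF RR(1)] by blast
  qed
  then have "\<eta> \<in> D" using OW \<eta>W by blast
  then have fF: "z * \<phi> \<eta> \<in> F0" using z D_iff subr_mult[OF Fs] by blast
  have "(z * \<phi> \<eta>) * (\<phi> x - e) \<in> mxi (RR i)" using xm(1) fF Val_F[OF RR(1)] by (intro R.m_mult) auto
  then have "(z * \<phi> \<eta>) * \<phi> x - e - (z * \<phi> \<eta>) * (\<phi> x - e) \<in> mxi (RR i)"
    using m1 unfolding x_eq by (rule R.m_diff[rotated])
  moreover have "(z * \<phi> \<eta>) * \<phi> x - e - (z * \<phi> \<eta>) * (\<phi> x - e) = (z * \<phi> \<eta> - 1) * e"
    by (simp add: algebra_simps)
  ultimately have "(z * \<phi> \<eta> - 1) * e = 0"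
    using Val_F_m[OF RR(1), of "(z * \<phi> \<eta> - 1) * e" i] fF eF subr_1[OF Fs] subr_mult[OF Fs] subr_diff[OF Fs] by simp
  then have "(\<sigma> ^^ h) (\<phi> x) = \<phi> x" using x_eq eF by simp
  moreover have "h > 0" using t(1) ij(1) by (simp add: h_def)
  ultimately have "\<phi> x \<in> F0" unfolding F0_def using \<phi>_L by blast
  then have "x \<in> W" using D_iff W(3) by blast
  moreover have "a = x + \<alpha> - \<beta>" by (simp add: x_def)
  ultimately show ?thesis using \<alpha>\<beta> S(2) S'(2) W(1) by (auto intro!: subgroup_diff subgroup_add)
qed

lemma \<sigma>_Fspan: assumes "x \<in> Fspan W" "\<gamma> ` W = W" shows "\<sigma> x \<in> Fspan W"
  using assms(1)
proof induction
  case (step c a x)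
  obtain z where z: "z \<in> F0" "\<sigma> (\<phi> a) = z * \<phi> (\<gamma> a)" using \<sigma>_\<phi>_root by blast
  have "\<sigma> (c * \<phi> a + x) = (\<sigma> c * z) * \<phi> (\<gamma> a) + \<sigma> x"
    using step(1) Fspan_L[OF step(3)] F0_L \<phi>_L z(2)
    by (simp add: \<sigma>_add \<sigma>_mult subr_mult[OF Ls] mult_ac)
  moreover have "\<gamma> a \<in> W" using step(2) assms(2) by blast
  ultimately show ?case using Fspan.step[OF subr_mult[OF Fs \<sigma>_F0[OF step(1)] z(1)]] step(4) by simp
qed (simp add: \<sigma>_0 Fspan.zero)

lemma Fspan_F0: "is_subgroup W \<Longrightarrow> c \<in> F0 \<Longrightarrow> c \<in> Fspan W"
  using Fspan_base[of c 0 W] subgroup_0[of W] by (simp add: \<phi>_0)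

text \<open>A shortest linear relation over the fractions of \<open>Fspan W\<close> is \<open>\<sigma>\<close>-invariant up to scaling,
  so a ratio of two of its terms is fixed by \<open>\<sigma>\<close>.\<close>
lemma lin_indep_over_base:
  assumes W: "is_subgroup W" "\<gamma> ` W = W" "D \<subseteq> W" "Ind W"
    and S: "finite S" "\<And>a. a \<in> S \<Longrightarrow> \<gamma> a - a \<in> W" "\<And>a b. a \<in> S \<Longrightarrow> b \<in> S \<Longrightarrow> a - b \<in> W \<Longrightarrow> a = b"
    and c: "\<And>a. a \<in> S \<Longrightarrow> c a \<in> Fspan W" "(\<Sum>a\<in>S. c a * \<phi> a) = 0"
  shows "\<forall>a\<in>S. c a = 0"
  using S c
proof (induction "card S" arbitrary: S c rule: less_induct)
  case (less S c)
  note sW = Fspan_subr[OF W(1)]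
  show ?case
  proof (rule ccontr)
    assume n: "\<not> (\<forall>a\<in>S. c a = 0)"
    define S' where "S' = {a \<in> S. c a \<noteq> 0}"
    have full: "c a \<noteq> 0" if "a \<in> S" for a
    proof
      assume "c a = 0"
      then have "S' \<subset> S" using that by (auto simp: S'_def)
      then have "card S' < card S" using less.prems(1) by (rule psubset_card_mono[rotated])
      moreover have "(\<Sum>a\<in>S'. c a * \<phi> a) = 0"
        using less.prems(1,5) by (subst sum.mono_neutral_left[of S S']) (auto simp: S'_def)
      ultimately have "\<forall>a\<in>S'. c a = 0"
        using less.prems(1-4) by (intro less.hyps) (auto simp: S'_def)
      then show False using n by (auto simp: S'_def)
    qed
    obtain a0 where a0: "a0 \<in> S" using n by blast
    \<comment> \<open>The conjugated relation is rewritten in terms of the original \<phi> a. Its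
      coefficients stay in the span because \<gamma> a - a lies in \<open>W\<close>.\<close>
    define c' where "c' a = \<sigma> (c a) * (\<sigma> (\<phi> a) / \<phi> a)" for a
    have c'W: "c' a \<in> Fspan W" if "a \<in> S" for a
    proof -
      obtain z where z: "z \<in> F0" "\<sigma> (\<phi> a) = z * \<phi> (\<gamma> a)" using \<sigma>_\<phi>_root by blast
      have "c' a = \<sigma> (c a) * (z * \<phi> (\<gamma> a - a))" by (simp add: c'_def z \<phi>_diff)
      then show ?thesis using subr_mult[OF sW \<sigma>_Fspan[OF less.prems(4)[OF that] W(2)] Fspan_base[OF z(1) less.prems(2)[OF that]]]
        by simp
    qed
    have "(\<Sum>a\<in>S. c' a * \<phi> a) = (\<Sum>a\<in>S. \<sigma> (c a * \<phi> a))"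
    proof (rule sum.cong)
      fix a assume "a \<in> S"
      then have "\<sigma> (c a * \<phi> a) = \<sigma> (c a) * \<sigma> (\<phi> a)"
        using \<sigma>_mult[OF Fspan_L[OF less.prems(4)] \<phi>_L] by blast
      then show "c' a * \<phi> a = \<sigma> (c a * \<phi> a)" by (simp add: c'_def \<phi>_nz)
    qed simp
    also have "\<dots> = \<sigma> (\<Sum>a\<in>S. c a * \<phi> a)"
      using subr_mult[OF Ls Fspan_L[OF less.prems(4)] \<phi>_L] by (subst \<sigma>_sum) auto
    finally have c'0: "(\<Sum>a\<in>S. c' a * \<phi> a) = 0" using less.prems(5) \<sigma>_0 by simp
    \<comment> \<open>Eliminating \<open>a0\<close> between the relation and its conjugate leaves a
      shorter one, which vanishes by induction.\<close>
    define d where "d a = c a0 * c' a - c' a0 * c a" for a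
    have "(\<Sum>a\<in>S. d a * \<phi> a) = c a0 * (\<Sum>a\<in>S. c' a * \<phi> a) - c' a0 * (\<Sum>a\<in>S. c a * \<phi> a)"
      by (simp add: d_def sum_distrib_left sum_subtractf algebra_simps)
    then have "(\<Sum>a\<in>S. d a * \<phi> a) = 0" using c'0 less.prems(5) by simp
    moreover have "d a0 = 0" by (simp add: d_def)
    ultimately have d0: "(\<Sum>a\<in>S - {a0}. d a * \<phi> a) = 0"
      using sum.remove[OF less.prems(1) a0, of "\<lambda>a. d a * \<phi> a"] by simp
    have "card (S - {a0}) < card S" using less.prems(1) a0 by (rule card_Diff1_less)
    moreover have "d a \<in> Fspan W" if "a \<in> S" for a
      unfolding d_def using that a0 c'W less.prems(4) by (intro subr_diff[OF sW] subr_mult[OF sW])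
    ultimately have dz: "\<forall>a\<in>S - {a0}. d a = 0"
      using less.prems(1-3) d0 by (intro less.hyps) auto
    have "S \<noteq> {a0}" using less.prems(5) full[OF a0] \<phi>_nz by auto
    then obtain a where a: "a \<in> S" "a \<noteq> a0" using a0 by blast
    define x where "x = c a * \<phi> a / (c a0 * \<phi> a0)"
    have cL: "c b \<in> L0" if "b \<in> S" for b using less.prems(4)[OF that] Fspan_L by blast
    have xL: "x \<in> L0" unfolding x_def using cL a a0 \<phi>_L by (intro L_div subr_mult[OF Ls]) auto
    have "c' a0 \<noteq> 0" unfolding c'_def using full[OF a0] cL[OF a0] \<sigma>_eq_0 \<phi>_nz \<phi>_L by auto
    have "\<sigma> x = (c' a * \<phi> a) / (c' a0 * \<phi> a0)"
      unfolding x_def c'_def using cL a a0 \<phi>_L \<phi>_nz by (simp add: \<sigma>_divide \<sigma>_mult subr_mult[OF Ls])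
    also have "\<dots> = x"
    proof -
      have "c a0 * c' a = c' a0 * c a" using dz a by (simp add: d_def)
      then show ?thesis unfolding x_def using full[OF a0] \<open>c' a0 \<noteq> 0\<close> \<phi>_nz by (simp add: frac_eq_eq mult_ac)
    qed
    finally have "\<sigma> x = x" .
    then have "x \<in> F0" unfolding F0_def using xL by (auto intro!: exI[of _ "1::nat"])
    have e2: "\<phi> (a0 - a) * (x * c a0) = c a"
      unfolding x_def using full[OF a0] \<phi>_nz by (simp add: \<phi>_diff field_simps)
    \<comment> \<open>Since the fixed ratio \<open>x\<close> lies in \<open>F0\<close>, this
      exhibits \<phi> (a - a0) as a fraction over the span, and \<open>fraction_in_base\<close>
      applies.\<close>
    have "\<phi> (a - a0) * c a = x * c a0"
      unfolding e2[symmetric] by (simp add: \<phi>_diff \<phi>_nz)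
    moreover have "x * c a0 \<in> Fspan W"
      using subr_mult[OF sW Fspan_F0[OF W(1) \<open>x \<in> F0\<close>] less.prems(4)[OF a0]] .
    moreover have "\<gamma> (a - a0) - (a - a0) \<in> W"
    proof -
      have "\<gamma> (a - a0) - (a - a0) = (\<gamma> a - a) - (\<gamma> a0 - a0)" by (simp add: \<gamma>_diff)
      then show ?thesis using subgroup_diff[OF W(1) less.prems(2)[OF a(1)] less.prems(2)[OF a0]] by metis
    qed
    ultimately have "a - a0 \<in> W"
      using fraction_in_base[OF W, of "a - a0" "c a" "x * c a0"] less.prems(4)[OF a(1)] full[OF a(1)] by blast
    then show False using less.prems(3) a a0 by blast
  qed
qed

text \<open>The unipotent step. A relation is sorted by cosets of \<open>W\<close>: the coset sums
  become coefficients in the span of \<open>W\<close> and vanish by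
  \<open>lin_indep_over_base\<close>; inside one coset, translated into \<open>W\<close>, the
  hypothesis applies.\<close>

lemma Ind_extend:
  assumes W: "is_subgroup W" "\<gamma> ` W = W" "D \<subseteq> W" "Ind W"
  shows "Ind {x. \<gamma> x - x \<in> W}"
  unfolding Ind_def
proof (intro allI impI)
  fix S c assume S: "finite S" "S \<subseteq> {x. \<gamma> x - x \<in> W}" "distD S" "\<forall>a\<in>S. c a \<in> F0" "(\<Sum>a\<in>S. c a * \<phi> a) = 0"
  define r where "r a = (SOME b. b \<in> S \<and> a - b \<in> W)" for a
  have r: "r a \<in> S \<and> a - r a \<in> W" if "a \<in> S" for a
    unfolding r_def using someI_ex[of "\<lambda>b. b \<in> S \<and> a - b \<in> W"] that subgroup_0[OF W(1)] by force
  have sym: "b - a \<in> W" if "a - b \<in> W" for a b using subgroup_uminus[OF W(1) that] by simp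
  have req: "r a = r b" if "a - b \<in> W" for a b
  proof -
    have "a - x \<in> W \<longleftrightarrow> b - x \<in> W" for x
      using subgroup_diff[OF W(1), of "a - x" "a - b"] subgroup_add[OF W(1), of "a - b" "b - x"] that by auto
    then show ?thesis by (simp add: r_def)
  qed
  define e where "e b = (\<Sum>a\<in>{a\<in>S. r a = b}. c a * \<phi> (a - b))" for b
  have "(\<Sum>b\<in>r ` S. e b * \<phi> b) = (\<Sum>b\<in>r ` S. \<Sum>a\<in>{a\<in>S. r a = b}. c a * \<phi> a)"
    unfolding e_def sum_distrib_right
    by (intro sum.cong) (simp_all add: \<phi>_diff \<phi>_nz)
  also have "\<dots> = (\<Sum>a\<in>S. c a * \<phi> a)" using S(1) by (rule sum.image_gen[symmetric])
  finally have e0: "(\<Sum>b\<in>r ` S. e b * \<phi> b) = 0" using S(5) by simp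
  have "\<forall>b\<in>r ` S. e b = 0"
  proof (rule lin_indep_over_base[OF W _ _ _ _ e0])
    show "finite (r ` S)" using S(1) by simp
    show "\<gamma> b - b \<in> W" if "b \<in> r ` S" for b using that r S(2) by blast
    show "b = b'" if "b \<in> r ` S" "b' \<in> r ` S" "b - b' \<in> W" for b b'
    proof -
      obtain a a' where a: "a \<in> S" "b = r a" "a' \<in> S" "b' = r a'" using \<open>b \<in> r ` S\<close> \<open>b' \<in> r ` S\<close> by blast
      have "a - a' = (a - b) + (b - b') - (a' - b')" by simp
      also have "\<dots> \<in> W" using r[OF a(1)] r[OF a(3)] a(2,4) \<open>b - b' \<in> W\<close>
        by (metis subgroup_add[OF W(1)] subgroup_diff[OF W(1)])
      finally show ?thesis using req[of a a'] a(2,4) by simp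
    qed
    show "e b \<in> Fspan W" if "b \<in> r ` S" for b
      unfolding e_def using S(4) r by (intro Fspan_sum Fspan_base) auto
  qed
  show "\<forall>a\<in>S. c a = 0"
  proof
    fix a assume a: "a \<in> S"
    let ?S = "{a'\<in>S. r a' = r a}"
    have "e (r a) = 0" using \<open>\<forall>b\<in>r ` S. e b = 0\<close> a by blast
    have inj: "inj_on (\<lambda>x. x - r a) ?S" by (auto simp: inj_on_def)
    have "(\<Sum>y\<in>(\<lambda>x. x - r a) ` ?S. c (y + r a) * \<phi> y) = e (r a)"
      unfolding e_def by (subst sum.reindex[OF inj]) simp
    then have "(\<Sum>y\<in>(\<lambda>x. x - r a) ` ?S. c (y + r a) * \<phi> y) = 0" using \<open>e (r a) = 0\<close> by simp
    moreover have "distD ((\<lambda>x. x - r a) ` ?S)" using S(3) by (auto simp: distD_def)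
    moreover have "(\<lambda>x. x - r a) ` ?S \<subseteq> W" using r by force
    moreover have "a - r a \<in> (\<lambda>x. x - r a) ` ?S" using a by blast
    ultimately have "c (a - r a + r a) = 0"
      using S(1,4) by (intro IndD[OF W(4), of "(\<lambda>x. x - r a) ` ?S" "\<lambda>y. c (y + r a)" "a - r a"]) auto
    then show "c a = 0" by simp
  qed
qed

end

section \<open>Units, residues and vanishing orders in a valuation ring\<close>

context vring
begin

definition un :: "'l \<Rightarrow> bool" where "un x \<longleftrightarrow> x \<noteq> 0 \<and> x \<in> R \<and> inverse x \<in> R"

lemma un_mult: "un x \<Longrightarrow> un y \<Longrightarrow> un (x * y)" by (auto simp: un_def intro: subr_mult[OF s])
lemma un_inverse: "un x \<Longrightarrow> un (inverse x)" by (auto simp: un_def)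
lemma un_divide: "un x \<Longrightarrow> un y \<Longrightarrow> un (x / y)" unfolding divide_inverse by (intro un_mult un_inverse)
lemma un_1: "un 1" by (simp add: un_def subr_1[OF s])
lemma un_power: "un x \<Longrightarrow> un (x ^ n)" by (induction n) (auto simp: un_1 intro: un_mult)
lemma un_R: "un x \<Longrightarrow> x \<in> R" by (simp add: un_def)
lemma un_not_m: "un x \<Longrightarrow> x \<notin> mxi R" by (auto simp: un_def mxi_def)
lemma unI: "x \<in> R \<Longrightarrow> x \<notin> mxi R \<Longrightarrow> un x" by (auto simp: un_def mxi_def)
lemma un_plus_m: "un x \<Longrightarrow> y \<in> mxi R \<Longrightarrow> un (x + y)"
  using unit_plus_m[of x y] un_R[of x] un_not_m[of x] unI by blast
lemma un_cong: "un x \<Longrightarrow> y - x \<in> mxi R \<Longrightarrow> un y" using un_plus_m[of x "y - x"] by simp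

lemma synthetic_coeffs: "(\<And>i. coeff p i \<in> R) \<Longrightarrow> c \<in> R \<Longrightarrow> coeff (synthetic_div p c) i \<in> R"
proof (induction p arbitrary: i)
  case (pCons a p)
  have "coeff p i \<in> R" for i using pCons.prems(1)[of "Suc i"] by simp
  then show ?case using pCons.IH pCons.prems(2) subr_poly[OF s]
    by (auto simp: synthetic_div_pCons coeff_pCons split: nat.split)
qed (simp add: subr_0[OF s])

text \<open>A nonzero polynomial over the residue field has finitely many roots. Representatives in
  \<open>Y\<close> replace residue classes, and synthetic division at a lift replaces splitting off
  a linear factor.\<close>

lemma residue_roots_finite:
  assumes "\<And>i. coeff p i \<in> R" "\<exists>i. coeff p i \<notin> mxi R"
  shows "\<exists>Y. finite Y \<and> (\<forall>y\<in>R. poly p y \<in> mxi R \<longrightarrow> (\<exists>y0\<in>Y. y - y0 \<in> mxi R))"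
  using assms
proof (induction "degree p" arbitrary: p rule: less_induct)
  case less
  show ?case
  proof (cases "\<exists>y0\<in>R. poly p y0 \<in> mxi R")
    case False
    then show ?thesis by (intro exI[of _ "{}"]) auto
  next
    case True
    then obtain y0 where y0: "y0 \<in> R" "poly p y0 \<in> mxi R" by blast
    let ?q = "synthetic_div p y0"
    have eq: "[:- y0, 1:] * ?q + [:poly p y0:] = p" by (rule synthetic_div_correct')
    have q: "coeff ?q i \<in> R" for i using synthetic_coeffs less.prems(1) y0(1) by blast
    have nq: "\<exists>i. coeff ?q i \<notin> mxi R"
    proof (rule ccontr)
      assume n: "\<not> ?thesis"
      have "coeff p i \<in> mxi R" for i
      proof -
        have "coeff p i = coeff ([:- y0, 1:] * ?q + [:poly p y0:]) i" using eq by simp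
        also have "\<dots> = (case i of 0 \<Rightarrow> 0 | Suc j \<Rightarrow> coeff ?q j) - y0 * coeff ?q i + (case i of 0 \<Rightarrow> poly p y0 | Suc j \<Rightarrow> 0)"
          by (simp add: coeff_pCons split: nat.split)
        also have "\<dots> \<in> mxi R" using n y0 m0 by (intro m_add m_diff m_mult) (auto split: nat.split)
        finally show ?thesis .
      qed
      then show False using less.prems(2) by blast
    qed
    have "degree p \<noteq> 0"
    proof
      assume "degree p = 0"
      then have "?q = 0" by (simp add: synthetic_div_eq_0_iff)
      then show False using nq m0 by simp
    qed
    then have "degree ?q < degree p" by (simp add: degree_synthetic_div)
    then obtain Y where Y: "finite Y" "\<forall>y\<in>R. poly ?q y \<in> mxi R \<longrightarrow> (\<exists>y0\<in>Y. y - y0 \<in> mxi R)"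
      using less.hyps[OF _ q nq] by blast
    have "\<exists>y1\<in>insert y0 Y. y - y1 \<in> mxi R" if y: "y \<in> R" "poly p y \<in> mxi R" for y
    proof -
      have "poly p y = (y - y0) * poly ?q y + poly p y0"
        using arg_cong[OF eq, of "\<lambda>p. poly p y"] by (simp add: algebra_simps)
      then have "(y - y0) * poly ?q y = poly p y - poly p y0" by simp
      then have "(y - y0) * poly ?q y \<in> mxi R" using m_diff[OF y(2) y0(2)] by metis
      then have "y - y0 \<in> mxi R \<or> poly ?q y \<in> mxi R"
        using m_prime y y0 subr_diff[OF s] subr_poly[OF s q] by blast
      then show ?thesis using Y(2) y(1) by blast
    qed
    then show ?thesis using Y(1) by (intro exI[of _ "insert y0 Y"]) auto
  qed
qed

text \<open>When all nonzero coefficients are units, the one of lowest degree dominates at a point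
  of the maximal ideal; \<open>e\<close> is the order of vanishing of \<open>p\<close> at 0.\<close>

lemma low_term:
  assumes "p \<noteq> 0" "\<And>i. coeff p i \<noteq> 0 \<Longrightarrow> un (coeff p i)" "y \<in> mxi R"
  shows "\<exists>e v. e \<le> degree p \<and> un v \<and> poly p y = y ^ e * v"
  using assms
proof (induction p)
  case (pCons a p)
  have cR: "coeff p i \<in> R" for i
    using pCons.prems(2)[of "Suc i"] un_R subr_0[OF s] by (cases "coeff p i = 0") auto
  show ?case
  proof (cases "a = 0")
    case False
    then have "un a" using pCons.prems(2)[of 0] by simp
    moreover have "y * poly p y \<in> mxi R" using subr_poly[OF s cR mR] assms(3) m_mult2 by blast
    ultimately have "un (a + y * poly p y)" using un_plus_m by blast
    then show ?thesis by (intro exI[of _ 0] exI[of _ "a + y * poly p y"]) simp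
  next
    case True
    then have "p \<noteq> 0" using pCons.hyps by simp
    moreover have "un (coeff p i)" if "coeff p i \<noteq> 0" for i using pCons.prems(2)[of "Suc i"] that by simp
    ultimately obtain e v where "e \<le> degree p" "un v" "poly p y = y ^ e * v" using pCons.IH assms(3) by blast
    then show ?thesis using True \<open>p \<noteq> 0\<close> by (intro exI[of _ "Suc e"] exI[of _ v]) simp
  qed
qed simp

text \<open>The least value in a vanishing sum is attained twice; otherwise dividing by the least
  term puts -1 into the maximal ideal.\<close>

lemma two_minimal:
  assumes "finite B" "B \<noteq> {}" "\<And>b. b \<in> B \<Longrightarrow> t b \<in> L" "\<And>b. b \<in> B \<Longrightarrow> t b \<noteq> 0" "sum t B = 0"
  shows "\<exists>b\<in>B. \<exists>b'\<in>B. b \<noteq> b' \<and> un (t b / t b')"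
proof -
  obtain b where b: "b \<in> B" "\<forall>a\<in>B. t a / t b \<in> R" using min_term[OF assms(1,2), of t] assms(3,4) by blast
  show ?thesis
  proof (rule ccontr)
    assume n: "\<not> ?thesis"
    have "t a / t b \<in> mxi R" if "a \<in> B - {b}" for a using n b that unI by blast
    then have "(\<Sum>a\<in>B - {b}. t a / t b) \<in> mxi R" by (rule m_sum)
    moreover have "1 + (\<Sum>a\<in>B - {b}. t a / t b) = 0"
      using sum.remove[OF assms(1) b(1), of t] assms(5) assms(4)[OF b(1)]
      by (simp flip: sum_divide_distrib) (metis add_divide_distrib div_0 divide_self)
    ultimately have "- 1 \<in> mxi R" by (metis minus_unique)
    then show False using m_minus m1 by fastforce
  qed
qed

end

section \<open>Polynomial relations over a base \<open>W\<close>\<close>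

context dyn
begin

lemma un_F0: "Val R \<Longrightarrow> c \<in> F0 \<Longrightarrow> c \<noteq> 0 \<Longrightarrow> vring.un R c"
  using vring.un_def[OF Val_vring] Val_F F_inv by auto
lemma un_\<phi>: "Val R \<Longrightarrow> vring.un R (\<phi> a) \<longleftrightarrow> a \<in> kerv R"
  using vring.un_def[OF Val_vring] \<phi>_nz by (simp add: kerv_def \<phi>_minus)

lemma un_pull:
  assumes R: "Val R" and x: "x \<in> L0"
  shows "vring.un ((pull ^^ h) R) x \<longleftrightarrow> vring.un R ((\<sigma> ^^ h) x)"
proof -
  have P: "Val ((pull ^^ h) R)" and e: "(pull ^^ h) R = {x \<in> L0. (\<sigma> ^^ h) x \<in> R}" using pull_funpow[OF R] by blast+
  show ?thesis unfolding vring.un_def[OF Val_vring[OF P]] vring.un_def[OF Val_vring[OF R]]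
    unfolding e using x dyn.\<sigma>_inverse[OF dyn_power] dyn.\<sigma>_eq_0[OF dyn_power] dyn.\<sigma>_0[OF dyn_power]
    by (auto simp: L_inv)
qed

lemma \<sigma>n_\<phi>: obtains z where "z \<in> F0" "z \<noteq> 0" "(\<sigma> ^^ h) (\<phi> a) = z * \<phi> ((\<gamma> ^^ h) a)" "\<exists>m>0. z ^ m = 1"
proof -
  obtain m where m: "m > 0" "(\<sigma> ^^ h) (\<phi> a) ^ m = \<phi> ((\<gamma> ^^ h) a) ^ m" using dyn.\<sigma>_\<phi>[OF dyn_power] by blast
  let ?z = "(\<sigma> ^^ h) (\<phi> a) / \<phi> ((\<gamma> ^^ h) a)"
  have z: "?z ^ m = 1" using m \<phi>_nz by (simp add: power_divide)
  then have "?z \<in> F0" using F0_root_of_unity m(1) by blast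
  moreover have "?z \<noteq> 0" using z m(1) by (metis power_eq_0_iff zero_neq_one)
  moreover have "(\<sigma> ^^ h) (\<phi> a) = ?z * \<phi> ((\<gamma> ^^ h) a)" using \<phi>_nz by simp
  ultimately show ?thesis using that[of ?z] z m(1) by blast
qed

text \<open>A failure of independence on W + Zu, sorted by components in \<open>W\<close>. Keeping
  the \<phi> b apart from polynomials over \<open>F0\<close> lets values, carried by the b, and
  residues, governed by the q b, be read off separately.\<close>

definition relW :: "'a set \<Rightarrow> 'a \<Rightarrow> 'a set \<Rightarrow> ('a \<Rightarrow> 'l poly) \<Rightarrow> bool" where
  "relW W u B q \<longleftrightarrow> finite B \<and> B \<noteq> {} \<and> B \<subseteq> W \<and> distD B \<and> (\<forall>b\<in>B. q b \<noteq> 0 \<and> (\<forall>i. coeff (q b) i \<in> F0))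
     \<and> (\<Sum>b\<in>B. \<phi> b * poly (q b) (\<phi> u)) = 0"

lemma relation_polys:
  assumes n: "\<not> Ind (set_plus W (range (\<lambda>k. zs k u)))"
  shows "\<exists>B q. relW W u B q"
proof -
  obtain S0 c where S0: "finite S0" "S0 \<subseteq> set_plus W (range (\<lambda>k. zs k u))" "distD S0" "\<forall>a\<in>S0. c a \<in> F0"
    "(\<Sum>a\<in>S0. c a * \<phi> a) = 0" "\<not> (\<forall>a\<in>S0. c a = 0)"
    using n unfolding Ind_def by blast
  define S where "S = {a\<in>S0. c a \<noteq> 0}"
  have S: "finite S" "S \<noteq> {}" "distD S" "\<And>a. a \<in> S \<Longrightarrow> c a \<in> F0 \<and> c a \<noteq> 0"
    using S0 by (auto simp: S_def distD_def)
  have sum0: "(\<Sum>a\<in>S. c a * \<phi> a) = 0"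
    using S0(1,5) by (subst sum.mono_neutral_left[of S0 S]) (auto simp: S_def)
  have "\<forall>a\<in>S. \<exists>w k. w \<in> W \<and> a = w + zs k u" using S0(2) unfolding S_def set_plus_def by blast
  then obtain w k where wk: "\<And>a. a \<in> S \<Longrightarrow> w a \<in> W" "\<And>a. a \<in> S \<Longrightarrow> a = w a + zs (k a) u" by metis
  \<comment> \<open>A power of \<phi> u large enough to clear all negative exponents.\<close>
  define m where "m = (\<Sum>a\<in>S. nat (- k a))"
  have m: "k a + int m \<ge> 0" if "a \<in> S" for a
  proof -
    have "nat (- k a) \<le> m" unfolding m_def using S(1) that by (intro member_le_sum) auto
    then show ?thesis by linarith
  qed
  define e where "e a = nat (k a + int m)" for a
  have \<phi>a: "\<phi> a * \<phi> u ^ m = \<phi> (w a) * \<phi> u ^ e a" if "a \<in> S" for a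
  proof -
    have "a + zs (int m) u = w a + zs (int (e a)) u"
      using wk(2)[OF that] m[OF that] by (simp add: e_def zs_add_left add.assoc)
    then have "\<phi> (a + zs (int m) u) = \<phi> (w a + zs (int (e a)) u)" by simp
    then show ?thesis by (simp add: \<phi>_add \<phi>_zs)
  qed
  \<comment> \<open>Components congruent modulo \<open>D\<close> are merged; the correction \<phi>
    (w a - b) is a scalar of \<open>F0\<close>.\<close>
  define r where "r a = (SOME v. v \<in> w ` S \<and> w a - v \<in> D)" for a
  have r: "r a \<in> w ` S \<and> w a - r a \<in> D" if "a \<in> S" for a
    unfolding r_def using someI_ex[of "\<lambda>v. v \<in> w ` S \<and> w a - v \<in> D"] that subgroup_0[OF D_sub] by force
  have req: "r a = r b" if "w a - w b \<in> D" for a b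
  proof -
    have "w a - x \<in> D \<longleftrightarrow> w b - x \<in> D" for x
      using subgroup_diff[OF D_sub, of "w a - x" "w a - w b"] subgroup_add[OF D_sub, of "w a - w b" "w b - x"] that by auto
    then show ?thesis by (simp add: r_def)
  qed
  define B where "B = r ` S"
  define q where "q b = (\<Sum>a\<in>{a\<in>S. r a = b}. monom (c a * \<phi> (w a - b)) (e a))" for b
  have "r a \<in> W" if "a \<in> S" for a using r[OF that] wk(1) by force
  then have BW: "B \<subseteq> W" unfolding B_def by blast
  have dB: "distD B" unfolding distD_def B_def
  proof (intro ballI impI)
    fix x y assume "x \<in> r ` S" "y \<in> r ` S" "x - y \<in> D"
    then obtain a b where ab: "a \<in> S" "b \<in> S" "x = r a" "y = r b" by blast
    have "w a - w b = (w a - r a) + (x - y) - (w b - r b)" using ab by simp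
    also have "\<dots> \<in> D" using r[OF ab(1)] r[OF ab(2)] \<open>x - y \<in> D\<close>
      by (metis subgroup_diff[OF D_sub] subgroup_add[OF D_sub])
    finally show "x = y" using req[of a b] ab by simp
  qed
  have qF: "coeff (q b) i \<in> F0" for b i
    unfolding q_def coeff_sum
  proof (rule subr_sum[OF Fs])
    fix a assume "a \<in> {a\<in>S. r a = b}"
    then have "c a * \<phi> (w a - b) \<in> F0" using S(4) r[of a] D_iff subr_mult[OF Fs] by auto
    then show "coeff (monom (c a * \<phi> (w a - b)) (e a)) i \<in> F0" by (simp add: coeff_monom subr_0[OF Fs])
  qed
  \<comment> \<open>Two elements of \<open>S\<close> with the same representative and the same
    exponent would be congruent modulo \<open>D\<close>. So the monomials of \<open>q b\<close> have
    distinct degrees and cannot cancel.\<close>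
  have qnz: "q b \<noteq> 0" if "b \<in> B" for b
  proof -
    obtain a where a: "a \<in> S" "b = r a" using \<open>b \<in> B\<close> by (auto simp: B_def)
    have "coeff (q b) (e a) = (\<Sum>x\<in>{x\<in>S. r x = b}. if x = a then c a * \<phi> (w a - b) else 0)"
      unfolding q_def coeff_sum
    proof (rule sum.cong)
      fix x assume x: "x \<in> {x\<in>S. r x = b}"
      have "x = a" if "e x = e a"
      proof -
        have "k x = k a" using \<open>e x = e a\<close> m[of x] m[OF a(1)] x by (simp add: e_def)
        then have "x - a = w x - w a" using wk(2)[of x] wk(2)[OF a(1)] x by (metis (no_types, lifting) add_diff_cancel_right mem_Collect_eq)
        also have "\<dots> = (w x - r x) - (w a - r a)" using x a by simp
        finally have "x - a = (w x - r x) - (w a - r a)" .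
        then have "x - a \<in> D" using r[of x] r[OF a(1)] x subgroup_diff[OF D_sub] by simp
        then show ?thesis using S(3) x a by (auto simp: distD_def)
      qed
      then show "coeff (monom (c x * \<phi> (w x - b)) (e x)) (e a) = (if x = a then c a * \<phi> (w a - b) else 0)"
        by (auto simp: coeff_monom)
    qed simp
    also have "\<dots> = c a * \<phi> (w a - b)" using a S(1) by simp
    finally have "coeff (q b) (e a) \<noteq> 0" using S(4)[OF a(1)] \<phi>_nz by simp
    then show ?thesis by auto
  qed
  have "(\<Sum>b\<in>B. \<phi> b * poly (q b) (\<phi> u)) = (\<Sum>b\<in>B. \<Sum>a\<in>{a\<in>S. r a = b}. c a * \<phi> a * \<phi> u ^ m)"
  proof (rule sum.cong)
    fix b assume "b \<in> B"
    have "\<phi> b * poly (q b) (\<phi> u) = (\<Sum>a\<in>{a\<in>S. r a = b}. \<phi> b * (c a * \<phi> (w a - b) * \<phi> u ^ e a))"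
      by (simp add: q_def poly_sum poly_monom sum_distrib_left)
    also have "\<dots> = (\<Sum>a\<in>{a\<in>S. r a = b}. c a * \<phi> a * \<phi> u ^ m)"
    proof (rule sum.cong)
      fix a assume "a \<in> {a\<in>S. r a = b}"
      then have "\<phi> a * \<phi> u ^ m = \<phi> (w a) * \<phi> u ^ e a" using \<phi>a by blast
      then show "\<phi> b * (c a * \<phi> (w a - b) * \<phi> u ^ e a) = c a * \<phi> a * \<phi> u ^ m"
        using \<phi>_nz by (simp add: \<phi>_diff)
    qed simp
    finally show "\<phi> b * poly (q b) (\<phi> u) = (\<Sum>a\<in>{a\<in>S. r a = b}. c a * \<phi> a * \<phi> u ^ m)" .
  qed simp
  also have "\<dots> = (\<Sum>a\<in>S. c a * \<phi> a * \<phi> u ^ m)" unfolding B_def using S(1) by (rule sum.image_gen[symmetric])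
  also have "\<dots> = 0" using sum0 by (simp flip: sum_distrib_right)
  finally show ?thesis unfolding relW_def using S(1,2) BW dB qF qnz
    by (intro exI[of _ B] exI[of _ q]) (auto simp: B_def)
qed

text \<open>Outside \<open>D\<close>, \<phi> u is transcendental over \<open>F0\<close>, because
  \<open>F0\<close> is algebraically closed in \<open>L0\<close>.\<close>

lemma relW_nz: "relW W u B q \<Longrightarrow> u \<notin> D \<Longrightarrow> b \<in> B \<Longrightarrow> poly (q b) (\<phi> u) \<noteq> 0"
  using F0_root[of "\<phi> u" "q b"] \<phi>_L by (auto simp: relW_def D_iff)

text \<open>If every q b (\<phi> u) were a unit, the terms would have the pairwise distinct values
  of the \<phi> b and could not sum to zero. So the residue of \<phi> u is a root of a polynomial
  that does not depend on \<open>R\<close>.\<close>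

lemma relW_residue:
  assumes rel: "relW W u B q" and R: "Val R" "kerv R \<inter> W = D" "u \<in> kerv R" "is_subgroup W" and u: "u \<notin> D"
  shows "poly (\<Prod>b\<in>B. q b) (\<phi> u) \<in> mxi R"
proof -
  interpret R: vring L0 R using Val_vring[OF R(1)] .
  have \<phi>u: "\<phi> u \<in> R" using R(3) by (simp add: kerv_def)
  have pR: "poly (q b) (\<phi> u) \<in> R" if "b \<in> B" for b
    using rel that Val_F[OF R(1)] \<phi>u by (intro subr_poly[OF R.s]) (auto simp: relW_def)
  have "\<exists>b\<in>B. poly (q b) (\<phi> u) \<in> mxi R"
  proof (rule ccontr)
    assume n: "\<not> ?thesis"
    have unq: "R.un (poly (q b) (\<phi> u))" if "b \<in> B" for b using n that pR R.unI by blast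
    have "\<exists>b\<in>B. \<exists>b'\<in>B. b \<noteq> b' \<and> R.un ((\<phi> b * poly (q b) (\<phi> u)) / (\<phi> b' * poly (q b') (\<phi> u)))"
    proof (rule R.two_minimal)
      show "finite B" "B \<noteq> {}" "(\<Sum>b\<in>B. \<phi> b * poly (q b) (\<phi> u)) = 0" using rel by (auto simp: relW_def)
      show "\<phi> b * poly (q b) (\<phi> u) \<in> L0" "\<phi> b * poly (q b) (\<phi> u) \<noteq> 0" if "b \<in> B" for b
        using subr_mult[OF Ls \<phi>_L R.RL[OF pR[OF that]]] relW_nz[OF rel u that] \<phi>_nz by auto
    qed
    then obtain b b' where b: "b \<in> B" "b' \<in> B" "b \<noteq> b'" 
      "R.un ((\<phi> b * poly (q b) (\<phi> u)) / (\<phi> b' * poly (q b') (\<phi> u)))" by blast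
    have "R.un ((\<phi> b * poly (q b) (\<phi> u)) / (\<phi> b' * poly (q b') (\<phi> u)) * poly (q b') (\<phi> u) / poly (q b) (\<phi> u))"
      by (intro R.un_divide[OF R.un_mult[OF b(4) unq[OF b(2)]] unq[OF b(1)]])
    then have "R.un (\<phi> (b - b'))" using relW_nz[OF rel u] b(1,2) by (simp add: \<phi>_diff)
    then have "b - b' \<in> kerv R" using un_\<phi>[OF R(1)] by blast
    moreover have "b - b' \<in> W" using b rel subgroup_diff[OF R(4)] by (auto simp: relW_def)
    ultimately have "b - b' \<in> D" using R(2) by blast
    then show False using rel b by (auto simp: relW_def distD_def)
  qed
  then obtain b where b: "b \<in> B" "poly (q b) (\<phi> u) \<in> mxi R" by blast
  have fin: "finite B" using rel by (simp add: relW_def)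
  have "poly (\<Prod>b\<in>B. q b) (\<phi> u) = poly (q b) (\<phi> u) * (\<Prod>b\<in>B - {b}. poly (q b) (\<phi> u))"
    unfolding poly_prod using fin b(1) by (rule prod.remove)
  also have "\<dots> \<in> mxi R" using b(2) pR by (intro R.m_mult2 subr_prod[OF R.s]) auto
  finally show ?thesis .
qed

lemma coeff_pcompose_F0:
  assumes "\<And>i. coeff p i \<in> F0" "\<And>i. coeff q i \<in> F0" shows "coeff (pcompose p q) i \<in> F0"
  using assms(1)
proof (induction p arbitrary: i)
  case (pCons a p)
  have a: "a \<in> F0" using pCons.prems[of 0] by simp
  have "coeff p i \<in> F0" for i using pCons.prems[of "Suc i"] by simp
  then have IH: "coeff (pcompose p q) i \<in> F0" for i using pCons.IH by blast
  have "coeff [:a:] i \<in> F0" for i using a by (cases i) (auto simp: subr_0[OF Fs])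
  then show ?case unfolding pcompose_pCons coeff_add coeff_mult using IH assms(2)
    by (intro subr_add[OF Fs] subr_sum[OF Fs] subr_mult[OF Fs])
qed (simp add: subr_0[OF Fs])

text \<open>Expanding each \<open>q b\<close> around \<zeta> makes the value of q b (\<phi> u) a
  multiple of that of \<phi> u - \<zeta>, with multiplicity at most the degree. Two terms of equal
  value then express a bounded positive multiple of this value through a difference of elements of
  \<open>B\<close>.\<close>

lemma relW_jump:
  assumes rel: "relW W u B q" and R: "Val R" "kerv R \<inter> W = D" "is_subgroup W" and u: "u \<notin> D"
    and \<zeta>: "\<zeta> \<in> F0" "\<phi> u - \<zeta> \<in> mxi R"
  shows "\<exists>b\<in>B. \<exists>b'\<in>B. \<exists>k\<in>{1..(\<Sum>b\<in>B. degree (q b))}. b \<noteq> b' \<and> vring.un R ((\<phi> u - \<zeta>) ^ k * \<phi> (b - b'))"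
proof -
  interpret R: vring L0 R using Val_vring[OF R(1)] .
  define y where "y = \<phi> u - \<zeta>"
  have y0: "y \<noteq> 0" using u \<zeta>(1) by (auto simp: y_def D_iff)
  have fin: "finite B" using rel by (simp add: relW_def)
  have "\<exists>e v. e \<le> degree (q b) \<and> R.un v \<and> poly (q b) (\<phi> u) = y ^ e * v" if b: "b \<in> B" for b
  proof -
    define p where "p = pcompose (q b) [:\<zeta>, 1:]"
    have qb: "q b \<noteq> 0" "\<And>i. coeff (q b) i \<in> F0" using rel b by (auto simp: relW_def)
    have "p \<noteq> 0" unfolding p_def using qb(1) pcompose_eq_0[of "q b" "[:\<zeta>, 1:]"] by auto
    moreover have "coeff [:\<zeta>, 1:] i \<in> F0" for i using \<zeta>(1) by (auto simp: coeff_pCons subr_0[OF Fs] subr_1[OF Fs] split: nat.split)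
    then have "coeff p i \<in> F0" for i unfolding p_def using coeff_pcompose_F0 qb(2) by blast
    then have "R.un (coeff p i)" if "coeff p i \<noteq> 0" for i using un_F0[OF R(1)] that by blast
    ultimately obtain e v where "e \<le> degree p" "R.un v" "poly p y = y ^ e * v"
      using R.low_term[of p y] \<zeta>(2) y_def by blast
    moreover have "poly p y = poly (q b) (\<phi> u)" by (simp add: p_def poly_pcompose y_def)
    moreover have "degree p = degree (q b)" unfolding p_def by (simp add: degree_pcompose)
    ultimately show ?thesis by auto
  qed
  then obtain e v where ev: "\<And>b. b \<in> B \<Longrightarrow> e b \<le> degree (q b)" "\<And>b. b \<in> B \<Longrightarrow> R.un (v b)"
    "\<And>b. b \<in> B \<Longrightarrow> poly (q b) (\<phi> u) = y ^ e b * v b" by metis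
  have yL: "y \<in> L0" using \<zeta>(2) R.mR R.RL y_def by blast
  have "\<exists>b\<in>B. \<exists>b'\<in>B. b \<noteq> b' \<and> R.un ((\<phi> b * poly (q b) (\<phi> u)) / (\<phi> b' * poly (q b') (\<phi> u)))"
  proof (rule R.two_minimal)
    show "finite B" "B \<noteq> {}" "(\<Sum>b\<in>B. \<phi> b * poly (q b) (\<phi> u)) = 0" using rel by (auto simp: relW_def)
    show "\<phi> b * poly (q b) (\<phi> u) \<in> L0" if b: "b \<in> B" for b
      unfolding ev(3)[OF b]
      by (intro subr_mult[OF Ls] \<phi>_L subr_power[OF Ls yL] R.RL[OF R.un_R[OF ev(2)[OF b]]])
    show "\<phi> b * poly (q b) (\<phi> u) \<noteq> 0" if "b \<in> B" for b
      using relW_nz[OF rel u that] \<phi>_nz by auto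
  qed
  then obtain b b' where b: "b \<in> B" "b' \<in> B" "b \<noteq> b'" 
    "R.un ((\<phi> b * poly (q b) (\<phi> u)) / (\<phi> b' * poly (q b') (\<phi> u)))" by blast
  have vnz: "v b \<noteq> 0" "v b' \<noteq> 0" using ev(2) b R.un_def by auto
  have "R.un ((\<phi> b * poly (q b) (\<phi> u)) / (\<phi> b' * poly (q b') (\<phi> u)) * v b' / v b)"
    by (intro R.un_divide[OF R.un_mult[OF b(4) ev(2)[OF b(2)]] ev(2)[OF b(1)]])
  then have U: "R.un (\<phi> (b - b') * (y ^ e b / y ^ e b'))"
    unfolding ev(3)[OF b(1)] ev(3)[OF b(2)] using vnz by (simp add: \<phi>_diff)
  \<comment> \<open>By symmetry the larger exponent may stand on the left. Equal exponents are
    impossible because \<open>b\<close> and \<open>b'\<close> differ modulo \<open>D\<close>; hence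
    k is at least 1.\<close>
  have gen: ?thesis if b: "b \<in> B" "b' \<in> B" "b \<noteq> b'" and U: "R.un (\<phi> (b - b') * (y ^ e b / y ^ e b'))" and le: "e b' \<le> e b" for b b'
  proof -
    have "y ^ e b / y ^ e b' = y ^ (e b - e b')" using y0 le by (simp add: power_diff)
    then have un: "R.un (y ^ (e b - e b') * \<phi> (b - b'))" using U by (simp add: mult.commute)
    have "e b \<noteq> e b'"
    proof
      assume "e b = e b'"
      then have "R.un (\<phi> (b - b'))" using un by simp
      then have "b - b' \<in> kerv R" using un_\<phi>[OF R(1)] by blast
      moreover have "b - b' \<in> W" using b rel subgroup_diff[OF R(3)] by (auto simp: relW_def)
      ultimately have "b - b' \<in> D" using R(2) by blast
      then show False using rel b by (auto simp: relW_def distD_def)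
    qed
    moreover have "e b \<le> (\<Sum>b\<in>B. degree (q b))"
      using ev(1)[OF b(1)] member_le_sum[of b B "\<lambda>b. degree (q b)"] fin b(1) by auto
    ultimately have "e b - e b' \<in> {1..(\<Sum>b\<in>B. degree (q b))}" using le by auto
    then show ?thesis using b un unfolding y_def by blast
  qed
  show ?thesis
  proof (cases "e b' \<le> e b")
    case True
    then show ?thesis using gen b U by blast
  next
    case False
    have "R.un (inverse (\<phi> (b - b') * (y ^ e b / y ^ e b')))" using U by (rule R.un_inverse)
    then have "R.un (\<phi> (b' - b) * (y ^ e b' / y ^ e b))" by (simp add: \<phi>_diff field_simps)
    then show ?thesis using gen[of b' b] b False by simp
  qed
qed

section \<open>Residues that are roots of unity\<close>

lemma pull_kerv_Int:
  assumes "Val R" "kerv R \<inter> W = D" "\<gamma> ` W = W"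
  shows "kerv ((pull ^^ n) R) \<inter> W = D"
proof -
  have "a \<in> kerv ((pull ^^ n) R) \<inter> W \<longleftrightarrow> a \<in> D" for a
    using pull_funpow[OF assms(1), of n] assms(2) \<gamma>n_mem[OF assms(3), of n a] \<gamma>n_mem[OF D_\<gamma>, of n a] by blast
  then show ?thesis by blast
qed

lemma pull_kerv_sub:
  assumes "Val R" "U \<subseteq> kerv R" "\<gamma> ` U = U"
  shows "U \<subseteq> kerv ((pull ^^ n) R)"
proof
  fix a assume "a \<in> U"
  then have "(\<gamma> ^^ n) a \<in> kerv R" using \<gamma>n_mem[OF assms(3), of n a] assms(2) by blast
  then show "a \<in> kerv ((pull ^^ n) R)" using pull_funpow[OF assms(1), of n] by blast
qed

text \<open>The kernel of the residue of \<phi>. Its pure closure consists of the elements whose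
  residue is a root of unity, and this closure is what survives the ambiguity of \<sigma>.\<close>

definition ones :: "'l set \<Rightarrow> 'a set" where "ones R = {z. \<phi> z - 1 \<in> mxi R}"

lemma ones_subgroup: assumes R: "Val R" shows "is_subgroup (ones R)"
  unfolding is_subgroup_def ones_def
proof (intro conjI ballI)
  interpret R: vring L0 R using Val_vring[OF R] .
  show "0 \<in> {z. \<phi> z - 1 \<in> mxi R}" by (simp add: \<phi>_0 R.m0)
  fix x y assume "x \<in> {z. \<phi> z - 1 \<in> mxi R}" "y \<in> {z. \<phi> z - 1 \<in> mxi R}"
  then have "\<phi> x / \<phi> y - 1 / 1 \<in> mxi R"
    using Val_quotient(1)[OF R, of "\<phi> x" 1 "\<phi> y" 1] subr_1[OF Fs] by simp
  then show "x - y \<in> {z. \<phi> z - 1 \<in> mxi R}" by (simp add: \<phi>_diff)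
qed

lemma m_power_diff_1:
  assumes R: "Val R" and y: "y - 1 \<in> mxi R" shows "y ^ n - 1 \<in> mxi R"
proof (induction n)
  interpret R: vring L0 R using Val_vring[OF R] .
  case 0
  show ?case by (simp add: R.m0)
next
  interpret R: vring L0 R using Val_vring[OF R] .
  case (Suc n)
  have "y \<in> R" using R.un_R[OF R.un_cong[OF R.un_1 y]] .
  then have "y * (y ^ n - 1) + (y - 1) \<in> mxi R" using Suc y by (intro R.m_add R.m_mult)
  then show ?case by (simp add: algebra_simps)
qed

text \<open>Raising to the exponent m removes the root of unity between \<sigma>^n (\<phi> x) and
  \<phi> (\<gamma>^n x), and the pure closure absorbs the exponent.\<close>

lemma pcl_ones_pull:
  assumes R: "Val R" and z: "(\<gamma> ^^ n) z \<in> pcl (ones R)" shows "z \<in> pcl (ones ((pull ^^ n) R))"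
proof -
  obtain k where k: "k \<noteq> 0" "zs k ((\<gamma> ^^ n) z) \<in> ones R" using z by (auto simp: pcl_def)
  define x where "x = zs k z"
  have x: "(\<gamma> ^^ n) x \<in> ones R" using k(2) additive_zs[OF additive_funpow[OF \<gamma>_add]] by (simp add: x_def)
  obtain m where m: "m > 0" "(\<sigma> ^^ n) (\<phi> x) ^ m = \<phi> ((\<gamma> ^^ n) x) ^ m" using dyn.\<sigma>_\<phi>[OF dyn_power] by blast
  have "\<phi> ((\<gamma> ^^ n) x) ^ m - 1 \<in> mxi R" using m_power_diff_1[OF R] x by (simp add: ones_def)
  then have "(\<sigma> ^^ n) (\<phi> (zs (int m) x)) - 1 \<in> mxi R"
    using m(2) dyn.\<sigma>_power[OF dyn_power \<phi>_L] by (simp add: \<phi>_zs)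
  moreover have "(\<sigma> ^^ n) (\<phi> (zs (int m) x) - 1) = (\<sigma> ^^ n) (\<phi> (zs (int m) x)) - 1"
    using dyn.\<sigma>_diff[OF dyn_power \<phi>_L subr_1[OF Ls]] dyn.\<sigma>_1[OF dyn_power] by simp
  ultimately have "\<phi> (zs (int m) x) - 1 \<in> mxi ((pull ^^ n) R)"
    using pull_funpow[OF R, of n] subr_diff[OF Ls \<phi>_L subr_1[OF Ls]] by auto
  then have "zs (int m * k) z \<in> ones ((pull ^^ n) R)" by (simp add: ones_def x_def)
  moreover have "int m * k \<noteq> 0" using m k by simp
  ultimately show ?thesis unfolding pcl_def by blast
qed

lemma ones_Int_D: assumes R: "Val R" and "z \<in> pcl (ones R)" "z \<in> D" shows "z = 0"
proof -
  obtain k where k: "k \<noteq> 0" "zs k z \<in> ones R" using assms(2) by (auto simp: pcl_def)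
  have "zs k z \<in> D" using subgroup_zs[OF D_sub assms(3)] .
  then have "\<phi> (zs k z) - 1 \<in> F0" using D_iff subr_diff[OF Fs] subr_1[OF Fs] by blast
  then have "\<phi> (zs k z) - 1 = 0" using Val_F_m[OF R] k(2) by (simp only: ones_def mem_Collect_eq)
  then have "\<phi> (zs k z) = 1" by simp
  then have "zs k z = 0" by (rule \<phi>_inj)
  then show ?thesis using tf k(1) by blast
qed

text \<open>Residues of the conjugates of \<open>\<phi> u\<close> are roots of one fixed polynomial over \<open>F0\<close>, so two of them
  agree simultaneously for all \<open>u\<close> in a basis of \<open>U\<close>.\<close>
lemma trivial_residues:
  assumes W: "is_subgroup W" "\<gamma> ` W = W"
    and U: "pure U" "\<gamma> ` U = U" "D \<subset> U"
    and rel: "\<And>u. u \<in> U \<Longrightarrow> u \<notin> D \<Longrightarrow> \<exists>B q. relW W u B q"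
    and R: "Val R" "kerv R \<inter> W = D" "U \<subseteq> kerv R"
  shows "\<exists>Y. pure Y \<and> \<gamma> ` Y = Y \<and> Y \<subseteq> U \<and> Y \<inter> D = {0} \<and> Y \<noteq> {0} \<and> Y \<subseteq> pcl (ones R)"
proof -
  interpret R: vring L0 R using Val_vring[OF R(1)] .
  note sU = pure_subgroup[OF U(1)]
  obtain X where X: "X \<subseteq> U" "zind X" "\<And>h. is_subgroup U \<Longrightarrow> h \<in> U \<Longrightarrow> \<exists>k. k \<noteq> 0 \<and> zs k h \<in> zspan X"
    using max_ind[of U] by metis
  have fX: "finite X" using X(2) by (simp add: zind_def)
  \<comment> \<open>One polynomial per \<open>u\<close> that works for all pullbacks: linear if
    \<open>u\<close> lies in \<open>D\<close>, otherwise the product from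
    \<open>relW_residue\<close>.\<close>
  have "\<exists>p. p \<noteq> 0 \<and> (\<forall>i. coeff p i \<in> F0) \<and> (\<forall>n. poly p (\<phi> u) \<in> mxi ((pull ^^ n) R))" if u: "u \<in> U" for u
  proof (cases "u \<in> D")
    case True
    have "vring L0 ((pull ^^ n) R)" for n using Val_vring pull_funpow[OF R(1), of n] by blast
    then show ?thesis using True vring.m0
      by (intro exI[of _ "[:- \<phi> u, 1:]"])
         (auto simp: D_iff coeff_pCons subr_0[OF Fs] subr_1[OF Fs] subr_minus[OF Fs] split: nat.split)
  next
    case False
    obtain B q where rel': "relW W u B q" using rel[OF u False] by blast
    have "poly (\<Prod>b\<in>B. q b) (\<phi> u) \<in> mxi ((pull ^^ n) R)" for n
    proof (rule relW_residue[OF rel' _ _ _ W(1) False])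
      show "Val ((pull ^^ n) R)" using pull_funpow[OF R(1)] by blast
      show "kerv ((pull ^^ n) R) \<inter> W = D" by (rule pull_kerv_Int[OF R(1,2) W(2)])
      show "u \<in> kerv ((pull ^^ n) R)" using pull_kerv_sub[OF R(1,3) U(2)] u by blast
    qed
    moreover have "(\<Prod>b\<in>B. q b) \<noteq> 0" using rel' by (auto simp: relW_def)
    moreover have "coeff (\<Prod>b\<in>B. q b) i \<in> F0" for i
    proof -
      have fin: "finite B" and c: "\<And>b j. b \<in> B \<Longrightarrow> coeff (q b) j \<in> F0" using rel' by (auto simp: relW_def)
      show ?thesis using fin c
      proof (induction B arbitrary: i rule: finite_induct)
        case empty
        then show ?case by (auto simp: coeff_1 subr_0[OF Fs] subr_1[OF Fs])
      next
        case (insert b B)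
        then show ?case by (auto simp: coeff_mult intro!: subr_sum[OF Fs] subr_mult[OF Fs])
      qed
    qed
    ultimately show ?thesis by blast
  qed
  then obtain p where p: "\<And>u. u \<in> U \<Longrightarrow> p u \<noteq> 0" "\<And>u i. u \<in> U \<Longrightarrow> coeff (p u) i \<in> F0"
    "\<And>u n. u \<in> U \<Longrightarrow> poly (p u) (\<phi> u) \<in> mxi ((pull ^^ n) R)" by metis
  \<comment> \<open>Along multiples of a common period the coefficients do not move, so all
    conjugates \<rho> n x are roots of the same \<open>p x\<close> modulo the maximal ideal of the
    one ring \<open>R\<close>.\<close>
  have "finite (\<Union>x\<in>X. coeff (p x) ` {..degree (p x)})" "(\<Union>x\<in>X. coeff (p x) ` {..degree (p x)}) \<subseteq> F0"
    using fX p(2) X(1) by auto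
  from common_period[OF this] obtain t where t: "t > 0"
    "\<forall>c\<in>(\<Union>x\<in>X. coeff (p x) ` {..degree (p x)}). \<forall>n. (\<sigma> ^^ (t * n)) c = c" by blast
  have tc: "(\<sigma> ^^ (t * n)) (coeff (p x) i) = coeff (p x) i" if "x \<in> X" for x n i
    using t(2) that dyn.\<sigma>_0[OF dyn_power] by (cases "i \<le> degree (p x)") (auto simp: coeff_eq_0)
  define \<rho> where "\<rho> n x = (\<sigma> ^^ (t * n)) (\<phi> x)" for n x
  have \<rho>un: "R.un (\<rho> n x)" if "x \<in> U" for n x
  proof -
    have "x \<in> kerv ((pull ^^ (t * n)) R)" using pull_kerv_sub[OF R(1,3) U(2)] that by blast
    then have "vring.un ((pull ^^ (t * n)) R) (\<phi> x)" using un_\<phi> pull_funpow[OF R(1)] by blast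
    then show ?thesis using un_pull[OF R(1) \<phi>_L] by (simp add: \<rho>_def)
  qed
  have \<rho>m: "poly (p x) (\<rho> n x) \<in> mxi R" if "x \<in> X" for n x
  proof -
    have xU: "x \<in> U" using that X(1) by blast
    have "(\<sigma> ^^ (t * n)) (poly (p x) (\<phi> x)) \<in> mxi R"
      using p(3)[OF xU, of "t * n"] pull_funpow[OF R(1), of "t * n"] by blast
    then show ?thesis using \<sigma>n_poly[of "p x" "t * n" "\<phi> x"] tc[OF that] F0_L[OF p(2)[OF xU]] \<phi>_L by (simp add: \<rho>_def)
  qed
  have "\<exists>Z. finite Z \<and> (\<forall>y\<in>R. poly (p x) y \<in> mxi R \<longrightarrow> (\<exists>y0\<in>Z. y - y0 \<in> mxi R))" if "x \<in> X" for x
  proof (rule R.residue_roots_finite)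
    have xU: "x \<in> U" using that X(1) by blast
    show "coeff (p x) i \<in> R" for i using p(2)[OF xU] Val_F[OF R(1)] by blast
    have "coeff (p x) (degree (p x)) \<noteq> 0" using p(1)[OF xU] by simp
    then show "\<exists>i. coeff (p x) i \<notin> mxi R" using Val_F_m[OF R(1)] p(2)[OF xU] by blast
  qed
  then obtain Z where Z: "\<And>x. x \<in> X \<Longrightarrow> finite (Z x)"
    "\<And>x y. x \<in> X \<Longrightarrow> y \<in> R \<Longrightarrow> poly (p x) y \<in> mxi R \<Longrightarrow> \<exists>y0\<in>Z x. y - y0 \<in> mxi R" by metis
  \<comment> \<open>The tuple of residue classes of the n-th conjugates of the basis, an element of
    a finite product.\<close>
  define f where "f n = restrict (\<lambda>x. SOME y0. y0 \<in> Z x \<and> \<rho> n x - y0 \<in> mxi R) X" for n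
  have f: "f n x \<in> Z x \<and> \<rho> n x - f n x \<in> mxi R" if "x \<in> X" for n x
  proof -
    have "\<exists>y0. y0 \<in> Z x \<and> \<rho> n x - y0 \<in> mxi R"
      using Z(2)[OF that R.un_R[OF \<rho>un] \<rho>m[OF that]] that X(1) by blast
    from someI_ex[OF this] show ?thesis using that by (simp add: f_def)
  qed
  have "finite (PiE X Z)" using fX Z(1) by (intro finite_PiE)
  then obtain i j where ij: "i < j" "f i = f j"
  proof (rule nat_pigeonhole)
    show "f n \<in> PiE X Z" for n
    proof (rule PiE_I)
      show "f n x \<in> Z x" if "x \<in> X" for x using f[OF that] by blast
      show "f n x = undefined" if "x \<notin> X" for x using that by (simp add: f_def)
    qed
  qed
  \<comment> \<open>Equal residues at times i and j say that \<phi> (T x) reduces to a root of unity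
    for each basis element x; purity extends this to all of \<open>U\<close>.\<close>
  define T where "T a = (\<gamma> ^^ (t * i)) a - (\<gamma> ^^ (t * j)) a" for a
  have addn: "additive (\<gamma> ^^ n)" for n by (rule additive_funpow[OF \<gamma>_add])
  have addT: "additive T"
    by (rule additive.intro) (simp add: T_def additive.add[OF addn])
  have TU: "T a \<in> U" if "a \<in> U" for a
    using that \<gamma>n_mem[OF U(2)] by (auto simp: T_def intro!: subgroup_diff[OF sU])
  have pN: "pure (pcl (ones R))" by (rule pure_pcl[OF ones_subgroup[OF R(1)]])
  have Tx: "T x \<in> pcl (ones R)" if x: "x \<in> X" for x
  proof -
    have xU: "x \<in> U" using x X(1) by blast
    have "\<rho> i x - \<rho> j x = (\<rho> i x - f i x) - (\<rho> j x - f j x)" using ij(2) by simp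
    also have "\<dots> \<in> mxi R" by (rule R.m_diff[OF f[OF x, THEN conjunct2] f[OF x, THEN conjunct2]])
    finally have "(\<rho> i x - \<rho> j x) * inverse (\<rho> j x) \<in> mxi R"
      using \<rho>un[OF xU, of j] by (intro R.m_mult2) (auto simp: R.un_def)
    moreover have "(\<rho> i x - \<rho> j x) * inverse (\<rho> j x) = \<rho> i x / \<rho> j x - 1"
      using \<rho>un[OF xU, of j] by (simp add: R.un_def field_simps)
    ultimately have one: "\<rho> i x / \<rho> j x - 1 \<in> mxi R" by simp
    obtain z1 where z1: "(\<sigma> ^^ (t * i)) (\<phi> x) = z1 * \<phi> ((\<gamma> ^^ (t * i)) x)" "\<exists>m>0. z1 ^ m = 1" by (rule \<sigma>n_\<phi>)
    obtain z2 where z2: "(\<sigma> ^^ (t * j)) (\<phi> x) = z2 * \<phi> ((\<gamma> ^^ (t * j)) x)" "\<exists>m>0. z2 ^ m = 1" by (rule \<sigma>n_\<phi>)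
    obtain m1 m2 where m: "m1 > 0" "z1 ^ m1 = 1" "m2 > 0" "z2 ^ m2 = 1" using z1 z2 by blast
    have m': "z1 ^ (m1 * m2) = 1" "z2 ^ (m1 * m2) = 1" using m by (simp_all add: power_mult mult.commute[of m1] ) (metis mult.commute power_mult power_one)+
    have "\<rho> i x / \<rho> j x = (z1 / z2) * \<phi> (T x)" by (simp add: \<rho>_def z1(1) z2(1) T_def \<phi>_diff)
    then have "(\<rho> i x / \<rho> j x) ^ (m1 * m2) = \<phi> (zs (int (m1 * m2)) (T x))"
      using m' by (simp only: \<phi>_zs power_mult_distrib power_divide) simp
    then have "zs (int (m1 * m2)) (T x) \<in> ones R" using m_power_diff_1[OF R(1) one, of "m1 * m2"] by (simp add: ones_def)
    then show ?thesis using m unfolding pcl_def by (intro CollectI exI[of _ "int (m1 * m2)"]) simp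
  qed
  have TN: "T u \<in> pcl (ones R)" if u: "u \<in> U" for u
  proof -
    obtain k where k: "k \<noteq> 0" "zs k u \<in> zspan X" using X(3)[OF sU u] by blast
    then obtain c where c: "zs k u = (\<Sum>x\<in>X. zs (c x) x)" by (auto simp: zspan_def)
    have "zs k (T u) = T (zs k u)" using additive_zs[OF addT] by simp
    also have "\<dots> = (\<Sum>x\<in>X. zs (c x) (T x))" unfolding c by (simp add: additive.sum[OF addT] additive_zs[OF addT])
    also have "\<dots> \<in> pcl (ones R)" using Tx by (intro subgroup_sum[OF pure_subgroup[OF pN]] subgroup_zs[OF pure_subgroup[OF pN]])
    finally show ?thesis using pureD[OF pN] k(1) by blast
  qed
  have \<gamma>T: "\<gamma> (T a) = T (\<gamma> a)" for a
    by (simp add: T_def \<gamma>_diff funpow_swap1)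
  define Y where "Y = pcl (T ` U)"
  have "pure Y" unfolding Y_def by (rule pure_pcl[OF subgroup_image[OF addT sU]])
  moreover have "\<gamma> ` Y = Y"
  proof -
    have "\<gamma> ` T ` U = T ` \<gamma> ` U" using \<gamma>T by (auto simp: image_image)
    then show ?thesis unfolding Y_def using bij_image_pcl[OF \<gamma>_add \<gamma>_bij] U(2) by simp
  qed
  moreover have "Y \<subseteq> U" unfolding Y_def using TU by (intro pcl_least U(1)) blast
  moreover have YN: "Y \<subseteq> pcl (ones R)" unfolding Y_def using TN by (intro pcl_least pN) blast
  moreover have "Y \<inter> D = {0}"
    using ones_Int_D[OF R(1)] YN subgroup_0[OF D_sub] subgroup_0[OF pure_subgroup[OF \<open>pure Y\<close>]] by blast
  \<comment> \<open>\<open>T\<close> kills only periodic elements, and \<open>U\<close> contains one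
    that is not periodic.\<close>
  moreover have "Y \<noteq> {0}"
  proof
    assume Y0: "Y = {0}"
    obtain u where u: "u \<in> U" "u \<notin> D" using U(3) by blast
    have "T u \<in> Y" unfolding Y_def using u subset_pcl by blast
    then have e: "(\<gamma> ^^ (t * i)) u = (\<gamma> ^^ (t * j)) u" using Y0 by (simp add: T_def)
    have "t * j = t * i + t * (j - i)" using ij(1) by (simp add: algebra_simps)
    then have "(\<gamma> ^^ (t * i)) ((\<gamma> ^^ (t * (j - i))) u) = (\<gamma> ^^ (t * i)) u" using e by (simp add: funpow_add)
    then have "(\<gamma> ^^ (t * (j - i))) u = u" using bij_funpow[OF \<gamma>_bij] by (metis bij_is_inj injD)
    moreover have "t * (j - i) > 0" using t(1) ij(1) by simp
    ultimately show False using u(2) unfolding D_def by blast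
  qed
  ultimately show ?thesis by blast
qed

lemma Val_F_m_cancel:
  assumes R: "Val R" and c: "c \<in> F0" "c \<noteq> 0" and m: "c * x \<in> mxi R" shows "x \<in> mxi R"
proof -
  have "inverse c * (c * x) \<in> mxi R"
    using vring.m_mult[OF Val_vring[OF R] Val_F[OF R F_inv[OF c(1)]] m] .
  then show ?thesis using c(2) by (simp flip: mult.assoc)
qed

text \<open>Roots of unity lift from the residue field: X^n - 1 splits over the algebraically closed
  field with roots in \<open>F0\<close>, and the maximal ideal, being prime, contains one of the
  factors \<phi> z - \<zeta>.\<close>

lemma root_of_unity_residue:
  assumes R: "Val R" and z: "z \<in> pcl (ones R)" "z \<in> kerv R"
  shows "\<exists>\<zeta>. \<zeta> \<in> F0 \<and> \<zeta> \<noteq> 0 \<and> \<phi> z - \<zeta> \<in> mxi R"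
proof -
  interpret R: vring L0 R using Val_vring[OF R] .
  obtain k where k: "k \<noteq> 0" "zs k z \<in> ones R" using z(1) by (auto simp: pcl_def)
  define n where "n = nat \<bar>k\<bar>"
  have "zs (int n) z \<in> ones R"
    using k(2) subgroup_uminus[OF ones_subgroup[OF R] k(2)] by (cases "k \<ge> 0") (auto simp: n_def zs_minus_left)
  then have n: "n > 0" "\<phi> z ^ n - 1 \<in> mxi R" using k(1) \<phi>_zs[of n z] by (simp_all add: n_def ones_def)
  define p where "p = monom 1 n - [:1::'l:]"
  have "coeff p n = 1" using n(1) by (cases n) (auto simp: p_def coeff_monom)
  then have "p \<noteq> 0" by (metis coeff_0 zero_neq_one)
  then obtain A where A: "p = smult (lead_coeff p) (\<Prod>x\<in>#A. [:- x, 1:])"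
    using alg_closed_imp_factorization[of p] by blast
  have root: "x \<in> F0 \<and> x \<noteq> 0" if "x \<in># A" for x
  proof -
    have "poly (\<Prod>x\<in>#A. [:- x, 1:]) x = 0" using that by (induction A) auto
    then have "poly p x = 0" using A by (metis poly_smult mult_zero_right)
    then have "x ^ n = 1" by (simp add: p_def poly_monom)
    then show ?thesis using F0_root_of_unity n(1) by (metis power_eq_0_iff zero_neq_one)
  qed
  have zR: "\<phi> z \<in> R" using z(2) by (simp add: kerv_def)
  have ex: "\<exists>x\<in>#B. \<phi> z - x \<in> mxi R" if "(\<Prod>x\<in>#B. \<phi> z - x) \<in> mxi R" "\<forall>x\<in>#B. \<phi> z - x \<in> R" for B
    using that
  proof (induction B)
    case empty
    then show ?case using R.m1 by simp
  next
    case (add x B)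
    have "(\<Prod>x\<in>#B. \<phi> z - x) \<in> R" using add.prems(2)
      by (induction B) (auto simp: subr_1[OF R.s] subr_mult[OF R.s])
    then show ?case using add R.m_prime[of "\<phi> z - x" "\<Prod>x\<in>#B. \<phi> z - x"] by auto
  qed
  have "poly (\<Prod>x\<in>#A. [:- x, 1:]) y = (\<Prod>x\<in>#A. y - x)" for y
    by (induction A) (auto simp: algebra_simps)
  then have pe: "poly p y = lead_coeff p * (\<Prod>x\<in>#A. y - x)" for y using A by (metis poly_smult)
  have "coeff p i \<in> F0" for i
    by (auto simp: p_def coeff_monom coeff_pCons subr_0[OF Fs] subr_1[OF Fs]
        intro!: subr_diff[OF Fs] subr_minus[OF Fs] split: nat.split)
  then have "lead_coeff p \<in> F0" "lead_coeff p \<noteq> 0" using \<open>p \<noteq> 0\<close> by auto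
  then have "inverse (lead_coeff p) * poly p (\<phi> z) \<in> mxi R"
    using n(2) F_inv Val_F[OF R] by (intro R.m_mult) (auto simp: p_def poly_monom)
  then have "(\<Prod>x\<in>#A. \<phi> z - x) \<in> mxi R" using pe \<open>lead_coeff p \<noteq> 0\<close> by (simp add: field_simps)
  then have "\<exists>x\<in>#A. \<phi> z - x \<in> mxi R" using ex root Val_F[OF R] zR subr_diff[OF R.s] by blast
  then show ?thesis using root by blast
qed

text \<open>If elements of a rational basis are as close to \<open>F0\<close> as \<open>y0\<close>
  prescribes, so are the elements of the group they generate, hence some multiple n z. Returning to
  z uses characteristic zero: \<phi> z ^ n - \<zeta> ^ n is \<phi> z - \<zeta> times a factor
  congruent to n \<zeta> ^ (n - 1), which is a unit.\<close>

lemma minimal_jump: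
  assumes R: "Val R" and Y: "is_subgroup Y" "Y \<subseteq> kerv R" and y0: "y0 \<in> mxi R" "y0 \<noteq> 0"
    and X: "X \<subseteq> Y" "\<And>h. h \<in> Y \<Longrightarrow> \<exists>k. k \<noteq> 0 \<and> zs k h \<in> zspan X"
    and Xm: "\<And>x. x \<in> X \<Longrightarrow> \<exists>\<zeta>\<in>F0. \<zeta> \<noteq> 0 \<and> (\<phi> x - \<zeta>) / y0 \<in> R"
    and z: "z \<in> Y" "\<zeta> \<in> F0" "\<zeta> \<noteq> 0" "\<phi> z - \<zeta> \<in> mxi R"
  shows "(\<phi> z - \<zeta>) / y0 \<in> R"
proof -
  interpret R: vring L0 R using Val_vring[OF R] .
  define H where "H = {z \<in> Y. \<exists>\<zeta>\<in>F0. \<zeta> \<noteq> 0 \<and> (\<phi> z - \<zeta>) / y0 \<in> R}"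
  have sH: "is_subgroup H" unfolding is_subgroup_def
  proof (intro conjI ballI)
    show "0 \<in> H" using subgroup_0[OF Y(1)] subr_1[OF Fs] subr_0[OF R.s] unfolding H_def
      by (auto simp: \<phi>_0 intro!: bexI[of _ 1])
    fix x x' assume "x \<in> H" "x' \<in> H"
    then obtain e e' where e: "x \<in> Y" "e \<in> F0" "e \<noteq> 0" "(\<phi> x - e) / y0 \<in> R"
      "x' \<in> Y" "e' \<in> F0" "e' \<noteq> 0" "(\<phi> x' - e') / y0 \<in> R" unfolding H_def by blast
    have u: "R.un (\<phi> x')" using un_\<phi>[OF R] e(5) Y(2) by blast
    have iR: "inverse (\<phi> x') * inverse e' \<in> R" using u e F_inv Val_F[OF R] by (auto simp: R.un_def intro!: subr_mult[OF R.s])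
    have "e' * ((\<phi> x - e) / y0) - e * ((\<phi> x' - e') / y0) \<in> R"
      using e Val_F[OF R] by (intro subr_diff[OF R.s] subr_mult[OF R.s]) auto
    then have "inverse (\<phi> x') * inverse e' * (e' * ((\<phi> x - e) / y0) - e * ((\<phi> x' - e') / y0)) \<in> R"
      by (rule subr_mult[OF R.s iR])
    moreover have "inverse (\<phi> x') * inverse e' * (e' * ((\<phi> x - e) / y0) - e * ((\<phi> x' - e') / y0)) = (\<phi> (x - x') - e / e') / y0"
      using e(3,7) y0(2) \<phi>_nz[of x'] by (simp add: \<phi>_diff field_simps)
    moreover have "e / e' \<in> F0" "e / e' \<noteq> 0" using e F_div by auto
    moreover have "x - x' \<in> Y" using e subgroup_diff[OF Y(1)] by blast
    ultimately show "x - x' \<in> H" unfolding H_def mem_Collect_eq by (metis (no_types, lifting))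
  qed
  have "X \<subseteq> H" using X(1) Xm by (auto simp: H_def)
  then have "zspan X \<subseteq> H" by (rule zspan_least[OF sH])
  then obtain k where k: "k \<noteq> 0" "zs k z \<in> H" using X(2)[OF z(1)] by blast
  define n where "n = nat \<bar>k\<bar>"
  have n: "n > 0" using k(1) by (simp add: n_def)
  have "zs (int n) z \<in> H"
    using k(2) subgroup_uminus[OF sH k(2)] by (cases "k \<ge> 0") (auto simp: n_def zs_minus_left)
  then obtain e where e: "e \<in> F0" "(\<phi> z ^ n - e) / y0 \<in> R" by (auto simp: H_def \<phi>_zs)
  have zR: "\<phi> z \<in> R" using z(1) Y(2) by (auto simp: kerv_def)
  have \<zeta>R: "\<zeta> \<in> R" using z(2) Val_F[OF R] by blast
  have pm: "\<phi> z ^ i - \<zeta> ^ i \<in> mxi R" for i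
    unfolding power_diff_sumr2 using z(4) zR \<zeta>R
    by (intro R.m_mult2 subr_sum[OF R.s] subr_mult[OF R.s] subr_power[OF R.s])
  \<comment> \<open>The constant \<open>e\<close> that \<open>H\<close> supplies for n z must be
    \<zeta> ^ n, since both are residues of the same element.\<close>
  have "y0 * ((\<phi> z ^ n - e) / y0) \<in> mxi R" using R.m_mult2[OF y0(1) e(2)] .
  then have em: "\<phi> z ^ n - e \<in> mxi R" using y0(2) by simp
  have "\<phi> z ^ n - e - (\<phi> z ^ n - \<zeta> ^ n) \<in> mxi R" using R.m_diff[OF em pm] .
  then have "\<zeta> ^ n - e \<in> mxi R" by simp
  then have "\<zeta> ^ n - e = 0" using Val_F_m[OF R] e(1) z(2) subr_diff[OF Fs] subr_power[OF Fs] by blast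
  then have e_eq: "e = \<zeta> ^ n" by simp
  define S where "S = (\<Sum>i<n. \<zeta> ^ (n - Suc i) * \<phi> z ^ i)"
  have fact: "\<phi> z ^ n - \<zeta> ^ n = (\<phi> z - \<zeta>) * S" unfolding S_def by (rule power_diff_sumr2)
  have "S - of_nat n * \<zeta> ^ (n - 1) = (\<Sum>i<n. \<zeta> ^ (n - Suc i) * (\<phi> z ^ i - \<zeta> ^ i))"
  proof -
    have "of_nat n * \<zeta> ^ (n - 1) = (\<Sum>i<n. \<zeta> ^ (n - Suc i) * \<zeta> ^ i)" by (simp flip: power_add)
    then show ?thesis by (simp add: S_def sum_subtractf right_diff_distrib)
  qed
  also have "\<dots> \<in> mxi R" using pm \<zeta>R by (intro R.m_sum R.m_mult subr_power[OF R.s])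
  finally have Sm: "S - of_nat n * \<zeta> ^ (n - 1) \<in> mxi R" .
  have "R.un (of_nat n * \<zeta> ^ (n - 1))"
    using char0[OF n] z(2,3) by (intro un_F0[OF R] subr_mult[OF Fs] subr_of_nat[OF Fs] subr_power[OF Fs]) auto
  then have uS: "R.un S" using R.un_cong Sm by blast
  have "((\<phi> z ^ n - e) / y0) * inverse S \<in> R" using e(2) uS by (intro subr_mult[OF R.s]) (auto simp: R.un_def)
  moreover have "((\<phi> z ^ n - e) / y0) * inverse S = (\<phi> z - \<zeta>) / y0"
  proof -
    have "S \<noteq> 0" using uS by (simp add: R.un_def)
    then show ?thesis unfolding e_eq fact by simp
  qed
  ultimately show ?thesis by metis
qed

text \<open>The reduction of \<open>\<phi>\<close> is torsion on \<open>Y\<close>, and the relations confine the values of \<open>\<phi> z - \<zeta>\<close> to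
  fractions of values of \<open>\<phi>\<close> on a finite subset of \<open>W\<close>. Comparing the pullbacks along powers of \<open>\<sigma>\<close>, the
  pigeonhole principle yields an element of \<open>W\<close> that is periodic modulo \<open>D\<close>.\<close>
lemma core_contradiction:
  assumes W: "is_subgroup W" "\<gamma> ` W = W"
    and U: "pure U" "\<gamma> ` U = U" "D \<subset> U"
    and rel: "\<And>u. u \<in> U \<Longrightarrow> u \<notin> D \<Longrightarrow> \<exists>B q. relW W u B q"
    and nonper: "\<And>w h. w \<in> W \<Longrightarrow> h > 0 \<Longrightarrow> (\<gamma> ^^ h) w - w \<in> D \<Longrightarrow> w \<in> D"
    and R: "Val R" "kerv R \<inter> W = D" "U \<subseteq> kerv R"
  shows False
proof -
  obtain Y where Y: "pure Y" "\<gamma> ` Y = Y" "Y \<subseteq> U" "Y \<inter> D = {0}" "Y \<noteq> {0}" "Y \<subseteq> pcl (ones R)"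
    using trivial_residues[OF W U rel R] by blast
  note sY = pure_subgroup[OF Y(1)]
  obtain X where X: "X \<subseteq> Y" "zind X" "\<And>h. is_subgroup Y \<Longrightarrow> h \<in> Y \<Longrightarrow> \<exists>k. k \<noteq> 0 \<and> zs k h \<in> zspan X"
    using max_ind[of Y] by metis
  have fX: "finite X" using X(2) by (simp add: zind_def)
  have X0: "x \<notin> D" if "x \<in> X" for x
  proof
    assume "x \<in> D"
    then have "x = 0" using Y(4) X(1) that by blast
    have "(\<Sum>y\<in>X. zs (if y = x then 1 else 0) y) = 0" using \<open>x = 0\<close> by (intro sum.neutral) auto
    from zindD[OF X(2) this that] show False by simp
  qed
  have Xne: "X \<noteq> {}"
  proof
    assume "X = {}"
    obtain y where y: "y \<in> Y" "y \<noteq> 0" using Y(5) subgroup_0[OF sY] by blast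
    then show False using X(3)[OF sY y(1)] tf[of _ y] \<open>X = {}\<close> by (auto simp: zspan_def)
  qed
  have "\<exists>B q. relW W x B q" if "x \<in> X" for x using rel[of x] X0[OF that] that X(1) Y(3) by blast
  then obtain B q where Bq: "\<And>x. x \<in> X \<Longrightarrow> relW W x (B x) (q x)" by metis
  define RR where "RR n = (pull ^^ n) R" for n
  have V: "Val (RR n)" for n unfolding RR_def using pull_funpow[OF R(1)] by blast
  have KW: "kerv (RR n) \<inter> W = D" for n unfolding RR_def by (rule pull_kerv_Int[OF R(1,2) W(2)])
  have KY: "Y \<subseteq> kerv (RR n)" for n unfolding RR_def using pull_kerv_sub[OF R(1,3) U(2)] Y(3) by blast
  have YN: "Y \<subseteq> pcl (ones (RR n))" for n
  proof
    fix z assume "z \<in> Y"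
    then have "(\<gamma> ^^ n) z \<in> pcl (ones R)" using \<gamma>n_mem[OF Y(2), of n z] Y(6) by blast
    then show "z \<in> pcl (ones (RR n))" unfolding RR_def by (rule pcl_ones_pull[OF R(1)])
  qed
  have "\<exists>\<zeta>. \<zeta> \<in> F0 \<and> \<zeta> \<noteq> 0 \<and> \<phi> z - \<zeta> \<in> mxi (RR n)" if "z \<in> Y" for z n
    using root_of_unity_residue[OF V] YN KY that by blast
  note ex\<zeta> = this
  \<comment> \<open>The element of \<open>F0\<close> to which \<phi> z reduces in the n-th pullback;
    injectivity of reduction on \<open>F0\<close> makes it unique.\<close>
  define \<zeta> where "\<zeta> n z = (SOME \<zeta>. \<zeta> \<in> F0 \<and> \<zeta> \<noteq> 0 \<and> \<phi> z - \<zeta> \<in> mxi (RR n))" for n z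
  have \<zeta>: "\<zeta> n z \<in> F0 \<and> \<zeta> n z \<noteq> 0 \<and> \<phi> z - \<zeta> n z \<in> mxi (RR n)" if "z \<in> Y" for n z
    unfolding \<zeta>_def by (rule someI_ex[OF ex\<zeta>[OF that]])
  have ynz: "\<phi> x - \<zeta> n x \<noteq> 0" if "x \<in> X" for x n
    using \<zeta>[of x n] X0[OF that] that X(1) D_iff by auto
  \<comment> \<open>A basis element whose distance from \<open>F0\<close> has least value; by
    \<open>minimal_jump\<close> this value bounds the distances on all of \<open>Y\<close> from
    below.\<close>
  have "\<exists>b\<in>X. \<forall>a\<in>X. (\<phi> a - \<zeta> n a) / (\<phi> b - \<zeta> n b) \<in> RR n" for n
  proof (rule vring.min_term[OF Val_vring[OF V] fX Xne])
    show "\<phi> a - \<zeta> n a \<in> L0" if "a \<in> X" for a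
      using \<zeta>[of a n] that X(1) by (intro subr_diff[OF Ls] \<phi>_L F0_L) auto
    show "\<phi> a - \<zeta> n a \<noteq> 0" if "a \<in> X" for a using ynz[OF that] .
  qed
  then obtain x where x: "\<And>n. x n \<in> X" "\<And>n a. a \<in> X \<Longrightarrow> (\<phi> a - \<zeta> n a) / (\<phi> (x n) - \<zeta> n (x n)) \<in> RR n" by metis
  define K where "K y = (\<Sum>b\<in>B y. degree (q y b))" for y
  \<comment> \<open>The data of a jump are two exponents of the base and a multiplicity. Since
    \<open>X\<close> is finite, only finitely many occur as n varies.\<close>
  have "\<exists>s. s \<in> B (x n) \<times> B (x n) \<times> {1..K (x n)} \<and> fst s \<noteq> fst (snd s)
     \<and> vring.un (RR n) ((\<phi> (x n) - \<zeta> n (x n)) ^ snd (snd s) * \<phi> (fst s - fst (snd s)))" for n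
  proof -
    have xY: "x n \<in> Y" using x(1) X(1) by blast
    have "\<exists>b\<in>B (x n). \<exists>b'\<in>B (x n). \<exists>k\<in>{1..K (x n)}. b \<noteq> b' \<and> vring.un (RR n) ((\<phi> (x n) - \<zeta> n (x n)) ^ k * \<phi> (b - b'))"
      unfolding K_def using relW_jump[OF Bq[OF x(1)] V KW W(1) X0[OF x(1)]] \<zeta>[OF xY] by blast
    then obtain b b' k where "b \<in> B (x n)" "b' \<in> B (x n)" "k \<in> {1..K (x n)}" "b \<noteq> b'"
       "vring.un (RR n) ((\<phi> (x n) - \<zeta> n (x n)) ^ k * \<phi> (b - b'))" by blast
    then show ?thesis by (intro exI[of _ "(b, b', k)"]) simp
  qed
  then obtain s where s: "\<And>n. s n \<in> B (x n) \<times> B (x n) \<times> {1..K (x n)}" "\<And>n. fst (s n) \<noteq> fst (snd (s n))"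
    "\<And>n. vring.un (RR n) ((\<phi> (x n) - \<zeta> n (x n)) ^ snd (snd (s n)) * \<phi> (fst (s n) - fst (snd (s n))))" by metis
  have "finite (Sigma X (\<lambda>x. B x \<times> B x \<times> {1..K x}))" using fX Bq by (auto simp: relW_def)
  then obtain n m where nm: "n < m" "(x n, s n) = (x m, s m)"
  proof (rule nat_pigeonhole)
    show "(x n, s n) \<in> Sigma X (\<lambda>x. B x \<times> B x \<times> {1..K x})" for n using x(1) s(1) by blast
  qed
  \<comment> \<open>Two pullbacks share the same data: in each ring, k times the least distance
    cancels the value of the same \<phi> w. It remains to transport the m-th equation into the n-th
    ring by \<sigma>^h.\<close>
  define a where "a = x n"
  define w where "w = fst (s n) - fst (snd (s n))"
  define k where "k = snd (snd (s n))"
  have xs: "x n = a" "x m = a" and ss: "s m = s n" using nm(2) by (auto simp: a_def)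
  have aX: "a \<in> X" and aY: "a \<in> Y" using x(1)[of n] X(1) by (auto simp: a_def)
  have bb: "fst (s n) \<in> B a" "fst (snd (s n)) \<in> B a" "fst (s n) \<noteq> fst (snd (s n))"
    using s(1,2)[of n] xs by auto
  have wW: "w \<in> W" unfolding w_def using bb(1,2) Bq[OF aX] subgroup_diff[OF W(1)] by (auto simp: relW_def)
  have wD: "w \<notin> D" unfolding w_def using bb Bq[OF aX] by (auto simp: relW_def distD_def)
  define yn ym where "yn = \<phi> a - \<zeta> n a" and "ym = \<phi> a - \<zeta> m a"
  have un: "vring.un (RR n) (yn ^ k * \<phi> w)" using s(3)[of n] by (simp add: xs yn_def k_def w_def)
  have um: "vring.un (RR m) (ym ^ k * \<phi> w)" using s(3)[of m] by (simp add: xs ss ym_def k_def w_def)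
  have mn: "\<forall>b\<in>X. (\<phi> b - \<zeta> n b) / yn \<in> RR n" using x(2)[of _ n] by (simp add: xs yn_def)
  have mm: "\<forall>b\<in>X. (\<phi> b - \<zeta> m b) / ym \<in> RR m" using x(2)[of _ m] by (simp add: xs ym_def)
  define h where "h = m - n"
  have RRm: "RR m = (pull ^^ h) (RR n)"
  proof -
    have "m = h + n" using nm(1) by (simp add: h_def)
    then show ?thesis by (simp add: RR_def funpow_add)
  qed
  interpret R: vring L0 "RR n" using Val_vring[OF V] .
  note pm = pull_funpow[OF V[of n], of h, folded RRm]
  have \<zeta>L: "\<zeta> i b \<in> L0" if "b \<in> Y" for i b using \<zeta>[OF that] F0_L by blast
  have ymL: "ym \<in> L0" "yn \<in> L0" using \<zeta>L[OF aY] by (auto simp: ym_def yn_def intro!: subr_diff[OF Ls] \<phi>_L)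
  have nz: "yn \<noteq> 0" "ym \<noteq> 0" using ynz[OF aX] by (auto simp: yn_def ym_def)
  have \<sigma>F: "(\<sigma> ^^ h) c \<in> F0" if "c \<in> F0" for c using that by (induction h) (auto intro: \<sigma>_F0)
  have \<sigma>nz: "(\<sigma> ^^ h) c \<noteq> 0" if "c \<in> L0" "c \<noteq> 0" for c using dyn.\<sigma>_eq_0[OF dyn_power] that by blast
  have shift: "\<exists>z0 e. z0 \<in> F0 \<and> z0 \<noteq> 0 \<and> e \<in> F0 \<and> e \<noteq> 0 \<and> (\<sigma> ^^ h) (\<phi> b - c) = z0 * (\<phi> ((\<gamma> ^^ h) b) - e)"
    if c: "c \<in> F0" "c \<noteq> 0" for b c
  proof -
    obtain z0 where z0: "z0 \<in> F0" "z0 \<noteq> 0" "(\<sigma> ^^ h) (\<phi> b) = z0 * \<phi> ((\<gamma> ^^ h) b)" by (rule \<sigma>n_\<phi>)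
    have "(\<sigma> ^^ h) (\<phi> b - c) = z0 * (\<phi> ((\<gamma> ^^ h) b) - (\<sigma> ^^ h) c / z0)"
      using dyn.\<sigma>_diff[OF dyn_power \<phi>_L F0_L[OF c(1)]] z0 by (simp add: right_diff_distrib)
    moreover have "(\<sigma> ^^ h) c / z0 \<in> F0" "(\<sigma> ^^ h) c / z0 \<noteq> 0" using z0 \<sigma>F[OF c(1)] \<sigma>nz[OF F0_L[OF c(1)] c(2)] F_div by auto
    ultimately show ?thesis using z0 by blast
  qed
  obtain z0 e where z0: "z0 \<in> F0" "z0 \<noteq> 0" "e \<in> F0" "e \<noteq> 0" "(\<sigma> ^^ h) ym = z0 * (\<phi> ((\<gamma> ^^ h) a) - e)"
    using shift[of "\<zeta> m a" a] \<zeta>[OF aY, of m] unfolding ym_def by blast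
  define y' where "y' = \<phi> ((\<gamma> ^^ h) a) - e"
  have y'nz: "y' \<noteq> 0" using \<sigma>nz[OF ymL(1) nz(2)] z0 by (auto simp: y'_def)
  have "(\<sigma> ^^ h) ym \<in> mxi (RR n)" using \<zeta>[OF aY, of m] pm ym_def by auto
  then have y'm: "y' \<in> mxi (RR n)" using Val_F_m_cancel[OF V z0(1,2)] z0(5) by (simp add: y'_def)
  \<comment> \<open>\<open>y'\<close> and \<open>yn\<close> have the same value. One direction is
    minimality of \<open>yn\<close> in the n-th ring; the other is minimality of \<open>ym\<close>
    in the m-th ring, applied to the preimage of \<open>a\<close> under \<gamma>^h and then
    conjugated.\<close>
  have q1: "y' / yn \<in> RR n" unfolding y'_def
  proof (rule minimal_jump[OF V sY KY _ nz(1) X(1) X(3)[OF sY]])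
    show "yn \<in> mxi (RR n)" using \<zeta>[OF aY, of n] by (simp add: yn_def)
    show "\<exists>\<zeta>\<in>F0. \<zeta> \<noteq> 0 \<and> (\<phi> b - \<zeta>) / yn \<in> RR n" if "b \<in> X" for b
      using mn \<zeta>[of b n] that X(1) by blast
    show "(\<gamma> ^^ h) a \<in> Y" using aY \<gamma>n_mem[OF Y(2)] by blast
  qed (use z0 y'm in \<open>auto simp: y'_def\<close>)
  have q2: "yn / y' \<in> RR n"
  proof -
    have "(\<gamma> ^^ h) ` Y = Y" unfolding image_funpow[symmetric] using Y(2) by (induction h) auto
    then obtain b where b: "b \<in> Y" "(\<gamma> ^^ h) b = a" using aY by (metis imageE)
    have "(\<phi> b - \<zeta> m b) / ym \<in> RR m"
    proof (rule minimal_jump[OF V sY KY _ nz(2) X(1) X(3)[OF sY]])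
      show "ym \<in> mxi (RR m)" using \<zeta>[OF aY, of m] by (simp add: ym_def)
      show "\<exists>\<zeta>\<in>F0. \<zeta> \<noteq> 0 \<and> (\<phi> c - \<zeta>) / ym \<in> RR m" if "c \<in> X" for c
        using mm \<zeta>[of c m] that X(1) by blast
    qed (use b \<zeta>[of b m] in auto)
    then have r: "(\<sigma> ^^ h) ((\<phi> b - \<zeta> m b) / ym) \<in> RR n" using pm by blast
    have bL: "\<phi> b - \<zeta> m b \<in> L0" using \<zeta>L[OF b(1)] by (intro subr_diff[OF Ls] \<phi>_L)
    obtain z1 e1 where z1: "z1 \<in> F0" "z1 \<noteq> 0" "e1 \<in> F0" "(\<sigma> ^^ h) (\<phi> b - \<zeta> m b) = z1 * (\<phi> a - e1)"
      using shift[of "\<zeta> m b" b] \<zeta>[OF b(1), of m] b(2) by metis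
    have "(\<sigma> ^^ h) (\<phi> b - \<zeta> m b) \<in> mxi (RR n)" using \<zeta>[OF b(1), of m] pm by blast
    then have e1m: "\<phi> a - e1 \<in> mxi (RR n)" using Val_F_m_cancel[OF V z1(1,2)] z1(4) by simp
    have "\<phi> a - e1 - (\<phi> a - \<zeta> n a) \<in> mxi (RR n)" using R.m_diff[OF e1m] \<zeta>[OF aY, of n] by blast
    then have "\<zeta> n a - e1 \<in> mxi (RR n)" by simp
    then have "e1 = \<zeta> n a" using Val_F_m[OF V[of n]] \<zeta>[OF aY, of n] z1(3) subr_diff[OF Fs] by (metis eq_iff_diff_eq_0)
    then have "(\<sigma> ^^ h) ((\<phi> b - \<zeta> m b) / ym) = (z1 / z0) * (yn / y')"
      using dyn.\<sigma>_divide[OF dyn_power bL ymL(1)] z1(4) z0(5) by (simp add: yn_def y'_def)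
    then have "(z1 / z0) * (yn / y') \<in> RR n" using r by metis
    moreover have "z1 / z0 \<in> F0" "z1 / z0 \<noteq> 0" using z0(1,2) z1(1,2) F_div by auto
    ultimately show ?thesis using Val_F_mult_iff[OF V[of n], of "z1 / z0" "yn / y'"] by blast
  qed
  have u1: "R.un (yn / y')" using q1 q2 nz y'nz by (simp add: R.un_def inverse_divide)
  have u2: "R.un (y' ^ k * \<phi> ((\<gamma> ^^ h) w))"
  proof -
    have "ym ^ k * \<phi> w \<in> L0" using ymL by (intro subr_mult[OF Ls] subr_power[OF Ls] \<phi>_L)
    then have u: "R.un ((\<sigma> ^^ h) (ym ^ k * \<phi> w))" using um un_pull[OF V[of n], of _ h] unfolding RRm by blast
    obtain z2 where z2: "z2 \<in> F0" "z2 \<noteq> 0" "(\<sigma> ^^ h) (\<phi> w) = z2 * \<phi> ((\<gamma> ^^ h) w)" by (rule \<sigma>n_\<phi>)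
    have "(\<sigma> ^^ h) (ym ^ k * \<phi> w) = (z0 * y') ^ k * (z2 * \<phi> ((\<gamma> ^^ h) w))"
      using dyn.\<sigma>_mult[OF dyn_power subr_power[OF Ls ymL(1)] \<phi>_L] dyn.\<sigma>_power[OF dyn_power ymL(1)] z2 z0(5)
      by (simp add: y'_def)
    also have "\<dots> = (z0 ^ k * z2) * (y' ^ k * \<phi> ((\<gamma> ^^ h) w))" by (simp add: power_mult_distrib mult_ac)
    finally have "R.un ((z0 ^ k * z2) * (y' ^ k * \<phi> ((\<gamma> ^^ h) w)))" using u by simp
    moreover have "R.un (z0 ^ k * z2)" using z0 z2 by (intro un_F0[OF V] subr_mult[OF Fs] subr_power[OF Fs]) auto
    ultimately have "R.un ((z0 ^ k * z2) * (y' ^ k * \<phi> ((\<gamma> ^^ h) w)) / (z0 ^ k * z2))" by (rule R.un_divide)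
    then show ?thesis using z0(2) z2(2) by simp
  qed
  \<comment> \<open>With equal distances the two unit conditions can be divided, leaving \<phi>
    (\<gamma>^h w - w) as a unit.\<close>
  have "R.un ((yn / y') ^ k * (y' ^ k * \<phi> ((\<gamma> ^^ h) w)) / (yn ^ k * \<phi> w))"
    by (rule R.un_divide[OF R.un_mult[OF R.un_power[OF u1] u2] un])
  then have "R.un (\<phi> ((\<gamma> ^^ h) w - w))" using nz y'nz by (simp add: \<phi>_diff power_divide)
  then have "(\<gamma> ^^ h) w - w \<in> kerv (RR n)" using un_\<phi>[OF V] by blast
  moreover have "(\<gamma> ^^ h) w - w \<in> W" using wW \<gamma>n_mem[OF W(2)] subgroup_diff[OF W(1)] by blast
  ultimately have "(\<gamma> ^^ h) w - w \<in> D" using KW by blast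
  moreover have "h > 0" using nm(1) by (simp add: h_def)
  ultimately show False using nonper wW wD by blast
qed

section \<open>Climbing from \<open>D\<close> to the whole group\<close>

lemma Ind_pow: "i > 0 \<Longrightarrow> dyn.Ind (\<gamma> ^^ i) L0 \<phi> (\<sigma> ^^ i) = Ind"
  unfolding dyn.Ind_def[OF dyn_power] dyn.distD_def[OF dyn_power] Ind_def distD_def
  by (simp add: F0_pow D_pow fun_eq_iff)

lemma Val_pow: "i > 0 \<Longrightarrow> dyn.Val L0 (\<sigma> ^^ i) = Val"
  unfolding dyn.Val_def[OF dyn_power] Val_def by (simp add: F0_pow fun_eq_iff)

text \<open>\<open>invariant_core\<close> delivers a subgroup fixed only by a power of \<gamma>. The
  notions \<open>F0\<close>, \<open>D\<close>, \<open>Ind\<close> and \<open>Val\<close> do not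
  change when \<gamma> and \<sigma> are replaced by positive powers.\<close>

lemma core_contradiction_pow:
  assumes i: "i > 0" and W: "is_subgroup W" "(\<gamma> ^^ i) ` W = W"
    and U: "pure U" "(\<gamma> ^^ i) ` U = U" "D \<subset> U"
    and rel: "\<And>u. u \<in> U \<Longrightarrow> u \<notin> D \<Longrightarrow> \<not> Ind (set_plus W (range (\<lambda>k. zs k u)))"
    and nonper: "\<And>w h. w \<in> W \<Longrightarrow> h > 0 \<Longrightarrow> (\<gamma> ^^ h) w - w \<in> D \<Longrightarrow> w \<in> D"
    and R: "Val R" "kerv R \<inter> W = D" "U \<subseteq> kerv R"
  shows False
proof -
  interpret p: dyn "TYPE('a)" N "\<gamma> ^^ i" L0 \<phi> "\<sigma> ^^ i" by (rule dyn_power)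
  show False
  proof (rule p.core_contradiction[OF W U(1,2)])
    show "p.D \<subset> U" using U(3) D_pow[OF i] by simp
    show "\<exists>B q. p.relW W u B q" if "u \<in> U" "u \<notin> p.D" for u
      using p.relation_polys[of W u] rel[of u] that Ind_pow[OF i] D_pow[OF i] by simp
    show "w \<in> p.D" if "w \<in> W" "h > 0" "((\<gamma> ^^ i) ^^ h) w - w \<in> p.D" for w h
      using nonper[of w "i * h"] that i D_pow[OF i] by (simp add: funpow_mult)
    show "p.Val R" using R(1) Val_pow[OF i] by simp
    show "p.kerv R \<inter> W = p.D" using R(2) D_pow[OF i] by (simp add: kerv_def p.kerv_def)
    show "U \<subseteq> p.kerv R" using R(3) by (simp add: kerv_def p.kerv_def)
  qed
qed

text \<open>Minimality of \<open>V\<close> forces every valuation kernel that meets \<open>W\<close>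
  in \<open>D\<close> to fill \<open>V\<close> up to \<open>W\<close> and torsion. Hence adjoining
  to \<open>W\<close> any single element of \<open>V\<close> outside it already destroys
  independence, which provides the relations for \<open>core_contradiction\<close>.\<close>

lemma minimal_step:
  assumes W: "pure W" "\<gamma> ` W = W" "D \<subseteq> W" "Ind W"
    and V: "pure V" "\<gamma> ` V = V" "W \<subset> V" "\<not> Ind V"
    and min: "\<And>U i. pure U \<Longrightarrow> W \<subset> U \<Longrightarrow> U \<subseteq> V \<Longrightarrow> i > 0 \<Longrightarrow> (\<gamma> ^^ i) ` U = U \<Longrightarrow> U = V"
    and nonper: "\<And>w h. w \<in> W \<Longrightarrow> h > 0 \<Longrightarrow> (\<gamma> ^^ h) w - w \<in> D \<Longrightarrow> w \<in> D"
  shows False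
proof -
  note sW = pure_subgroup[OF W(1)] and sV = pure_subgroup[OF V(1)]
  obtain S0 c where S0: "finite S0" "S0 \<subseteq> V" "distD S0" "\<forall>a\<in>S0. c a \<in> F0"
    "(\<Sum>a\<in>S0. c a * \<phi> a) = 0" "\<not> (\<forall>a\<in>S0. c a = 0)"
    using V(4) unfolding Ind_def by blast
  define S where "S = {a\<in>S0. c a \<noteq> 0}"
  have S: "finite S" "S \<noteq> {}" "S \<subseteq> V" "distD S" "\<forall>a\<in>S. c a \<in> F0 - {0}"
    using S0 by (auto simp: S_def distD_def)
  have sum0: "(\<Sum>a\<in>S. c a * \<phi> a) = 0"
    using S0(1,5) by (subst sum.mono_neutral_left[of S0 S]) (auto simp: S_def)
  \<comment> \<open>By \<open>relation_ker\<close> one fixed relation forces every kernel to contain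
    one of these finitely many differences.\<close>
  define E where "E = (\<lambda>(a, b). a - b) ` (S \<times> S) - D"
  have E: "finite E" "E \<inter> D = {}" using S(1) by (auto simp: E_def)
  have EK: "E \<inter> (kerv R \<inter> V) \<noteq> {}" if R: "Val R" for R
  proof -
    obtain a b where ab: "a \<in> S" "b \<in> S" "a \<noteq> b" "a - b \<in> kerv R"
      using relation_ker[OF R S(1,2,5) sum0] by blast
    have "a - b \<notin> D" using S(4) ab by (auto simp: distD_def)
    then have "a - b \<in> E" using ab by (auto simp: E_def)
    moreover have "a - b \<in> V" using ab S(3) subgroup_diff[OF sV] by blast
    ultimately show ?thesis using ab by blast
  qed
  \<comment> \<open>\<open>invariant_core\<close> for the kernels of valuations with a property
    \<open>Q\<close> stable under pullback. It serves twice, once with a property to be refuted and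
    once with none.\<close>
  have core: "\<exists>U i R. pure U \<and> D \<subset> U \<and> i > 0 \<and> (\<gamma> ^^ i) ` U = U \<and> Val R \<and> kerv R \<inter> W = D \<and> Q R \<and> U \<subseteq> kerv R \<inter> V"
    if ex: "\<exists>R. Val R \<and> kerv R \<inter> W = D \<and> Q R" and st: "\<And>R. Val R \<Longrightarrow> kerv R \<inter> W = D \<Longrightarrow> Q R \<Longrightarrow> Q (pull R)" for Q
  proof -
    define \<K> where "\<K> = {kerv R \<inter> V |R. Val R \<and> kerv R \<inter> W = D \<and> Q R}"
    have pK: "pure K" if "K \<in> \<K>" for K using that kerv_pure V(1) pure_Int by (auto simp: \<K>_def)
    have DK: "D \<subseteq> K" if "K \<in> \<K>" for K using that D_kerv W(3) V(3) by (auto simp: \<K>_def)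
    have sK: "{a. \<gamma> a \<in> K} \<in> \<K>" if KK: "K \<in> \<K>" for K
    proof -
      obtain R where R: "K = kerv R \<inter> V" "Val R" "kerv R \<inter> W = D" "Q R" using KK unfolding \<K>_def by blast
      have "{a. \<gamma> a \<in> K} = kerv (pull R) \<inter> V"
        using pull_kerv[OF R(2)] \<gamma>n_mem[OF V(2), of 1] R(1) by auto
      moreover have "kerv (pull R) \<inter> W = D" using pull_kerv_Int[OF R(2,3) W(2), of 1] by simp
      ultimately show ?thesis using pull_Val[OF R(2)] st[OF R(2,3,4)] unfolding \<K>_def by blast
    qed
    have ne: "\<K> \<noteq> {}" using ex by (auto simp: \<K>_def)
    have eK: "E \<inter> K \<noteq> {}" if "K \<in> \<K>" for K using that EK by (auto simp: \<K>_def)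
    obtain U i K where "pure U" "D \<subset> U" "i > 0" "(\<gamma> ^^ i) ` U = U" "K \<in> \<K>" "U \<subseteq> K"
      by (rule invariant_core[OF \<gamma>_add \<gamma>_bij pK DK sK ne E(1) E(2) eK D_sub])
    then show ?thesis unfolding \<K>_def by blast
  qed
  have imgW: "(\<gamma> ^^ i) ` W = W" for i unfolding image_funpow[symmetric] using W(2) by (induction i) auto
  \<comment> \<open>If some kernel failed to fill \<open>V\<close>, an invariant subgroup of such a
    kernel together with \<open>W\<close> would have a pure closure that is invariant and strictly
    above \<open>W\<close>, hence equal to \<open>V\<close>.\<close>
  have claim1: "V \<subseteq> pcl (set_plus (kerv R \<inter> V) W)" if R: "Val R" "kerv R \<inter> W = D" for R
  proof (rule ccontr)
    assume n: "\<not> ?thesis"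
    define Q where "Q R \<longleftrightarrow> \<not> V \<subseteq> pcl (set_plus (kerv R \<inter> V) W)" for R
    have st: "Q (pull R)" if "Val R" "kerv R \<inter> W = D" "Q R" for R
      unfolding Q_def
    proof
      assume a: "V \<subseteq> pcl (set_plus (kerv (pull R) \<inter> V) W)"
      have "\<gamma> ` V \<subseteq> pcl (\<gamma> ` set_plus (kerv (pull R) \<inter> V) W)"
        unfolding bij_image_pcl[OF \<gamma>_add \<gamma>_bij, symmetric] using a by blast
      also have "\<dots> \<subseteq> pcl (set_plus (kerv R \<inter> V) W)"
      proof (rule pcl_mono)
        have "\<gamma> ` (kerv (pull R) \<inter> V) \<subseteq> kerv R \<inter> V" using pull_kerv[OF \<open>Val R\<close>] V(2) by auto
        then show "\<gamma> ` set_plus (kerv (pull R) \<inter> V) W \<subseteq> set_plus (kerv R \<inter> V) W"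
          unfolding image_set_plus[OF \<gamma>_add] W(2) unfolding set_plus_def by blast
      qed
      finally show False using \<open>Q R\<close> V(2) by (simp add: Q_def)
    qed
    have ex: "\<exists>R. Val R \<and> kerv R \<inter> W = D \<and> Q R" using R n by (auto simp: Q_def)
    obtain U i R where U: "pure U" "D \<subset> U" "i > 0" "(\<gamma> ^^ i) ` U = U" "Val R" "kerv R \<inter> W = D" "Q R" "U \<subseteq> kerv R \<inter> V"
      using core[of Q, OF ex st] by blast
    have sU: "is_subgroup (set_plus U W)" by (rule subgroup_set_plus[OF pure_subgroup[OF U(1)] sW])
    define U' where "U' = pcl (set_plus U W)"
    have "pure U'" unfolding U'_def by (rule pure_pcl[OF sU])
    moreover have "W \<subset> U'"
    proof -
      have "W \<subseteq> U'" unfolding U'_def using set_plus_right[OF pure_subgroup[OF U(1)]] subset_pcl by blast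
      moreover have "U \<subseteq> U'" unfolding U'_def using set_plus_left[OF sW] subset_pcl by blast
      moreover obtain x where "x \<in> U" "x \<notin> D" using U(2) by blast
      moreover from this have "x \<notin> W" using U(6,8) by blast
      ultimately show ?thesis by blast
    qed
    moreover have "U' \<subseteq> V" unfolding U'_def using U(8) V(3) by (intro pcl_least V(1) set_plus_least sV) auto
    moreover have "(\<gamma> ^^ i) ` U' = U'"
      unfolding U'_def bij_image_pcl[OF additive_funpow[OF \<gamma>_add] bij_funpow[OF \<gamma>_bij]]
        image_set_plus[OF additive_funpow[OF \<gamma>_add]] U(4) imgW ..
    ultimately have "U' = V" using min U(3) by blast
    moreover have "U' \<subseteq> pcl (set_plus (kerv R \<inter> V) W)"
      unfolding U'_def using U(8) by (intro pcl_mono) (auto simp: set_plus_def)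
    ultimately show False using U(7) by (simp add: Q_def)
  qed
  \<comment> \<open>Independence on W + Zu would yield a valuation whose kernel meets this group
    only in \<open>D\<close>, whereas \<open>claim1\<close> produces a kernel element of the form k
    u - w, which cannot lie in \<open>W\<close>.\<close>
  have claim2: "\<not> Ind (set_plus W (range (\<lambda>k. zs k u)))" if u: "u \<in> V" "u \<notin> W" for u
  proof
    let ?Wu = "set_plus W (range (\<lambda>k. zs k u))"
    assume I: "Ind ?Wu"
    have sWu: "is_subgroup ?Wu" by (rule subgroup_set_plus[OF sW subgroup_range_zs])
    have WWu: "W \<subseteq> ?Wu" by (rule set_plus_left[OF subgroup_range_zs])
    obtain R where R: "Val R" "kerv R \<inter> ?Wu = D" by (rule Val_exists[OF sWu order.trans[OF W(3) WWu] I])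
    have RW: "kerv R \<inter> W = D" using R(2) WWu D_kerv[OF R(1)] W(3) by blast
    obtain k where k: "k \<noteq> 0" "zs k u \<in> set_plus (kerv R \<inter> V) W"
      using subsetD[OF claim1[OF R(1) RW] u(1)] unfolding pcl_def by blast
    then obtain \<kappa> w where kw: "zs k u = \<kappa> + w" "\<kappa> \<in> kerv R" "w \<in> W" unfolding set_plus_def by blast
    have "zs k u \<in> ?Wu" by (rule subsetD[OF set_plus_right[OF sW] rangeI])
    then have "zs k u - w \<in> ?Wu" using subgroup_diff[OF sWu] kw(3) WWu by blast
    then have "\<kappa> \<in> ?Wu" using kw(1) by simp
    then have "\<kappa> \<in> W" using kw(2) R(2) W(3) by blast
    then have "zs k u \<in> W" using kw subgroup_add[OF sW] by simp
    then show False using u(2) pureD[OF W(1)] k(1) by blast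
  qed
  obtain R0 where "Val R0" "kerv R0 \<inter> W = D" using Val_exists[OF sW W(3,4)] by blast
  then have ex: "\<exists>R. Val R \<and> kerv R \<inter> W = D \<and> True" by blast
  obtain U i R where U: "pure U" "D \<subset> U" "i > 0" "(\<gamma> ^^ i) ` U = U" "Val R" "kerv R \<inter> W = D" "U \<subseteq> kerv R \<inter> V"
    using core[of "\<lambda>_. True", OF ex] by blast
  have "u \<notin> W" if "u \<in> U" "u \<notin> D" for u using that U(6,7) by blast
  then have rel: "\<not> Ind (set_plus W (range (\<lambda>k. zs k u)))" if "u \<in> U" "u \<notin> D" for u
    using claim2 that U(7) by blast
  have "U \<subseteq> kerv R" using U(7) by blast
  show False
  proof (rule core_contradiction_pow[OF U(3) sW imgW U(1,4,2) _ _ U(5,6) \<open>U \<subseteq> kerv R\<close>])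
    show "\<not> Ind (set_plus W (range (\<lambda>k. zs k u)))" if "u \<in> U" "u \<notin> D" for u by (rule rel[OF that])
    show "w \<in> D" if "w \<in> W" "h > 0" "(\<gamma> ^^ h) w - w \<in> D" for w h by (rule nonper[OF that])
  qed
qed

lemma D_Ind: "Ind D"
  unfolding Ind_def
proof (intro allI impI ballI)
  fix S c a assume S: "finite S" "S \<subseteq> D" "distD S" "\<forall>a\<in>S. c a \<in> F0" "(\<Sum>a\<in>S. c a * \<phi> a) = 0" "a \<in> S"
  have "S = {a}" using S(2,3,6) subgroup_diff[OF D_sub] unfolding distD_def by blast
  then show "c a = 0" using S(5) \<phi>_nz by simp
qed

text \<open>Take an independent W of largest rank and a V of least rank properly above it, each
  invariant under some power of \<gamma>; maximality of W makes V dependent. A common power reduces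
  the matter to \<open>minimal_step\<close>.\<close>

lemma Ind_nonperiodic:
  assumes W0: "pure W0" "\<gamma> ` W0 = W0" "D \<subseteq> W0"
    and nonper: "\<And>w h. w \<in> W0 \<Longrightarrow> h > 0 \<Longrightarrow> (\<gamma> ^^ h) w - w \<in> D \<Longrightarrow> w \<in> D"
  shows "Ind W0"
proof (rule ccontr)
  assume n: "\<not> Ind W0"
  define P where "P W \<longleftrightarrow> pure W \<and> D \<subseteq> W \<and> W \<subseteq> W0 \<and> Ind W \<and> (\<exists>i>0. (\<gamma> ^^ i) ` W = W)" for W
  have "P D" unfolding P_def using D_pure W0(3) D_Ind D_\<gamma> by (auto intro!: exI[of _ "1::nat"])
  have "\<exists>W. P W \<and> (\<forall>W'. P W' \<longrightarrow> rank W' \<le> rank W)"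
    using rank_le_N by (intro ex_has_greatest_nat[of P D rank "Suc N"] \<open>P D\<close>) (simp add: less_Suc_eq_le)
  then obtain W where W: "P W" and Wmax: "\<And>W'. P W' \<Longrightarrow> rank W' \<le> rank W" by auto
  define P' where "P' V \<longleftrightarrow> pure V \<and> W \<subset> V \<and> V \<subseteq> W0 \<and> (\<exists>i>0. (\<gamma> ^^ i) ` V = V)" for V
  have "W \<noteq> W0" using W n by (auto simp: P_def)
  then have "P' W0" unfolding P'_def using W W0 by (auto simp: P_def intro!: exI[of _ "1::nat"])
  then obtain V where V: "P' V" and Vmin: "\<And>V'. P' V' \<Longrightarrow> rank V \<le> rank V'"
    using ex_has_least_nat[of P' W0 rank] by blast
  have "rank W < rank V" using rank_strict W V by (auto simp: P_def P'_def)
  moreover have "P V" if "Ind V" using that V W unfolding P_def P'_def by blast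
  ultimately have nV: "\<not> Ind V" using Wmax by fastforce
  obtain i where i: "i > 0" "(\<gamma> ^^ i) ` W = W" using W by (auto simp: P_def)
  obtain i' where i': "i' > 0" "(\<gamma> ^^ i') ` V = V" using V by (auto simp: P'_def)
  define j where "j = i * i'"
  have j: "j > 0" using i i' by (simp add: j_def)
  have jW: "(\<gamma> ^^ j) ` W = W" using fix_mult[of i "(`) \<gamma>" W i'] i(2) by (simp add: image_funpow j_def)
  have jV: "(\<gamma> ^^ j) ` V = V" using fix_mult[of i' "(`) \<gamma>" V i] i'(2) by (simp add: image_funpow j_def mult.commute)
  interpret p: dyn "TYPE('a)" N "\<gamma> ^^ j" L0 \<phi> "\<sigma> ^^ j" by (rule dyn_power)
  show False
  proof (rule p.minimal_step[of W V])
    show "pure W" "pure V" "W \<subset> V" using W V by (auto simp: P_def P'_def)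
    show "(\<gamma> ^^ j) ` W = W" "(\<gamma> ^^ j) ` V = V" by (fact jW, fact jV)
    show "p.D \<subseteq> W" using D_pow[OF j] W by (simp add: P_def)
    show "p.Ind W" "\<not> p.Ind V" using Ind_pow[OF j] W nV by (simp_all add: P_def)
    show "w \<in> p.D" if "w \<in> W" "h > 0" "((\<gamma> ^^ j) ^^ h) w - w \<in> p.D" for w h
      using nonper[of w "j * h"] that j D_pow[OF j] W by (auto simp: funpow_mult P_def)
    fix U k assume U: "pure U" "W \<subset> U" "U \<subseteq> V" "k > (0::nat)" "((\<gamma> ^^ j) ^^ k) ` U = U"
    have "\<exists>i>0. (\<gamma> ^^ i) ` U = U" using U(4,5) j by (intro exI[of _ "j * k"]) (simp add: funpow_mult)
    then have "P' U" unfolding P'_def using U V by (auto simp: P'_def)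
    then show "U = V" using rank_eqI[OF U(1,3)] Vmin by blast
  qed
qed

text \<open>A Fitting argument: the rank of the image H of (\<gamma>^M - 1)^t is made least. Then H
  meets \<open>D\<close> trivially, D + H has no elements that are periodic only modulo
  \<open>D\<close>, and the rest of A is reached by t unipotent steps.\<close>

theorem Ind_UNIV: "Ind UNIV"
proof -
  define T where "T M a = (\<gamma> ^^ M) a - a" for M a
  note addn = additive_funpow[OF \<gamma>_add]
  have addT: "additive (T M)" for M
    by (rule additive.intro) (simp add: T_def additive.add[OF addn])
  note addTt = additive_funpow[OF addT]
  have \<gamma>\<gamma>: "(\<gamma> ^^ n) ((\<gamma> ^^ M) a) = (\<gamma> ^^ M) ((\<gamma> ^^ n) a)" for n M a
    using funpow_add[of n M \<gamma>] funpow_add[of M n \<gamma>] by (metis add.commute comp_apply)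
  have \<gamma>T: "(\<gamma> ^^ n) (T M a) = T M ((\<gamma> ^^ n) a)" for n M a
    unfolding T_def additive.diff[OF addn] \<gamma>\<gamma>[of n M a] ..
  have TT: "T M (T M' a) = T M' (T M a)" for M M' a
    using \<gamma>T[of M M' a] additive.diff[OF addT] by (simp add: T_def[of M])
  have \<gamma>Tt: "(\<gamma> ^^ n) ((T M ^^ t) a) = (T M ^^ t) ((\<gamma> ^^ n) a)" for n M t a
    by (induction t) (simp_all add: \<gamma>T)
  have TTt: "T M' ((T M ^^ t) a) = (T M ^^ t) (T M' a)" for M M' t a
    by (induction t) (simp_all add: TT[of M' M])
  \<comment> \<open>The minimum is taken over M and t together, as a larger M may lower the rank
    further.\<close>
  define Q where "Q p \<longleftrightarrow> fst p > (0::nat)" for p :: "nat \<times> nat"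
  have "Q (1, 0)" by (simp add: Q_def)
  then obtain p where p: "Q p" "\<And>p'. Q p' \<Longrightarrow> rank (range (T (fst p) ^^ snd p)) \<le> rank (range (T (fst p') ^^ snd p'))"
    using ex_has_least_nat[of Q "(1, 0)" "\<lambda>p. rank (range (T (fst p) ^^ snd p))"] by blast
  define M t where "M = fst p" and "t = snd p"
  have M: "M > 0" using p(1) by (simp add: Q_def M_def)
  have min: "rank (range (T M ^^ t)) \<le> rank (range (T M' ^^ t'))" if "M' > 0" for M' t'
    using p(2)[of "(M', t')"] that by (simp add: Q_def M_def t_def)
  define H where "H = range (T M ^^ t)"
  have sub_UNIV: "is_subgroup (UNIV :: 'a set)" by (simp add: is_subgroup_def)
  have sH: "is_subgroup H" unfolding H_def by (rule subgroup_image[OF addTt sub_UNIV])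
  \<comment> \<open>If h in H is nonzero with period M', then \<gamma>^(M M') - 1 kills h and so
    lowers the rank of H. As this operator factors through \<gamma>^M - 1, the image of its power t
    + 1 lies in its image of H, against minimality.\<close>
  have H0: "h = 0" if h: "h \<in> H" "h \<in> D" for h
  proof (rule ccontr)
    assume "h \<noteq> 0"
    obtain M' where M': "M' > 0" "(\<gamma> ^^ M') h = h" using h(2) by (auto simp: D_def)
    let ?M = "M * M'"
    have r1: "T ?M a \<in> range (T M)" for a
    proof -
      have s: "is_subgroup (range (T M))" by (rule subgroup_image[OF addT sub_UNIV])
      have "T (M * n) a \<in> range (T M)" for n
      proof (induction n)
        case 0
        then show ?case using subgroup_0[OF s] by (simp add: T_def)
      next
        case (Suc n)
        have "T (M * Suc n) a = T M ((\<gamma> ^^ (M * n)) a) + T (M * n) a"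
          by (simp add: T_def funpow_add)
        then show ?case using subgroup_add[OF s _ Suc] by simp
      qed
      then show ?thesis .
    qed
    have r2: "range (T ?M ^^ n) \<subseteq> range (T M ^^ n)" for n
    proof (induction n)
      case (Suc n)
      show ?case
      proof
        fix y assume "y \<in> range (T ?M ^^ Suc n)"
        then obtain a where "y = T ?M ((T ?M ^^ n) a)" by auto
        moreover obtain b where "(T ?M ^^ n) a = (T M ^^ n) b" using Suc by blast
        ultimately have "y = (T M ^^ n) (T ?M b)" by (simp add: TTt)
        moreover obtain c where "T ?M b = T M c" using r1[of b] by blast
        ultimately have "y = (T M ^^ Suc n) c" by (simp add: funpow_swap1)
        then show "y \<in> range (T M ^^ Suc n)" by blast
      qed
    qed simp
    have "range (T ?M ^^ Suc t) \<subseteq> T ?M ` H" unfolding H_def using r2[of t] by auto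
    then have "rank (range (T ?M ^^ Suc t)) \<le> rank (T ?M ` H)" by (rule rank_mono)
    also have "T ?M h = 0" using fix_mult[OF M'(2), of M] by (simp add: T_def mult.commute)
    then have "rank (T ?M ` H) < rank H" using rank_image_kernel[OF addT h(1) \<open>h \<noteq> 0\<close>] by blast
    finally show False using min[of ?M "Suc t"] M M'(1) by (simp add: H_def)
  qed
  have \<gamma>H: "\<gamma> ` H = H"
  proof -
    have "\<gamma> ((T M ^^ t) a) = (T M ^^ t) (\<gamma> a)" for a using \<gamma>Tt[of 1] by simp
    then have "\<gamma> ` H = (T M ^^ t) ` range \<gamma>" unfolding H_def by (auto simp: image_image)
    then show ?thesis using \<gamma>_bij by (simp add: H_def bij_is_surj)
  qed
  define W0 where "W0 = pcl (set_plus D H)"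
  have sDH: "is_subgroup (set_plus D H)" by (rule subgroup_set_plus[OF D_sub sH])
  have W0: "pure W0" "\<gamma> ` W0 = W0" "D \<subseteq> W0" "H \<subseteq> W0"
    unfolding W0_def bij_image_pcl[OF \<gamma>_add \<gamma>_bij] image_set_plus[OF \<gamma>_add] D_\<gamma> \<gamma>H
    using pure_pcl[OF sDH] set_plus_left[OF sH, of D] set_plus_right[OF D_sub, of H] subset_pcl[of "set_plus D H"]
    by auto
  have I0: "Ind W0"
  proof (rule Ind_nonperiodic[OF W0(1-3)])
    fix w h assume w: "w \<in> W0" "h > 0" "(\<gamma> ^^ h) w - w \<in> D"
    obtain m where m: "m \<noteq> 0" "zs m w \<in> set_plus D H" using w(1) by (auto simp: W0_def pcl_def)
    then obtain d h0 where dh: "zs m w = d + h0" "d \<in> D" "h0 \<in> H" unfolding set_plus_def by blast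
    have "T h h0 = T h (zs m w) - T h d" by (simp add: dh(1) additive.add[OF addT])
    also have "\<dots> = zs m (T h w) - T h d" by (simp add: additive_zs[OF addT])
    also have "\<dots> \<in> D"
      using w(3) dh(2) \<gamma>n_mem[OF D_\<gamma>, of h d] by (intro subgroup_diff[OF D_sub] subgroup_zs[OF D_sub]) (auto simp: T_def intro: subgroup_diff[OF D_sub])
    finally have "T h h0 \<in> D" .
    moreover have "T h h0 \<in> H" unfolding T_def using \<gamma>n_mem[OF \<gamma>H, of h h0] dh(3) subgroup_diff[OF sH] by blast
    ultimately have "T h h0 = 0" using H0 by blast
    then have "h0 \<in> D" using w(2) by (auto simp: D_def T_def)
    then have "zs m w \<in> D" using dh subgroup_add[OF D_sub] by simp
    then show "w \<in> D" using pureD[OF D_pure] m(1) by blast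
  qed
  \<comment> \<open>Each preimage arises from the previous one by \<open>Ind_extend\<close>, and V t
    is everything because H lies in \<open>W0\<close>.\<close>
  define V where "V i = {x. (T M ^^ i) x \<in> W0}" for i
  interpret p: dyn "TYPE('a)" N "\<gamma> ^^ M" L0 \<phi> "\<sigma> ^^ M" by (rule dyn_power)
  have sW0: "is_subgroup W0" by (rule pure_subgroup[OF W0(1)])
  have sV: "is_subgroup (V i)" for i
    unfolding is_subgroup_def V_def
    using subgroup_0[OF sW0] subgroup_diff[OF sW0] additive.zero[OF addTt] additive.diff[OF addTt] by auto
  have \<gamma>V: "(\<gamma> ^^ M) ` V i = V i" for i
  proof -
    have *: "(\<gamma> ^^ M) x \<in> V i \<longleftrightarrow> x \<in> V i" for x
      using \<gamma>n_mem[OF W0(2), of M "(T M ^^ i) x"] \<gamma>Tt[of M i M x] by (simp add: V_def)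
    show ?thesis
    proof (intro Set.set_eqI iffI)
      fix x assume "x \<in> V i"
      obtain y where "x = (\<gamma> ^^ M) y" using bij_funpow[OF \<gamma>_bij] by (meson bij_pointE)
      then show "x \<in> (\<gamma> ^^ M) ` V i" using * \<open>x \<in> V i\<close> by blast
    qed (use * in auto)
  qed
  have DV: "D \<subseteq> V i" for i
  proof
    fix d assume d: "d \<in> D"
    have "(T M ^^ i) d \<in> D"
    proof (induction i)
      case (Suc i)
      then show ?case using \<gamma>n_mem[OF D_\<gamma>, of M] subgroup_diff[OF D_sub] by (simp add: T_def)
    qed (simp add: d)
    then show "d \<in> V i" using W0(3) by (auto simp: V_def)
  qed
  have IV: "Ind (V i)" for i
  proof (induction i)
    case 0
    then show ?case using I0 by (simp add: V_def)
  next
    case (Suc i)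
    have "p.Ind {x. (\<gamma> ^^ M) x - x \<in> V i}"
      using p.Ind_extend[OF sV \<gamma>V] DV Suc D_pow[OF M] Ind_pow[OF M] by simp
    moreover have "{x. (\<gamma> ^^ M) x - x \<in> V i} = V (Suc i)"
      by (simp add: V_def T_def[symmetric] funpow_swap1)
    ultimately show ?case using Ind_pow[OF M] by simp
  qed
  have "V t = UNIV" using W0(4) by (auto simp: V_def H_def)
  then show ?thesis using IV[of t] by simp
qed

end

section \<open>Embedding a prime quotient of the group algebra\<close>

abbreviation "keys \<equiv> Poly_Mapping.keys"
abbreviation "lookup \<equiv> Poly_Mapping.lookup"
abbreviation "single \<equiv> Poly_Mapping.single"

definition rhom :: "('k::comm_ring_1 \<Rightarrow> 'r::comm_ring_1) \<Rightarrow> bool" where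
  "rhom \<epsilon> \<longleftrightarrow> \<epsilon> 1 = 1 \<and> (\<forall>x y. \<epsilon> (x - y) = \<epsilon> x - \<epsilon> y \<and> \<epsilon> (x * y) = \<epsilon> x * \<epsilon> y)"

definition char :: "('b::comm_monoid_add \<Rightarrow> 'r::comm_ring_1) \<Rightarrow> bool" where
  "char \<chi> \<longleftrightarrow> \<chi> 0 = 1 \<and> (\<forall>a b. \<chi> (a + b) = \<chi> a * \<chi> b)"

text \<open>The algebra map on a group algebra given by a coefficient map and a character. With
  \<open>single 0\<close> as coefficient map it also covers the maps induced by homomorphisms of
  groups.\<close>

definition ev :: "('k::comm_ring_1 \<Rightarrow> 'r::comm_ring_1) \<Rightarrow> ('b::comm_monoid_add \<Rightarrow> 'r) \<Rightarrow> ('b \<Rightarrow>\<^sub>0 'k) \<Rightarrow> 'r" where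
  "ev \<epsilon> \<chi> f = (\<Sum>b\<in>keys f. \<epsilon> (lookup f b) * \<chi> b)"

lemma rhom_1: "rhom \<epsilon> \<Longrightarrow> \<epsilon> 1 = 1" and rhom_diff: "rhom \<epsilon> \<Longrightarrow> \<epsilon> (x - y) = \<epsilon> x - \<epsilon> y"
  and rhom_mult: "rhom \<epsilon> \<Longrightarrow> \<epsilon> (x * y) = \<epsilon> x * \<epsilon> y"
  by (auto simp: rhom_def)

lemma rhom_0: "rhom \<epsilon> \<Longrightarrow> \<epsilon> 0 = 0"
  using rhom_diff[of \<epsilon> 0 0] by simp

lemma rhom_minus: "rhom \<epsilon> \<Longrightarrow> \<epsilon> (- x) = - \<epsilon> x"
  using rhom_diff[of \<epsilon> 0 x] rhom_0[of \<epsilon>] by simp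

lemma rhom_add: "rhom \<epsilon> \<Longrightarrow> \<epsilon> (x + y) = \<epsilon> x + \<epsilon> y"
  using rhom_diff[of \<epsilon> x "- y"] rhom_minus[of \<epsilon> y] by simp

lemma rhom_of_nat: "rhom \<epsilon> \<Longrightarrow> \<epsilon> (of_nat n) = of_nat n"
  by (induction n) (auto simp: rhom_0 rhom_add rhom_1)

lemma rhom_nz: fixes \<epsilon> :: "'k::field \<Rightarrow> 'r::comm_ring_1"
  assumes "rhom \<epsilon>" "x \<noteq> 0" shows "\<epsilon> x \<noteq> 0"
  using rhom_mult[OF assms(1), of x "inverse x"] rhom_1[OF assms(1)] assms(2) by auto

lemma char_0: "char \<chi> \<Longrightarrow> \<chi> 0 = 1" and char_add: "char \<chi> \<Longrightarrow> \<chi> (a + b) = \<chi> a * \<chi> b"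
  by (auto simp: char_def)

lemma ev_superset:
  assumes "rhom \<epsilon>" "finite S" "keys f \<subseteq> S"
  shows "ev \<epsilon> \<chi> f = (\<Sum>b\<in>S. \<epsilon> (lookup f b) * \<chi> b)"
  unfolding ev_def using assms by (intro sum.mono_neutral_left) (auto simp: in_keys_iff rhom_0)

lemma ev_0 [simp]: "ev \<epsilon> \<chi> 0 = 0" by (simp add: ev_def)

lemma ev_single: assumes "rhom \<epsilon>" shows "ev \<epsilon> \<chi> (single b c) = \<epsilon> c * \<chi> b"
  using ev_superset[OF assms, of "{b}"] by (simp split: if_splits)

lemma ev_add: assumes "rhom \<epsilon>" shows "ev \<epsilon> \<chi> (f + g) = ev \<epsilon> \<chi> f + ev \<epsilon> \<chi> g"
proof -
  let ?S = "keys f \<union> keys g"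
  have k: "keys (f + g) \<subseteq> ?S" by (auto simp: in_keys_iff lookup_add)
  show ?thesis
    using ev_superset[OF assms _ k, of \<chi>] ev_superset[OF assms, of ?S f \<chi>] ev_superset[OF assms, of ?S g \<chi>]
    by (simp add: lookup_add rhom_add[OF assms] distrib_right sum.distrib)
qed

lemma ev_sum: assumes "rhom \<epsilon>" shows "ev \<epsilon> \<chi> (sum f X) = (\<Sum>x\<in>X. ev \<epsilon> \<chi> (f x))"
  by (induction X rule: infinite_finite_induct) (auto simp: ev_add[OF assms])

lemma ev_minus: assumes "rhom \<epsilon>" shows "ev \<epsilon> \<chi> (- f) = - ev \<epsilon> \<chi> f"
  using ev_add[OF assms, of \<chi> f "- f"] by (simp add: eq_neg_iff_add_eq_0 add.commute)

lemma ev_diff: assumes "rhom \<epsilon>" shows "ev \<epsilon> \<chi> (f - g) = ev \<epsilon> \<chi> f - ev \<epsilon> \<chi> g"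
  using ev_add[OF assms, of \<chi> f "- g"] ev_minus[OF assms, of \<chi> g] by simp

lemma sum_single: "(\<Sum>b\<in>keys f. single b (lookup f b)) = f"
proof (rule poly_mapping_eqI)
  fix k
  have "lookup (\<Sum>b\<in>keys f. single b (lookup f b)) k = (\<Sum>b\<in>keys f. if b = k then lookup f k else 0)"
    by (subst lookup_sum, intro sum.cong) (auto simp: lookup_single when_def)
  then show "lookup (\<Sum>b\<in>keys f. single b (lookup f b)) k = lookup f k"
    by (auto simp: in_keys_iff)
qed

lemma ev_mult: assumes "rhom \<epsilon>" "char \<chi>" shows "ev \<epsilon> \<chi> (f * g) = ev \<epsilon> \<chi> f * ev \<epsilon> \<chi> g"
proof -
  have "f * g = (\<Sum>a\<in>keys f. \<Sum>b\<in>keys g. single (a + b) (lookup f a * lookup g b))"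
    by (subst (1 2) sum_single[symmetric], subst sum_product) (simp add: mult_single)
  then have "ev \<epsilon> \<chi> (f * g) = (\<Sum>a\<in>keys f. \<Sum>b\<in>keys g. (\<epsilon> (lookup f a) * \<chi> a) * (\<epsilon> (lookup g b) * \<chi> b))"
    using assms by (simp add: ev_sum ev_single rhom_mult char_add mult.assoc mult.left_commute)
  then show ?thesis by (simp add: ev_def sum_product)
qed

lemma rhom_ev: assumes "rhom \<epsilon>" "char \<chi>" shows "rhom (ev \<epsilon> \<chi>)"
proof -
  have "ev \<epsilon> \<chi> 1 = 1"
    using ev_single[OF assms(1), of \<chi> 0 1] char_0[OF assms(2)] rhom_1[OF assms(1)] by simp
  then show ?thesis unfolding rhom_def by (simp add: ev_diff[OF assms(1)] ev_mult[OF assms])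
qed

lemma rhom_single: "rhom (single (0::'b::comm_monoid_add))"
  by (simp add: rhom_def mult_single single_diff)

lemma rhom_comp: "rhom \<epsilon> \<Longrightarrow> rhom \<delta> \<Longrightarrow> rhom (\<lambda>x. \<delta> (\<epsilon> x))" by (simp add: rhom_def)

lemma rhom_to_ac_Fract: "rhom (\<lambda>x::'r::idom. to_ac (Fraction_Field.Fract x 1))"
  by (simp add: rhom_def One_fract_def[symmetric] flip: to_ac_diff to_ac_mult)

lemma prime_set_ideal: "is_prime_ideal P \<Longrightarrow> prime_set P"
proof -
  assume P: "is_prime_ideal P"
  have "1 \<notin> P"
  proof
    assume 1: "1 \<in> P"
    have "x \<in> P" for x using P 1 unfolding is_prime_ideal_def is_ideal_def by (metis mult.right_neutral)
    then show False using P unfolding is_prime_ideal_def by blast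
  qed
  then show ?thesis using P unfolding is_prime_ideal_def is_ideal_def prime_set_def by blast
qed

lemma push_forward:
  fixes \<kappa> :: "'b::comm_monoid_add \<Rightarrow> 'a::comm_monoid_add" and p :: "'b \<Rightarrow>\<^sub>0 'k::comm_ring_1"
  assumes "inj_on \<kappa> M" "keys p \<subseteq> M"
  defines "q \<equiv> ev (single 0) (\<lambda>m. single (\<kappa> m) 1) p"
  shows "keys q \<subseteq> \<kappa> ` M" "q = 0 \<Longrightarrow> p = 0"
proof -
  have q: "q = (\<Sum>m\<in>keys p. single (\<kappa> m) (lookup p m))" by (simp add: q_def ev_def mult_single)
  show "keys q \<subseteq> \<kappa> ` M"
  proof
    fix b assume "b \<in> keys q"
    then obtain m where "m \<in> keys p" "b \<in> keys (single (\<kappa> m) (lookup p m))"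
      using keys_sum[of "\<lambda>m. single (\<kappa> m) (lookup p m)" "keys p"] unfolding q by blast
    then show "b \<in> \<kappa> ` M" using assms(2) by (auto split: if_splits)
  qed
  assume 0: "q = 0"
  have "lookup p m = 0" if m: "m \<in> keys p" for m
  proof -
    have "lookup q (\<kappa> m) = (\<Sum>n\<in>keys p. if n = m then lookup p m else 0)"
      unfolding q lookup_sum
      by (rule sum.cong) (use assms m in \<open>auto simp: lookup_single when_def inj_on_def\<close>)
    then show ?thesis using m 0 by simp
  qed
  then show "p = 0" by (intro poly_mapping_eqI) (metis in_keys_iff lookup_zero)
qed

context frg
begin

text \<open>\<open>X\<close> is maximal among independent sets whose group algebra meets
  \<open>P\<close> in zero, so modulo \<open>P\<close> it behaves like a transcendence basis made of
  group elements.\<close>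

lemma transcendence_base:
  fixes P :: "('a \<Rightarrow>\<^sub>0 'k::field) set"
  assumes "is_prime_ideal P"
  obtains X where "zind X" "P \<inter> grp_alg (zspan X) \<subseteq> {0}"
    "\<And>a. (\<And>n. zs n a \<in> zspan X \<Longrightarrow> n = 0) \<Longrightarrow> \<exists>p\<in>P. p \<noteq> 0 \<and> keys p \<subseteq> zspan (insert a X)"
proof -
  define Q where "Q X \<longleftrightarrow> zind X \<and> P \<inter> grp_alg (zspan X) \<subseteq> {0}" for X :: "'a set"
  have P: "prime_set P" using assms by (rule prime_set_ideal)
  have "Q {}" unfolding Q_def
  proof
    show "zind ({} :: 'a set)" by (simp add: zind_def)
    show "P \<inter> grp_alg (zspan {}) \<subseteq> {0}"
    proof
      fix f assume f: "f \<in> P \<inter> grp_alg (zspan {})"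
      then have k: "keys f \<subseteq> {0}" by (auto simp: grp_alg_def zspan_def)
      define c where "c = lookup f 0"
      have e: "f = single 0 c"
        by (rule poly_mapping_eqI) (use k in \<open>auto simp: c_def lookup_single when_def in_keys_iff\<close>)
      have "c = 0"
      proof (rule ccontr)
        assume "c \<noteq> 0"
        then have 1: "single 0 (inverse c) * f = 1" by (simp add: e mult_single)
        have "single 0 (inverse c) * f \<in> P" using P f by (simp add: prime_set_def)
        then show False using P unfolding 1 by (simp add: prime_set_def)
      qed
      then show "f \<in> {0}" using e by simp
    qed
  qed
  moreover have "\<forall>X. Q X \<longrightarrow> card X \<le> N" by (simp add: Q_def bd)
  ultimately have "\<exists>X. Q X \<and> (\<forall>Y. Q Y \<longrightarrow> card Y \<le> card X)"
    by (intro ex_has_greatest_nat[of Q "{}" card "Suc N"]) (auto simp: less_Suc_eq_le)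
  then obtain X where X: "Q X" "\<And>Y. Q Y \<Longrightarrow> card Y \<le> card X" by auto
  show ?thesis
  proof (rule that)
    show "zind X" "P \<inter> grp_alg (zspan X) \<subseteq> {0}" using X by (auto simp: Q_def)
    fix a assume a: "\<And>n. zs n a \<in> zspan X \<Longrightarrow> n = 0"
    have fin: "finite X" using X by (simp add: Q_def zind_def)
    have n: "a \<notin> pcl (zspan X)" using a by (auto simp: pcl_def)
    have s: "X \<subseteq> pcl (zspan X)" using zspan_base fin subset_pcl by blast
    have na: "a \<notin> X" using n s by blast
    have "zind (insert a X)" using zind_insert[OF _ na pure_pcl[OF subgroup_zspan] s n] X(1) by (simp add: Q_def)
    moreover have "\<not> Q (insert a X)" using X(2)[of "insert a X"] na fin by auto
    ultimately show "\<exists>p\<in>P. p \<noteq> 0 \<and> keys p \<subseteq> zspan (insert a X)" unfolding Q_def grp_alg_def by blast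
  qed
qed

text \<open>Finitely supported functions on \<open>nat \<Rightarrow>\<^sub>0 int\<close> are the Laurent polynomials in countably many
  variables; they contain the group algebra of every finitely generated free abelian group, so one
  target field serves all \<open>P\<close>.\<close>
lemma base_phom:
  fixes P :: "('a \<Rightarrow>\<^sub>0 'k::field) set"
  assumes "zind X" and X: "P \<inter> grp_alg (zspan X) \<subseteq> {0}" and P: "prime_set P"
  obtains \<Gamma>0 :: "(('a \<Rightarrow>\<^sub>0 'k) \<times> (((nat \<Rightarrow>\<^sub>0 int) \<Rightarrow>\<^sub>0 'k) fract) alg_closure) set" and \<epsilon>
  where "phom P \<Gamma>0" "rhom \<epsilon>" "\<And>c. (single 0 c, \<epsilon> c) \<in> \<Gamma>0"
    "\<And>b c. b \<in> zspan X \<Longrightarrow> \<exists>\<alpha>. (single b c, \<alpha>) \<in> \<Gamma>0"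
proof -
  have fin: "finite X" using assms by (simp add: zind_def)
  obtain e :: "'a \<Rightarrow> nat" where e: "inj_on e X" using finite_imp_inj_to_nat_seg[OF fin] by blast
  define M where "M = {m :: nat \<Rightarrow>\<^sub>0 int. keys m \<subseteq> e ` X}"
  \<comment> \<open>Laurent monomials in the variables numbered by \<open>e\<close> correspond to
    the elements of the span of \<open>X\<close>.\<close>
  define \<kappa> where "\<kappa> m = (\<Sum>x\<in>X. zs (lookup m (e x)) x)" for m :: "nat \<Rightarrow>\<^sub>0 int"
  have \<kappa>_add: "\<kappa> (m + m') = \<kappa> m + \<kappa> m'" for m m' by (simp add: \<kappa>_def lookup_add zs_add_left sum.distrib)
  have \<kappa>_0: "\<kappa> 0 = 0" by (simp add: \<kappa>_def)
  have M_add: "m + m' \<in> M" if "m \<in> M" "m' \<in> M" for m m' using that keys_add[of m m'] by (auto simp: M_def)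
  have \<kappa>_inj: "inj_on \<kappa> M"
  proof (rule inj_onI)
    fix m m' assume m: "m \<in> M" "m' \<in> M" "\<kappa> m = \<kappa> m'"
    then have "(\<Sum>x\<in>X. zs (lookup m (e x) - lookup m' (e x)) x) = 0"
      by (simp add: \<kappa>_def zs_diff_left sum_subtractf)
    then have x: "lookup m (e x) = lookup m' (e x)" if "x \<in> X" for x
      using zindD[where c="\<lambda>x. lookup m (e x) - lookup m' (e x)", OF assms(1) _ that] by simp
    show "m = m'"
    proof (rule poly_mapping_eqI)
      fix i show "lookup m i = lookup m' i"
      proof (cases "i \<in> e ` X")
        case False
        then have "i \<notin> keys m" "i \<notin> keys m'" using m by (auto simp: M_def)
        then show ?thesis by (simp add: in_keys_iff)
      qed (use x in auto)
    qed
  qed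
  have \<kappa>_surj: "\<exists>m\<in>M. \<kappa> m = b" if b: "b \<in> zspan X" for b
  proof -
    obtain c where c: "b = (\<Sum>x\<in>X. zs (c x) x)" using b unfolding zspan_def by blast
    define m where "m = (\<Sum>x\<in>X. single (e x) (c x))"
    have "keys m \<subseteq> e ` X" unfolding m_def by (rule order_trans[OF keys_sum]) auto
    moreover have "lookup m (e x) = c x" if x: "x \<in> X" for x
    proof -
      have "lookup m (e x) = (\<Sum>y\<in>X. if y = x then c x else 0)" unfolding m_def lookup_sum
        by (rule sum.cong) (use e x in \<open>auto simp: lookup_single when_def inj_on_def\<close>)
      then show ?thesis using x fin by simp
    qed
    then have "\<kappa> m = b" by (simp add: \<kappa>_def c)
    ultimately show ?thesis by (auto simp: M_def)
  qed
  have \<kappa>_span: "\<kappa> m \<in> zspan X" for m unfolding \<kappa>_def zspan_def mem_Collect_eq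
    by (rule exI[of _ "\<lambda>x. lookup m (e x)"]) simp
  define \<iota> where "\<iota> p = to_ac (Fraction_Field.Fract p 1)" for p :: "(nat \<Rightarrow>\<^sub>0 int) \<Rightarrow>\<^sub>0 'k"
  have \<iota>: "rhom \<iota>" unfolding \<iota>_def by (rule rhom_to_ac_Fract)
  have \<iota>_0: "\<iota> p = 0 \<longleftrightarrow> p = 0" for p by (simp add: \<iota>_def Zero_fract_def eq_fract)
  define K where "K = ev (single 0) (\<lambda>m. single (\<kappa> m) (1::'k))"
  have K: "rhom K" unfolding K_def
    by (intro rhom_ev rhom_single) (simp add: char_def \<kappa>_0 \<kappa>_add mult_single)
  have K_single: "K (single m c) = single (\<kappa> m) c" for m c
    by (simp add: K_def ev_single[OF rhom_single] mult_single)
  define R where "R = {p :: (nat \<Rightarrow>\<^sub>0 int) \<Rightarrow>\<^sub>0 'k. keys p \<subseteq> M}"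
  have R1: "1 \<in> R" by (auto simp: R_def M_def)
  have Rd: "p - q \<in> R" if "p \<in> R" "q \<in> R" for p q
    using that keys_diff[of p q] unfolding R_def by blast
  have Rm: "p * q \<in> R" if "p \<in> R" "q \<in> R" for p q
    using that keys_mult[of p q] M_add unfolding R_def by blast
  \<comment> \<open>The graph of the inverse of \<open>K\<close> followed by \<iota>:
    \<open>K\<close> is injective on \<open>R\<close>, and its image there meets \<open>P\<close>
    only in zero.\<close>
  define \<Gamma>0 where "\<Gamma>0 = (\<lambda>p. (K p, \<iota> p)) ` R"
  have Kkeys: "keys (K p) \<subseteq> zspan X" and K0: "K p = 0 \<Longrightarrow> p = 0" if "p \<in> R" for p
    using push_forward[OF \<kappa>_inj, of p] that \<kappa>_span unfolding K_def R_def by auto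
  have P0: "0 \<in> P" using P by (simp add: prime_set_def)
  show ?thesis
  proof (rule that)
    show "phom P \<Gamma>0" unfolding phom_def
    proof (intro conjI allI impI)
      show "(1, 1) \<in> \<Gamma>0" unfolding \<Gamma>0_def using R1 rhom_1[OF K] rhom_1[OF \<iota>] by force
    next
      fix x a y b assume "(x, a) \<in> \<Gamma>0" "(y, b) \<in> \<Gamma>0"
      then obtain p q where pq: "p \<in> R" "q \<in> R" "x = K p" "a = \<iota> p" "y = K q" "b = \<iota> q"
        unfolding \<Gamma>0_def by blast
      show "(x - y, a - b) \<in> \<Gamma>0"
        using Rd[OF pq(1,2)] unfolding \<Gamma>0_def pq(3-) rhom_diff[OF K, symmetric] rhom_diff[OF \<iota>, symmetric] by blast
      show "(x * y, a * b) \<in> \<Gamma>0"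
        using Rm[OF pq(1,2)] unfolding \<Gamma>0_def pq(3-) rhom_mult[OF K, symmetric] rhom_mult[OF \<iota>, symmetric] by blast
    next
      fix x a assume "(x, a) \<in> \<Gamma>0"
      then obtain p where p: "p \<in> R" "x = K p" "a = \<iota> p" unfolding \<Gamma>0_def by blast
      have "x \<in> P \<longleftrightarrow> x = 0" using Kkeys[OF p(1)] X P0 p(2) unfolding grp_alg_def by blast
      also have "\<dots> \<longleftrightarrow> p = 0" using K0[OF p(1)] p(2) rhom_0[OF K] by auto
      finally show "x \<in> P \<longleftrightarrow> a = 0" using \<iota>_0 p(3) by simp
    qed
    show "rhom (\<lambda>c. \<iota> (single 0 c))" using rhom_comp[OF rhom_single \<iota>] .
    show "(single 0 c, \<iota> (single 0 c)) \<in> \<Gamma>0" for c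
    proof -
      have "single 0 c \<in> R" by (auto simp: R_def M_def)
      then show ?thesis unfolding \<Gamma>0_def using K_single[of 0 c] \<kappa>_0 by force
    qed
    show "\<exists>\<alpha>. (single b c, \<alpha>) \<in> \<Gamma>0" if b: "b \<in> zspan X" for b c
    proof -
      obtain m where m: "m \<in> M" "\<kappa> m = b" using \<kappa>_surj[OF b] by blast
      have "single m c \<in> R" using m by (auto simp: R_def)
      then show ?thesis unfolding \<Gamma>0_def using K_single[of m c] m by force
    qed
  qed
qed

end

lemma single_power: "single a (1::'k::comm_ring_1) ^ n = single (zs (int n) a) 1"
  by (induction n) (simp_all add: mult_single zs_add_left)

lemma zspan_insertE:
  assumes "finite X" "a \<notin> X" "b \<in> zspan (insert a X)"
  obtains n s where "b = zs n a + s" "s \<in> zspan X"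
proof -
  obtain c where c: "b = (\<Sum>x\<in>insert a X. zs (c x) x)" using assms(3) unfolding zspan_def by blast
  have "(\<Sum>x\<in>X. zs (c x) x) \<in> zspan X" unfolding zspan_def by auto
  then show ?thesis using that c assms(1,2) by auto
qed

text \<open>Every group element is algebraic over the base, as a root of an element of the span or
  through a relation in \<open>P\<close>, so a maximal partial homomorphism is defined on it. By
  linearity its graph contains each f together with \<open>ev \<epsilon> \<phi> f\<close>, and the
  kernel condition gives the equivalence.\<close>

lemma (in frg) prime_quotient_embedding:
  fixes P :: "('a \<Rightarrow>\<^sub>0 'k::field) set"
  assumes "is_prime_ideal P"
  obtains \<epsilon> and \<phi> :: "'a \<Rightarrow> (((nat \<Rightarrow>\<^sub>0 int) \<Rightarrow>\<^sub>0 'k) fract) alg_closure"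
  where "rhom \<epsilon>" "char \<phi>" "\<And>f. f \<in> P \<longleftrightarrow> ev \<epsilon> \<phi> f = 0"
proof -
  have P: "prime_set P" using assms by (rule prime_set_ideal)
  obtain X where X: "zind X" "P \<inter> grp_alg (zspan X) \<subseteq> {0}"
    and alg: "\<And>a. (\<And>n. zs n a \<in> zspan X \<Longrightarrow> n = 0) \<Longrightarrow> \<exists>p\<in>P. p \<noteq> 0 \<and> keys p \<subseteq> zspan (insert a X)"
    using transcendence_base[OF assms] by metis
  obtain \<Gamma>0 :: "(('a \<Rightarrow>\<^sub>0 'k) \<times> (((nat \<Rightarrow>\<^sub>0 int) \<Rightarrow>\<^sub>0 'k) fract) alg_closure) set" and \<epsilon>
    where \<Gamma>0: "phom P \<Gamma>0" and \<epsilon>: "rhom \<epsilon>" "\<And>c. (single 0 c, \<epsilon> c) \<in> \<Gamma>0"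
    and ex: "\<And>b c. b \<in> zspan X \<Longrightarrow> \<exists>\<alpha>. (single b c, \<alpha>) \<in> \<Gamma>0"
    using base_phom[OF X P] by metis
  have "\<exists>\<Gamma>. phom P \<Gamma> \<and> \<Gamma>0 \<subseteq> \<Gamma> \<and>
      (\<forall>y f g. ppair \<Gamma> f g \<longrightarrow> g \<noteq> 0 \<longrightarrow> poly f y \<in> P \<longrightarrow> (\<exists>\<alpha>. (y, \<alpha>) \<in> \<Gamma>))"
    by (rule maximal_phom[OF P \<Gamma>0]) blast
  then obtain \<Gamma> where \<Gamma>: "phom P \<Gamma>" "\<Gamma>0 \<subseteq> \<Gamma>"
    and mx: "\<And>y f g. ppair \<Gamma> f g \<Longrightarrow> g \<noteq> 0 \<Longrightarrow> poly f y \<in> P \<Longrightarrow> \<exists>\<alpha>. (y, \<alpha>) \<in> \<Gamma>"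
    by auto
  interpret part_hom P \<Gamma> using P \<Gamma> by unfold_locales
  have fin: "finite X" using X by (simp add: zind_def)
  have "\<exists>\<alpha>. (single a 1, \<alpha>) \<in> \<Gamma>" for a
  proof (cases "\<exists>n. n \<noteq> 0 \<and> zs n a \<in> zspan X")
    case True
    then obtain n where n: "n \<noteq> 0" "zs n a \<in> zspan X" by blast
    have "zs \<bar>n\<bar> a \<in> zspan X"
      using n subgroup_uminus[OF subgroup_zspan, of "zs n a" X] by (simp add: abs_if zs_minus_left)
    then obtain m where m: "m > 0" "zs (int m) a \<in> zspan X"
      using n by (metis nat_0_iff not_gr_zero int_nat_eq abs_ge_zero zero_less_abs_iff not_less)
    obtain \<alpha> where \<alpha>: "(single (zs (int m) a) 1, \<alpha>) \<in> \<Gamma>" using ex[OF m(2), of 1] \<Gamma>(2) by blast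
    define f g where "f = monom 1 m - [:single (zs (int m) a) (1::'k):]" and "g = monom 1 m - [:\<alpha>:]"
    have "ppair \<Gamma> f g" unfolding f_def g_def
      by (intro pp_diff pp_monom g1) (auto simp: ppair_def coeff_pCons \<alpha> g0 split: nat.splits)
    moreover have "coeff g m = 1" using m by (simp add: g_def coeff_pCons split: nat.splits)
    then have "g \<noteq> 0" by auto
    moreover have "poly f (single a 1) = 0" by (simp add: f_def poly_monom single_power)
    then have "poly f (single a 1) \<in> P" using P_0 by simp
    ultimately show ?thesis by (rule mx)
  next
    case False
    then obtain p where p: "p \<in> P" "p \<noteq> 0" "keys p \<subseteq> zspan (insert a X)" using alg[of a] by blast
    have na: "a \<notin> X" using False zspan_base[OF fin, of a] by (metis zs_1 one_neq_zero)
    have "\<exists>n s. b = zs n a + s \<and> s \<in> zspan X" if "b \<in> keys p" for b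
    proof -
      have "b \<in> zspan (insert a X)" using p(3) that by blast
      then show ?thesis by (rule zspan_insertE[OF fin na]) blast
    qed
    then obtain n s where ns: "\<And>b. b \<in> keys p \<Longrightarrow> b = zs (n b) a + s b \<and> s b \<in> zspan X" by metis
    have "\<exists>\<alpha>. (single (s b) (lookup p b), \<alpha>) \<in> \<Gamma>0" if "b \<in> keys p" for b using ex ns[OF that] by blast
    then obtain \<alpha> where \<alpha>: "\<And>b. b \<in> keys p \<Longrightarrow> (single (s b) (lookup p b), \<alpha> b) \<in> \<Gamma>0" by metis
    \<comment> \<open>Translating the relation by a large multiple of \<open>a\<close> turns Laurent
      exponents into natural ones.\<close>
    define M where "M = (\<Sum>b\<in>keys p. \<bar>n b\<bar>)"
    define k where "k b = nat (n b + M)" for b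
    have k: "int (k b) = n b + M" if "b \<in> keys p" for b
    proof -
      have "\<bar>n b\<bar> \<le> M" unfolding M_def using that by (intro member_le_sum) auto
      then show ?thesis by (simp add: k_def)
    qed
    define f g where "f = (\<Sum>b\<in>keys p. monom (single (s b) (lookup p b)) (k b))"
      and "g = (\<Sum>b\<in>keys p. monom (\<alpha> b) (k b))"
    have fi: "coeff f i = (\<Sum>b\<in>keys p. if k b = i then single (s b) (lookup p b) else 0)" for i
      by (simp add: f_def coeff_sum)
    have fg: "ppair \<Gamma> f g" unfolding ppair_def f_def g_def coeff_sum coeff_monom
      using g0 subsetD[OF \<Gamma>(2) \<alpha>] by (auto intro!: gsum)
    have "single (s b) (lookup p b) * single a 1 ^ k b = single (zs M a) 1 * single b (lookup p b)" if b: "b \<in> keys p" for b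
    proof -
      have "s b + zs (n b + M) a = zs M a + b" using ns[OF b] by (simp add: zs_add_left algebra_simps)
      then show ?thesis by (simp add: single_power mult_single k[OF b])
    qed
    then have "poly f (single a 1) = single (zs M a) 1 * (\<Sum>b\<in>keys p. single b (lookup p b))"
      by (simp add: f_def poly_sum poly_monom sum_distrib_left)
    then have pf: "poly f (single a 1) = single (zs M a) 1 * p" by (simp add: sum_single)
    \<comment> \<open>If the image polynomial vanished, the coefficients of \<open>f\<close> would
      lie in \<open>P\<close> and in the group algebra of the span of \<open>X\<close>, hence be
      zero, and then so would \<open>p\<close>.\<close>
    have "g \<noteq> 0"
    proof
      assume g: "g = 0"
      have "coeff f i = 0" for i
      proof -
        have "(coeff f i, 0) \<in> \<Gamma>" using fg g by (auto simp: ppair_def)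
        then have 1: "coeff f i \<in> P" using gker by simp
        have "keys (coeff f i) \<subseteq> zspan X" unfolding fi
          by (rule order_trans[OF keys_sum]) (use ns in \<open>auto split: if_splits\<close>)
        then show ?thesis using 1 X(2) by (auto simp: grp_alg_def)
      qed
      then have "f = 0" by (intro poly_eqI) simp
      then have "single (zs M a) 1 * p = 0" using pf by simp
      then have "single (- zs M a) 1 * (single (zs M a) 1 * p) = 0" by simp
      then show False using p(2) by (simp add: mult.assoc[symmetric] mult_single)
    qed
    with fg show ?thesis by (rule mx) (simp add: pf P_mult p(1))
  qed
  then obtain \<phi> where \<phi>: "\<And>a. (single a 1, \<phi> a) \<in> \<Gamma>" by metis
  have 1: "char \<phi>" unfolding char_def
  proof (intro conjI allI)
    show "\<phi> 0 = 1" using gfun[OF \<phi>[of 0]] g1 by simp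
    show "\<phi> (a + b) = \<phi> a * \<phi> b" for a b
      using gfun[OF \<phi>[of "a + b"]] gmult[OF \<phi>[of a] \<phi>[of b]] by (simp add: mult_single)
  qed
  have 2: "(f, ev \<epsilon> \<phi> f) \<in> \<Gamma>" for f
  proof -
    have "(single 0 (lookup f b) * single b 1, \<epsilon> (lookup f b) * \<phi> b) \<in> \<Gamma>" for b
      using \<epsilon>(2) \<Gamma>(2) by (intro gmult \<phi>) blast
    then have "(\<Sum>b\<in>keys f. single b (lookup f b), ev \<epsilon> \<phi> f) \<in> \<Gamma>" unfolding ev_def
      by (intro gsum) (simp add: mult_single)
    then show ?thesis by (simp add: sum_single)
  qed
  show ?thesis using that[OF \<epsilon>(1) 1] gker[OF 2] by blast
qed

section \<open>Lifting an automorphism of the group to a field\<close>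

inductive_set fieldgen :: "'l::field set \<Rightarrow> 'l set" for S where
  base: "x \<in> S \<Longrightarrow> x \<in> fieldgen S"
| one: "1 \<in> fieldgen S"
| diff: "x \<in> fieldgen S \<Longrightarrow> y \<in> fieldgen S \<Longrightarrow> x - y \<in> fieldgen S"
| mult: "x \<in> fieldgen S \<Longrightarrow> y \<in> fieldgen S \<Longrightarrow> x * y \<in> fieldgen S"
| inv: "x \<in> fieldgen S \<Longrightarrow> inverse x \<in> fieldgen S"

text \<open>The assignment of \<psi> c to \<phi> c, for c in \<open>C\<close>, extends to a maximal
  partial homomorphism. The image of \<phi> a is only known to be a root of some value of \<psi>, so
  \<open>L0\<close> is generated by the coefficients and all roots of values of \<phi>; with
  \<open>range \<psi> \<subseteq> range \<phi>\<close> it is mapped into itself.\<close>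

lemma char_lift:
  fixes \<phi> \<psi> :: "'a::ab_group_add \<Rightarrow> 'l::alg_closed_field" and \<epsilon> :: "'k::field \<Rightarrow> 'l"
  assumes \<epsilon>: "rhom \<epsilon>" and \<phi>: "char \<phi>" and \<psi>: "char \<psi>" and rg: "range \<psi> \<subseteq> range \<phi>"
    and C: "is_subgroup C" "\<And>a. \<exists>n>0. zs (int n) a \<in> C"
    and eq: "\<And>f. keys f \<subseteq> C \<Longrightarrow> ev \<epsilon> \<phi> f = 0 \<longleftrightarrow> ev \<epsilon> \<psi> f = 0"
  obtains L0 \<sigma> where "subf L0" "range \<phi> \<subseteq> L0" "\<And>x m. x ^ m = 1 \<Longrightarrow> m > 0 \<Longrightarrow> x \<in> L0"
    "\<And>c. \<epsilon> c \<in> L0 \<and> \<sigma> (\<epsilon> c) = \<epsilon> c"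
    "\<And>x. x \<in> L0 \<Longrightarrow> \<sigma> x \<in> L0" "\<sigma> 1 = 1"
    "\<And>x y. x \<in> L0 \<Longrightarrow> y \<in> L0 \<Longrightarrow> \<sigma> (x - y) = \<sigma> x - \<sigma> y"
    "\<And>x y. x \<in> L0 \<Longrightarrow> y \<in> L0 \<Longrightarrow> \<sigma> (x * y) = \<sigma> x * \<sigma> y"
    "\<And>a. \<exists>m>0. \<sigma> (\<phi> a) ^ m = \<psi> a ^ m"
proof -
  define \<Gamma>0 where "\<Gamma>0 = (\<lambda>f. (ev \<epsilon> \<phi> f, ev \<epsilon> \<psi> f)) ` {f. keys f \<subseteq> C}"
  have 0: "prime_set {0::'l}" by (auto simp: prime_set_def)
  have p0: "phom {0} \<Gamma>0" unfolding phom_def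
  proof (intro conjI allI impI)
    have "keys (1 :: 'a \<Rightarrow>\<^sub>0 'k) \<subseteq> C" using C by (auto simp: subgroup_0)
    then show "(1, 1) \<in> \<Gamma>0" unfolding \<Gamma>0_def
      using rhom_1[OF rhom_ev[OF \<epsilon> \<phi>]] rhom_1[OF rhom_ev[OF \<epsilon> \<psi>]] by force
  next
    fix x a y b assume "(x, a) \<in> \<Gamma>0" "(y, b) \<in> \<Gamma>0"
    then obtain p q where pq: "keys p \<subseteq> C" "keys q \<subseteq> C"
      and e: "x = ev \<epsilon> \<phi> p" "a = ev \<epsilon> \<psi> p" "y = ev \<epsilon> \<phi> q" "b = ev \<epsilon> \<psi> q"
      unfolding \<Gamma>0_def by blast
    have "keys (p - q) \<subseteq> C" using pq keys_diff[of p q] by blast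
    then show "(x - y, a - b) \<in> \<Gamma>0"
      unfolding \<Gamma>0_def e ev_diff[OF \<epsilon>, symmetric] by blast
    have "keys (p * q) \<subseteq> C" using pq keys_mult[of p q] subgroup_add[OF C(1)] by blast
    then show "(x * y, a * b) \<in> \<Gamma>0"
      unfolding \<Gamma>0_def e ev_mult[OF \<epsilon> \<phi>, symmetric] ev_mult[OF \<epsilon> \<psi>, symmetric] by blast
  next
    fix x a assume "(x, a) \<in> \<Gamma>0"
    then show "x \<in> {0} \<longleftrightarrow> a = 0" unfolding \<Gamma>0_def using eq by auto
  qed
  have "\<exists>\<Gamma>. phom {0} \<Gamma> \<and> \<Gamma>0 \<subseteq> \<Gamma> \<and>
      (\<forall>y f g. ppair \<Gamma> f g \<longrightarrow> g \<noteq> 0 \<longrightarrow> poly f y \<in> {0} \<longrightarrow> (\<exists>\<alpha>. (y, \<alpha>) \<in> \<Gamma>))"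
    by (rule maximal_phom[OF 0 p0]) blast
  then obtain \<Gamma> where \<Gamma>: "phom {0} \<Gamma>" "\<Gamma>0 \<subseteq> \<Gamma>"
    and mx: "\<And>y f g. ppair \<Gamma> f g \<Longrightarrow> g \<noteq> 0 \<Longrightarrow> poly f y \<in> {0} \<Longrightarrow> \<exists>\<alpha>. (y, \<alpha>) \<in> \<Gamma>"
    by auto
  interpret part_hom "{0}" \<Gamma> using 0 \<Gamma> by unfold_locales
  define V where "V = {x. \<exists>m>0. \<exists>a. x ^ m = \<phi> a}"
  define L0 where "L0 = fieldgen (range \<epsilon> \<union> V)"
  define \<sigma> where "\<sigma> x = (THE \<alpha>. (x, \<alpha>) \<in> \<Gamma>)" for x
  have \<sigma>: "\<sigma> x = \<alpha>" if "(x, \<alpha>) \<in> \<Gamma>" for x \<alpha>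
    unfolding \<sigma>_def using that gfun by blast
  have zs_pow: "\<chi> (zs (int n) a) = \<chi> a ^ n" if "char \<chi>" for \<chi> :: "'a \<Rightarrow> 'l" and a n
    by (induction n) (use that in \<open>auto simp: char_def zs_add_left\<close>)
  have gC: "(\<phi> c, \<psi> c) \<in> \<Gamma>" if "c \<in> C" for c
  proof -
    have "(ev \<epsilon> \<phi> (single c 1), ev \<epsilon> \<psi> (single c 1)) \<in> \<Gamma>0" unfolding \<Gamma>0_def using that by auto
    then show ?thesis using \<Gamma>(2) by (auto simp: ev_single[OF \<epsilon>] rhom_1[OF \<epsilon>])
  qed
  have g\<epsilon>: "(\<epsilon> c, \<epsilon> c) \<in> \<Gamma>" for c
  proof -
    have "(ev \<epsilon> \<phi> (single 0 c), ev \<epsilon> \<psi> (single 0 c)) \<in> \<Gamma>0" unfolding \<Gamma>0_def using C by (auto simp: subgroup_0)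
    then show ?thesis using \<Gamma>(2) by (auto simp: ev_single[OF \<epsilon>] char_0[OF \<phi>] char_0[OF \<psi>])
  qed
  have gV: "\<exists>\<alpha>. (x, \<alpha>) \<in> \<Gamma> \<and> \<alpha> \<in> V" if x: "x \<in> V" for x
  proof -
    obtain m a where m: "m > 0" "x ^ m = \<phi> a" using x by (auto simp: V_def)
    obtain n where n: "n > 0" "zs (int n) a \<in> C" using C(2) by blast
    have xn: "x ^ (m * n) = \<phi> (zs (int n) a)" using m by (simp add: power_mult zs_pow[OF \<phi>])
    define f g where "f = monom 1 (m * n) - [:\<phi> (zs (int n) a):]" and "g = monom 1 (m * n) - [:\<psi> (zs (int n) a):]"
    have "ppair \<Gamma> f g" unfolding f_def g_def
      by (intro pp_diff pp_monom g1) (auto simp: ppair_def coeff_pCons gC[OF n(2)] g0 split: nat.splits)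
    moreover have "coeff g (m * n) = 1" using m n by (simp add: g_def coeff_pCons split: nat.splits)
    then have "g \<noteq> 0" by auto
    moreover have "poly f x \<in> {0}" by (simp add: f_def poly_monom xn)
    ultimately obtain \<alpha> where \<alpha>: "(x, \<alpha>) \<in> \<Gamma>" using mx by blast
    have "\<alpha> ^ (m * n) = \<psi> (zs (int n) a)" using gfun[OF gpow[OF \<alpha>, of "m * n"]] gC[OF n(2)] xn by simp
    moreover obtain b where "\<psi> (zs (int n) a) = \<phi> b" using rg by blast
    ultimately show ?thesis using \<alpha> m n unfolding V_def mem_Collect_eq
      by (metis nat_0_less_mult_iff)
  qed
  have L: "(x, \<sigma> x) \<in> \<Gamma> \<and> \<sigma> x \<in> L0" if "x \<in> L0" for x
  proof -
    have "\<exists>\<alpha>. (x, \<alpha>) \<in> \<Gamma> \<and> \<alpha> \<in> L0" using that unfolding L0_def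
    proof induction
      case (base x)
      then show ?case using g\<epsilon> gV by (metis UnE UnI1 UnI2 fieldgen.base rangeE rangeI)
    next
      case one
      then show ?case using g1 fieldgen.one by blast
    next
      case (diff x y)
      then show ?case using gdiff fieldgen.diff by blast
    next
      case (mult x y)
      then show ?case using gmult fieldgen.mult by blast
    next
      case (inv x)
      then obtain \<beta> where \<beta>: "(x, \<beta>) \<in> \<Gamma>" "\<beta> \<in> fieldgen (range \<epsilon> \<union> V)" by blast
      show ?case
      proof (cases "x = 0")
        case True
        then show ?thesis using \<beta> by auto
      next
        case False
        \<comment> \<open>The domain of \<Gamma> is a priori only a ring; the inverse enters it as
          the root of a linear polynomial.\<close>
        have pp: "ppair \<Gamma> [:-1, x:] [:-1, \<beta>:]"
          using gminus[OF g1] \<beta> g0 by (auto simp: ppair_def coeff_pCons split: nat.splits)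
        have nz: "[:-1, \<beta>:] \<noteq> 0" by simp
        have "poly [:-1, x:] (inverse x) \<in> {0}" using False by simp
        then obtain \<alpha> where \<alpha>: "(inverse x, \<alpha>) \<in> \<Gamma>" using mx[OF pp nz] by blast
        have "\<beta> * \<alpha> = 1" using gfun[OF gmult[OF \<beta>(1) \<alpha>]] g1 False by simp
        then have "\<alpha> = inverse \<beta>" by (metis inverse_unique)
        then show ?thesis using \<alpha> \<beta> fieldgen.inv by blast
      qed
    qed
    then show ?thesis using \<sigma> by blast
  qed
  have V: "x \<in> V \<Longrightarrow> x \<in> L0" for x unfolding L0_def by (simp add: fieldgen.base)
  have V\<phi>: "\<phi> a \<in> V" for a unfolding V_def mem_Collect_eq by (rule exI[of _ 1]) auto
  show ?thesis
  proof (rule that[of L0 \<sigma>])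
    show "subf L0" unfolding subf_def subr_def L0_def
      using fieldgen.intros by auto
    show "range \<phi> \<subseteq> L0" using V V\<phi> by blast
    show "x \<in> L0" if "x ^ m = 1" "m > 0" for x m
    proof (rule V)
      have "x ^ m = \<phi> 0" using that by (simp add: char_0[OF \<phi>])
      then show "x \<in> V" unfolding V_def using that(2) by blast
    qed
    show "\<epsilon> c \<in> L0 \<and> \<sigma> (\<epsilon> c) = \<epsilon> c" for c
      using \<sigma>[OF g\<epsilon>] by (auto simp: L0_def intro: fieldgen.base)
    show "\<sigma> x \<in> L0" if "x \<in> L0" for x using L[OF that] by simp
    show "\<sigma> 1 = 1" using \<sigma>[OF g1] .
    show "\<sigma> (x - y) = \<sigma> x - \<sigma> y" if "x \<in> L0" "y \<in> L0" for x y
      using \<sigma>[OF gdiff] L that by blast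
    show "\<sigma> (x * y) = \<sigma> x * \<sigma> y" if "x \<in> L0" "y \<in> L0" for x y
      using \<sigma>[OF gmult] L that by blast
    show "\<exists>m>0. \<sigma> (\<phi> a) ^ m = \<psi> a ^ m" for a
    proof -
      obtain n where n: "n > 0" "zs (int n) a \<in> C" using C(2) by blast
      have "(\<phi> a, \<sigma> (\<phi> a)) \<in> \<Gamma>" using L[OF V[OF V\<phi>]] by blast
      from gpow[OF this, of n] have "(\<phi> (zs (int n) a), \<sigma> (\<phi> a) ^ n) \<in> \<Gamma>" by (simp add: zs_pow[OF \<phi>])
      then have "\<sigma> (\<phi> a) ^ n = \<psi> (zs (int n) a)" using gfun gC[OF n(2)] by blast
      then show ?thesis using n by (auto simp: zs_pow[OF \<psi>])
    qed
  qed
qed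

section \<open>Control by periodic elements\<close>

definition periodic :: "('a \<Rightarrow> 'a) \<Rightarrow> 'a set" where
  "periodic \<gamma> = {a. \<exists>i>0. (\<gamma> ^^ i) a = a}"

text \<open>The projection of the group algebra onto functions supported in \<open>S\<close>.
  Control by a subgroup is derived from stability of \<open>P\<close> under the projections onto its
  cosets.\<close>

definition restr :: "'a set \<Rightarrow> ('a \<Rightarrow>\<^sub>0 'k::comm_monoid_add) \<Rightarrow> ('a \<Rightarrow>\<^sub>0 'k)" where
  "restr S f = (\<Sum>b\<in>keys f \<inter> S. single b (lookup f b))"

lemma lookup_restr: "lookup (restr S f) b = (if b \<in> S then lookup f b else 0)"
proof -
  have "lookup (restr S f) b = (\<Sum>x\<in>keys f \<inter> S. if x = b then lookup f b else 0)"
    unfolding restr_def lookup_sum by (rule sum.cong) (auto simp: lookup_single when_def)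
  then show ?thesis by (auto simp: in_keys_iff)
qed

lemma keys_restr: "keys (restr S f) = keys f \<inter> S"
  by (auto simp: in_keys_iff lookup_restr split: if_splits)

lemma restr_restr: "restr S (restr T f) = restr (S \<inter> T) f"
  by (rule poly_mapping_eqI) (auto simp: lookup_restr)

lemma restr_cong: "keys f \<inter> S = keys f \<inter> T \<Longrightarrow> restr S f = restr T f"
  by (simp add: restr_def)

lemma char_nz: "char \<phi> \<Longrightarrow> \<phi> a \<noteq> (0::'l::field)" for a :: "'a::ab_group_add"
  using char_add[of \<phi> a "- a"] char_0[of \<phi>] by auto

context dyn
begin

text \<open>Grouping by cosets of \<open>D\<close> leaves one coefficient in \<open>F0\<close> at a
  representative of each coset, and \<open>Ind_UNIV\<close> kills all of them.\<close>

lemma coset_sum_zero: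
  assumes c: "\<And>b. b \<in> K \<Longrightarrow> c b \<in> F0" and K: "finite K" and z: "(\<Sum>b\<in>K. c b * \<phi> b) = 0"
  shows "(\<Sum>b\<in>{b\<in>K. b - a \<in> D}. c b * \<phi> b) = 0"
proof -
  define rep where "rep b = (SOME d. d - b \<in> D)" for b
  have rep: "rep b - b \<in> D" for b unfolding rep_def by (rule someI[of _ b]) (simp add: subgroup_0[OF D_sub])
  have rep_eq: "rep b = rep d \<longleftrightarrow> b - d \<in> D" for b d
  proof
    assume "rep b = rep d"
    then show "b - d \<in> D" using subgroup_diff[OF D_sub rep[of d] rep[of b]] by simp
  next
    assume bd: "b - d \<in> D"
    have "x - b \<in> D \<longleftrightarrow> x - d \<in> D" for x
      using subgroup_add[OF D_sub _ bd, of "x - b"] subgroup_diff[OF D_sub _ bd, of "x - d"] by auto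
    then show "rep b = rep d" by (simp add: rep_def)
  qed
  define e where "e s = (\<Sum>b\<in>{b\<in>K. rep b = s}. c b * \<phi> (b - s))" for s
  have F: "subr F0" using F0_subf by (simp add: subf_def)
  have "e s * \<phi> s = (\<Sum>b\<in>{b\<in>K. rep b = s}. c b * \<phi> b)" for s
    unfolding e_def sum_distrib_right
    by (rule sum.cong) (simp_all add: mult.assoc \<phi>_add[symmetric])
  note e\<phi> = this
  have "e s = 0" if s: "s \<in> rep ` K" for s
  proof (rule IndD[OF Ind_UNIV])
    show "finite (rep ` K)" using K by simp
    show "distD (rep ` K)" unfolding distD_def
    proof (intro ballI impI)
      fix u v assume uv: "u \<in> rep ` K" "v \<in> rep ` K" "u - v \<in> D"
      then obtain b d where bd: "u = rep b" "v = rep d" by blast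
      have "b - d \<in> D" using subgroup_diff[OF D_sub subgroup_add[OF D_sub uv(3) rep[of d]] rep[of b]] bd by simp
      then show "u = v" using rep_eq bd by simp
    qed
    show "e s \<in> F0" if "s \<in> rep ` K" for s unfolding e_def
    proof (rule subr_sum[OF F])
      fix b assume b: "b \<in> {b \<in> K. rep b = s}"
      then have "b - s \<in> D" using subgroup_uminus[OF D_sub rep[of b]] by simp
      then show "c b * \<phi> (b - s) \<in> F0" using b c D_iff subr_mult[OF F] by simp
    qed
    show "(\<Sum>s\<in>rep ` K. e s * \<phi> s) = 0" unfolding e\<phi>
      using sum.group[of K "rep ` K" rep "\<lambda>b. c b * \<phi> b"] K z by simp
  qed (use s in auto)
  then have "(\<Sum>b\<in>{b\<in>K. rep b = s}. c b * \<phi> b) = 0" if "s \<in> rep ` K" for s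
    using e\<phi>[of s] that by simp
  moreover have "{b\<in>K. rep b = s} = {}" if "s \<notin> rep ` K" for s using that by auto
  ultimately have "(\<Sum>b\<in>{b\<in>K. rep b = rep a}. c b * \<phi> b) = 0" by (metis sum.empty)
  then show ?thesis by (simp add: rep_eq)
qed

end

text \<open>Evaluation at \<phi> turns an element of \<open>P\<close> into a relation whose
  coefficients are fixed by \<sigma>, hence lie in \<open>F0\<close>. Faithfulness becomes
  injectivity of \<phi>, and the agreement on \<open>C\<close> is the kernel condition of
  \<open>char_lift\<close> for \<phi> composed with \<gamma>.\<close>

lemma (in frg) control_by_periodic:
  fixes P :: "('a \<Rightarrow>\<^sub>0 'k::field_char_0) set"
  assumes P: "is_prime_ideal P" "faithful P" and \<gamma>: "additive \<gamma>" "bij \<gamma>"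
    and C: "is_subgroup C" "\<And>a. \<exists>n>0. zs (int n) a \<in> C"
    and eq: "\<And>f. keys f \<subseteq> C \<Longrightarrow> f \<in> P \<longleftrightarrow> ev (single 0) (\<lambda>b. single (\<gamma> b) 1) f \<in> P"
    and f: "f \<in> P"
  shows "restr {b. b - a \<in> periodic \<gamma>} f \<in> P"
proof -
  obtain \<epsilon> and \<phi> :: "'a \<Rightarrow> (((nat \<Rightarrow>\<^sub>0 int) \<Rightarrow>\<^sub>0 'k) fract) alg_closure"
    where \<epsilon>: "rhom \<epsilon>" and \<phi>: "char \<phi>" and ker: "\<And>f. f \<in> P \<longleftrightarrow> ev \<epsilon> \<phi> f = 0"
    using prime_quotient_embedding[OF P(1)] by metis
  define \<psi> where "\<psi> a = \<phi> (\<gamma> a)" for a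
  have \<psi>: "char \<psi>" using \<phi> additive.zero[OF \<gamma>(1)] additive.add[OF \<gamma>(1)] by (simp add: char_def \<psi>_def)
  have push: "ev \<epsilon> \<phi> (ev (single 0) (\<lambda>b. single (\<gamma> b) 1) f) = ev \<epsilon> \<psi> f" for f
    unfolding ev_def[of "single 0"] ev_sum[OF \<epsilon>] ev_def[of \<epsilon> \<psi>]
    by (simp add: mult_single ev_single[OF \<epsilon>] \<psi>_def)
  have rg: "range \<psi> \<subseteq> range \<phi>" by (auto simp: \<psi>_def)
  have eq': "ev \<epsilon> \<phi> f = 0 \<longleftrightarrow> ev \<epsilon> \<psi> f = 0" if "keys f \<subseteq> C" for f
    using eq[OF that] unfolding ker push .
  show ?thesis
  proof (rule char_lift[OF \<epsilon> \<phi> \<psi> rg C eq'])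
    fix L0 \<sigma>
    assume L: "subf L0" "range \<phi> \<subseteq> L0" "\<And>x m. x ^ m = 1 \<Longrightarrow> m > 0 \<Longrightarrow> x \<in> L0"
      "\<And>c. \<epsilon> c \<in> L0 \<and> \<sigma> (\<epsilon> c) = \<epsilon> c"
      "\<And>x. x \<in> L0 \<Longrightarrow> \<sigma> x \<in> L0" "\<sigma> 1 = 1"
      "\<And>x y. x \<in> L0 \<Longrightarrow> y \<in> L0 \<Longrightarrow> \<sigma> (x - y) = \<sigma> x - \<sigma> y"
      "\<And>x y. x \<in> L0 \<Longrightarrow> y \<in> L0 \<Longrightarrow> \<sigma> (x * y) = \<sigma> x * \<sigma> y"
      "\<And>a. \<exists>m>0. \<sigma> (\<phi> a) ^ m = \<psi> a ^ m"
    interpret d: dyn "TYPE('a)" N \<gamma> L0 \<phi> \<sigma>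
    proof unfold_locales
      fix n :: nat assume n: "n > 0"
      then show "of_nat n \<noteq> (0 :: (((nat \<Rightarrow>\<^sub>0 int) \<Rightarrow>\<^sub>0 'k) fract) alg_closure)"
        using rhom_nz[OF \<epsilon>, of "of_nat n"] rhom_of_nat[OF \<epsilon>, of n] by simp
    next
      fix a assume "\<phi> a = 1"
      then have "ev \<epsilon> \<phi> (single a 1 - single 0 1) = 0"
        by (simp add: ev_diff[OF \<epsilon>] ev_single[OF \<epsilon>] char_0[OF \<phi>] del: single_one)
      then have "single a 1 - 1 \<in> P" using ker by simp
      then have "1 + (single a 1 - 1) \<in> (\<lambda>x. 1 + x) ` P" by (rule imageI)
      then show "a = 0" using P(2) unfolding faithful_def by simp
    qed (use \<gamma> L \<phi> in \<open>auto simp: char_add char_nz \<psi>_def additive.add\<close>)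
    have "(\<Sum>b\<in>{b \<in> keys f. b - a \<in> d.D}. \<epsilon> (lookup f b) * \<phi> b) = 0"
    proof (rule d.coset_sum_zero)
      show "\<epsilon> (lookup f b) \<in> d.F0" for b using L(4)[of "lookup f b"] by (auto simp: d.F0_def intro: exI[of _ 1])
      show "(\<Sum>b\<in>keys f. \<epsilon> (lookup f b) * \<phi> b) = 0" using f ker[of f] by (simp add: ev_def)
    qed simp
    moreover have "keys f \<inter> {b. b - a \<in> periodic \<gamma>} = {b \<in> keys f. b - a \<in> d.D}"
      by (auto simp: d.D_def periodic_def)
    ultimately have "ev \<epsilon> \<phi> (restr {b. b - a \<in> periodic \<gamma>} f) = 0"
      unfolding restr_def ev_sum[OF \<epsilon>] ev_single[OF \<epsilon>] by simp
    then show "restr {b. b - a \<in> periodic \<gamma>} f \<in> P" using ker by simp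
  qed
qed

text \<open>Only finitely many group elements occur in \<open>f\<close>, so the unwanted ones are
  excluded by finitely many members of the family, and the corresponding projections
  compose.\<close>

lemma restr_Inter:
  assumes r: "\<And>D f. D \<in> \<D> \<Longrightarrow> f \<in> P \<Longrightarrow> restr {b. b - a \<in> D} f \<in> P" and f: "f \<in> P"
  shows "restr {b. b - a \<in> \<Inter>\<D>} f \<in> P"
proof -
  have "\<forall>b\<in>{b \<in> keys f. b - a \<notin> \<Inter>\<D>}. \<exists>D. D \<in> \<D> \<and> b - a \<notin> D" by blast
  from bchoice[OF this] obtain d
    where d: "\<And>b. b \<in> keys f \<Longrightarrow> b - a \<notin> \<Inter>\<D> \<Longrightarrow> d b \<in> \<D> \<and> b - a \<notin> d b"
    by auto
  define \<F> where "\<F> = d ` {b \<in> keys f. b - a \<notin> \<Inter>\<D>}"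
  have fin: "finite \<F>" "\<F> \<subseteq> \<D>" using d by (auto simp: \<F>_def)
  have "restr {b. \<forall>D\<in>\<F>. b - a \<in> D} f \<in> P" using fin
  proof induction
    case empty
    have "restr UNIV f = f" by (rule poly_mapping_eqI) (simp add: lookup_restr)
    then show ?case using f by simp
  next
    case (insert D \<F>)
    have "restr {b. b - a \<in> D} (restr {b. \<forall>D\<in>\<F>. b - a \<in> D} f) \<in> P" using insert r by simp
    moreover have "{b. b - a \<in> D} \<inter> {b. \<forall>D\<in>\<F>. b - a \<in> D} = {b. \<forall>D\<in>insert D \<F>. b - a \<in> D}" by auto
    ultimately show ?case by (simp add: restr_restr)
  qed
  moreover have "restr {b. \<forall>D\<in>\<F>. b - a \<in> D} f = restr {b. b - a \<in> \<Inter>\<D>} f"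
  proof (rule restr_cong, intro Set.set_eqI iffI)
    fix b assume b: "b \<in> keys f \<inter> {b. \<forall>D\<in>\<F>. b - a \<in> D}"
    have "b - a \<in> \<Inter>\<D>"
    proof (rule ccontr)
      assume n: "b - a \<notin> \<Inter>\<D>"
      have "d b \<in> \<F>" unfolding \<F>_def using b n by (intro imageI) simp
      then show False using b d[OF _ n] by auto
    qed
    then show "b \<in> keys f \<inter> {b. b - a \<in> \<Inter>\<D>}" using b by simp
  next
    fix b assume "b \<in> keys f \<inter> {b. b - a \<in> \<Inter>\<D>}"
    then show "b \<in> keys f \<inter> {b. \<forall>D\<in>\<F>. b - a \<in> D}" using fin(2) by auto
  qed
  ultimately show ?thesis by simp
qed

text \<open>Coset components are split off one at a time; each lies in \<open>P\<close> and becomes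
  an element of \<open>P \<inter> grp_alg E\<close> after translation by a group element.\<close>

lemma control_by_restr:
  fixes P :: "('a::ab_group_add \<Rightarrow>\<^sub>0 'k::field) set"
  assumes P: "is_ideal P" and E: "is_subgroup E"
    and r: "\<And>a f. f \<in> P \<Longrightarrow> restr {b. b - a \<in> E} f \<in> P"
  shows "P = ideal_gen (P \<inter> grp_alg E)"
proof
  show "ideal_gen (P \<inter> grp_alg E) \<subseteq> P" unfolding ideal_gen_def using P by blast
  have "f \<in> I" if I: "is_ideal I" "P \<inter> grp_alg E \<subseteq> I" and f: "f \<in> P" for I f
    using f
  proof (induction "card (keys f)" arbitrary: f rule: less_induct)
    case less
    show ?case
    proof (cases "f = 0")
      case True
      then show ?thesis using I by (simp add: is_ideal_def)
    next
      case False
      then obtain a where a: "a \<in> keys f" by (metis keys_eq_empty ex_in_conv)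
      define h where "h = restr {b. b - a \<in> E} f"
      have hP: "h \<in> P" using r less.prems by (simp add: h_def)
      have "(-1) * h \<in> P" using hP P unfolding is_ideal_def by blast
      then have fh: "f - h \<in> P" using less.prems P unfolding is_ideal_def by (metis mult_minus1 uminus_add_conv_diff add.commute)
      have "keys (f - h) \<subseteq> keys f - {a}" using a subgroup_0[OF E]
        by (auto simp: in_keys_iff lookup_minus h_def lookup_restr split: if_splits)
      then have "card (keys (f - h)) < card (keys f)" using a
        by (intro psubset_card_mono) auto
      then have 1: "f - h \<in> I" using less.hyps fh by blast
      have "keys (single (- a) 1 * h) \<subseteq> E"
      proof
        fix b assume "b \<in> keys (single (- a) 1 * h)"
        then obtain c where "b = - a + c" "c \<in> keys h" using keys_mult[of "single (- a) 1" h] by (auto split: if_splits)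
        then show "b \<in> E" by (simp add: h_def keys_restr)
      qed
      moreover have "single (- a) 1 * h \<in> P" using hP P unfolding is_ideal_def by blast
      ultimately have "single (- a) 1 * h \<in> I" using I(2) by (auto simp: grp_alg_def)
      then have "single a 1 * (single (- a) 1 * h) \<in> I" using I(1) unfolding is_ideal_def by blast
      then have "h \<in> I" by (simp add: mult.assoc[symmetric] mult_single)
      then have "(f - h) + h \<in> I" using 1 I(1) unfolding is_ideal_def by blast
      then show ?thesis by simp
    qed
  qed
  then show "P \<subseteq> ideal_gen (P \<inter> grp_alg E)" unfolding ideal_gen_def by blast
qed

section \<open>The action on the group algebra and the standardiser\<close>

lemma aut_action_inverse:
  assumes "aut_action act"
  shows "act (- g) (act g a) = a" "act g (act (- g) a) = a"
proof -
  have "act (- g) \<circ> act g = id" "act g \<circ> act (- g) = id"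
    using assms unfolding aut_action_def by (metis left_minus) (metis assms aut_action_def right_minus)
  then show "act (- g) (act g a) = a" "act g (act (- g) a) = a" by (auto simp: fun_eq_iff)
qed

text \<open>The function inside \<open>Abs_poly_mapping\<close> is supported on the image of the
  keys of \<open>f\<close>; this finiteness is what makes the abstraction meaningful.\<close>

lemma act_alg_eq_ev:
  assumes "aut_action act"
  shows "act_alg act g f = ev (single 0) (\<lambda>b. single (act g b) 1) f"
proof (rule poly_mapping_eqI)
  fix b
  have "{b. lookup f (act (- g) b) \<noteq> 0} \<subseteq> act g ` keys f"
  proof
    fix b assume "b \<in> {b. lookup f (act (- g) b) \<noteq> 0}"
    then have "act (- g) b \<in> keys f" by (simp add: in_keys_iff)
    then show "b \<in> act g ` keys f" using aut_action_inverse(2)[OF assms, of g b] by force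
  qed
  then have "finite {b. lookup f (act (- g) b) \<noteq> 0}" by (rule finite_subset) simp
  then have "lookup (act_alg act g f) b = lookup f (act (- g) b)"
    unfolding act_alg_def by (simp add: Abs_poly_mapping_inverse)
  also have "\<dots> = (\<Sum>k\<in>keys f. if k = act (- g) b then lookup f k else 0)" by (auto simp: in_keys_iff)
  also have "\<dots> = (\<Sum>k\<in>keys f. lookup (single (act g k) (lookup f k)) b)"
    using aut_action_inverse[OF assms, of g] by (intro sum.cong) (auto simp: lookup_single when_def)
  finally show "lookup (act_alg act g f) b = lookup (ev (single 0) (\<lambda>b. single (act g b) 1) f) b"
    by (simp add: ev_def mult_single lookup_sum)
qed

lemma aut_action_additive: "aut_action act \<Longrightarrow> additive (act g)"
  by unfold_locales (simp add: aut_action_def)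

lemma aut_action_bij: "aut_action act \<Longrightarrow> bij (act g)"
  using aut_action_inverse[of act] by (intro o_bij[of "act (- g)"]) (auto simp: fun_eq_iff)

lemma act_alg_inverse:
  fixes f :: "'a::ab_group_add \<Rightarrow>\<^sub>0 'k::field"
  assumes act: "aut_action act"
  shows "act_alg act (- g) (act_alg act g f) = f"
proof -
  have "act_alg act (- g) (act_alg act g f)
      = (\<Sum>b\<in>keys f. ev (single 0) (\<lambda>b. single (act (- g) b) 1) (single (act g b) (lookup f b)))"
    unfolding act_alg_eq_ev[OF act] ev_def[of _ _ f] by (simp add: ev_sum[OF rhom_single] mult_single)
  then show ?thesis
    by (simp add: ev_single[OF rhom_single] mult_single aut_action_inverse[OF act] sum_single)
qed

lemma standardiser_dense:
  fixes act :: "'g::group_add \<Rightarrow> 'a::ab_group_add \<Rightarrow> 'a" and P :: "('a \<Rightarrow>\<^sub>0 'k::field) set"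
  assumes act: "aut_action act" and g: "g \<in> standardiser act P"
  shows "\<exists>C. is_subgroup C \<and> (\<forall>a. \<exists>n>0. zs (int n) a \<in> C) \<and>
    (\<forall>f. keys f \<subseteq> C \<longrightarrow> (f \<in> P \<longleftrightarrow> ev (single 0) (\<lambda>b. single (act g b) 1) f \<in> P))"
proof -
  obtain B where B: "dense_subgroup B" "P \<inter> grp_alg B = (act_alg act g ` P) \<inter> grp_alg B"
    using g unfolding standardiser_def by blast
  have Bs: "is_subgroup B" using B by (simp add: dense_subgroup_def)
  have dB: "\<exists>n>0. zs (int n) a \<in> B" for a using B by (simp add: dense_subgroup_def zs_of_nat)
  have ad: "additive (act g)" using act by (rule aut_action_additive)
  \<comment> \<open>For \<open>f\<close> supported on \<open>B\<close> the image may leave kB, where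
    nothing is known. Requiring the translated support to lie in \<open>B\<close> as well keeps
    density and makes membership comparable on both sides.\<close>
  define C where "C = {c \<in> B. act g c \<in> B}"
  show ?thesis
  proof (intro exI[of _ C] conjI allI impI)
    show "is_subgroup C" using Bs unfolding is_subgroup_def C_def
      by (simp add: additive.zero[OF ad] additive.diff[OF ad])
    show "\<exists>n>0. zs (int n) a \<in> C" for a
    proof -
      obtain n where n: "n > 0" "zs (int n) a \<in> B" using dB by blast
      obtain m where m: "m > 0" "zs (int m) (act g a) \<in> B" using dB by blast
      have "zs (int m) (zs (int n) a) \<in> B" "zs (int n) (zs (int m) (act g a)) \<in> B"
        using subgroup_zs[OF Bs] n m by blast+
      then have "zs (int (n * m)) a \<in> C" by (simp add: C_def additive_zs[OF ad] mult.commute)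
      then show ?thesis using n m by (metis nat_0_less_mult_iff)
    qed
    fix f :: "'a \<Rightarrow>\<^sub>0 'k" assume f: "keys f \<subseteq> C"
    have "act_alg act g f = (\<Sum>b\<in>keys f. single (act g b) (lookup f b))"
      by (simp add: act_alg_eq_ev[OF act] ev_def mult_single)
    then have "keys (act_alg act g f) \<subseteq> (\<Union>b\<in>keys f. keys (single (act g b) (lookup f b)))"
      using keys_sum by metis
    also have "\<dots> \<subseteq> B" using f by (auto simp: C_def split: if_splits)
    finally have "keys (act_alg act g f) \<subseteq> B" .
    then have "act_alg act g f \<in> P \<longleftrightarrow> act_alg act g f \<in> act_alg act g ` P"
      using B(2) unfolding grp_alg_def by blast
    also have "\<dots> \<longleftrightarrow> f \<in> P"
      using inj_image_mem_iff[OF inj_on_inverseI[of UNIV "act_alg act (- g)" "act_alg act g"]]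
      by (simp add: act_alg_inverse[OF act])
    finally show "f \<in> P \<longleftrightarrow> ev (single 0) (\<lambda>b. single (act g b) 1) f \<in> P"
      by (simp add: act_alg_eq_ev[OF act, of g f])
  qed
qed

section \<open>Finiteness of orbits\<close>

text \<open>Separatedness in the p-adic topology. It holds for free groups of finite rank and fails
  for nonzero p-divisible groups, so suitable lattices have to be found inside A.\<close>

definition sep :: "int \<Rightarrow> 'a::ab_group_add set \<Rightarrow> bool" where
  "sep p \<Lambda> \<longleftrightarrow> (\<forall>x. (\<forall>j. x \<in> zs (p ^ j) ` \<Lambda>) \<longrightarrow> x = 0)"

lemma subgroup_zs_image: "is_subgroup \<Lambda> \<Longrightarrow> is_subgroup (zs p ` \<Lambda>)"
  by (rule subgroup_image) (simp_all add: additive_def zs_add_right)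

context frg
begin

lemma coprime_divide:
  fixes x :: 'a
  assumes \<Lambda>: "is_subgroup \<Lambda>" and "coprime l r" and x: "x \<in> \<Lambda>" "zs l x \<in> zs r ` \<Lambda>"
  shows "x \<in> zs r ` \<Lambda>"
proof -
  obtain z where z: "z \<in> \<Lambda>" "zs l x = zs r z" using x by blast
  obtain u v where uv: "u * l + v * r = 1" using assms(2) bezout_int[of l r] by auto
  have "x = zs (u * l + v * r) x" using uv by simp
  also have "\<dots> = zs u (zs l x) + zs r (zs v x)" by (simp add: zs_add_left mult.commute)
  also have "\<dots> = zs r (zs u z + zs v x)" using z by (simp add: zs_add_right mult.commute)
  finally show ?thesis using z x \<Lambda> by (metis imageI subgroup_add subgroup_zs)
qed

lemma zs_cancel: "zs k a = zs k b \<Longrightarrow> k \<noteq> 0 \<Longrightarrow> a = b" for a b :: 'a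
  using tf[of k "a - b"] by (simp add: zs_diff_right)

lemma congruent_funpow:
  fixes h :: "'a \<Rightarrow> 'a"
  assumes h: "additive h" "h ` \<Lambda> \<subseteq> \<Lambda>" and \<Lambda>: "is_subgroup \<Lambda>" and c: "\<And>x. x \<in> \<Lambda> \<Longrightarrow> h x - x \<in> zs r ` \<Lambda>"
    and x: "x \<in> \<Lambda>"
  shows "(h ^^ i) x \<in> \<Lambda> \<and> (h ^^ i) x - x \<in> zs r ` \<Lambda>"
proof (induction i)
  case 0
  then show ?case using subgroup_0[OF subgroup_zs_image[OF \<Lambda>]] x by simp
next
  case (Suc i)
  then have "h ((h ^^ i) x) - (h ^^ i) x + ((h ^^ i) x - x) \<in> zs r ` \<Lambda>"
    using c by (intro subgroup_add[OF subgroup_zs_image[OF \<Lambda>]]) auto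
  then show ?case using Suc h by auto
qed

text \<open>If h x - x = r^s z, the sum of the translates over \<open>l\<close> steps telescopes to
  zero, while each translate of z is congruent to z modulo \<open>r\<close>. So l z, and hence z, is
  divisible by \<open>r\<close>; thus h x - x is divisible by every power of
  \<open>r\<close>.\<close>

lemma congruent_coprime_order:
  fixes h :: "'a \<Rightarrow> 'a"
  assumes h: "additive h" "h ` \<Lambda> \<subseteq> \<Lambda>" and \<Lambda>: "is_subgroup \<Lambda>" and c: "\<And>x. x \<in> \<Lambda> \<Longrightarrow> h x - x \<in> zs r ` \<Lambda>"
    and r: "r \<noteq> 0" "sep r \<Lambda>" and l: "coprime (int l) r" "\<And>x. x \<in> \<Lambda> \<Longrightarrow> (h ^^ l) x = x"
    and x: "x \<in> \<Lambda>"
  shows "h x = x"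
proof -
  have "\<forall>x\<in>\<Lambda>. h x - x \<in> zs (r ^ s) ` \<Lambda>" for s
  proof (induction s)
    case 0
    have "h x - x \<in> \<Lambda>" if "x \<in> \<Lambda>" for x using that h(2) subgroup_diff[OF \<Lambda>] by blast
    then show ?case by simp
  next
    case (Suc s)
    show ?case
    proof
      fix x assume x: "x \<in> \<Lambda>"
      then obtain z where z: "z \<in> \<Lambda>" "h x - x = zs (r ^ s) z" using Suc by blast
      have ad: "additive (h ^^ i)" for i using h(1) by (rule additive_funpow)
      have "(\<Sum>i<l. zs (r ^ s) ((h ^^ i) z)) = (\<Sum>i<l. (h ^^ Suc i) x - (h ^^ i) x)"
        using additive.diff[OF ad] by (simp add: additive_zs[OF ad, symmetric] z(2)[symmetric] funpow_swap1)
      also have "\<dots> = 0" using sum_lessThan_telescope[of "\<lambda>i. (h ^^ i) x" l] l(2)[OF x] by simp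
      finally have "zs (r ^ s) (\<Sum>i<l. (h ^^ i) z) = 0" by (simp add: zs_sum_right)
      then have 0: "(\<Sum>i<l. (h ^^ i) z) = 0" using tf r(1) by auto
      have "(\<Sum>i<l. (h ^^ i) z - z) \<in> zs r ` \<Lambda>"
        using congruent_funpow[OF h \<Lambda> c z(1)] by (intro subgroup_sum subgroup_zs_image \<Lambda>) auto
      moreover have "(\<Sum>i<l. (h ^^ i) z - z) = - zs (int l) z"
      proof -
        have "(\<Sum>i<l. z) = zs (int l) z" by (induction l) (simp_all add: zs_add_left)
        then show ?thesis using 0 by (simp add: sum_subtractf)
      qed
      ultimately have "zs (int l) z \<in> zs r ` \<Lambda>"
        using subgroup_uminus[OF subgroup_zs_image[OF \<Lambda>]] by fastforce
      then have "z \<in> zs r ` \<Lambda>" by (rule coprime_divide[OF \<Lambda> l(1) z(1)])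
      then show "h x - x \<in> zs (r ^ Suc s) ` \<Lambda>" unfolding z(2) by (auto simp: mult.commute)
    qed
  qed
  then have "h x - x = 0" using r(2) x unfolding sep_def by blast
  then show ?thesis by simp
qed

text \<open>Minkowski's argument. Two primes are used so that one of them differs from the order of
  the automorphism.\<close>
lemma congruent_finite_order:
  fixes g :: "'a \<Rightarrow> 'a" and p q :: int
  assumes \<Lambda>: "is_subgroup \<Lambda>" and pq: "prime p" "prime q" "p \<noteq> q" "sep p \<Lambda>" "sep q \<Lambda>"
    and g: "additive g" "g ` \<Lambda> \<subseteq> \<Lambda>" and c: "\<And>x. x \<in> \<Lambda> \<Longrightarrow> g x - x \<in> zs p ` \<Lambda> \<and> g x - x \<in> zs q ` \<Lambda>"
    and m: "m > 0" "\<And>x. x \<in> \<Lambda> \<Longrightarrow> (g ^^ m) x = x" and x: "x \<in> \<Lambda>"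
  shows "g x = x"
  using m
proof (induction m rule: less_induct)
  case (less m)
  show ?case
  proof (cases "m = 1")
    case True
    then show ?thesis using less.prems x by simp
  next
    case False
    \<comment> \<open>The order is reduced by one prime factor at a time: h = g^k satisfies h^l = 1
      on \<Lambda>, and the prime l differs from at least one of p and q.\<close>
    then obtain l where l: "prime l" "l dvd m" using prime_factor_nat by blast
    obtain k where k: "m = l * k" using l by blast
    define h where "h = g ^^ k"
    have k0: "k > 0" "k < m" using k less.prems(1) prime_gt_1_nat[OF l(1)] by auto
    have h: "additive h" "h ` \<Lambda> \<subseteq> \<Lambda>" unfolding h_def
      using additive_funpow[OF g(1)] congruent_funpow[OF g \<Lambda>, of p] c by blast+
    have hl: "(h ^^ l) x = x" if "x \<in> \<Lambda>" for x
      using less.prems(2)[OF that] unfolding h_def funpow_mult k by (simp add: mult.commute)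
    have hc: "h x - x \<in> zs p ` \<Lambda>" "h x - x \<in> zs q ` \<Lambda>" if "x \<in> \<Lambda>" for x
      unfolding h_def using congruent_funpow[OF g \<Lambda>, of p] congruent_funpow[OF g \<Lambda>, of q] c that by blast+
    have "h x = x" if "x \<in> \<Lambda>" for x
    proof (cases "int l = p")
      case True
      then have "coprime (int l) q" using pq by (simp add: primes_coprime)
      then show ?thesis using congruent_coprime_order[OF h \<Lambda> hc(2) _ pq(5) _ hl that] pq by auto
    next
      case False
      then have "coprime (int l) p" using pq l by (simp add: primes_coprime)
      then show ?thesis using congruent_coprime_order[OF h \<Lambda> hc(1) _ pq(4) _ hl that] pq by auto
    qed
    then show ?thesis using less.IH[OF k0(2,1)] by (simp add: h_def)
  qed
qed

text \<open>The order of \<Lambda>/p\<Lambda> is at most p^N: elements independent modulo p are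
  independent over the integers, so a maximal such set has at most \<open>N\<close> members, and it
  generates the quotient. A numbering of classes replaces the quotient group.\<close>

lemma residue_count:
  fixes \<Lambda> :: "'a set" and p :: int
  assumes \<Lambda>: "is_subgroup \<Lambda>" and p: "prime p"
  obtains r :: "'a \<Rightarrow> nat" where "\<And>x. x \<in> \<Lambda> \<Longrightarrow> r x < nat p ^ N"
    "\<And>x y. x \<in> \<Lambda> \<Longrightarrow> y \<in> \<Lambda> \<Longrightarrow> r x = r y \<Longrightarrow> x - y \<in> zs p ` \<Lambda>"
proof -
  have p1: "p > 1" using p by (simp add: prime_gt_1_int)
  note S = subgroup_zs_image[OF \<Lambda>, of p]
  define Q where "Q Y \<longleftrightarrow> finite Y \<and> Y \<subseteq> \<Lambda> \<and>
    (\<forall>c. (\<Sum>y\<in>Y. zs (c y) y) \<in> zs p ` \<Lambda> \<longrightarrow> (\<forall>y\<in>Y. p dvd c y))" for Y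
  have zQ: "zind Y" if Q: "Q Y" for Y
    unfolding zind_def
  proof (intro conjI allI impI)
    show "finite Y" using Q by (simp add: Q_def)
    fix c assume "(\<Sum>y\<in>Y. zs (c y) y) = 0"
    \<comment> \<open>Descent: all coefficients of a relation are divisible by p, and without
      torsion dividing them by p gives a smaller relation.\<close>
    then show "\<forall>y\<in>Y. c y = 0"
    proof (induction "\<Sum>y\<in>Y. nat \<bar>c y\<bar>" arbitrary: c rule: less_induct)
      case less
      have "(\<Sum>y\<in>Y. zs (c y) y) \<in> zs p ` \<Lambda>" using less.prems subgroup_0[OF S] by simp
      then have dv: "p dvd c y" if "y \<in> Y" for y using Q that by (simp add: Q_def)
      define d where "d y = c y div p" for y
      have cd: "c y = p * d y" if "y \<in> Y" for y using dv[OF that] by (simp add: d_def)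
      have "zs p (\<Sum>y\<in>Y. zs (d y) y) = (\<Sum>y\<in>Y. zs (c y) y)"
        unfolding zs_sum_right by (rule sum.cong) (simp_all add: cd)
      then have d0: "(\<Sum>y\<in>Y. zs (d y) y) = 0" using tf[of p] less.prems p1 by simp
      show ?case
      proof (rule ccontr)
        assume "\<not> ?thesis"
        then obtain y where y: "y \<in> Y" "c y \<noteq> 0" by blast
        have le: "nat \<bar>d y\<bar> \<le> nat \<bar>c y\<bar>" if "y \<in> Y" for y
          using cd[OF that] p1 by (simp add: abs_mult mult_le_cancel_right1 nat_mono)
        have "nat \<bar>d y\<bar> < nat \<bar>c y\<bar>" using cd[OF y(1)] y(2) p1 by (simp add: abs_mult)
        then have "(\<Sum>y\<in>Y. nat \<bar>d y\<bar>) < (\<Sum>y\<in>Y. nat \<bar>c y\<bar>)"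
          using le y(1) Q by (intro sum_strict_mono_ex1) (auto simp: Q_def)
        then have "\<forall>y\<in>Y. d y = 0" using less.hyps d0 by blast
        then show False using cd y by simp
      qed
    qed
  qed
  have "0 \<in> \<Lambda>" using \<Lambda> by (rule subgroup_0)
  have "\<exists>Y. Q Y \<and> (\<forall>Z. Q Z \<longrightarrow> card Z \<le> card Y)"
    by (intro ex_has_greatest_nat[of Q "{}" card "Suc N"]) (auto simp: Q_def[of "{}"] less_Suc_eq_le bd zQ)
  then obtain Y where Y: "Q Y" and mx: "\<And>Z. Q Z \<Longrightarrow> card Z \<le> card Y" by auto
  have fin: "finite Y" and Ys: "Y \<subseteq> \<Lambda>" using Y by (auto simp: Q_def)
  have ex: "\<exists>c. x - (\<Sum>y\<in>Y. zs (c y) y) \<in> zs p ` \<Lambda>" if x: "x \<in> \<Lambda>" for x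
  proof (cases "x \<in> Y")
    case True
    then obtain c where "x = (\<Sum>y\<in>Y. zs (c y) y)" using zspan_base[OF fin] unfolding zspan_def by blast
    then have "x - (\<Sum>y\<in>Y. zs (c y) y) \<in> zs p ` \<Lambda>" using subgroup_0[OF S] by simp
    then show ?thesis by blast
  next
    case False
    then have "\<not> Q (insert x Y)" using mx[of "insert x Y"] fin by auto
    then obtain c where c: "(\<Sum>y\<in>insert x Y. zs (c y) y) \<in> zs p ` \<Lambda>" "\<exists>y\<in>insert x Y. \<not> p dvd c y"
      using fin Ys x unfolding Q_def by auto
    have c': "zs (c x) x + (\<Sum>y\<in>Y. zs (c y) y) \<in> zs p ` \<Lambda>" using c(1) fin False by simp
    have "\<not> p dvd c x"
    proof
      assume "p dvd c x"
      then obtain e where "c x = p * e" by blast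
      then have "zs (c x) x \<in> zs p ` \<Lambda>" using subgroup_zs[OF \<Lambda> x, of e] by (metis imageI zs_zs)
      then have "(\<Sum>y\<in>Y. zs (c y) y) \<in> zs p ` \<Lambda>" using subgroup_diff[OF S c'] by fastforce
      then show False using Y c(2) \<open>p dvd c x\<close> by (auto simp: Q_def)
    qed
    then have "coprime (c x) p" using p by (simp add: prime_imp_coprime coprime_commute)
    then obtain u v where uv: "u * c x + v * p = 1" using bezout_int[of "c x" p] by auto
    have "zs u (zs (c x) x + (\<Sum>y\<in>Y. zs (c y) y)) + zs p (zs v x) \<in> zs p ` \<Lambda>"
      using subgroup_add[OF S subgroup_zs[OF S c']] subgroup_zs[OF \<Lambda> x] by blast
    also have "zs u (zs (c x) x + (\<Sum>y\<in>Y. zs (c y) y)) + zs p (zs v x)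
        = zs (u * c x + v * p) x + (\<Sum>y\<in>Y. zs (u * c y) y)"
      by (simp add: zs_add_right zs_add_left zs_sum_right mult.commute add.assoc add.left_commute)
    also have "\<dots> = x - (\<Sum>y\<in>Y. zs (- u * c y) y)" by (simp add: uv zs_minus_left sum_negf)
    finally show ?thesis by (rule exI[of _ "\<lambda>y. - u * c y"])
  qed
  define A where "A = PiE Y (\<lambda>_. {0..<p})"
  have "\<exists>c\<in>A. x - (\<Sum>y\<in>Y. zs (c y) y) \<in> zs p ` \<Lambda>" if x: "x \<in> \<Lambda>" for x
  proof -
    obtain c where c: "x - (\<Sum>y\<in>Y. zs (c y) y) \<in> zs p ` \<Lambda>" using ex[OF x] by blast
    define d where "d = restrict (\<lambda>y. c y mod p) Y"
    have "(\<Sum>y\<in>Y. zs (c y) y) - (\<Sum>y\<in>Y. zs (d y) y) = (\<Sum>y\<in>Y. zs (c y - d y) y)"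
      by (simp add: zs_diff_left sum_subtractf)
    also have "\<dots> \<in> zs p ` \<Lambda>"
    proof (rule subgroup_sum[OF S])
      fix y assume y: "y \<in> Y"
      have "c y - d y = p * (c y div p)" using y by (simp add: d_def minus_mod_eq_mult_div)
      then show "zs (c y - d y) y \<in> zs p ` \<Lambda>" using Ys y subgroup_zs[OF \<Lambda>] by (metis imageI subsetD zs_zs)
    qed
    finally have "x - (\<Sum>y\<in>Y. zs (c y) y) + ((\<Sum>y\<in>Y. zs (c y) y) - (\<Sum>y\<in>Y. zs (d y) y)) \<in> zs p ` \<Lambda>"
      by (rule subgroup_add[OF S c])
    moreover have "d \<in> A" using p1 by (auto simp: A_def d_def)
    ultimately show ?thesis by auto
  qed
  then obtain c where c: "\<And>x. x \<in> \<Lambda> \<Longrightarrow> c x \<in> A \<and> x - (\<Sum>y\<in>Y. zs (c x y) y) \<in> zs p ` \<Lambda>" by metis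
  have "finite A" using fin by (auto simp: A_def intro: finite_PiE)
  then obtain e :: "(_ \<Rightarrow> int) \<Rightarrow> nat" where e: "bij_betw e A {0..<card A}"
    using ex_bij_betw_finite_nat by blast
  have "card A = nat p ^ card Y" using fin p1 by (simp add: A_def card_PiE)
  also have "\<dots> \<le> nat p ^ N" using bd zQ[OF Y] p1 by (intro power_increasing) auto
  finally have cA: "card A \<le> nat p ^ N" .
  show ?thesis
  proof (rule that[of "\<lambda>x. e (c x)"])
    show "e (c x) < nat p ^ N" if "x \<in> \<Lambda>" for x
      using bij_betwE[OF e] c[OF that] cA by fastforce
    show "x - y \<in> zs p ` \<Lambda>" if xy: "x \<in> \<Lambda>" "y \<in> \<Lambda>" "e (c x) = e (c y)" for x y
    proof -
      have "c x = c y" using xy c bij_betw_imp_inj_on[OF e] by (meson inj_onD)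
      then have "x - (\<Sum>z\<in>Y. zs (c x z) z) \<in> zs p ` \<Lambda>" "y - (\<Sum>z\<in>Y. zs (c x z) z) \<in> zs p ` \<Lambda>"
        using c[OF xy(1)] c[OF xy(2)] by simp_all
      from subgroup_diff[OF S this] show ?thesis by simp
    qed
  qed
qed

text \<open>The bound counts pairs of self-maps of sets with p^N and q^N elements, which code the
  actions on \<Lambda>/p\<Lambda> and \<Lambda>/q\<Lambda>. Two members of \<open>F\<close> with
  equal codes differ by an element congruent to 1 modulo p and q, which acts trivially by
  \<open>congruent_finite_order\<close>.\<close>

lemma finite_order_pigeonhole:
  fixes act :: "'g::group_add \<Rightarrow> 'a \<Rightarrow> 'a" and p q :: int
  assumes act: "aut_action act" and \<Lambda>: "is_subgroup \<Lambda>"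
    and pq: "prime p" "prime q" "p \<noteq> q" "sep p \<Lambda>" "sep q \<Lambda>"
    and H: "\<And>g h. g \<in> H \<Longrightarrow> h \<in> H \<Longrightarrow> g - h \<in> H" "\<And>g. g \<in> H \<Longrightarrow> act g ` \<Lambda> \<subseteq> \<Lambda>"
      "\<And>g. g \<in> H \<Longrightarrow> \<exists>m>0. \<forall>x\<in>\<Lambda>. (act g ^^ m) x = x"
    and F: "F \<subseteq> H" "finite F" "card F > (nat p ^ N) ^ (nat p ^ N) * (nat q ^ N) ^ (nat q ^ N)"
  obtains g h where "g \<in> F" "h \<in> F" "g \<noteq> h" "\<And>x. x \<in> \<Lambda> \<Longrightarrow> act g x = act h x"
proof -
  define K where "K p = PiE {..<nat p ^ N} (\<lambda>_. {..<nat p ^ N})" for p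
  have cK: "finite (K p)" "card (K p) = (nat p ^ N) ^ (nat p ^ N)" for p
    by (auto simp: K_def card_PiE intro: finite_PiE)
  have ad: "additive (act g)" for g using act by (rule aut_action_additive)
  define G where "G p \<Phi> \<longleftrightarrow> (\<forall>g\<in>H. \<Phi> g \<in> K p) \<and>
      (\<forall>g\<in>H. \<forall>h\<in>H. \<Phi> g = \<Phi> h \<longrightarrow> (\<forall>x\<in>\<Lambda>. act h x - act g x \<in> zs p ` \<Lambda>))" for p \<Phi>
  have ex: "\<exists>\<Phi>. G p \<Phi>" if p: "prime p" for p :: int
  proof -
    note S = subgroup_zs_image[OF \<Lambda>, of p]
    obtain r where r: "\<And>x. x \<in> \<Lambda> \<Longrightarrow> r x < nat p ^ N"
      "\<And>x y. x \<in> \<Lambda> \<Longrightarrow> y \<in> \<Lambda> \<Longrightarrow> r x = r y \<Longrightarrow> x - y \<in> zs p ` \<Lambda>"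
      using residue_count[OF \<Lambda> p] by blast
    define s where "s i = (if \<exists>x\<in>\<Lambda>. r x = i then SOME x. x \<in> \<Lambda> \<and> r x = i else 0)" for i
    have s\<Lambda>: "s i \<in> \<Lambda>" for i
      unfolding s_def using someI_ex[of "\<lambda>x. x \<in> \<Lambda> \<and> r x = i"] subgroup_0[OF \<Lambda>] by auto
    have rs: "r (s (r x)) = r x" if "x \<in> \<Lambda>" for x
      unfolding s_def using someI[of "\<lambda>y. y \<in> \<Lambda> \<and> r y = r x" x] that by auto
    define \<Phi> where "\<Phi> g = restrict (\<lambda>i. r (act g (s i))) {..<nat p ^ N}" for g
    have aL: "act g x \<in> \<Lambda>" if "g \<in> H" "x \<in> \<Lambda>" for g x using H(2) that by blast
    have "G p \<Phi>" unfolding G_def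
    proof (intro conjI ballI impI)
      show "\<Phi> g \<in> K p" if "g \<in> H" for g using r(1) aL[OF that s\<Lambda>] by (auto simp: \<Phi>_def K_def)
      fix g h x assume gh: "g \<in> H" "h \<in> H" "\<Phi> g = \<Phi> h" and x: "x \<in> \<Lambda>"
      define y where "y = s (r x)"
      have y: "y \<in> \<Lambda>" by (simp add: y_def s\<Lambda>)
      obtain z where z: "z \<in> \<Lambda>" "x - y = zs p z" using r(2)[OF x y] rs[OF x] by (auto simp: y_def)
      have cg: "act k x - act k y \<in> zs p ` \<Lambda>" if "k \<in> H" for k
        using z aL[OF that z(1)] by (simp add: additive.diff[OF ad, symmetric] additive_zs[OF ad])
      have "r (act g y) = r (act h y)"
        using fun_cong[OF gh(3), of "r x"] r(1)[OF x] by (simp add: \<Phi>_def y_def)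
      then have "act h y - act g y \<in> zs p ` \<Lambda>" using r(2) aL gh y by simp
      from subgroup_diff[OF S subgroup_add[OF S cg[OF gh(2)] this] cg[OF gh(1)]]
      show "act h x - act g x \<in> zs p ` \<Lambda>" by simp
    qed
    then show ?thesis by blast
  qed
  obtain \<Phi> \<Psi> where G: "G p \<Phi>" "G q \<Psi>" using ex[OF pq(1)] ex[OF pq(2)] by blast
  have \<Phi>: "\<Phi> g \<in> K p" "\<Phi> g = \<Phi> h \<Longrightarrow> x \<in> \<Lambda> \<Longrightarrow> act h x - act g x \<in> zs p ` \<Lambda>"
    if "g \<in> H" "h \<in> H" for g h x
    using G(1) that unfolding G_def by blast+
  have \<Psi>: "\<Psi> g \<in> K q" "\<Psi> g = \<Psi> h \<Longrightarrow> x \<in> \<Lambda> \<Longrightarrow> act h x - act g x \<in> zs q ` \<Lambda>"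
    if "g \<in> H" "h \<in> H" for g h x
    using G(2) that unfolding G_def by blast+
  have "(\<lambda>g. (\<Phi> g, \<Psi> g)) ` F \<subseteq> K p \<times> K q" using \<Phi>(1) \<Psi>(1) F(1) by auto
  then have "card ((\<lambda>g. (\<Phi> g, \<Psi> g)) ` F) \<le> card (K p \<times> K q)" using cK by (intro card_mono) auto
  then have "\<not> inj_on (\<lambda>g. (\<Phi> g, \<Psi> g)) F"
    using F(3) cK by (intro pigeonhole) (simp add: card_cartesian_product)
  then obtain g h where gh: "g \<in> F" "h \<in> F" "g \<noteq> h" "\<Phi> g = \<Phi> h" "\<Psi> g = \<Psi> h"
    unfolding inj_on_def by auto
  have gH: "g \<in> H" "h \<in> H" using gh F by auto
  \<comment> \<open>The quotient of the two elements; the group is written additively without being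
    commutative, so the order of the terms matters.\<close>
  define k where "k = - g + h"
  have "0 \<in> H" using H(1)[OF gH(1) gH(1)] by simp
  then have mg: "- g \<in> H" using H(1)[of 0 g] gH by simp
  have kH: "k \<in> H" using H(1)[OF mg, of "- h"] H(1)[OF \<open>0 \<in> H\<close> gH(2)] by (simp add: k_def)
  have kx: "act k x = act (- g) (act h x)" for x using act by (simp add: k_def aut_action_def)
  have kd: "act k x - x = act (- g) (act h x - act g x)" for x
    by (simp add: kx additive.diff[OF ad] aut_action_inverse[OF act])
  have im: "act (- g) y \<in> zs m ` \<Lambda>" if y: "y \<in> zs m ` \<Lambda>" for y m
  proof -
    obtain z where z: "z \<in> \<Lambda>" "y = zs m z" using y by blast
    have "act (- g) z \<in> \<Lambda>" using H(2)[OF mg] z by blast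
    then show ?thesis by (auto simp: z(2) additive_zs[OF ad])
  qed
  obtain m where m: "m > 0" "\<And>x. x \<in> \<Lambda> \<Longrightarrow> (act k ^^ m) x = x" using H(3)[OF kH] by blast
  have "act k x = x" if x: "x \<in> \<Lambda>" for x
  proof (rule congruent_finite_order[OF \<Lambda> pq ad H(2)[OF kH] _ m x])
    show "act k x - x \<in> zs p ` \<Lambda> \<and> act k x - x \<in> zs q ` \<Lambda>" if "x \<in> \<Lambda>" for x
      unfolding kd using im \<Phi>(2)[OF gH gh(4) that] \<Psi>(2)[OF gH gh(5) that] by blast
  qed
  then have "act g x = act h x" if "x \<in> \<Lambda>" for x
    using that aut_action_inverse(2)[OF act, of g "act h x"] by (simp add: kx)
  then show ?thesis using that gh by blast
qed

end

section \<open>Lattices, denominators and finite orbits\<close>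

lemma infinite_image_subset:
  assumes "infinite (f ` S)"
  obtains F where "F \<subseteq> S" "finite F" "card F = n" "inj_on f F"
proof -
  obtain B where B: "finite B" "card B = n" "B \<subseteq> f ` S" using infinite_arbitrarily_large[OF assms] by blast
  obtain F where F: "F \<subseteq> S" "inj_on f F" "B = f ` F" using B(3) subset_image_inj[of B f S] by blast
  show ?thesis using that[OF F(1) _ _ F(2)] F B by (simp add: card_image finite_image_iff)
qed

lemma common_multiplier:
  fixes k :: "'i \<Rightarrow> int"
  assumes "finite I" "is_subgroup B" "\<And>i. i \<in> I \<Longrightarrow> k i \<noteq> 0 \<and> zs (k i) (y i) \<in> B"
  obtains K where "K \<noteq> 0" "\<And>i. i \<in> I \<Longrightarrow> zs K (y i) \<in> B"
proof
  show "prod k I \<noteq> 0" using assms by simp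
  show "zs (prod k I) (y i) \<in> B" if "i \<in> I" for i
  proof -
    have "zs (prod k (I - {i})) (zs (k i) (y i)) \<in> B" using assms that subgroup_zs by blast
    then show ?thesis using assms(1) that by (simp add: prod.remove mult.commute)
  qed
qed

inductive_set grpgen :: "'g::group_add set \<Rightarrow> 'g set" for F where
  base: "g \<in> F \<Longrightarrow> g \<in> grpgen F"
| zero: "0 \<in> grpgen F"
| diff: "g \<in> grpgen F \<Longrightarrow> h \<in> grpgen F \<Longrightarrow> g - h \<in> grpgen F"

context frg
begin

text \<open>The multiplier c is prime to p, so only the fixed \<open>d\<close> contributes powers of
  p to denominators over \<open>X\<close>. Divisibility by all powers of p then forces every
  coordinate to vanish.\<close>

lemma sep_lattice:
  fixes p :: int and \<Lambda> :: "'a set"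
  assumes X: "zind X" and p: "prime p" and d: "d \<noteq> 0"
    and \<Lambda>: "\<And>x. x \<in> \<Lambda> \<Longrightarrow> \<exists>c. coprime c p \<and> zs (c * d) x \<in> zspan X"
  shows "sep p \<Lambda>"
  unfolding sep_def
proof (intro allI impI)
  fix x assume x: "\<forall>j. x \<in> zs (p ^ j) ` \<Lambda>"
  then have "x \<in> zs (p ^ 0) ` \<Lambda>" by blast
  then have "x \<in> \<Lambda>" by simp
  then obtain c0 where c0: "coprime c0 p" "zs (c0 * d) x \<in> zspan X" using \<Lambda> by blast
  then obtain b where b: "zs (c0 * d) x = (\<Sum>y\<in>X. zs (b y) y)" unfolding zspan_def by blast
  have "b y = 0" if y: "y \<in> X" for y
  proof -
    have dv: "p ^ j dvd b y" for j
    proof -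
      obtain z where z: "z \<in> \<Lambda>" "x = zs (p ^ j) z" using x by blast
      obtain c where c: "coprime c p" "zs (c * d) z \<in> zspan X" using \<Lambda> z by blast
      then obtain e where e: "zs (c * d) z = (\<Sum>y\<in>X. zs (e y) y)" unfolding zspan_def by blast
      have "zs c (zs (c0 * d) x) = zs (c0 * p ^ j) (zs (c * d) z)" by (simp add: z(2) ac_simps)
      then have "(\<Sum>y\<in>X. zs (c * b y - c0 * p ^ j * e y) y) = 0"
        unfolding b e by (simp add: zs_sum_right zs_diff_left sum_subtractf)
      then have "c * b y = c0 * p ^ j * e y"
        using zindD[where c="\<lambda>y. c * b y - c0 * p ^ j * e y", OF X _ y] by simp
      then have "p ^ j dvd c * b y" by simp
      then show ?thesis using c(1) by (simp add: coprime_dvd_mult_right_iff coprime_commute)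
    qed
    show ?thesis
    proof (rule ccontr)
      assume n: "b y \<noteq> 0"
      have p2: "\<bar>p\<bar> \<ge> 2" using prime_ge_2_int[OF p] by simp
      have "int (nat \<bar>b y\<bar>) < 2 ^ nat \<bar>b y\<bar>" by (metis less_exp of_nat_less_iff of_nat_numeral of_nat_power)
      also have "\<dots> \<le> \<bar>p\<bar> ^ nat \<bar>b y\<bar>" using p2 by (rule power_mono) simp
      also have "\<dots> \<le> \<bar>b y\<bar>" using dvd_imp_le_int[OF n dv[of "nat \<bar>b y\<bar>"]] by (simp add: power_abs)
      finally show False by simp
    qed
  qed
  then have "zs (c0 * d) x = 0" by (simp add: b)
  moreover have "c0 \<noteq> 0" using c0(1) p by auto
  ultimately show "x = 0" using tf d by auto
qed

text \<open>A common period of the finite set is a period on its span, and on the pure closure as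
  well because multiplication by k is injective.\<close>

lemma periodic_uniform:
  fixes f :: "'a \<Rightarrow> 'a"
  assumes f: "additive f" and X: "finite X" "X \<subseteq> periodic f"
  obtains m where "m > 0" "\<And>a k. k \<noteq> 0 \<Longrightarrow> zs k a \<in> zspan X \<Longrightarrow> (f ^^ m) a = a"
proof -
  have "\<exists>m>0. \<forall>x\<in>X. (f ^^ m) x = x" using X
  proof (induction X)
    case empty
    then show ?case by auto
  next
    case (insert x X)
    then obtain m i where m: "m > 0" "\<forall>x\<in>X. (f ^^ m) x = x" and i: "i > 0" "(f ^^ i) x = x"
      by (auto simp: periodic_def)
    have it: "(h ^^ j) y = y" if "h y = y" for h :: "'a \<Rightarrow> 'a" and j y by (induction j) (simp_all add: that)
    have "(f ^^ (m * i)) y = y" if "y \<in> insert x X" for y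
      using that m(2) i(2) it[of "f ^^ m" y i] it[of "f ^^ i" x m] by (auto simp: funpow_mult mult.commute)
    then show ?case using m i by (intro exI[of _ "m * i"]) auto
  qed
  then obtain m where m: "m > 0" "\<And>x. x \<in> X \<Longrightarrow> (f ^^ m) x = x" by blast
  have ad: "additive (f ^^ m)" using f by (rule additive_funpow)
  have "is_subgroup {b. (f ^^ m) b = b}" by (simp add: is_subgroup_def additive.zero[OF ad] additive.diff[OF ad])
  then have B: "zspan X \<subseteq> {b. (f ^^ m) b = b}" by (rule zspan_least) (use m in auto)
  have "(f ^^ m) a = a" if "k \<noteq> 0" "zs k a \<in> zspan X" for a k
    using B that zs_cancel[of k "(f ^^ m) a" a] by (auto simp: additive_zs[OF ad, symmetric])
  then show ?thesis using that m(1) by blast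
qed

text \<open>Finitely many group elements \<open>F\<close> have bounded denominators on a rational
  basis of \<open>E\<close>, so the group they generate preserves a lattice localised at two other
  primes, and the orbits of the basis are finite. These orbits span a true lattice, on which 2 and 3
  bound the number of distinct maps.\<close>

lemma finite_orbits:
  fixes act :: "'g::group_add \<Rightarrow> 'a \<Rightarrow> 'a"
  assumes act: "aut_action act" and E: "is_subgroup E" "\<And>g. act g ` E \<subseteq> E" "\<And>g. E \<subseteq> periodic (act g)"
    and a: "a \<in> E"
  shows "finite (range (\<lambda>g. act g a))"
proof (rule ccontr)
  assume inf: "infinite (range (\<lambda>g. act g a))"
  have ad: "additive (act g)" for g using act by (rule aut_action_additive)
  have act_diff: "act (g - h) x = act g (act (- h) x)" for g h x
    using act unfolding aut_action_def by (metis comp_apply diff_conv_add_uminus)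
  have act_0: "act 0 x = x" for x using act by (simp add: aut_action_def)
  obtain X where X: "X \<subseteq> E" "zind X" and mx: "\<And>h. h \<in> E \<Longrightarrow> \<exists>k. k \<noteq> 0 \<and> zs k h \<in> zspan X"
    using max_ind[of E] E(1) by metis
  have fX: "finite X" using X by (simp add: zind_def)
  define bnd where "bnd p q = (nat p ^ N) ^ (nat p ^ N) * (nat q ^ N) ^ (nat q ^ N)" for p q :: int
  \<comment> \<open>The size of \<open>F\<close> is dictated by the primes 2 and 3. The first
    reduction uses primes that depend on \<open>F\<close> and could not supply this number.\<close>
  obtain F where F: "finite F" "card F = Suc (bnd 2 3)" "inj_on (\<lambda>g. act g a) F"
    using infinite_image_subset[OF inf] by blast
  define H where "H = grpgen F"
  have FH: "F \<subseteq> H" and H0: "0 \<in> H" and Hd: "\<And>g h. g \<in> H \<Longrightarrow> h \<in> H \<Longrightarrow> g - h \<in> H"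
    by (auto simp: H_def intro: grpgen.intros)
  have per: "\<exists>m>0. \<forall>x\<in>\<Lambda>. (act h ^^ m) x = x" if "\<And>x. x \<in> \<Lambda> \<Longrightarrow> \<exists>k. k \<noteq> 0 \<and> zs k x \<in> zspan X" for h \<Lambda>
  proof -
    have "X \<subseteq> periodic (act h)" using X(1) E(3) by blast
    from periodic_uniform[OF ad fX this] show ?thesis using that by metis
  qed
  have agree: "\<exists>g\<in>F'. \<exists>h\<in>F'. g \<noteq> h \<and> (\<forall>x\<in>\<Lambda>. act g x = act h x)"
    if \<Lambda>: "is_subgroup \<Lambda>" "\<And>h. h \<in> H \<Longrightarrow> act h ` \<Lambda> \<subseteq> \<Lambda>" and pq: "prime p" "prime q" "p \<noteq> q"
      and c: "d \<noteq> 0" "\<And>x. x \<in> \<Lambda> \<Longrightarrow> \<exists>c. coprime c p \<and> coprime c q \<and> zs (c * d) x \<in> zspan X"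
      and F': "F' \<subseteq> H" "finite F'" "card F' = Suc (bnd p q)" for \<Lambda> p q d F'
  proof -
    have sp: "sep p \<Lambda>" "sep q \<Lambda>"
      using sep_lattice[OF X(2) pq(1) c(1), of \<Lambda>] sep_lattice[OF X(2) pq(2) c(1), of \<Lambda>] c(2) by blast+
    have nz: "\<exists>k. k \<noteq> 0 \<and> zs k x \<in> zspan X" if x: "x \<in> \<Lambda>" for x
    proof -
      obtain e where e: "coprime e p" "zs (e * d) x \<in> zspan X" using c(2)[OF x] by blast
      then have "e * d \<noteq> 0" using c(1) pq(1) by auto
      then show ?thesis using e by blast
    qed
    have pr: "\<exists>m>0. \<forall>x\<in>\<Lambda>. (act h ^^ m) x = x" if "h \<in> H" for h
      by (rule per) (rule nz)
    have cF: "card F' > (nat p ^ N) ^ (nat p ^ N) * (nat q ^ N) ^ (nat q ^ N)" using F'(3) by (simp add: bnd_def)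
    show ?thesis
    proof (rule finite_order_pigeonhole[OF act \<Lambda>(1) pq sp Hd \<Lambda>(2) pr F'(1,2) cF])
      fix g h assume "g \<in> F'" "h \<in> F'" "g \<noteq> h" "\<And>x. x \<in> \<Lambda> \<Longrightarrow> act g x = act h x"
      then show ?thesis by (intro bexI[of _ g] bexI[of _ h]) simp_all
    qed
  qed
  obtain K where K: "K \<noteq> 0" "\<And>i. i \<in> (F \<union> uminus ` F) \<times> X \<Longrightarrow> zs K (act (fst i) (snd i)) \<in> zspan X"
  proof -
    have "\<exists>k. k \<noteq> 0 \<and> zs k (act (fst i) (snd i)) \<in> zspan X" if "i \<in> (F \<union> uminus ` F) \<times> X" for i
    proof -
      have "snd i \<in> E" using that X(1) by auto
      then have "act (fst i) (snd i) \<in> E" using E(2) by blast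
      then show ?thesis by (rule mx)
    qed
    then have "\<exists>k. \<forall>i\<in>(F \<union> uminus ` F) \<times> X. k i \<noteq> 0 \<and> zs (k i) (act (fst i) (snd i)) \<in> zspan X"
      by (intro bchoice) blast
    then obtain k where k: "\<forall>i\<in>(F \<union> uminus ` F) \<times> X. k i \<noteq> 0 \<and> zs (k i) (act (fst i) (snd i)) \<in> zspan X" ..
    have "finite ((F \<union> uminus ` F) \<times> X)" using F(1) fX by simp
    then show ?thesis
    proof (rule common_multiplier[OF _ subgroup_zspan])
      fix i assume "i \<in> (F \<union> uminus ` F) \<times> X"
      with k show "k i \<noteq> 0 \<and> zs (k i) (act (fst i) (snd i)) \<in> zspan X" by (rule bspec)
    qed (rule that)
  qed
  have KB: "zs K (act g b) \<in> zspan X" if g: "g \<in> F \<union> uminus ` F" and b: "b \<in> zspan X" for g b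
  proof -
    have "is_subgroup {b. zs K (act g b) \<in> zspan X}"
      using subgroup_zspan[of X] by (simp add: is_subgroup_def additive.zero[OF ad] additive.diff[OF ad] zs_diff_right)
    then have "zspan X \<subseteq> {b. zs K (act g b) \<in> zspan X}"
      by (rule zspan_least) (use K(2)[of "(g, _)"] g in auto)
    then show ?thesis using b by blast
  qed
  obtain p q :: int where pq: "prime p" "prime q" "p \<noteq> q" "coprime K p" "coprime K q"
  proof -
    obtain p where p: "prime p" "p > nat \<bar>K\<bar>" using bigger_prime by blast
    obtain q where q: "prime q" "q > p" using bigger_prime by blast
    have "coprime K (int r)" if "prime r" "r > nat \<bar>K\<bar>" for r
    proof -
      have "\<not> int r dvd K" using dvd_imp_le_int[OF K(1), of "int r"] that by auto
      then show ?thesis using that prime_imp_coprime[of "int r" K] by (simp add: coprime_commute)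
    qed
    then show ?thesis using that[of "int p" "int q"] p q by simp
  qed
  have orbit: "finite ((\<lambda>h. act h x) ` H)" if x: "x \<in> X" for x
  proof (rule ccontr)
    assume "infinite ((\<lambda>h. act h x) ` H)"
    from infinite_image_subset[OF this, of "Suc (bnd p q)"] obtain F'
      where F': "F' \<subseteq> H" "finite F'" "card F' = Suc (bnd p q)" "inj_on (\<lambda>h. act h x) F'" by blast
    \<comment> \<open>The span of \<open>X\<close> with denominators prime to p and q allowed.
      \<open>K\<close> is among them, so the generators preserve \<Lambda>, and it is still
      separated for p and q.\<close>
    define \<Lambda> where "\<Lambda> = {x. \<exists>c. coprime c p \<and> coprime c q \<and> zs c x \<in> zspan X}"
    have X\<Lambda>: "zspan X \<subseteq> \<Lambda>" unfolding \<Lambda>_def by (auto intro: exI[of _ 1])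
    have "is_subgroup \<Lambda>" unfolding is_subgroup_def
    proof (intro conjI ballI)
      show "0 \<in> \<Lambda>" using X\<Lambda> subgroup_0[OF subgroup_zspan] by blast
      fix x y assume "x \<in> \<Lambda>" "y \<in> \<Lambda>"
      then obtain c e where c: "coprime c p" "coprime c q" "zs c x \<in> zspan X"
        and e: "coprime e p" "coprime e q" "zs e y \<in> zspan X" unfolding \<Lambda>_def by blast
      have "zs e (zs c x) - zs c (zs e y) \<in> zspan X" 
        by (rule subgroup_diff[OF subgroup_zspan subgroup_zs[OF subgroup_zspan c(3)] subgroup_zs[OF subgroup_zspan e(3)]])
      then have "zs (c * e) (x - y) \<in> zspan X" by (simp add: zs_diff_right mult.commute)
      moreover have "coprime (c * e) p" "coprime (c * e) q" using c e by simp_all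
      ultimately show "x - y \<in> \<Lambda>" unfolding \<Lambda>_def by blast
    qed
    moreover have base: "act g ` \<Lambda> \<subseteq> \<Lambda>" if g: "g \<in> F \<union> uminus ` F" for g
    proof
      fix y assume "y \<in> act g ` \<Lambda>"
      then obtain x c where c: "y = act g x" "coprime c p" "coprime c q" "zs c x \<in> zspan X" unfolding \<Lambda>_def by blast
      have "zs (K * c) y \<in> zspan X" using KB[OF g c(4)] by (simp add: c(1) additive_zs[OF ad])
      moreover have "coprime (K * c) p" "coprime (K * c) q" using c pq by simp_all
      ultimately show "y \<in> \<Lambda>" unfolding \<Lambda>_def by blast
    qed
    have "act h ` \<Lambda> \<subseteq> \<Lambda> \<and> act (- h) ` \<Lambda> \<subseteq> \<Lambda>" if "h \<in> H" for h
      using that unfolding H_def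
    proof induction
      case (base g)
      then show ?case using \<open>\<And>g. g \<in> F \<union> uminus ` F \<Longrightarrow> act g ` \<Lambda> \<subseteq> \<Lambda>\<close> by blast
    next
      case zero
      then show ?case by (auto simp: act_0)
    next
      case (diff g h)
      have "act (h - g) x = act h (act (- g) x)" for x by (rule act_diff)
      then show ?case using diff act_diff[of g h] by (fastforce simp: image_subset_iff)
    qed
    ultimately have "\<exists>g\<in>F'. \<exists>h\<in>F'. g \<noteq> h \<and> (\<forall>x\<in>\<Lambda>. act g x = act h x)"
      using pq F' by (intro agree[of _ p q 1]) (auto simp: \<Lambda>_def)
    moreover have "x \<in> \<Lambda>" using X\<Lambda> zspan_base[OF fX x] by blast
    ultimately show False using F'(4) unfolding inj_on_def by blast
  qed
  \<comment> \<open>The finite orbits span a finitely generated group stable under \<open>H\<close>.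
    One denominator \<open>d\<close> serves all its elements, and \<open>sep_lattice\<close>
    tolerates factors 2 and 3 in it.\<close>
  define Y where "Y = (\<Union>x\<in>X. (\<lambda>h. act h x) ` H)"
  have fY: "finite Y" using fX orbit by (auto simp: Y_def)
  have XY: "X \<subseteq> Y"
  proof
    fix x assume "x \<in> X"
    moreover have "x \<in> (\<lambda>h. act h x) ` H" using H0 act_0[of x] by (intro image_eqI[of _ _ 0]) simp_all
    ultimately show "x \<in> Y" unfolding Y_def by blast
  qed
  have YE: "Y \<subseteq> E" unfolding Y_def using E(2) X(1) by blast
  have YH: "act h y \<in> Y" if "h \<in> H" "y \<in> Y" for h y
  proof -
    obtain x g where x: "x \<in> X" "g \<in> H" "y = act g x" using \<open>y \<in> Y\<close> by (auto simp: Y_def)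
    have "h - (0 - g) \<in> H" using Hd H0 x(2) \<open>h \<in> H\<close> by blast
    moreover have "act (h - (0 - g)) x = act h y" by (simp only: act_diff x(3)) simp
    ultimately show ?thesis using x(1) unfolding Y_def by (metis UN_I imageI)
  qed
  have inv: "act h ` zspan Y \<subseteq> zspan Y" if h: "h \<in> H" for h
  proof -
    have "is_subgroup {b. act h b \<in> zspan Y}"
      using subgroup_zspan[of Y] by (simp add: is_subgroup_def additive.zero[OF ad] additive.diff[OF ad])
    then have "zspan Y \<subseteq> {b. act h b \<in> zspan Y}"
      by (rule zspan_least) (use YH[OF h] zspan_base[OF fY] in blast)
    then show ?thesis by blast
  qed
  obtain d where d: "d \<noteq> 0" "\<And>y. y \<in> Y \<Longrightarrow> zs d y \<in> zspan X"
  proof -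
    have "\<forall>y\<in>Y. \<exists>k. k \<noteq> 0 \<and> zs k y \<in> zspan X" using YE by (intro ballI mx) auto
    then have "\<exists>k. \<forall>y\<in>Y. k y \<noteq> 0 \<and> zs (k y) y \<in> zspan X" by (rule bchoice)
    then obtain k where k: "\<forall>y\<in>Y. k y \<noteq> 0 \<and> zs (k y) y \<in> zspan X" ..
    show ?thesis
    proof (rule common_multiplier[OF fY subgroup_zspan])
      fix y assume "y \<in> Y"
      with k show "k y \<noteq> 0 \<and> zs (k y) y \<in> zspan X" by (rule bspec)
    qed (rule that)
  qed
  have "is_subgroup {b. zs d b \<in> zspan X}"
    using subgroup_zspan[of X] by (simp add: is_subgroup_def zs_diff_right)
  then have dY: "zspan Y \<subseteq> {b. zs d b \<in> zspan X}" by (rule zspan_least) (use d in blast)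
  have "\<exists>g\<in>F. \<exists>h\<in>F. g \<noteq> h \<and> (\<forall>x\<in>zspan Y. act g x = act h x)"
  proof (rule agree[OF subgroup_zspan inv _ _ _ d(1) _ FH F(1,2)])
    fix x assume "x \<in> zspan Y"
    then have "zs d x \<in> zspan X" using dY by blast
    then show "\<exists>c. coprime c 2 \<and> coprime c 3 \<and> zs (c * d) x \<in> zspan X" by (intro exI[of _ 1]) simp
  qed simp_all
  then obtain g h where gh: "g \<in> F" "h \<in> F" "g \<noteq> h" "\<And>x. x \<in> zspan Y \<Longrightarrow> act g x = act h x" by blast
  obtain k where k: "k \<noteq> 0" "zs k a \<in> zspan X" using mx[OF a] by blast
  have "zspan X \<subseteq> zspan Y" using zspan_least[OF subgroup_zspan] zspan_base[OF fY] XY by blast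
  then have "zs k (act g a) = zs k (act h a)" using gh(4)[of "zs k a"] k by (auto simp: additive_zs[OF ad])
  then have "act g a = act h a" using k(1) by (rule zs_cancel)
  then show False using F(3) gh unfolding inj_on_def by blast
qed

end

lemma subgroup_periodic:
  fixes f :: "'a::ab_group_add \<Rightarrow> 'a"
  assumes "additive f"
  shows "is_subgroup (periodic f)"
  unfolding is_subgroup_def
proof (intro conjI ballI)
  have ad: "additive (f ^^ n)" for n using assms by (rule additive_funpow)
  show "0 \<in> periodic f" using assms by (auto simp: periodic_def additive.zero intro: exI[of _ 1])
  fix x y assume "x \<in> periodic f" "y \<in> periodic f"
  then obtain i j where i: "i > 0" "(f ^^ i) x = x" and j: "j > 0" "(f ^^ j) y = y" by (auto simp: periodic_def)
  have it: "(h ^^ j) y = y" if "h y = y" for h :: "'a \<Rightarrow> 'a" and j y by (induction j) (simp_all add: that)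
  have "(f ^^ (i * j)) x = x" "(f ^^ (i * j)) y = y"
    using it[of "f ^^ i" x j] it[of "f ^^ j" y i] i j by (simp_all add: funpow_mult mult.commute)
  then have "(f ^^ (i * j)) (x - y) = x - y" by (simp add: additive.diff[OF ad])
  then show "x - y \<in> periodic f" using i j unfolding periodic_def by (metis (mono_tags, lifting) mem_Collect_eq nat_0_less_mult_iff)
qed

text \<open>A finite orbit makes every group element act periodically by the pigeonhole principle.
  The converse is \<open>finite_orbits\<close> for the intersection, which is stable because
  periodicity of \<open>act g x\<close> under h is periodicity of x under the conjugate - g + h +
  g.\<close>

lemma Delta_eq_periodic:
  fixes act :: "'g::group_add \<Rightarrow> 'a::ab_group_add \<Rightarrow> 'a"
  assumes frg: "frg TYPE('a) N" and act: "aut_action act"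
  shows "Delta act = \<Inter>(range (\<lambda>g. periodic (act g)))"
proof -
  define E where "E = \<Inter>(range (\<lambda>g. periodic (act g)))"
  have ad: "additive (act g)" for g using act by (rule aut_action_additive)
  have inj: "inj (act g ^^ i)" for g i using aut_action_bij[OF act, of g] by (intro inj_fn) (simp add: bij_def)
  have comp: "act (g + h) x = act g (act h x)" for g h x using act by (simp add: aut_action_def)
  have "a \<in> periodic (act g)" if "a \<in> Delta act" for a g
  proof -
    have "(act g ^^ i) a \<in> range (\<lambda>g. act g a)" for i
    proof (induction i)
      case 0
      have "(act g ^^ 0) a = act 0 a" using act by (simp add: aut_action_def)
      then show ?case by blast
    next
      case (Suc i)
      then obtain h where "(act g ^^ i) a = act h a" by blast
      then have "(act g ^^ Suc i) a = act (g + h) a" by (simp add: comp)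
      then show ?case by blast
    qed
    then have "finite (range (\<lambda>i. (act g ^^ i) a))"
      using that unfolding Delta_def by (auto intro: finite_subset)
    then have "\<not> inj (\<lambda>i. (act g ^^ i) a)" using finite_imageD infinite_UNIV_nat by blast
    then obtain i j where ij: "i < j" "(act g ^^ i) a = (act g ^^ j) a"
      unfolding inj_on_def by (metis linorder_neqE_nat)
    have "(act g ^^ i) ((act g ^^ (j - i)) a) = (act g ^^ i) a"
      using ij funpow_add[of i "j - i" "act g"] by simp
    then have "(act g ^^ (j - i)) a = a" using injD[OF inj] by blast
    then show ?thesis using ij unfolding periodic_def by (metis (mono_tags, lifting) mem_Collect_eq zero_less_diff)
  qed
  moreover have "E \<subseteq> Delta act"
  proof
    fix a assume a: "a \<in> E"
    have "is_subgroup E" unfolding E_def is_subgroup_def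
      using subgroup_periodic[OF ad] by (auto simp: is_subgroup_def)
    moreover have "act g ` E \<subseteq> E" for g
    proof
      fix y assume "y \<in> act g ` E"
      then obtain x where x: "x \<in> E" "y = act g x" by blast
      show "y \<in> E" unfolding E_def
      proof (rule INT_I)
        fix h
        have c: "(act h ^^ i) (act g x) = act g ((act (- g + h + g) ^^ i) x)" for i
        proof (induction i)
          case (Suc i)
          have "act h (act g z) = act g (act (- g + h + g) z)" for z
            by (simp add: comp aut_action_inverse[OF act])
          then show ?case using Suc by simp
        qed simp
        obtain i where "i > 0" "(act (- g + h + g) ^^ i) x = x" using x(1) by (auto simp: E_def periodic_def)
        then show "y \<in> periodic (act h)" using c[of i] x(2) by (auto simp: periodic_def)
      qed
    qed
    moreover have "E \<subseteq> periodic (act g)" for g by (auto simp: E_def)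
    ultimately have "finite (range (\<lambda>g. act g a))" using a by (rule frg.finite_orbits[OF frg act])
    then show "a \<in> Delta act" by (simp add: Delta_def)
  qed
  ultimately show ?thesis unfolding E_def by blast
qed

theorem theorem4p4:
  fixes act :: "'g::group_add \<Rightarrow> 'a::ab_group_add \<Rightarrow> 'a"
    and P :: "('a \<Rightarrow>\<^sub>0 'k::field_char_0) set"
  assumes "torsion_free TYPE('a)"
    and "finite_rank TYPE('a)"
    and "aut_action act"
    and "is_prime_ideal P"
    and "faithful P"
    and "standardiser act P = UNIV"
  shows "P = ideal_gen (P \<inter> grp_alg (Delta act))"
proof -
  obtain N where "frg TYPE('a) N" using frg_exists[OF assms(1,2)] by blast
  then interpret frg "TYPE('a)" N .
  have ad: "additive (act g)" for g using assms(3) by (rule aut_action_additive)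
  have one: "restr {b. b - a \<in> periodic (act g)} f \<in> P" if f: "f \<in> P" for a g f
  proof -
    have "g \<in> standardiser act P" using assms(6) by simp
    then obtain C where C: "is_subgroup C" "\<And>a. \<exists>n>0. zs (int n) a \<in> C"
      "\<And>f. keys f \<subseteq> C \<Longrightarrow> f \<in> P \<longleftrightarrow> ev (single 0) (\<lambda>b. single (act g b) 1) f \<in> P"
      using standardiser_dense[OF assms(3)] by blast
    show ?thesis
      by (rule control_by_periodic[OF assms(4,5) ad aut_action_bij[OF assms(3)] C f])
  qed
  have D: "Delta act = \<Inter>(range (\<lambda>g. periodic (act g)))"
    by (rule Delta_eq_periodic[OF frg_axioms assms(3)])
  show ?thesis
  proof (rule control_by_restr)
    show "is_ideal P" using assms(4) by (simp add: is_prime_ideal_def)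
    show "is_subgroup (Delta act)" unfolding D is_subgroup_def
      using subgroup_periodic[OF ad] by (auto simp: is_subgroup_def)
    show "restr {b. b - a \<in> Delta act} f \<in> P" if "f \<in> P" for a f
      unfolding D using that one by (intro restr_Inter) auto
  qed
qed

end
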